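(* Let $(C,\Delta_C)$, $(A,\Delta_A)$, $(B,\Delta_B)$ be quantum groups obtained from modular multiplicative unitaries on $\mathcal H_C\otimes\mathcal H_C$, $\mathcal H_A\otimes\mathcal H_A$, $\mathcal H_B\otimes\mathcal H_B$. For any two bicharacters $V^{C\to A}\in\mathcal U\mathcal M(\hat C\otimes A)$ and $V^{A\to B}\in\mathcal U\mathcal M(\hat A\otimes B)$, there is a unique composition $V^{C\to B}\in\mathcal U\mathcal M(\hat C\otimes B)$, and it is a bicharacter from $C$ to $B$.
   Context: Tensor products of $C^*$-algebras are spatial; $\mathcal M(A)$ is the multiplier algebra, $\mathcal U\mathcal M(A)$ its unitary group, $\mathcal U(\mathcal H)$ the unitary group on $\mathcal H$; leg numbering notation is used. A unitary $\mathbb W$ on $\mathcal H\otimes\mathcal H$ is multiplicative if $\mathbb W_{23}\mathbb W_{12}=\mathbb W_{12}\mathbb W_{13}\mathbb W_{23}$. It is modular if there are positive self-adjoint operators $\hat Q,Q$ on $\mathcal H$ with trivial kernels and a unitary $\widetilde{\mathbb W}$ on $\overline{\mathcal H}\otimes\mathcal H$ ($\overline{\mathcal H}$ the complex-conjugate Hilbert space) such that $\mathbb W^*(\hat Q\otimes Q)\mathbb W=\hat Q\otimes Q$ and $(x\otimes y\mid\mathbb W\mid z\otimes u)=(\overline z\otimes Qy\mid\widetilde{\mathbb W}\mid\overline x\otimes Q^{-1}u)$ for all $x,z\in\mathcal H$, $y\in\mathrm{dom}(Q)$, $u\in\mathrm{dom}(Q^{-1})$, where $(x\mid T\mid y):=(x\mid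 Ty)$. The quantum group obtained from a modular multiplicative unitary $\mathbb W^C$ on $\mathcal H_C\otimes\mathcal H_C$ is $(C,\Delta_C)$, where $C\subseteq\mathbb B(\mathcal H_C)$ is the norm closure of $\{(\omega\otimes\mathrm{id})(\mathbb W^C):\omega\in\mathbb B(\mathcal H_C)_*\}$ and $\Delta_C(x)=\mathbb W^C(x\otimes1)(\mathbb W^C)^*$; its dual is $(\hat C,\Delta_{\hat C})$, where $\hat C\subseteq\mathbb B(\mathcal H_C)$ is the norm closure of $\{(\mathrm{id}\otimes\omega)((\mathbb W^C)^* ):\omega\in\mathbb B(\mathcal H_C)_*\}$ and $\Delta_{\hat C}(y)=\Sigma(\mathbb W^C)^*(1\otimes y)\mathbb W^C\Sigma$ with $\Sigma$ the coordinate flip. (It is known that $C,\hat C$ are nondegenerate $C^*$-algebras, $\Delta_C,\Delta_{\hat C}$ are comultiplications and $\mathbb W^C\in\mathcal U\mathcal M(\hat C\otimes C)$.) Similarly for $A$ and $B$. A bicharacter from $C$ to $A$ is a unitary $V\in\mathcal U\mathcal M(\hat C\otimes A)$ with $(\Delta_{\hat C}\otimes\mathrm{id}_A)V=V_{23}V_{13}$ and $(\mathrm{id}_{\hat C}\otimes\Delta_A)V=V_{12}V_{13}$. Its image in $\mathcal U(\mathcal H_C\otimes\mathcal H_A)$ is denoted $\mathbb V$. A unitary $V^{C\to B}\in\mathcal U\mathcal M(\hat C\otimes B)$ is a composition of the bicharacters $V^{C\to A}$ and $V^{A\to B}$ if its image $\mathbb V^{C\to B}\in\mathcal U(\mathcal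 H_C\otimes\mathcal H_B)$ satisfies $\mathbb V^{A\to B}_{23}\mathbb V^{C\to A}_{12}=\mathbb V^{C\to A}_{12}\mathbb V^{C\to B}_{13}\mathbb V^{A\to B}_{23}$ in $\mathcal U(\mathcal H_C\otimes\mathcal H_A\otimes\mathcal H_B)$. *)

theory Defs
  imports "HOL-Analysis.Analysis"
begin

section \<open>Complex Hilbert spaces\<close>

text \<open>
  The inner product is linear in the second variable.  Building on \<^class>\<open>real_inner\<close> makes the
  library's norm, topology and bounded operators available.
\<close>

class chilbert_space = real_inner + complete_space +
  fixes scaleC :: "complex \<Rightarrow> 'a \<Rightarrow> 'a" (infixr "*\<^sub>C" 75)
    and cinner :: "'a \<Rightarrow> 'a \<Rightarrow> complex"
  assumes scaleC_add_right: "c *\<^sub>C (x + y) = c *\<^sub>C x + c *\<^sub>C y"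
    and scaleC_add_left: "(c + d) *\<^sub>C x = c *\<^sub>C x + d *\<^sub>C x"
    and scaleC_scaleC: "c *\<^sub>C d *\<^sub>C x = (c * d) *\<^sub>C x"
    and scaleR_scaleC: "r *\<^sub>R x = complex_of_real r *\<^sub>C x"
    and cinner_commute: "cinner x y = cnj (cinner y x)"
    and cinner_add_right: "cinner x (y + z) = cinner x y + cinner x z"
    and cinner_scaleC_right: "cinner x (c *\<^sub>C y) = c * cinner x y"
    and Re_cinner: "Re (cinner x y) = inner x y"

lemma scaleC_one [simp]: "1 *\<^sub>C x = (x::'a::chilbert_space)"
  using scaleR_scaleC[of 1 x] by simp

lemma scaleC_zero_left [simp]: "0 *\<^sub>C x = (0::'a::chilbert_space)"
  using scaleR_scaleC[of 0 x] by simp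

lemma scaleC_zero_right [simp]: "c *\<^sub>C 0 = (0::'a::chilbert_space)"
  using scaleC_add_right[of c 0 0] by simp

lemma cinner_add_left: "cinner (x + y) z = cinner x z + cinner (y::'a::chilbert_space) z"
  by (metis cinner_commute cinner_add_right complex_cnj_add)

lemma cinner_scaleC_left: "cinner (c *\<^sub>C x) y = cnj c * cinner (x::'a::chilbert_space) y"
  by (metis cinner_commute cinner_scaleC_right complex_cnj_mult)

lemma cinner_scaleR_right: "cinner x (r *\<^sub>R y) = complex_of_real r * cinner (x::'a::chilbert_space) y"
  by (simp add: scaleR_scaleC cinner_scaleC_right)

lemma cinner_scaleR_left: "cinner (r *\<^sub>R x) y = complex_of_real r * cinner (x::'a::chilbert_space) y"
  by (simp add: scaleR_scaleC cinner_scaleC_left)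

lemma cinner_zero_right [simp]: "cinner (x::'a::chilbert_space) 0 = 0"
  using cinner_add_right[of x 0 0] by simp

lemma cinner_zero_left [simp]: "cinner 0 (x::'a::chilbert_space) = 0"
  using cinner_add_left[of 0 0 x] by simp

lemma cinner_minus_right: "cinner x (- y) = - cinner (x::'a::chilbert_space) y"
  using cinner_add_right[of x y "- y"] by (simp add: add_eq_0_iff)

lemma cinner_minus_left: "cinner (- x) y = - cinner (x::'a::chilbert_space) y"
  using cinner_add_left[of x "- x" y] by (simp add: add_eq_0_iff)

lemma cinner_diff_right: "cinner x (y - z) = cinner x y - cinner (x::'a::chilbert_space) z"
  using cinner_add_right[of x y "- z"] by (simp add: cinner_minus_right)

lemma cinner_diff_left: "cinner (x - y) z = cinner x z - cinner (y::'a::chilbert_space) z"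
  using cinner_add_left[of x "- y" z] by (simp add: cinner_minus_left)

lemma cinner_sum_right: "cinner x (sum f A) = (\<Sum>i\<in>A. cinner (x::'a::chilbert_space) (f i))"
  by (induction A rule: infinite_finite_induct) (simp_all add: cinner_add_right)

lemma cinner_sum_left: "cinner (sum f A) x = (\<Sum>i\<in>A. cinner (f i) (x::'a::chilbert_space))"
  by (induction A rule: infinite_finite_induct) (simp_all add: cinner_add_left)

lemma cinner_self: "cinner x x = complex_of_real ((norm (x::'a::chilbert_space))\<^sup>2)"
proof (rule complex_eqI)
  show "Im (cinner x x) = Im (complex_of_real ((norm x)\<^sup>2))"
    using cinner_commute[of x x] by (metis Im_complex_of_real complex_cnj cnj.sel(2) neg_equal_zero)
qed (simp add: Re_cinner power2_norm_eq_inner)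

lemma cinner_ext: "(\<And>z. cinner z x = cinner z y) \<Longrightarrow> x = (y::'a::chilbert_space)"
  using cinner_self[of "x - y"] by (simp add: cinner_diff_right)

lemma norm_scaleC [simp]: "norm (c *\<^sub>C x) = cmod c * norm (x::'a::chilbert_space)"
proof -
  have "complex_of_real ((norm (c *\<^sub>C x))\<^sup>2) = c * cnj c * cinner x x"
    by (simp only: cinner_self[symmetric] cinner_scaleC_left cinner_scaleC_right mult_ac)
  also have "\<dots> = complex_of_real ((cmod c * norm x)\<^sup>2)"
    by (simp only: cinner_self complex_norm_square[symmetric] power_mult_distrib of_real_mult)
  finally have "(norm (c *\<^sub>C x))\<^sup>2 = (cmod c * norm x)\<^sup>2" by (simp only: of_real_eq_iff)
  then show ?thesis by (simp add: power2_eq_iff_nonneg)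
qed

lemma norm_cinner_le: "cmod (cinner x y) \<le> norm x * norm (y::'a::chilbert_space)"
proof (cases "cinner x y = 0")
  case False
  define c where "c = cnj (cinner x y) / cmod (cinner x y)"
  have c: "cmod c = 1" using False by (simp add: c_def norm_divide)
  have "cinner x (c *\<^sub>C y) = complex_of_real (cmod (cinner x y))"
    using False by (simp add: cinner_scaleC_right c_def divide_simps complex_norm_square[symmetric] power2_eq_square mult.commute)
  then have "cmod (cinner x y) = inner x (c *\<^sub>C y)"
    by (metis Re_cinner Re_complex_of_real)
  also have "\<dots> \<le> norm x * norm (c *\<^sub>C y)" by (rule norm_cauchy_schwarz)
  finally show ?thesis using c by simp
qed simp

lemma bounded_bilinear_cinner: "bounded_bilinear (cinner :: 'a::chilbert_space \<Rightarrow> 'a \<Rightarrow> complex)"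
  by unfold_locales
    (auto simp: cinner_add_left cinner_add_right cinner_scaleR_left cinner_scaleR_right scaleR_conv_of_real
      intro!: exI[of _ 1] norm_cinner_le)

lemma bounded_linear_scaleC: "bounded_linear ((*\<^sub>C) c :: 'a::chilbert_space \<Rightarrow> 'a)"
  by (rule bounded_linear_intro[of _ "cmod c"])
    (auto simp: scaleC_add_right scaleR_scaleC scaleC_scaleC mult.commute)


section \<open>The conjugate Hilbert space\<close>

typedef 'a conjugate = "UNIV :: 'a set" morphisms of_conj to_conj by simp

lemmas [simp] = of_conj_inverse to_conj_inverse[OF UNIV_I] to_conj_inject[OF UNIV_I UNIV_I]

instantiation conjugate :: (chilbert_space) real_inner
begin

definition "0 = to_conj 0"
definition "x + y = to_conj (of_conj x + of_conj y)"
definition "x - y = to_conj (of_conj x - of_conj y)"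
definition "- x = to_conj (- of_conj x)"
definition "r *\<^sub>R x = to_conj (r *\<^sub>R of_conj x)"
definition "inner x y = inner (of_conj x) (of_conj y)"
definition "norm x = norm (of_conj x)"
definition "dist x y = dist (of_conj x) (of_conj y)"
definition "sgn x = to_conj (sgn (of_conj x))"
definition "(uniformity :: ('a conjugate \<times> 'a conjugate) filter) = (INF e\<in>{0 <..}. principal {(x, y). dist x y < e})"
definition "open (U :: 'a conjugate set) = (\<forall>x\<in>U. \<forall>\<^sub>F (x', y) in uniformity. x' = x \<longrightarrow> y \<in> U)"

instance
proof
  show "dist x y = norm (x - y)" for x y :: "'a conjugate"
    by (simp add: dist_conjugate_def norm_conjugate_def minus_conjugate_def dist_norm)
  show "inner (r *\<^sub>R x) y = r * inner x y" for r and x y :: "'a conjugate"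
    by (simp add: inner_conjugate_def scaleR_conjugate_def)
  show "(inner x x = 0) = (x = 0)" for x :: "'a conjugate"
    by (metis inner_conjugate_def inner_eq_zero_iff of_conj_inverse zero_conjugate_def to_conj_inverse UNIV_I)
qed (auto simp: zero_conjugate_def plus_conjugate_def minus_conjugate_def uminus_conjugate_def
    scaleR_conjugate_def inner_conjugate_def
    norm_conjugate_def sgn_conjugate_def uniformity_conjugate_def open_conjugate_def
    algebra_simps inner_commute norm_eq_sqrt_inner sgn_div_norm)

end

instance conjugate :: (chilbert_space) complete_space
proof
  fix X :: "nat \<Rightarrow> 'a conjugate"
  assume "Cauchy X"
  then have "Cauchy (\<lambda>n. of_conj (X n))"
    by (simp add: Cauchy_def dist_conjugate_def)
  then obtain l where "(\<lambda>n. of_conj (X n)) \<longlonglongrightarrow> l"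
    using Cauchy_convergent convergent_def by blast
  then have "X \<longlonglongrightarrow> to_conj l"
    by (simp add: lim_sequentially dist_conjugate_def)
  then show "convergent X"
    by (auto simp: convergent_def)
qed

instantiation conjugate :: (chilbert_space) chilbert_space
begin

definition "c *\<^sub>C x = to_conj (cnj c *\<^sub>C of_conj x)"
definition "cinner x y = cinner (of_conj y) (of_conj x)"

instance
proof
  show "cinner x y = cnj (cinner y x)" for x y :: "'a conjugate"
    by (simp add: cinner_conjugate_def flip: cinner_commute)
  show "Re (cinner x y) = inner x y" for x y :: "'a conjugate"
    by (simp add: cinner_conjugate_def inner_conjugate_def Re_cinner inner_commute)
qed (simp_all add: scaleC_conjugate_def cinner_conjugate_def plus_conjugate_def scaleR_conjugate_def
    scaleC_add_right scaleC_add_left scaleC_scaleC scaleR_scaleC cinner_add_left cinner_scaleC_left)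

end


section \<open>Orthonormal bases\<close>

definition orthonormal :: "'a::chilbert_space set \<Rightarrow> bool" where
  "orthonormal E \<longleftrightarrow> (\<forall>x\<in>E. \<forall>y\<in>E. cinner x y = (if x = y then 1 else 0))"

text \<open>A fixed orthonormal basis of each Hilbert space.  It is only used to construct the Hilbert
  space tensor product below.\<close>

definition hbasis :: "'a::chilbert_space set" where
  "hbasis = (SOME E. orthonormal E \<and> (\<forall>F. orthonormal F \<longrightarrow> E \<subseteq> F \<longrightarrow> F = E))"

lemma hbasis_maximal:
  shows orthonormal_hbasis: "orthonormal (hbasis :: 'a::chilbert_space set)"
    and hbasis_max: "orthonormal F \<Longrightarrow> hbasis \<subseteq> F \<Longrightarrow> F = (hbasis :: 'a set)"
proof -
  have "\<exists>M\<in>Collect orthonormal. \<forall>X\<in>Collect orthonormal. M \<subseteq> X \<longrightarrow> X = (M :: 'a set)"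
  proof (rule subset_Zorn')
    fix C :: "'a set set"
    assume C: "subset.chain (Collect orthonormal) C"
    have "cinner x y = (if x = y then 1 else 0)" if x: "x \<in> \<Union>C" and y: "y \<in> \<Union>C" for x y
    proof -
      obtain E F where "E \<in> C" "x \<in> E" "F \<in> C" "y \<in> F" using x y by blast
      moreover have "E \<subseteq> F \<or> F \<subseteq> E" using C \<open>E \<in> C\<close> \<open>F \<in> C\<close> by (auto simp: subset.chain_def)
      ultimately show ?thesis using C unfolding subset.chain_def orthonormal_def by blast
    qed
    then show "\<Union>C \<in> Collect orthonormal" by (auto simp: orthonormal_def)
  qed
  then have "\<exists>E :: 'a set. orthonormal E \<and> (\<forall>F. orthonormal F \<longrightarrow> E \<subseteq> F \<longrightarrow> F = E)" by blast
  from someI_ex[OF this] show "orthonormal (hbasis :: 'a set)"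
    and "orthonormal F \<Longrightarrow> hbasis \<subseteq> F \<Longrightarrow> F = (hbasis :: 'a set)"
    unfolding hbasis_def by auto
qed

lemma cinner_hbasis: "e \<in> hbasis \<Longrightarrow> f \<in> hbasis \<Longrightarrow> cinner e f = (if e = f then 1 else 0)"
  using orthonormal_hbasis by (auto simp: orthonormal_def)

lemma hbasis_total:
  assumes "\<And>e. e \<in> hbasis \<Longrightarrow> cinner e x = 0"
  shows "x = (0::'a::chilbert_space)"
proof (rule ccontr)
  assume x: "x \<noteq> 0"
  define u where "u = (1 / norm x) *\<^sub>R x"
  have u: "cinner u u = 1" using x by (simp add: u_def cinner_self)
  have eu: "cinner e u = 0" if "e \<in> hbasis" for e
    using assms[OF that] by (simp add: u_def cinner_scaleR_right)
  have ue: "cinner u e = 0" if "e \<in> hbasis" for e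
    using eu[OF that] by (metis cinner_commute complex_cnj_zero)
  have "orthonormal (insert u hbasis)"
    using orthonormal_hbasis u eu ue by (auto simp: orthonormal_def)
  then have "u \<in> hbasis" using hbasis_max by blast
  then show False using eu u by fastforce
qed

lemma bessel:
  assumes "finite F" "F \<subseteq> hbasis"
  shows "(norm (x - (\<Sum>e\<in>F. cinner e x *\<^sub>C e)))\<^sup>2 = (norm (x::'a::chilbert_space))\<^sup>2 - (\<Sum>e\<in>F. (cmod (cinner e x))\<^sup>2)"
proof -
  define s where "s = (\<Sum>e\<in>F. cinner e x *\<^sub>C e)"
  have es: "cinner e s = cinner e x" if "e \<in> F" for e
  proof -
    have "cinner e s = (\<Sum>f\<in>F. if f = e then cinner e x else 0)"
      unfolding s_def cinner_sum_right cinner_scaleC_right using that assms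
      by (intro sum.cong) (auto simp: cinner_hbasis subset_iff)
    then show ?thesis using that assms by simp
  qed
  have sy: "cinner s y = (\<Sum>e\<in>F. cnj (cinner e x) * cinner e y)" for y
    by (simp add: s_def cinner_sum_left cinner_scaleC_left)
  have ss: "cinner s s = complex_of_real (\<Sum>e\<in>F. (cmod (cinner e x))\<^sup>2)"
    by (simp only: sy of_real_sum) (auto intro!: sum.cong simp: es complex_norm_square mult.commute simp del: of_real_power)
  have sx: "cinner s x = cinner s s" by (simp add: sy es)
  have xs: "cinner x s = cinner s s" using sx cinner_commute[of x s] ss by simp
  have "complex_of_real ((norm (x - s))\<^sup>2) = complex_of_real ((norm x)\<^sup>2 - (\<Sum>e\<in>F. (cmod (cinner e x))\<^sup>2))"
    unfolding cinner_self[symmetric] of_real_diff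
    by (simp add: cinner_diff_left cinner_diff_right sx xs ss del: of_real_sum of_real_power)
  then show ?thesis unfolding s_def by (simp only: of_real_eq_iff)
qed

lemma hbasis_sum_norm:
  assumes "finite F" "F \<subseteq> hbasis"
  shows "(norm (\<Sum>e\<in>F. c e *\<^sub>C (e::'a::chilbert_space)))\<^sup>2 = (\<Sum>e\<in>F. (cmod (c e))\<^sup>2)"
proof -
  have "cinner (\<Sum>e\<in>F. c e *\<^sub>C e) (\<Sum>e\<in>F. c e *\<^sub>C e) = (\<Sum>f\<in>F. \<Sum>e\<in>F. cinner (c e *\<^sub>C e) (c f *\<^sub>C f))"
    by (simp only: cinner_sum_left cinner_sum_right)
  also have "\<dots> = (\<Sum>f\<in>F. \<Sum>e\<in>F. if f = e then cnj (c e) * c f else 0)" using assms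
    by (intro sum.cong refl) (auto simp: cinner_hbasis subset_iff cinner_scaleC_left cinner_scaleC_right)
  also have "\<dots> = (\<Sum>e\<in>F. cnj (c e) * c e)" using assms by (intro sum.cong) auto
  also have "\<dots> = complex_of_real (\<Sum>e\<in>F. (cmod (c e))\<^sup>2)"
    unfolding of_real_sum by (intro sum.cong) (simp_all add: complex_norm_square mult.commute del: of_real_power)
  finally show ?thesis by (simp only: cinner_self of_real_eq_iff)
qed

lemma hbasis_coord_summable: "(\<lambda>e. (cmod (cinner e (x::'a::chilbert_space)))\<^sup>2) summable_on hbasis"
proof (rule nonneg_bdd_above_summable_on)
  have "(\<Sum>e\<in>F. (cmod (cinner e x))\<^sup>2) \<le> (norm x)\<^sup>2" if "finite F" "F \<subseteq> hbasis" for F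
    using bessel[OF that, of x] by (smt (verit) zero_le_power2)
  then show "bdd_above (sum (\<lambda>e. (cmod (cinner e x))\<^sup>2) ` {F. F \<subseteq> hbasis \<and> finite F})"
    by (auto intro!: bdd_aboveI)
qed auto

instance chilbert_space \<subseteq> banach ..

lemma hbasis_summable:
  assumes c: "(\<lambda>e. (cmod (c e))\<^sup>2) summable_on hbasis"
  shows "(\<lambda>e. c e *\<^sub>C (e::'a::chilbert_space)) summable_on hbasis"
proof -
  define a where "a = infsum (\<lambda>e. (cmod (c e))\<^sup>2) (hbasis::'a set)"
  let ?q = "\<lambda>F. \<Sum>e\<in>F. (cmod (c e))\<^sup>2" and ?s = "\<lambda>F. \<Sum>e\<in>F. c e *\<^sub>C e"
  have "\<exists>F. finite F \<and> F \<subseteq> (hbasis::'a set) \<and> a - 1 / Suc n < ?q F" for n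
  proof -
    define \<delta> where "\<delta> = 1 / (2 * real (Suc n))"
    have \<delta>: "\<delta> > 0" "1 / Suc n = 2 * \<delta>" by (simp_all add: \<delta>_def field_simps)
    obtain F where F: "finite F" "F \<subseteq> (hbasis::'a set)" "dist (?q F) a \<le> \<delta>"
      using infsum_finite_approximation[OF c \<delta>(1)] unfolding a_def by blast
    have "a - 1 / Suc n < ?q F" using F(3) \<delta>(1) unfolding \<delta>(2) dist_real_def by linarith
    with F show ?thesis by blast
  qed
  then obtain F where F: "\<And>n. finite (F n)" "\<And>n. F n \<subseteq> (hbasis::'a set)" "\<And>n. a - 1 / Suc n < ?q (F n)"
    by metis
  define H where "H n = (\<Union>k\<le>n. F k)" for n
  have H: "finite (H n)" "H n \<subseteq> hbasis" "F n \<subseteq> H n" for n using F by (auto simp: H_def)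
  have close: "norm (?s G - ?s (H n)) \<le> sqrt (1 / Suc n)" if "finite G" "G \<subseteq> hbasis" "H n \<subseteq> G" for G n
  proof -
    have "?s G - ?s (H n) = ?s (G - H n)" using that by (simp add: sum_diff)
    then have "(norm (?s G - ?s (H n)))\<^sup>2 = ?q (G - H n)"
      using that by (simp add: hbasis_sum_norm subset_iff)
    also have "\<dots> = ?q G - ?q (H n)" using that by (simp add: sum_diff)
    finally have "(norm (?s G - ?s (H n)))\<^sup>2 = ?q G - ?q (H n)" .
    moreover have "?q G \<le> a" unfolding a_def using that c by (intro finite_sum_le_infsum) auto
    moreover have "?q (F n) \<le> ?q (H n)" using H by (intro sum_mono2) auto
    ultimately have "(norm (?s G - ?s (H n)))\<^sup>2 \<le> 1 / Suc n" using F(3)[of n] by linarith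
    then show ?thesis by (rule real_le_rsqrt)
  qed
  have lim: "(\<lambda>n. sqrt (1 / Suc n)) \<longlonglongrightarrow> 0"
    using tendsto_real_sqrt[OF LIMSEQ_inverse_real_of_nat] by (simp add: inverse_eq_divide)
  have "Cauchy (\<lambda>n. ?s (H n))"
  proof (rule metric_CauchyI)
    fix \<epsilon> :: real assume "\<epsilon> > 0"
    then obtain N where N: "sqrt (1 / Suc N) < \<epsilon> / 2"
      using order_tendstoD(2)[OF lim, of "\<epsilon> / 2"] \<open>\<epsilon> > 0\<close> unfolding eventually_sequentially
      by (metis half_gt_zero order_refl)
    have *: "dist (?s (H n)) (?s (H N)) < \<epsilon> / 2" if "n \<ge> N" for n
    proof -
      have "H N \<subseteq> H n" unfolding H_def using that by (intro UN_mono) auto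
      from close[OF H(1,2) this] N show ?thesis unfolding dist_norm by linarith
    qed
    show "\<exists>M. \<forall>m\<ge>M. \<forall>n\<ge>M. dist (?s (H m)) (?s (H n)) < \<epsilon>"
    proof (intro exI[of _ N] allI impI)
      fix m n assume "m \<ge> N" "n \<ge> N"
      from *[OF this(1)] *[OF this(2)] show "dist (?s (H m)) (?s (H n)) < \<epsilon>"
        using dist_triangle2[of "?s (H m)" "?s (H n)" "?s (H N)"] by linarith
    qed
  qed
  then obtain l where l: "(\<lambda>n. ?s (H n)) \<longlonglongrightarrow> l"
    using Cauchy_convergent convergent_def by blast
  have "(sum (\<lambda>e. c e *\<^sub>C e) \<longlongrightarrow> l) (finite_subsets_at_top hbasis)"
  proof (rule tendstoI)
    fix \<epsilon> :: real assume e: "\<epsilon> > 0"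
    have "eventually (\<lambda>n. sqrt (1 / Suc n) < \<epsilon> / 2 \<and> dist (?s (H n)) l < \<epsilon> / 2) sequentially"
      using order_tendstoD(2)[OF lim, of "\<epsilon> / 2"] tendstoD[OF l, of "\<epsilon> / 2"] e
      by (intro eventually_conj) simp_all
    then obtain n where n: "sqrt (1 / Suc n) < \<epsilon> / 2" "dist (?s (H n)) l < \<epsilon> / 2"
      using eventually_happens' sequentially_bot by blast
    have "dist (?s G) l < \<epsilon>" if "finite G" "H n \<subseteq> G" "G \<subseteq> hbasis" for G
    proof -
      have "dist (?s G) (?s (H n)) < \<epsilon> / 2"
        using close[OF that(1,3,2)] n(1) unfolding dist_norm by linarith
      then show ?thesis using n(2) dist_triangle[of "?s G" l "?s (H n)"] by linarith
    qed
    then show "eventually (\<lambda>G. dist (?s G) l < \<epsilon>) (finite_subsets_at_top hbasis)"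
      unfolding eventually_finite_subsets_at_top
      by (intro exI[of _ "H n"]) (simp add: H(1,2))
  qed
  then show ?thesis unfolding summable_on_def has_sum_def by (rule exI)
qed

lemma hbasis_expansion: "((\<lambda>e. cinner e x *\<^sub>C e) has_sum (x::'a::chilbert_space)) hbasis"
proof -
  obtain s where s: "((\<lambda>e. cinner e x *\<^sub>C e) has_sum s) hbasis"
    using hbasis_summable[OF hbasis_coord_summable[of x]] by (auto simp: summable_on_def)
  have "cinner f (x - s) = 0" if f: "f \<in> hbasis" for f
  proof -
    have "((\<lambda>e. cinner f (cinner e x *\<^sub>C e)) has_sum cinner f s) hbasis"
      by (rule has_sum_bounded_linear[OF bounded_bilinear.bounded_linear_right[OF bounded_bilinear_cinner] s])
    moreover have "((\<lambda>e. cinner f (cinner e x *\<^sub>C e)) has_sum cinner f x) hbasis"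
      by (rule has_sum_finite_neutralI[of "{f}"]) (use f in \<open>auto simp: cinner_scaleC_right cinner_hbasis\<close>)
    ultimately have "cinner f s = cinner f x" by (rule has_sum_unique)
    then show ?thesis by (simp add: cinner_diff_right)
  qed
  then have "x - s = 0" by (rule hbasis_total)
  then show ?thesis using s by simp
qed

lemma parseval: "((\<lambda>e. cinner x e * cinner e y) has_sum cinner x (y::'a::chilbert_space)) hbasis"
  using has_sum_bounded_linear[OF bounded_bilinear.bounded_linear_right[OF bounded_bilinear_cinner] hbasis_expansion, of x y]
  by (simp add: cinner_scaleC_right mult.commute)


section \<open>The Hilbert space tensor product\<close>

definition square_summable :: "('i \<Rightarrow> complex) \<Rightarrow> bool" where
  "square_summable f \<longleftrightarrow> (\<lambda>i. (cmod (f i))\<^sup>2) summable_on UNIV"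

lemma square_summable_mult:
  assumes "square_summable f" "square_summable g"
  shows "(\<lambda>i. cnj (f i) * g i) summable_on UNIV"
proof -
  have "(\<lambda>i. (cmod (f i))\<^sup>2 + (cmod (g i))\<^sup>2) summable_on UNIV"
    using assms unfolding square_summable_def by (rule summable_on_add)
  then have "(\<lambda>i. cmod (cnj (f i) * g i)) summable_on UNIV"
  proof (rule summable_on_comparison_test)
    show "cmod (cnj (f i) * g i) \<le> (cmod (f i))\<^sup>2 + (cmod (g i))\<^sup>2" for i
    proof -
      have "2 * (cmod (f i) * cmod (g i)) \<le> (cmod (f i))\<^sup>2 + (cmod (g i))\<^sup>2"
        using sum_squares_bound[of "cmod (f i)" "cmod (g i)"] by simp
      moreover have "0 \<le> cmod (f i) * cmod (g i)" by simp
      ultimately show ?thesis unfolding norm_mult complex_mod_cnj by linarith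
    qed
  qed auto
  then show ?thesis by (rule abs_summable_summable)
qed

lemma square_summable_add:
  assumes "square_summable f" "square_summable g"
  shows "square_summable (\<lambda>i. f i + g i)"
proof -
  have "(\<lambda>i. 2 * ((cmod (f i))\<^sup>2 + (cmod (g i))\<^sup>2)) summable_on UNIV"
    using assms unfolding square_summable_def by (intro summable_on_cmult_right summable_on_add)
  then show ?thesis unfolding square_summable_def
  proof (rule summable_on_comparison_test)
    show "(cmod (f i + g i))\<^sup>2 \<le> 2 * ((cmod (f i))\<^sup>2 + (cmod (g i))\<^sup>2)" for i
    proof -
      have "(cmod (f i + g i))\<^sup>2 \<le> (cmod (f i) + cmod (g i))\<^sup>2"
        by (intro power_mono norm_triangle_ineq) auto
      also have "\<dots> \<le> 2 * ((cmod (f i))\<^sup>2 + (cmod (g i))\<^sup>2)"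
        using sum_squares_bound[of "cmod (f i)" "cmod (g i)"] by (simp add: power2_sum)
      finally show ?thesis .
    qed
  qed auto
qed

lemma square_summable_scale: "square_summable f \<Longrightarrow> square_summable (\<lambda>i. c * f i)"
  unfolding square_summable_def norm_mult power_mult_distrib by (rule summable_on_cmult_right)

lemma square_summable_uminus: "square_summable f \<Longrightarrow> square_summable (\<lambda>i. - f i)"
  using square_summable_scale[of f "-1"] by simp

lemma square_summable_diff: "square_summable f \<Longrightarrow> square_summable g \<Longrightarrow> square_summable (\<lambda>i. f i - g i)"
  using square_summable_add[of f "\<lambda>i. - g i"] square_summable_uminus[of g] by simp

text \<open>The model of the tensor product is the space of square-summable families over the product of
  the chosen orthonormal bases.  Nothing depends on this choice: the elementary tensors defined below
  satisfy the two properties that determine a Hilbert space tensor product up to a unique unitary,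
  \<open>cinner_otimes\<close> and \<open>otimes_total\<close>.\<close>

typedef (overloaded) ('a, 'b) htensor (infixr "\<otimes>\<^sub>H" 70) =
  "{f :: 'a::chilbert_space \<times> 'b::chilbert_space \<Rightarrow> complex.
     square_summable f \<and> (\<forall>p. p \<notin> hbasis \<times> hbasis \<longrightarrow> f p = 0)}"
  morphisms coord Abs_htensor
  by (rule exI[of _ "\<lambda>_. 0"]) (simp add: square_summable_def)

setup_lifting type_definition_htensor

lemma square_summable_coord: "square_summable (coord x)"
  and coord_outside: "p \<notin> hbasis \<times> hbasis \<Longrightarrow> coord x p = 0"
  using coord[of x] by blast+

instantiation htensor :: (chilbert_space, chilbert_space) real_inner
begin

lift_definition zero_htensor :: "'a \<otimes>\<^sub>H 'b" is "\<lambda>_. 0" by (simp add: square_summable_def)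
lift_definition plus_htensor :: "'a \<otimes>\<^sub>H 'b \<Rightarrow> 'a \<otimes>\<^sub>H 'b \<Rightarrow> 'a \<otimes>\<^sub>H 'b" is "\<lambda>f g p. f p + g p"
  by (auto intro: square_summable_add)
lift_definition minus_htensor :: "'a \<otimes>\<^sub>H 'b \<Rightarrow> 'a \<otimes>\<^sub>H 'b \<Rightarrow> 'a \<otimes>\<^sub>H 'b" is "\<lambda>f g p. f p - g p"
  by (auto intro: square_summable_diff)
lift_definition uminus_htensor :: "'a \<otimes>\<^sub>H 'b \<Rightarrow> 'a \<otimes>\<^sub>H 'b" is "\<lambda>f p. - f p"
  by (auto intro: square_summable_uminus)
lift_definition scaleR_htensor :: "real \<Rightarrow> 'a \<otimes>\<^sub>H 'b \<Rightarrow> 'a \<otimes>\<^sub>H 'b" is "\<lambda>r f p. complex_of_real r * f p"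
  by (auto intro: square_summable_scale)
definition inner_htensor :: "'a \<otimes>\<^sub>H 'b \<Rightarrow> 'a \<otimes>\<^sub>H 'b \<Rightarrow> real" where
  "inner_htensor x y = Re (\<Sum>\<^sub>\<infinity>p. cnj (coord x p) * coord y p)"
definition norm_htensor :: "'a \<otimes>\<^sub>H 'b \<Rightarrow> real" where "norm_htensor x = sqrt (inner x x)"
definition dist_htensor :: "'a \<otimes>\<^sub>H 'b \<Rightarrow> 'a \<otimes>\<^sub>H 'b \<Rightarrow> real" where "dist_htensor x y = norm (x - y)"
definition sgn_htensor :: "'a \<otimes>\<^sub>H 'b \<Rightarrow> 'a \<otimes>\<^sub>H 'b" where "sgn_htensor x = inverse (norm x) *\<^sub>R x"
definition "(uniformity :: (('a \<otimes>\<^sub>H 'b) \<times> ('a \<otimes>\<^sub>H 'b)) filter) = (INF e\<in>{0 <..}. principal {(x, y). dist x y < e})"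
definition "open (U :: ('a \<otimes>\<^sub>H 'b) set) = (\<forall>x\<in>U. \<forall>\<^sub>F (x', y) in uniformity. x' = x \<longrightarrow> y \<in> U)"

lemma coord_summable: "(\<lambda>p. cnj (coord (x::'a \<otimes>\<^sub>H 'b) p) * coord (y::'a \<otimes>\<^sub>H 'b) p) summable_on UNIV"
  by (intro square_summable_mult square_summable_coord)

lemma coord_norm: "(\<Sum>\<^sub>\<infinity>p. cnj (coord x p) * coord (x::'a \<otimes>\<^sub>H 'b) p) = complex_of_real (\<Sum>\<^sub>\<infinity>p. (cmod (coord x p))\<^sup>2)"
proof -
  have "((\<lambda>p. complex_of_real ((cmod (coord x p))\<^sup>2)) has_sum complex_of_real (\<Sum>\<^sub>\<infinity>p. (cmod (coord x p))\<^sup>2)) UNIV"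
    using square_summable_coord[of x] by (intro has_sum_of_real has_sum_infsum) (simp add: square_summable_def)
  then show ?thesis by (simp only: complex_norm_square mult.commute infsumI)
qed

lemma inner_htensor_self: "inner x (x::'a \<otimes>\<^sub>H 'b) = (\<Sum>\<^sub>\<infinity>p. (cmod (coord x p))\<^sup>2)"
  by (simp add: inner_htensor_def coord_norm)

instance
proof
  fix x y z :: "'a \<otimes>\<^sub>H 'b" and a b r :: real
  show "x + y + z = x + (y + z)" "x + y = y + x" "0 + x = x" "- x + x = 0" "x - y = x + - y"
    "a *\<^sub>R (x + y) = a *\<^sub>R x + a *\<^sub>R y" "(a + b) *\<^sub>R x = a *\<^sub>R x + b *\<^sub>R x"
    "a *\<^sub>R b *\<^sub>R x = (a * b) *\<^sub>R x" "1 *\<^sub>R x = x"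
    by (transfer; simp add: fun_eq_iff algebra_simps)+
  show "inner x y = inner y x"
  proof -
    have "inner y x = Re (cnj (\<Sum>\<^sub>\<infinity>p. cnj (coord y p) * coord x p))"
      by (simp add: inner_htensor_def)
    also have "\<dots> = inner x y"
      unfolding infsum_cnj[symmetric] inner_htensor_def by (simp add: mult.commute)
    finally show ?thesis by simp
  qed
  show "inner (x + y) z = inner x z + inner y z"
    unfolding inner_htensor_def plus_htensor.rep_eq
    by (simp add: distrib_right infsum_add coord_summable)
  show "inner (r *\<^sub>R x) y = r * inner x y"
    unfolding inner_htensor_def scaleR_htensor.rep_eq
    by (simp add: mult.assoc infsum_cmult_right coord_summable)
  show "0 \<le> inner x x" by (simp add: inner_htensor_self infsum_nonneg)
  show "(inner x x = 0) = (x = 0)"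
  proof
    assume "inner x x = 0"
    then have "(\<Sum>\<^sub>\<infinity>p. (cmod (coord x p))\<^sup>2) \<le> 0" by (simp add: inner_htensor_self)
    then have "(cmod (coord x p))\<^sup>2 = 0" for p
      using square_summable_coord[of x]
      by (intro nonneg_infsum_le_0D[where f = "\<lambda>p. (cmod (coord x p))\<^sup>2" and A = UNIV])
        (auto simp: square_summable_def)
    then show "x = 0" by transfer (auto simp: fun_eq_iff)
  next
    assume "x = 0"
    then show "inner x x = 0" by (simp add: inner_htensor_self zero_htensor.rep_eq)
  qed
qed (rule dist_htensor_def norm_htensor_def sgn_htensor_def uniformity_htensor_def open_htensor_def)+

end

lemma norm_htensor: "(norm x)\<^sup>2 = (\<Sum>\<^sub>\<infinity>p. (cmod (coord (x::'a::chilbert_space \<otimes>\<^sub>H 'b::chilbert_space) p))\<^sup>2)"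
  by (simp add: power2_norm_eq_inner inner_htensor_self)

lemma coord_sum_le: "finite F \<Longrightarrow> (\<Sum>p\<in>F. (cmod (coord x p))\<^sup>2) \<le> (norm x)\<^sup>2"
  unfolding norm_htensor using square_summable_coord[of x]
  by (intro finite_sum_le_infsum) (auto simp: square_summable_def)

lemma coord_le: "cmod (coord x p) \<le> norm x"
  using coord_sum_le[of "{p}" x] by (simp add: power2_le_iff_abs_le)

instance htensor :: (chilbert_space, chilbert_space) complete_space
proof
  fix X :: "nat \<Rightarrow> 'a \<otimes>\<^sub>H 'b"
  assume X: "Cauchy X"
  have "Cauchy (\<lambda>n. coord (X n) p)" for p
  proof (rule metric_CauchyI)
    fix \<epsilon> :: real assume "\<epsilon> > 0"
    then obtain N where "\<forall>m\<ge>N. \<forall>n\<ge>N. dist (X m) (X n) < \<epsilon>" using metric_CauchyD[OF X] by blast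
    moreover have "dist (coord (X m) p) (coord (X n) p) \<le> dist (X m) (X n)" for m n
      using coord_le[of "X m - X n" p] by (simp add: dist_norm minus_htensor.rep_eq)
    ultimately show "\<exists>N. \<forall>m\<ge>N. \<forall>n\<ge>N. dist (coord (X m) p) (coord (X n) p) < \<epsilon>"
      by (meson le_less_trans)
  qed
  then have "\<exists>l. (\<lambda>n. coord (X n) p) \<longlonglongrightarrow> l" for p
    using Cauchy_convergent convergent_def by blast
  then obtain f where f: "\<And>p. (\<lambda>n. coord (X n) p) \<longlonglongrightarrow> f p" by metis
  have f0: "f p = 0" if "p \<notin> hbasis \<times> hbasis" for p
    using f[of p] coord_outside[OF that] by (simp add: LIMSEQ_const_iff)
  have close: "\<exists>N. \<forall>n\<ge>N. \<forall>F. finite F \<longrightarrow> (\<Sum>p\<in>F. (cmod (coord (X n) p - f p))\<^sup>2) \<le> \<epsilon>\<^sup>2" if e: "\<epsilon> > 0" for \<epsilon>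
  proof -
    obtain N where N: "\<And>m n. m \<ge> N \<Longrightarrow> n \<ge> N \<Longrightarrow> norm (X n - X m) < \<epsilon>"
      using metric_CauchyD[OF X e] by (auto simp: dist_norm)
    have "(\<Sum>p\<in>F. (cmod (coord (X n) p - f p))\<^sup>2) \<le> \<epsilon>\<^sup>2" if n: "n \<ge> N" and F: "finite F" for n F
    proof (rule LIMSEQ_le_const2)
      show "(\<lambda>m. \<Sum>p\<in>F. (cmod (coord (X n) p - coord (X m) p))\<^sup>2) \<longlonglongrightarrow> (\<Sum>p\<in>F. (cmod (coord (X n) p - f p))\<^sup>2)"
        by (intro tendsto_intros f)
      have "(\<Sum>p\<in>F. (cmod (coord (X n) p - coord (X m) p))\<^sup>2) \<le> \<epsilon>\<^sup>2" if m: "m \<ge> N" for m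
        using coord_sum_le[OF F, of "X n - X m"] power_mono[OF less_imp_le[OF N[OF m n]], of 2]
        by (simp add: minus_htensor.rep_eq)
      then show "\<exists>N. \<forall>m\<ge>N. (\<Sum>p\<in>F. (cmod (coord (X n) p - coord (X m) p))\<^sup>2) \<le> \<epsilon>\<^sup>2" by blast
    qed
    then show ?thesis by blast
  qed
  have sq: "square_summable (\<lambda>p. coord (X n) p - f p)"
    if "\<forall>F. finite F \<longrightarrow> (\<Sum>p\<in>F. (cmod (coord (X n) p - f p))\<^sup>2) \<le> c" for n and c :: real
    unfolding square_summable_def using that
    by (intro nonneg_bdd_above_summable_on) (auto intro!: bdd_aboveI)
  obtain n where "square_summable (\<lambda>p. coord (X n) p - f p)" using close[of 1] sq by fastforce
  from square_summable_diff[OF square_summable_coord[of "X n"] this] have "square_summable f"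
    by simp
  then have ff: "f \<in> {f. square_summable f \<and> (\<forall>p. p \<notin> hbasis \<times> hbasis \<longrightarrow> f p = 0)}"
    using f0 by simp
  define l where "l = (Abs_htensor f :: 'a \<otimes>\<^sub>H 'b)"
  have l: "coord l = f" unfolding l_def using ff by (rule Abs_htensor_inverse)
  have "X \<longlonglongrightarrow> l"
  proof (rule LIMSEQ_I)
    fix \<epsilon> :: real assume "\<epsilon> > 0"
    then obtain N where N: "\<And>n F. n \<ge> N \<Longrightarrow> finite F \<Longrightarrow> (\<Sum>p\<in>F. (cmod (coord (X n) p - f p))\<^sup>2) \<le> (\<epsilon>/2)\<^sup>2"
      using close[of "\<epsilon>/2"] by auto
    have "norm (X n - l) < \<epsilon>" if "n \<ge> N" for n
    proof -
      have "(norm (X n - l))\<^sup>2 \<le> (\<epsilon>/2)\<^sup>2"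
        unfolding norm_htensor minus_htensor.rep_eq l using N[OF that] square_summable_coord[of "X n - l"]
        by (intro infsum_le_finite_sums) (auto simp: square_summable_def minus_htensor.rep_eq l)
      then have "norm (X n - l) \<le> \<epsilon>/2" using \<open>\<epsilon> > 0\<close> by (simp add: power2_le_iff_abs_le)
      then show ?thesis using \<open>\<epsilon> > 0\<close> by simp
    qed
    then show "\<exists>N. \<forall>n\<ge>N. norm (X n - l) < \<epsilon>" by blast
  qed
  then show "convergent X" by (auto simp: convergent_def)
qed

instantiation htensor :: (chilbert_space, chilbert_space) chilbert_space
begin

lift_definition scaleC_htensor :: "complex \<Rightarrow> 'a \<otimes>\<^sub>H 'b \<Rightarrow> 'a \<otimes>\<^sub>H 'b" is "\<lambda>c f p. c * f p"
  by (auto intro: square_summable_scale)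
definition cinner_htensor :: "'a \<otimes>\<^sub>H 'b \<Rightarrow> 'a \<otimes>\<^sub>H 'b \<Rightarrow> complex" where
  "cinner_htensor x y = (\<Sum>\<^sub>\<infinity>p. cnj (coord x p) * coord y p)"

instance
proof
  fix x y z :: "'a \<otimes>\<^sub>H 'b" and c d :: complex and r :: real
  show "c *\<^sub>C (x + y) = c *\<^sub>C x + c *\<^sub>C y" "(c + d) *\<^sub>C x = c *\<^sub>C x + d *\<^sub>C x"
    "c *\<^sub>C d *\<^sub>C x = (c * d) *\<^sub>C x" "r *\<^sub>R x = complex_of_real r *\<^sub>C x"
    by (transfer; simp add: fun_eq_iff algebra_simps)+
  show "cinner x y = cnj (cinner y x)"
    unfolding cinner_htensor_def infsum_cnj[symmetric] by (simp add: mult.commute)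
  show "cinner x (y + z) = cinner x y + cinner x z"
    unfolding cinner_htensor_def plus_htensor.rep_eq
    by (simp add: distrib_left infsum_add coord_summable)
  show "cinner x (c *\<^sub>C y) = c * cinner x y"
    unfolding cinner_htensor_def scaleC_htensor.rep_eq
    by (simp add: mult.left_commute infsum_cmult_right coord_summable)
  show "Re (cinner x y) = inner x y"
    by (simp add: cinner_htensor_def inner_htensor_def)
qed

end

lemma otimes_square_summable:
  "square_summable (\<lambda>(e, f). if e \<in> hbasis \<and> f \<in> hbasis then cinner e (x::'a::chilbert_space) * cinner f (y::'b::chilbert_space) else 0)"
proof -
  let ?f = "\<lambda>(e, f). (cmod (cinner e x * cinner f y))\<^sup>2"
  have "?f summable_on hbasis \<times> hbasis"
  proof (rule summable_on_SigmaI)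
    show "((\<lambda>f. ?f (e, f)) has_sum (cmod (cinner e x))\<^sup>2 * (\<Sum>\<^sub>\<infinity>f\<in>hbasis. (cmod (cinner f y))\<^sup>2)) hbasis" for e
      by (simp add: norm_mult power_mult_distrib has_sum_cmult_right hbasis_coord_summable)
  qed (auto intro: summable_on_cmult_left hbasis_coord_summable)
  also have "?f summable_on hbasis \<times> hbasis \<longleftrightarrow>
      (\<lambda>p. (cmod (case p of (e, f) \<Rightarrow> if e \<in> hbasis \<and> f \<in> hbasis then cinner e x * cinner f y else 0))\<^sup>2) summable_on UNIV"
    by (rule summable_on_cong_neutral) (auto split: if_splits)
  finally show ?thesis by (simp add: square_summable_def)
qed

lift_definition otimes :: "'a::chilbert_space \<Rightarrow> 'b::chilbert_space \<Rightarrow> 'a \<otimes>\<^sub>H 'b" (infixr "\<otimes>\<^sub>v" 70)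
  is "\<lambda>x y (e, f). if e \<in> hbasis \<and> f \<in> hbasis then cinner e x * cinner f y else 0"
  by (auto intro: otimes_square_summable)

theorem cinner_otimes: "cinner (x \<otimes>\<^sub>v y) (x' \<otimes>\<^sub>v y') = cinner x x' * cinner y y'"
proof -
  let ?f = "\<lambda>p. cnj (coord (x \<otimes>\<^sub>v y) p) * coord (x' \<otimes>\<^sub>v y') p"
  have "?f summable_on hbasis \<times> hbasis"
    by (rule summable_on_subset_banach[OF coord_summable]) simp
  moreover have "((\<lambda>f. ?f (e, f)) has_sum (cinner x e * cinner e x') * cinner y y') hbasis"
    if e: "e \<in> hbasis" for e
  proof -
    have "((\<lambda>f. (cinner x e * cinner e x') * (cinner y f * cinner f y')) has_sum (cinner x e * cinner e x') * cinner y y') hbasis"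
      by (intro has_sum_cmult_right parseval)
    then show ?thesis
      by (rule has_sum_cong[THEN iffD1, rotated])
        (use e in \<open>simp add: otimes.rep_eq cinner_commute[of x] cinner_commute[of y] mult_ac\<close>)
  qed
  moreover have "((\<lambda>e. (cinner x e * cinner e x') * cinner y y') has_sum cinner x x' * cinner y y') hbasis"
    by (intro has_sum_cmult_left parseval)
  ultimately have "(?f has_sum cinner x x' * cinner y y') (hbasis \<times> hbasis)"
    by (intro has_sum_SigmaI) auto
  also have "(?f has_sum cinner x x' * cinner y y') (hbasis \<times> hbasis) \<longleftrightarrow> (?f has_sum cinner x x' * cinner y y') UNIV"
    by (rule has_sum_cong_neutral) (auto simp: coord_outside)
  finally show ?thesis by (simp add: cinner_htensor_def infsumI)
qed

lemma cinner_otimes_hbasis: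
  assumes "e \<in> hbasis" "f \<in> hbasis"
  shows "cinner (e \<otimes>\<^sub>v f) \<xi> = coord \<xi> (e, f)"
proof -
  have "((\<lambda>p. cnj (coord (e \<otimes>\<^sub>v f) p) * coord \<xi> p) has_sum coord \<xi> (e, f)) UNIV"
    by (rule has_sum_finite_neutralI[of "{(e, f)}"])
      (use assms in \<open>auto simp: otimes.rep_eq cinner_hbasis split: if_splits\<close>)
  then show ?thesis by (simp add: cinner_htensor_def infsumI)
qed

lemma norm_otimes [simp]: "norm (x \<otimes>\<^sub>v y) = norm x * norm y"
proof -
  have "complex_of_real ((norm (x \<otimes>\<^sub>v y))\<^sup>2) = complex_of_real ((norm x * norm y)\<^sup>2)"
    by (simp only: cinner_self[symmetric] cinner_otimes) (simp add: cinner_self power_mult_distrib)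
  then show ?thesis by (metis of_real_eq_iff power2_eq_iff_nonneg norm_ge_zero mult_nonneg_nonneg)
qed

lemma otimes_add_left: "(x + x') \<otimes>\<^sub>v y = x \<otimes>\<^sub>v y + x' \<otimes>\<^sub>v y"
  and otimes_add_right: "x \<otimes>\<^sub>v (y + y') = x \<otimes>\<^sub>v y + x \<otimes>\<^sub>v y'"
  and otimes_scaleC_left: "(c *\<^sub>C x) \<otimes>\<^sub>v y = c *\<^sub>C (x \<otimes>\<^sub>v y)"
  and otimes_scaleC_right: "x \<otimes>\<^sub>v (c *\<^sub>C y) = c *\<^sub>C (x \<otimes>\<^sub>v y)"
  by (transfer; auto simp: fun_eq_iff cinner_add_right cinner_scaleC_right algebra_simps)+

lemma bounded_bilinear_otimes: "bounded_bilinear (\<otimes>\<^sub>v)"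
  by unfold_locales
    (auto simp: otimes_add_left otimes_add_right scaleR_scaleC otimes_scaleC_left otimes_scaleC_right
      intro!: exI[of _ 1])

lemma htensor_orthogonal:
  assumes "\<And>x y. cinner (x \<otimes>\<^sub>v y) \<xi> = 0"
  shows "\<xi> = 0"
proof -
  have "coord \<xi> p = 0" for p
    using assms cinner_otimes_hbasis[of "fst p" "snd p" \<xi>] coord_outside[of p \<xi>] by (cases p) fastforce
  then show ?thesis by transfer (auto simp: fun_eq_iff)
qed

theorem otimes_total: "closure (span {x \<otimes>\<^sub>v y | x y. True}) = (UNIV :: ('a::chilbert_space \<otimes>\<^sub>H 'b::chilbert_space) set)"
proof -
  have "\<xi> \<in> closure (span {x \<otimes>\<^sub>v y | x y. True})" for \<xi> :: "'a \<otimes>\<^sub>H 'b"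
    unfolding closure_approachable
  proof (intro allI impI)
    fix \<epsilon> :: real assume e: "\<epsilon> > 0"
    let ?q = "\<lambda>p. (cmod (coord \<xi> p))\<^sup>2"
    have q: "?q summable_on UNIV" using square_summable_coord by (simp add: square_summable_def)
    obtain F where F: "finite F" "dist (sum ?q F) (infsum ?q UNIV) \<le> \<epsilon>\<^sup>2 / 2"
      using infsum_finite_approximation[OF q, of "\<epsilon>\<^sup>2 / 2"] e by auto
    let ?t = "\<lambda>p. coord \<xi> p *\<^sub>C (fst p \<otimes>\<^sub>v snd p)"
    define \<eta> where "\<eta> = sum ?t (F \<inter> hbasis \<times> hbasis)"
    have coord_sum: "coord (sum g A) p = (\<Sum>q\<in>A. coord (g q) p)" for g :: "'a \<times> 'b \<Rightarrow> 'a \<otimes>\<^sub>H 'b" and A p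
      by (induction A rule: infinite_finite_induct) (auto simp: zero_htensor.rep_eq plus_htensor.rep_eq)
    have "coord \<eta> p = (\<Sum>q \<in> F \<inter> hbasis \<times> hbasis. if q = p then coord \<xi> p else 0)" for p
      unfolding \<eta>_def coord_sum scaleC_htensor.rep_eq
      by (intro sum.cong) (auto simp: otimes.rep_eq cinner_hbasis split: prod.splits if_splits)
    then have \<eta>: "coord \<eta> p = (if p \<in> F then coord \<xi> p else 0)" for p
      using F(1) coord_outside[of p \<xi>] by auto
    have "(norm (\<xi> - \<eta>))\<^sup>2 = infsum ?q (UNIV - F)"
      unfolding norm_htensor minus_htensor.rep_eq \<eta> by (rule infsum_cong_neutral) auto
    also have "\<dots> = infsum ?q UNIV - sum ?q F"
      using infsum_Un_disjoint[of ?q F "UNIV - F"] q F(1) summable_on_subset_banach[OF q, of "UNIV - F"] by simp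
    also have "\<dots> < \<epsilon>\<^sup>2"
    proof -
      have "0 < \<epsilon>\<^sup>2" using e by simp
      then show ?thesis using F(2) unfolding dist_real_def by linarith
    qed
    finally have "dist \<eta> \<xi> < \<epsilon>"
      using e by (simp add: dist_norm norm_minus_commute power2_less_imp_less)
    moreover have "\<eta> \<in> span {x \<otimes>\<^sub>v y | x y. True}"
      unfolding \<eta>_def by (intro span_sum span_base) (metis (mono_tags, lifting) mem_Collect_eq otimes_scaleC_left)
    ultimately show "\<exists>y\<in>span {x \<otimes>\<^sub>v y | x y. True}. dist y \<xi> < \<epsilon>" by blast
  qed
  then show ?thesis by blast
qed


section \<open>Bounded operators\<close>

definition bop :: "('a::chilbert_space \<Rightarrow>\<^sub>L 'b::chilbert_space) set" where
  "bop = {T. \<forall>c x. blinfun_apply T (c *\<^sub>C x) = c *\<^sub>C blinfun_apply T x}"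

definition adj :: "('a::chilbert_space \<Rightarrow>\<^sub>L 'b::chilbert_space) \<Rightarrow> 'b \<Rightarrow>\<^sub>L 'a" where
  "adj T = (THE S :: 'b \<Rightarrow>\<^sub>L 'a. \<forall>x y. cinner (S x) y = cinner x (T y))"

definition unitary :: "('a::chilbert_space \<Rightarrow>\<^sub>L 'b::chilbert_space) \<Rightarrow> bool" where
  "unitary U \<longleftrightarrow> U \<in> bop \<and> adj U o\<^sub>L U = id_blinfun \<and> U o\<^sub>L adj U = id_blinfun"

definition tensor_op ::
    "('a::chilbert_space \<Rightarrow>\<^sub>L 'c::chilbert_space) \<Rightarrow> ('b::chilbert_space \<Rightarrow>\<^sub>L 'd::chilbert_space) \<Rightarrow>
     ('a \<otimes>\<^sub>H 'b) \<Rightarrow>\<^sub>L ('c \<otimes>\<^sub>H 'd)" (infixr "\<otimes>\<^sub>o" 70) where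
  "S \<otimes>\<^sub>o T = (THE R :: ('a \<otimes>\<^sub>H 'b) \<Rightarrow>\<^sub>L ('c \<otimes>\<^sub>H 'd). \<forall>x y. R (x \<otimes>\<^sub>v y) = S x \<otimes>\<^sub>v T y)"

definition flip :: "('a::chilbert_space \<otimes>\<^sub>H 'b::chilbert_space) \<Rightarrow>\<^sub>L ('b \<otimes>\<^sub>H 'a)" where
  "flip = (THE R :: ('a \<otimes>\<^sub>H 'b) \<Rightarrow>\<^sub>L ('b \<otimes>\<^sub>H 'a). \<forall>x y. R (x \<otimes>\<^sub>v y) = y \<otimes>\<^sub>v x)"

definition assoc ::
    "('a::chilbert_space \<otimes>\<^sub>H 'b::chilbert_space \<otimes>\<^sub>H 'c::chilbert_space) \<Rightarrow>\<^sub>L (('a \<otimes>\<^sub>H 'b) \<otimes>\<^sub>H 'c)" where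
  "assoc = (THE R :: ('a \<otimes>\<^sub>H 'b \<otimes>\<^sub>H 'c) \<Rightarrow>\<^sub>L (('a \<otimes>\<^sub>H 'b) \<otimes>\<^sub>H 'c). \<forall>x y z. R (x \<otimes>\<^sub>v y \<otimes>\<^sub>v z) = (x \<otimes>\<^sub>v y) \<otimes>\<^sub>v z)"

lemma riesz_antilinear:
  fixes \<phi> :: "'a::chilbert_space \<Rightarrow> complex"
  assumes add: "\<And>u v. \<phi> (u + v) = \<phi> u + \<phi> v" and scale: "\<And>c u. \<phi> (c *\<^sub>C u) = cnj c * \<phi> u"
    and bound: "\<And>u. cmod (\<phi> u) \<le> M * norm u" and M: "0 \<le> M"
  shows "\<exists>s. (\<forall>u. \<phi> u = cinner u s) \<and> norm s \<le> M"
proof -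
  have bl: "bounded_linear \<phi>"
    by (rule bounded_linear_intro[of _ M])
      (auto simp: add scaleR_scaleC scale scaleR_conv_of_real bound mult.commute)
  have sum: "\<phi> (sum g A) = (\<Sum>i\<in>A. \<phi> (g i))" for g :: "'a \<Rightarrow> 'a" and A
    using linear_sum[OF bounded_linear.linear[OF bl]] by blast
  have le: "(\<Sum>e\<in>F. (cmod (\<phi> e))\<^sup>2) \<le> M\<^sup>2" if F: "finite F" "F \<subseteq> hbasis" for F
  proof -
    let ?q = "\<Sum>e\<in>F. (cmod (\<phi> e))\<^sup>2"
    define w where "w = (\<Sum>e\<in>F. \<phi> e *\<^sub>C e)"
    have nw: "(norm w)\<^sup>2 = ?q" unfolding w_def by (rule hbasis_sum_norm[OF F])
    have "\<phi> w = complex_of_real ?q"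
      unfolding w_def sum scale of_real_sum
      by (intro sum.cong) (simp_all add: complex_norm_square mult.commute del: of_real_power)
    then have "cmod (\<phi> w) = ?q" by (simp add: sum_nonneg del: of_real_sum)
    then have "(norm w)\<^sup>2 \<le> M * norm w" using bound[of w] nw by simp
    then have "norm w \<le> M \<or> norm w = 0" by (auto simp: power2_eq_square)
    moreover have "(norm w)\<^sup>2 \<le> M\<^sup>2" if "norm w \<le> M" using that by (intro power_mono) auto
    ultimately show ?thesis using nw by auto
  qed
  have "(\<lambda>e. (cmod (\<phi> e))\<^sup>2) summable_on hbasis"
    by (rule nonneg_bdd_above_summable_on) (auto intro!: bdd_aboveI le)
  from hbasis_summable[OF this] obtain s where s: "((\<lambda>e. \<phi> e *\<^sub>C e) has_sum s) hbasis"
    by (auto simp: summable_on_def)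
  have \<phi>: "\<phi> u = cinner u s" for u
  proof -
    have "((\<lambda>e. \<phi> (cinner e u *\<^sub>C e)) has_sum \<phi> u) hbasis"
      by (rule has_sum_bounded_linear[OF bl hbasis_expansion])
    moreover have "((\<lambda>e. cinner u (\<phi> e *\<^sub>C e)) has_sum cinner u s) hbasis"
      by (rule has_sum_bounded_linear[OF bounded_bilinear.bounded_linear_right[OF bounded_bilinear_cinner] s])
    moreover have "cinner u (\<phi> e *\<^sub>C e) = \<phi> (cinner e u *\<^sub>C e)" for e
      by (simp add: scale cinner_scaleC_right cinner_commute[of u e] mult.commute)
    ultimately show ?thesis using has_sum_unique by (metis (no_types, lifting) has_sum_cong)
  qed
  have "norm s \<le> M"
  proof (cases "s = 0")
    case True
    then show ?thesis using M by simp
  next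
    case False
    have "norm s * norm s \<le> M * norm s"
      using bound[of s] by (simp add: \<phi> cinner_self power2_eq_square norm_mult)
    then show ?thesis using False by simp
  qed
  with \<phi> show ?thesis by blast
qed
lemma bopI: "(\<And>c x. blinfun_apply T (c *\<^sub>C x) = c *\<^sub>C blinfun_apply T x) \<Longrightarrow> T \<in> bop"
  by (simp add: bop_def)

lemma bop_scaleC: "T \<in> bop \<Longrightarrow> blinfun_apply T (c *\<^sub>C x) = c *\<^sub>C blinfun_apply T x"
  by (simp add: bop_def)

lemma bop_id [simp]: "id_blinfun \<in> bop"
  and bop_compose: "S \<in> bop \<Longrightarrow> T \<in> bop \<Longrightarrow> S o\<^sub>L T \<in> bop"
  by (simp_all add: bop_def)

lemma sesquilinear_op_ex:
  fixes B :: "'a::chilbert_space \<Rightarrow> 'b::chilbert_space \<Rightarrow> complex"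
  assumes "\<And>u u' v. B (u + u') v = B u v + B u' v" "\<And>c u v. B (c *\<^sub>C u) v = cnj c * B u v"
    and "\<And>u v v'. B u (v + v') = B u v + B u v'" "\<And>c u v. B u (c *\<^sub>C v) = c * B u v"
    and bound: "\<And>u v. cmod (B u v) \<le> M * norm u * norm v" and M: "0 \<le> M"
  shows "\<exists>T\<in>bop. \<forall>u v. cinner u (blinfun_apply T v) = B u v"
proof -
  have "\<exists>s. (\<forall>u. B u v = cinner u s) \<and> norm s \<le> M * norm v" for v
    using bound[of _ v] M by (intro riesz_antilinear assms) (simp_all add: mult_ac)
  then obtain t where t: "\<And>u v. B u v = cinner u (t v)" "\<And>v. norm (t v) \<le> M * norm v" by metis
  have add: "t (v + v') = t v + t v'" for v v'
    by (rule cinner_ext) (simp add: cinner_add_right assms flip: t(1))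
  have scale: "t (c *\<^sub>C v) = c *\<^sub>C t v" for c v
    by (rule cinner_ext) (simp add: cinner_scaleC_right assms flip: t(1))
  have "bounded_linear t"
    by (rule bounded_linear_intro[of _ M]) (auto simp: add scale scaleR_scaleC t(2) mult.commute)
  then show ?thesis
    by (intro bexI[of _ "Blinfun t"]) (auto simp: bounded_linear_Blinfun_apply bop_def scale t(1))
qed

lemma adj_ex:
  assumes "T \<in> bop"
  shows "\<exists>S\<in>bop. \<forall>x y. cinner (blinfun_apply S x) y = cinner x (blinfun_apply T y)"
proof -
  have "\<exists>S\<in>bop. \<forall>y x. cinner y (blinfun_apply S x) = cinner (blinfun_apply T y) x"
  proof (rule sesquilinear_op_ex)
    show "cmod (cinner (blinfun_apply T u) v) \<le> norm T * norm u * norm v" for u v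
      by (rule order_trans[OF norm_cinner_le]) (intro mult_right_mono norm_blinfun norm_ge_zero)
  qed (use assms in \<open>auto simp: blinfun.add_right cinner_add_left cinner_add_right bop_scaleC
      cinner_scaleC_left cinner_scaleC_right\<close>)
  then show ?thesis by (metis cinner_commute)
qed

lemma adj_unique:
  assumes "\<And>x y. cinner (blinfun_apply S x) y = cinner x (blinfun_apply T y)"
  shows "adj T = S"
  unfolding adj_def
proof (rule the_equality)
  fix R assume R: "\<forall>x y. cinner (blinfun_apply R x) y = cinner x (blinfun_apply T y)"
  show "R = S"
  proof (rule blinfun_eqI, rule cinner_ext)
    fix x z show "cinner z (blinfun_apply R x) = cinner z (blinfun_apply S x)"
      using R assms by (metis cinner_commute)
  qed
qed (use assms in simp)

lemma adj_bop: "T \<in> bop \<Longrightarrow> adj T \<in> bop"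
  and cinner_adj_left: "T \<in> bop \<Longrightarrow> cinner (blinfun_apply (adj T) x) y = cinner x (blinfun_apply T y)"
  using adj_ex[of T] adj_unique[of _ T] by metis+

lemma cinner_adj_right: "T \<in> bop \<Longrightarrow> cinner y (blinfun_apply (adj T) x) = cinner (blinfun_apply T y) x"
  by (metis cinner_adj_left cinner_commute)

lemma blinfun_otimes_eqI:
  fixes S T :: "('a::chilbert_space \<otimes>\<^sub>H 'b::chilbert_space) \<Rightarrow>\<^sub>L 'c::real_normed_vector"
  assumes "\<And>x y. blinfun_apply S (x \<otimes>\<^sub>v y) = blinfun_apply T (x \<otimes>\<^sub>v y)"
  shows "S = T"
proof (rule blinfun_eqI)
  fix \<xi> :: "'a \<otimes>\<^sub>H 'b"
  have "closed {\<xi>. blinfun_apply S \<xi> = blinfun_apply T \<xi>}"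
    by (intro closed_Collect_eq continuous_intros)
  moreover have "span {x \<otimes>\<^sub>v y | x y. True} \<subseteq> {\<xi>. blinfun_apply S \<xi> = blinfun_apply T \<xi>}"
  proof (rule span_minimal)
    show "subspace {\<xi>. blinfun_apply S \<xi> = blinfun_apply T \<xi>}"
      by (auto simp: subspace_def blinfun.add_right blinfun.scaleR_right)
  qed (use assms in auto)
  ultimately have "closure (span {x \<otimes>\<^sub>v y | x y. True}) \<subseteq> {\<xi>. blinfun_apply S \<xi> = blinfun_apply T \<xi>}"
    by (rule closure_minimal[rotated])
  then show "blinfun_apply S \<xi> = blinfun_apply T \<xi>" unfolding otimes_total by blast
qed

lemma the_otimes_op:
  fixes R :: "('a::chilbert_space \<otimes>\<^sub>H 'b::chilbert_space) \<Rightarrow>\<^sub>L 'c::chilbert_space"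
  assumes "\<And>x y. blinfun_apply R (x \<otimes>\<^sub>v y) = g x y"
  shows "(THE R :: ('a \<otimes>\<^sub>H 'b) \<Rightarrow>\<^sub>L 'c. \<forall>x y. blinfun_apply R (x \<otimes>\<^sub>v y) = g x y) = R"
  using assms by (intro the_equality blinfun_otimes_eqI) auto

lemma finite_prod_cover:
  assumes "finite F" "F \<subseteq> A \<times> B"
  shows "\<exists>G H. finite G \<and> finite H \<and> G \<subseteq> A \<and> H \<subseteq> B \<and> F \<subseteq> G \<times> H"
proof (intro exI conjI)
  show "finite (fst ` F)" "finite (snd ` F)" using assms by simp_all
  show "fst ` F \<subseteq> A" "snd ` F \<subseteq> B" using assms(2) by auto
  show "F \<subseteq> fst ` F \<times> snd ` F" by (rule subset_fst_snd)
qed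

lemma otimes_op_ex:
  fixes g :: "'a::chilbert_space \<Rightarrow> 'b::chilbert_space \<Rightarrow> 'c::chilbert_space"
  assumes bil: "bounded_bilinear g"
    and scale: "\<And>c x y. g (c *\<^sub>C x) y = c *\<^sub>C g x y" "\<And>c x y. g x (c *\<^sub>C y) = c *\<^sub>C g x y"
    and bound: "\<And>G H c. finite G \<Longrightarrow> finite H \<Longrightarrow> G \<subseteq> hbasis \<Longrightarrow> H \<subseteq> hbasis \<Longrightarrow>
       (norm (\<Sum>(e, f)\<in>G \<times> H. c e f *\<^sub>C g e f))\<^sup>2 \<le> M\<^sup>2 * (\<Sum>(e, f)\<in>G \<times> H. (cmod (c e f))\<^sup>2)"
    and M: "0 \<le> M"
  shows "\<exists>R\<in>bop. \<forall>x y. blinfun_apply R (x \<otimes>\<^sub>v y) = g x y"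
proof -
  define A where "A z = (\<lambda>(e, f). if e \<in> hbasis \<and> f \<in> hbasis then cinner (g e f) z else 0)" for z
  have fin_le: "(\<Sum>p\<in>F. (cmod (A z p))\<^sup>2) \<le> (M * norm z)\<^sup>2" if F: "finite F" for F z
  proof -
    obtain G H where GH: "finite G" "finite H" "G \<subseteq> hbasis" "H \<subseteq> hbasis" "F \<inter> hbasis \<times> hbasis \<subseteq> G \<times> H"
      using finite_prod_cover[of "F \<inter> hbasis \<times> hbasis" hbasis hbasis] F by auto
    let ?q = "\<Sum>(e, f)\<in>G \<times> H. (cmod (cinner (g e f) z))\<^sup>2"
    define w where "w = (\<Sum>(e, f)\<in>G \<times> H. cinner (g e f) z *\<^sub>C g e f)"
    have "cinner w z = complex_of_real ?q"
      unfolding w_def cinner_sum_left of_real_sum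
      by (intro sum.cong) (auto simp: cinner_scaleC_left complex_norm_square mult.commute simp del: of_real_power)
    then have "cmod (cinner w z) = ?q"
      by (simp add: sum_nonneg case_prod_beta del: of_real_sum)
    then have qle: "?q \<le> norm w * norm z" using norm_cinner_le[of w z] by simp
    have q0: "0 \<le> ?q" by (simp add: sum_nonneg case_prod_beta)
    have "(norm w)\<^sup>2 \<le> M\<^sup>2 * ?q" unfolding w_def by (rule bound[OF GH(1-4)])
    then have q_le: "?q \<le> M\<^sup>2 * (norm z)\<^sup>2"
    proof -
      have aux: "q \<le> M\<^sup>2 * (norm z)\<^sup>2" if "0 \<le> q" "q \<le> n * norm z" "n\<^sup>2 \<le> M\<^sup>2 * q" for q n :: real
      proof (cases "q = 0")
        case False
        have "q\<^sup>2 \<le> n\<^sup>2 * (norm z)\<^sup>2" using power_mono[OF that(2,1), of 2] by (simp only: power_mult_distrib)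
        also have "\<dots> \<le> (M\<^sup>2 * q) * (norm z)\<^sup>2" by (rule mult_right_mono[OF that(3)]) simp
        finally have "q * q \<le> q * (M\<^sup>2 * (norm z)\<^sup>2)" by (simp only: power2_eq_square mult_ac)
        then show ?thesis using False that(1) by (simp add: mult_le_cancel_left)
      qed simp
      assume "(norm w)\<^sup>2 \<le> M\<^sup>2 * ?q"
      with q0 qle show ?thesis by (rule aux)
    qed
    have "(\<Sum>p\<in>F. (cmod (A z p))\<^sup>2) = (\<Sum>p\<in>F \<inter> hbasis \<times> hbasis. (cmod (A z p))\<^sup>2)"
      using F by (intro sum.mono_neutral_right) (auto simp: A_def split: if_splits)
    also have "\<dots> \<le> (\<Sum>p\<in>G \<times> H. (cmod (A z p))\<^sup>2)"
      using GH by (intro sum_mono2) simp_all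
    also have "\<dots> = ?q"
    proof (rule sum.cong[OF refl])
      fix p assume "p \<in> G \<times> H"
      then have "fst p \<in> hbasis" "snd p \<in> hbasis" using GH by auto
      then show "(cmod (A z p))\<^sup>2 = (case p of (e, f) \<Rightarrow> (cmod (cinner (g e f) z))\<^sup>2)"
        by (simp add: A_def case_prod_beta)
    qed
    also note q_le
    finally show ?thesis by (simp only: power_mult_distrib)
  qed
  have sq: "square_summable (A z)" for z
    unfolding square_summable_def by (rule nonneg_bdd_above_summable_on) (auto intro!: bdd_aboveI fin_le)
  define a where "a z = (Abs_htensor (A z) :: 'a \<otimes>\<^sub>H 'b)" for z
  have a: "coord (a z) = A z" for z
    unfolding a_def by (rule Abs_htensor_inverse) (auto simp: sq, auto simp: A_def)
  have norm_a: "norm (a z) \<le> M * norm z" for z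
  proof -
    have "(norm (a z))\<^sup>2 \<le> (M * norm z)\<^sup>2"
      unfolding norm_htensor a using sq by (intro infsum_le_finite_sums fin_le) (simp add: square_summable_def)
    then show ?thesis using M by (simp add: power2_le_iff_abs_le)
  qed
  have "\<exists>R\<in>bop. \<forall>z \<xi>. cinner z (blinfun_apply R \<xi>) = cinner (a z) \<xi>"
  proof (rule sesquilinear_op_ex)
    have "a (u + u') = a u + a u'" for u u'
      unfolding coord_inject[symmetric] plus_htensor.rep_eq a by (auto simp: A_def fun_eq_iff cinner_add_right)
    then show "cinner (a (u + u')) v = cinner (a u) v + cinner (a u') v" for u u' v
      by (simp add: cinner_add_left)
    have "a (c *\<^sub>C u) = c *\<^sub>C a u" for c u
      unfolding coord_inject[symmetric] scaleC_htensor.rep_eq a by (auto simp: A_def fun_eq_iff cinner_scaleC_right)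
    then show "cinner (a (c *\<^sub>C u)) v = cnj c * cinner (a u) v" for c u v
      by (simp add: cinner_scaleC_left)
    show "cmod (cinner (a u) v) \<le> M * norm u * norm v" for u v
      by (rule order_trans[OF norm_cinner_le]) (intro mult_right_mono norm_a norm_ge_zero)
  qed (auto simp: cinner_add_right cinner_scaleC_right M)
  then obtain R where R: "R \<in> bop" "\<And>z \<xi>. cinner z (blinfun_apply R \<xi>) = cinner (a z) \<xi>" by blast
  have "cinner z (blinfun_apply R (x \<otimes>\<^sub>v y)) = cinner z (g x y)" for x y z
  proof -
    let ?h = "\<lambda>(e, f). cinner z (g e f) * (cinner e x * cinner f y)"
    let ?k = "\<lambda>p. cnj (coord (a z) p) * coord (x \<otimes>\<^sub>v y) p"
    have "(?k has_sum cinner (a z) (x \<otimes>\<^sub>v y)) UNIV"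
      unfolding cinner_htensor_def by (rule has_sum_infsum[OF coord_summable])
    also have "(?k has_sum cinner (a z) (x \<otimes>\<^sub>v y)) UNIV \<longleftrightarrow> (?h has_sum cinner (a z) (x \<otimes>\<^sub>v y)) (hbasis \<times> hbasis)"
      by (rule has_sum_cong_neutral)
        (auto simp: a A_def otimes.rep_eq cinner_commute[of z] split: if_splits)
    finally have 1: "(?h has_sum cinner (a z) (x \<otimes>\<^sub>v y)) (hbasis \<times> hbasis)" .
    have 2: "((\<lambda>f. ?h (e, f)) has_sum cinner e x * cinner z (g e y)) hbasis" for e
    proof -
      have "((\<lambda>f. cinner e x * cinner z (g e (cinner f y *\<^sub>C f))) has_sum cinner e x * cinner z (g e y)) hbasis"
        by (intro has_sum_cmult_right has_sum_bounded_linear[OF _ hbasis_expansion]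
            bounded_linear_compose[OF bounded_bilinear.bounded_linear_right[OF bounded_bilinear_cinner]
              bounded_bilinear.bounded_linear_right[OF bil]])
      then show ?thesis by (simp add: scale cinner_scaleC_right mult_ac)
    qed
    have 3: "((\<lambda>e. cinner e x * cinner z (g e y)) has_sum cinner z (g x y)) hbasis"
    proof -
      have "((\<lambda>e. cinner z (g (cinner e x *\<^sub>C e) y)) has_sum cinner z (g x y)) hbasis"
        by (intro has_sum_bounded_linear[OF _ hbasis_expansion]
            bounded_linear_compose[OF bounded_bilinear.bounded_linear_right[OF bounded_bilinear_cinner]
              bounded_bilinear.bounded_linear_left[OF bil]])
      then show ?thesis by (simp add: scale cinner_scaleC_right)
    qed
    have "((\<lambda>e. cinner e x * cinner z (g e y)) has_sum cinner (a z) (x \<otimes>\<^sub>v y)) hbasis"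
      by (rule has_sum_SigmaD[OF 1]) (rule 2)
    then have "cinner (a z) (x \<otimes>\<^sub>v y) = cinner z (g x y)"
      using 3 by (rule has_sum_unique)
    then show ?thesis by (simp add: R(2))
  qed
  then have "blinfun_apply R (x \<otimes>\<^sub>v y) = g x y" for x y by (intro cinner_ext)
  with R(1) show ?thesis by blast
qed

lemma otimes_isometry_ex:
  fixes g :: "'a::chilbert_space \<Rightarrow> 'b::chilbert_space \<Rightarrow> 'c::chilbert_space"
  assumes g: "\<And>x y x' y'. cinner (g x y) (g x' y') = cinner x x' * cinner y y'"
  shows "\<exists>R\<in>bop. \<forall>x y. blinfun_apply R (x \<otimes>\<^sub>v y) = g x y"
proof (rule otimes_op_ex)
  have zero: "v = 0" if "cinner v v = 0" for v :: 'c
    using that by (simp add: cinner_self)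
  have norm: "norm (g x y) = norm x * norm y" for x y
  proof -
    have "complex_of_real ((norm (g x y))\<^sup>2) = complex_of_real ((norm x * norm y)\<^sup>2)"
      by (simp only: cinner_self[symmetric] g) (simp add: cinner_self power_mult_distrib)
    then show ?thesis by (metis of_real_eq_iff power2_eq_iff_nonneg norm_ge_zero mult_nonneg_nonneg)
  qed
  have add1: "g (x + x') y = g x y + g x' y" for x x' y
  proof -
    have "g (x + x') y - (g x y + g x' y) = 0"
      by (rule zero) (simp add: g cinner_diff_left cinner_diff_right cinner_add_left cinner_add_right algebra_simps)
    then show ?thesis by simp
  qed
  have add2: "g x (y + y') = g x y + g x y'" for x y y'
  proof -
    have "g x (y + y') - (g x y + g x y') = 0"
      by (rule zero) (simp add: g cinner_diff_left cinner_diff_right cinner_add_left cinner_add_right algebra_simps)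
    then show ?thesis by simp
  qed
  have sc1: "g (c *\<^sub>C x) y = c *\<^sub>C g x y" for c x y
  proof -
    have "g (c *\<^sub>C x) y - c *\<^sub>C g x y = 0"
      by (rule zero) (simp add: g cinner_diff_left cinner_diff_right cinner_scaleC_left cinner_scaleC_right algebra_simps)
    then show ?thesis by simp
  qed
  have sc2: "g x (c *\<^sub>C y) = c *\<^sub>C g x y" for c x y
  proof -
    have "g x (c *\<^sub>C y) - c *\<^sub>C g x y = 0"
      by (rule zero) (simp add: g cinner_diff_left cinner_diff_right cinner_scaleC_left cinner_scaleC_right algebra_simps)
    then show ?thesis by simp
  qed
  show "bounded_bilinear g"
    by unfold_locales (auto simp: add1 add2 scaleR_scaleC sc1 sc2 norm intro!: exI[of _ 1])
  show "g (c *\<^sub>C x) y = c *\<^sub>C g x y" "g x (c *\<^sub>C y) = c *\<^sub>C g x y" for c x y by (rule sc1 sc2)+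
  show "(norm (\<Sum>(e, f)\<in>G \<times> H. c e f *\<^sub>C g e f))\<^sup>2 \<le> 1\<^sup>2 * (\<Sum>(e, f)\<in>G \<times> H. (cmod (c e f))\<^sup>2)"
    if GH: "finite G" "finite H" "G \<subseteq> hbasis" "H \<subseteq> hbasis" for G H c
  proof -
    define w where "w = (\<Sum>(e, f)\<in>G \<times> H. c e f *\<^sub>C g e f)"
    have "cinner w w = (\<Sum>p\<in>G \<times> H. \<Sum>q\<in>G \<times> H. cinner (case q of (e, f) \<Rightarrow> c e f *\<^sub>C g e f) (case p of (e, f) \<Rightarrow> c e f *\<^sub>C g e f))"
      unfolding w_def by (simp only: cinner_sum_left cinner_sum_right)
    also have "\<dots> = (\<Sum>p\<in>G \<times> H. \<Sum>q\<in>G \<times> H. if p = q then complex_of_real ((cmod (case q of (e, f) \<Rightarrow> c e f))\<^sup>2) else 0)"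
      using GH by (intro sum.cong refl)
        (auto simp: g cinner_scaleC_left cinner_scaleC_right cinner_hbasis subset_iff complex_norm_square mult.commute simp del: of_real_power split: if_splits)
    also have "\<dots> = (\<Sum>p\<in>G \<times> H. complex_of_real ((cmod (case p of (e, f) \<Rightarrow> c e f))\<^sup>2))"
      using GH by (intro sum.cong) auto
    also have "\<dots> = complex_of_real (\<Sum>(e, f)\<in>G \<times> H. (cmod (c e f))\<^sup>2)"
      unfolding of_real_sum by (intro sum.cong) auto
    finally have "(norm w)\<^sup>2 = (\<Sum>(e, f)\<in>G \<times> H. (cmod (c e f))\<^sup>2)"
      unfolding cinner_self of_real_eq_iff .
    then show ?thesis by (simp add: w_def)
  qed
qed simp

lemma norm_sum_otimes_right:
  assumes "finite H" "H \<subseteq> hbasis"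
  shows "(norm (\<Sum>f\<in>H. v f \<otimes>\<^sub>v f))\<^sup>2 = (\<Sum>f\<in>H. (norm (v f))\<^sup>2)"
proof -
  have "cinner (\<Sum>f\<in>H. v f \<otimes>\<^sub>v f) (\<Sum>f\<in>H. v f \<otimes>\<^sub>v f) = (\<Sum>f\<in>H. \<Sum>h\<in>H. cinner (v h \<otimes>\<^sub>v h) (v f \<otimes>\<^sub>v f))"
    by (simp only: cinner_sum_left cinner_sum_right)
  also have "\<dots> = (\<Sum>f\<in>H. \<Sum>h\<in>H. if f = h then complex_of_real ((norm (v f))\<^sup>2) else 0)" using assms
    by (intro sum.cong refl) (auto simp: cinner_otimes cinner_hbasis subset_iff cinner_self)
  also have "\<dots> = complex_of_real (\<Sum>f\<in>H. (norm (v f))\<^sup>2)" using assms by simp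
  finally show ?thesis by (simp only: cinner_self of_real_eq_iff)
qed

lemma norm_sum_otimes_left:
  assumes "finite H" "H \<subseteq> hbasis"
  shows "(norm (\<Sum>f\<in>H. f \<otimes>\<^sub>v v f))\<^sup>2 = (\<Sum>f\<in>H. (norm (v f))\<^sup>2)"
proof -
  have "cinner (\<Sum>f\<in>H. f \<otimes>\<^sub>v v f) (\<Sum>f\<in>H. f \<otimes>\<^sub>v v f) = (\<Sum>f\<in>H. \<Sum>h\<in>H. cinner (h \<otimes>\<^sub>v v h) (f \<otimes>\<^sub>v v f))"
    by (simp only: cinner_sum_left cinner_sum_right)
  also have "\<dots> = (\<Sum>f\<in>H. \<Sum>h\<in>H. if f = h then complex_of_real ((norm (v f))\<^sup>2) else 0)" using assms
    by (intro sum.cong refl) (auto simp: cinner_otimes cinner_hbasis subset_iff cinner_self)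
  also have "\<dots> = complex_of_real (\<Sum>f\<in>H. (norm (v f))\<^sup>2)" using assms by simp
  finally show ?thesis by (simp only: cinner_self of_real_eq_iff)
qed

lemmas otimes_sum_left = linear_sum[OF bounded_linear.linear[OF bounded_bilinear.bounded_linear_left[OF bounded_bilinear_otimes]]]
lemmas otimes_sum_right = linear_sum[OF bounded_linear.linear[OF bounded_bilinear.bounded_linear_right[OF bounded_bilinear_otimes]]]

lemma blinfun_sum_sq_le:
  assumes T: "T \<in> bop" and G: "finite G" "G \<subseteq> hbasis"
  shows "(norm (\<Sum>e\<in>G. c e *\<^sub>C blinfun_apply T e))\<^sup>2 \<le> (norm T)\<^sup>2 * (\<Sum>e\<in>G. (cmod (c e))\<^sup>2)"
proof -
  have "(\<Sum>e\<in>G. c e *\<^sub>C blinfun_apply T e) = blinfun_apply T (\<Sum>e\<in>G. c e *\<^sub>C e)"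
    by (simp add: blinfun.sum_right bop_scaleC[OF T])
  moreover have "(norm (blinfun_apply T (\<Sum>e\<in>G. c e *\<^sub>C e)))\<^sup>2 \<le> (norm T * norm (\<Sum>e\<in>G. c e *\<^sub>C e))\<^sup>2"
    by (intro power_mono norm_blinfun norm_ge_zero)
  ultimately show ?thesis by (simp add: power_mult_distrib hbasis_sum_norm[OF G])
qed

lemma tensor_left_ex:
  fixes S :: "'a::chilbert_space \<Rightarrow>\<^sub>L 'c::chilbert_space"
  assumes S: "S \<in> bop"
  shows "\<exists>R\<in>bop. \<forall>x (y :: 'b::chilbert_space). blinfun_apply R (x \<otimes>\<^sub>v y) = blinfun_apply S x \<otimes>\<^sub>v y"
proof (rule otimes_op_ex)
  show "bounded_bilinear (\<lambda>x (y::'b). blinfun_apply S x \<otimes>\<^sub>v y)"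
    by (rule bounded_bilinear.comp1[OF bounded_bilinear_otimes blinfun.bounded_linear_right])
  show "(norm (\<Sum>(e, f)\<in>G \<times> H. c e f *\<^sub>C (blinfun_apply S e \<otimes>\<^sub>v f)))\<^sup>2 \<le> (norm S)\<^sup>2 * (\<Sum>(e, f)\<in>G \<times> H. (cmod (c e f))\<^sup>2)"
    if GH: "finite G" "finite (H :: 'b set)" "G \<subseteq> hbasis" "H \<subseteq> hbasis" for G H c
  proof -
    have "(\<Sum>(e, f)\<in>G \<times> H. c e f *\<^sub>C (blinfun_apply S e \<otimes>\<^sub>v f)) = (\<Sum>f\<in>H. (\<Sum>e\<in>G. c e f *\<^sub>C blinfun_apply S e) \<otimes>\<^sub>v f)"
      by (simp add: sum.cartesian_product[symmetric] otimes_sum_left otimes_scaleC_left) (rule sum.swap)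
    then have "(norm (\<Sum>(e, f)\<in>G \<times> H. c e f *\<^sub>C (blinfun_apply S e \<otimes>\<^sub>v f)))\<^sup>2 = (\<Sum>f\<in>H. (norm (\<Sum>e\<in>G. c e f *\<^sub>C blinfun_apply S e))\<^sup>2)"
      by (simp add: norm_sum_otimes_right GH)
    also have "\<dots> \<le> (\<Sum>f\<in>H. (norm S)\<^sup>2 * (\<Sum>e\<in>G. (cmod (c e f))\<^sup>2))"
      by (intro sum_mono blinfun_sum_sq_le S GH)
    also have "\<dots> = (norm S)\<^sup>2 * (\<Sum>e\<in>G. \<Sum>f\<in>H. (cmod (c e f))\<^sup>2)"
      unfolding sum_distrib_left[symmetric] by (subst sum.swap) simp
    finally show ?thesis by (simp add: sum.cartesian_product)
  qed
qed (simp_all add: bop_scaleC[OF S] otimes_scaleC_left otimes_scaleC_right)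

lemma tensor_right_ex:
  fixes T :: "'b::chilbert_space \<Rightarrow>\<^sub>L 'c::chilbert_space"
  assumes T: "T \<in> bop"
  shows "\<exists>R\<in>bop. \<forall>(x :: 'a::chilbert_space) y. blinfun_apply R (x \<otimes>\<^sub>v y) = x \<otimes>\<^sub>v blinfun_apply T y"
proof (rule otimes_op_ex)
  show "bounded_bilinear (\<lambda>(x::'a) y. x \<otimes>\<^sub>v blinfun_apply T y)"
    using bounded_bilinear.comp[OF bounded_bilinear_otimes bounded_linear_ident blinfun.bounded_linear_right] .
  show "(norm (\<Sum>(e, f)\<in>G \<times> H. c e f *\<^sub>C (e \<otimes>\<^sub>v blinfun_apply T f)))\<^sup>2 \<le> (norm T)\<^sup>2 * (\<Sum>(e, f)\<in>G \<times> H. (cmod (c e f))\<^sup>2)"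
    if GH: "finite (G :: 'a set)" "finite H" "G \<subseteq> hbasis" "H \<subseteq> hbasis" for G H c
  proof -
    have "(\<Sum>(e, f)\<in>G \<times> H. c e f *\<^sub>C (e \<otimes>\<^sub>v blinfun_apply T f)) = (\<Sum>e\<in>G. e \<otimes>\<^sub>v (\<Sum>f\<in>H. c e f *\<^sub>C blinfun_apply T f))"
      by (simp add: sum.cartesian_product[symmetric] otimes_sum_right otimes_scaleC_right)
    then have "(norm (\<Sum>(e, f)\<in>G \<times> H. c e f *\<^sub>C (e \<otimes>\<^sub>v blinfun_apply T f)))\<^sup>2 = (\<Sum>e\<in>G. (norm (\<Sum>f\<in>H. c e f *\<^sub>C blinfun_apply T f))\<^sup>2)"
      by (simp add: norm_sum_otimes_left GH)
    also have "\<dots> \<le> (\<Sum>e\<in>G. (norm T)\<^sup>2 * (\<Sum>f\<in>H. (cmod (c e f))\<^sup>2))"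
      by (intro sum_mono blinfun_sum_sq_le T GH)
    also have "\<dots> = (norm T)\<^sup>2 * (\<Sum>(e, f)\<in>G \<times> H. (cmod (c e f))\<^sup>2)"
      unfolding sum_distrib_left[symmetric] by (simp add: sum.cartesian_product)
    finally show ?thesis .
  qed
qed (simp_all add: bop_scaleC[OF T] otimes_scaleC_left otimes_scaleC_right)

lemma tensor_op_bop: "S \<in> bop \<Longrightarrow> T \<in> bop \<Longrightarrow> S \<otimes>\<^sub>o T \<in> bop"
  and tensor_op_otimes: "S \<in> bop \<Longrightarrow> T \<in> bop \<Longrightarrow> blinfun_apply (S \<otimes>\<^sub>o T) (x \<otimes>\<^sub>v y) = blinfun_apply S x \<otimes>\<^sub>v blinfun_apply T y"
  for S :: "'a::chilbert_space \<Rightarrow>\<^sub>L 'c::chilbert_space" and T :: "'b::chilbert_space \<Rightarrow>\<^sub>L 'd::chilbert_space"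
proof -
  have *: "S \<otimes>\<^sub>o T \<in> bop \<and> (\<forall>x y. blinfun_apply (S \<otimes>\<^sub>o T) (x \<otimes>\<^sub>v y) = blinfun_apply S x \<otimes>\<^sub>v blinfun_apply T y)"
    if ST: "S \<in> bop" "T \<in> bop"
  proof -
    obtain R1 where R1: "R1 \<in> bop" "\<And>x (y::'d). blinfun_apply R1 (x \<otimes>\<^sub>v y) = blinfun_apply S x \<otimes>\<^sub>v y"
      using tensor_left_ex[OF ST(1)] by blast
    obtain R2 where R2: "R2 \<in> bop" "\<And>(x::'a) y. blinfun_apply R2 (x \<otimes>\<^sub>v y) = x \<otimes>\<^sub>v blinfun_apply T y"
      using tensor_right_ex[OF ST(2)] by blast
    have R: "blinfun_apply (R1 o\<^sub>L R2) (x \<otimes>\<^sub>v y) = blinfun_apply S x \<otimes>\<^sub>v blinfun_apply T y" for x y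
      by (simp add: R1 R2)
    from R have "S \<otimes>\<^sub>o T = R1 o\<^sub>L R2" unfolding tensor_op_def by (rule the_otimes_op)
    with R show ?thesis using bop_compose[OF R1(1) R2(1)] by simp
  qed
  show "S \<in> bop \<Longrightarrow> T \<in> bop \<Longrightarrow> S \<otimes>\<^sub>o T \<in> bop"
    and "S \<in> bop \<Longrightarrow> T \<in> bop \<Longrightarrow> blinfun_apply (S \<otimes>\<^sub>o T) (x \<otimes>\<^sub>v y) = blinfun_apply S x \<otimes>\<^sub>v blinfun_apply T y"
    using * by auto
qed

lemma flip_bop: "(flip :: ('a::chilbert_space \<otimes>\<^sub>H 'b::chilbert_space) \<Rightarrow>\<^sub>L ('b \<otimes>\<^sub>H 'a)) \<in> bop"
  and flip_otimes: "blinfun_apply flip ((x::'a) \<otimes>\<^sub>v (y::'b)) = y \<otimes>\<^sub>v x"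
proof -
  obtain R where R: "R \<in> bop" "\<And>(x::'a) (y::'b). blinfun_apply R (x \<otimes>\<^sub>v y) = y \<otimes>\<^sub>v x"
    using otimes_isometry_ex[of "\<lambda>(x::'a) (y::'b). y \<otimes>\<^sub>v x"] by (auto simp: cinner_otimes)
  from R(2) have "flip = R" unfolding flip_def by (rule the_otimes_op)
  with R show "(flip :: ('a \<otimes>\<^sub>H 'b) \<Rightarrow>\<^sub>L ('b \<otimes>\<^sub>H 'a)) \<in> bop" "blinfun_apply flip ((x::'a) \<otimes>\<^sub>v (y::'b)) = y \<otimes>\<^sub>v x"
    by simp_all
qed

lemma cinner_blinfun_otimes_eqI:
  fixes S T :: "('a::chilbert_space \<otimes>\<^sub>H 'b::chilbert_space) \<Rightarrow>\<^sub>L 'c::chilbert_space"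
  assumes "\<And>x y x' y'. cinner (blinfun_apply S (x \<otimes>\<^sub>v y)) (blinfun_apply T (x' \<otimes>\<^sub>v y')) = c * cinner (x \<otimes>\<^sub>v y) (x' \<otimes>\<^sub>v y')"
    and S: "S \<in> bop" and T: "T \<in> bop"
  shows "cinner (blinfun_apply S \<xi>) (blinfun_apply T \<eta>) = c * cinner \<xi> \<eta>"
proof -
  have adjS: "cinner (blinfun_apply S \<xi>) (blinfun_apply T \<eta>) = cinner \<xi> (blinfun_apply (adj S o\<^sub>L T) \<eta>)" for \<xi> \<eta>
    by (simp add: cinner_adj_right S)
  have bl: "bounded_linear (\<lambda>\<eta>::'a \<otimes>\<^sub>H 'b. c *\<^sub>C \<eta>)" by (rule bounded_linear_scaleC)
  have "blinfun_apply (adj S o\<^sub>L T) (x \<otimes>\<^sub>v y) = blinfun_apply (Blinfun ((*\<^sub>C) c)) (x \<otimes>\<^sub>v y)" for x y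
  proof -
    have "cinner (x' \<otimes>\<^sub>v y') (blinfun_apply (adj S o\<^sub>L T) (x \<otimes>\<^sub>v y) - c *\<^sub>C (x \<otimes>\<^sub>v y)) = 0" for x' y'
      by (simp add: cinner_diff_right cinner_scaleC_right assms(1) flip: adjS del: blinfun_apply_blinfun_compose)
    from htensor_orthogonal[OF this] show ?thesis by (simp add: bounded_linear_Blinfun_apply[OF bl])
  qed
  then have "adj S o\<^sub>L T = Blinfun ((*\<^sub>C) c)" by (rule blinfun_otimes_eqI)
  then show ?thesis unfolding adjS by (simp add: bounded_linear_Blinfun_apply[OF bl] cinner_scaleC_right)
qed

lemma assoc_bop: "(assoc :: ('a::chilbert_space \<otimes>\<^sub>H 'b::chilbert_space \<otimes>\<^sub>H 'c::chilbert_space) \<Rightarrow>\<^sub>L _) \<in> bop"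
  and assoc_otimes: "blinfun_apply assoc (x \<otimes>\<^sub>v y \<otimes>\<^sub>v z) = ((x::'a) \<otimes>\<^sub>v (y::'b)) \<otimes>\<^sub>v (z::'c)"
proof -
  have "\<exists>R\<in>bop. \<forall>(y::'b) (z::'c). blinfun_apply R (y \<otimes>\<^sub>v z) = ((x::'a) \<otimes>\<^sub>v y) \<otimes>\<^sub>v z" for x
  proof (cases "x = 0")
    case True
    then show ?thesis
      by (intro bexI[of _ 0])
        (auto simp: bop_def bounded_bilinear.zero_left[OF bounded_bilinear_otimes])
  next
    case False
    define u where "u = inverse (norm x) *\<^sub>R x"
    have "norm u = 1" using False by (simp add: u_def)
    then have u: "cinner u u = 1" "x = complex_of_real (norm x) *\<^sub>C u"
      using False by (simp add: cinner_self, simp add: u_def scaleR_scaleC scaleC_scaleC)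
    obtain R where R: "R \<in> bop" "\<And>(y::'b) (z::'c). blinfun_apply R (y \<otimes>\<^sub>v z) = (u \<otimes>\<^sub>v y) \<otimes>\<^sub>v z"
      using otimes_isometry_ex[of "\<lambda>y z. (u \<otimes>\<^sub>v y) \<otimes>\<^sub>v z"] by (auto simp: cinner_otimes u(1))
    show ?thesis
    proof (intro bexI[of _ "norm x *\<^sub>R R"] allI)
      show "blinfun_apply (norm x *\<^sub>R R) (y \<otimes>\<^sub>v z) = (x \<otimes>\<^sub>v y) \<otimes>\<^sub>v z" for y z
      proof -
        have "(x \<otimes>\<^sub>v y) \<otimes>\<^sub>v z = complex_of_real (norm x) *\<^sub>C ((u \<otimes>\<^sub>v y) \<otimes>\<^sub>v z)"
          by (metis u(2) otimes_scaleC_left)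
        then show ?thesis by (simp add: R(2) scaleR_scaleC blinfun.scaleR_left)
      qed
      show "norm x *\<^sub>R R \<in> bop"
        using R(1) by (simp add: bop_def blinfun.scaleR_left scaleR_scaleC scaleC_scaleC mult.commute)
    qed
  qed
  then obtain r where r: "\<And>x. r x \<in> bop" "\<And>x y z. blinfun_apply (r x) (y \<otimes>\<^sub>v z) = ((x::'a) \<otimes>\<^sub>v (y::'b)) \<otimes>\<^sub>v (z::'c)"
    by metis
  have "\<exists>R\<in>bop. \<forall>x \<zeta>. blinfun_apply R (x \<otimes>\<^sub>v \<zeta>) = blinfun_apply (r x) \<zeta>"
    by (rule otimes_isometry_ex, rule cinner_blinfun_otimes_eqI) (simp_all add: r cinner_otimes mult_ac)
  then obtain R where R: "R \<in> bop" "\<And>x y z. blinfun_apply R (x \<otimes>\<^sub>v y \<otimes>\<^sub>v z) = ((x::'a) \<otimes>\<^sub>v (y::'b)) \<otimes>\<^sub>v (z::'c)"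
    using r(2) by metis
  have "assoc = R" unfolding assoc_def
  proof (rule the_equality)
    fix R' :: "('a \<otimes>\<^sub>H 'b \<otimes>\<^sub>H 'c) \<Rightarrow>\<^sub>L ('a \<otimes>\<^sub>H 'b) \<otimes>\<^sub>H 'c"
    assume R': "\<forall>x y z. blinfun_apply R' (x \<otimes>\<^sub>v y \<otimes>\<^sub>v z) = (x \<otimes>\<^sub>v y) \<otimes>\<^sub>v z"
    show "R' = R"
    proof (rule blinfun_otimes_eqI)
      fix x \<zeta>
      have bl: "bounded_linear (\<lambda>\<zeta>::'b \<otimes>\<^sub>H 'c. (x::'a) \<otimes>\<^sub>v \<zeta>)"
        by (rule bounded_bilinear.bounded_linear_right[OF bounded_bilinear_otimes])
      have "R' o\<^sub>L Blinfun (\<lambda>\<zeta>. x \<otimes>\<^sub>v \<zeta>) = R o\<^sub>L Blinfun (\<lambda>\<zeta>. x \<otimes>\<^sub>v \<zeta>)"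
        by (rule blinfun_otimes_eqI) (simp add: bounded_linear_Blinfun_apply[OF bl] R' R)
      then have "blinfun_apply (R' o\<^sub>L Blinfun (\<lambda>\<zeta>. x \<otimes>\<^sub>v \<zeta>)) \<zeta> = blinfun_apply (R o\<^sub>L Blinfun (\<lambda>\<zeta>. x \<otimes>\<^sub>v \<zeta>)) \<zeta>" by simp
      then show "blinfun_apply R' (x \<otimes>\<^sub>v \<zeta>) = blinfun_apply R (x \<otimes>\<^sub>v \<zeta>)"
        by (simp add: bounded_linear_Blinfun_apply[OF bl])
    qed
  qed (use R in simp)
  with R show "(assoc :: ('a \<otimes>\<^sub>H 'b \<otimes>\<^sub>H 'c) \<Rightarrow>\<^sub>L _) \<in> bop"
    "blinfun_apply assoc (x \<otimes>\<^sub>v y \<otimes>\<^sub>v z) = ((x::'a) \<otimes>\<^sub>v (y::'b)) \<otimes>\<^sub>v (z::'c)" by simp_all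
qed

section \<open>Slices by normal functionals\<close>

type_synonym 'a operator = "'a \<Rightarrow>\<^sub>L 'a"

text \<open>The normal functionals, i.e. the elements of the predual of the bounded operators.\<close>

definition predual :: "('a::chilbert_space operator \<Rightarrow> complex) set" where
  "predual = {\<lambda>T. \<Sum>n. cinner (x n) (blinfun_apply T (y n)) | x y.
     summable (\<lambda>n. (norm (x n))\<^sup>2) \<and> summable (\<lambda>n. (norm (y n))\<^sup>2)}"

lift_definition otimes_left :: "'a::chilbert_space \<Rightarrow> 'b::chilbert_space \<Rightarrow>\<^sub>L ('a \<otimes>\<^sub>H 'b)" is "\<lambda>x y. x \<otimes>\<^sub>v y"
  by (rule bounded_bilinear.bounded_linear_right[OF bounded_bilinear_otimes])

lift_definition otimes_right :: "'b::chilbert_space \<Rightarrow> 'a::chilbert_space \<Rightarrow>\<^sub>L ('a \<otimes>\<^sub>H 'b)" is "\<lambda>y x. x \<otimes>\<^sub>v y"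
  by (rule bounded_bilinear.bounded_linear_left[OF bounded_bilinear_otimes])

text \<open>\<open>slice_fst \<omega> T\<close> is \<open>(\<omega> \<otimes> id)(T)\<close>: its matrix coefficient at \<open>u, v\<close> is the value of \<open>\<omega>\<close> at the
  operator \<open>(id \<otimes> \<omega>\<^sub>u\<^sub>,\<^sub>v)(T)\<close> on the first factor.  Likewise \<open>slice_snd \<omega> T\<close> is \<open>(id \<otimes> \<omega>)(T)\<close>.\<close>

definition slice_fst ::
    "('a::chilbert_space operator \<Rightarrow> complex) \<Rightarrow> ('a \<otimes>\<^sub>H 'b::chilbert_space) operator \<Rightarrow> 'b operator" where
  "slice_fst \<omega> T = (THE S. S \<in> bop \<and>
     (\<forall>u v. cinner u (blinfun_apply S v) = \<omega> (adj (otimes_right u) o\<^sub>L T o\<^sub>L otimes_right v)))"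

definition slice_snd ::
    "('b::chilbert_space operator \<Rightarrow> complex) \<Rightarrow> ('a::chilbert_space \<otimes>\<^sub>H 'b) operator \<Rightarrow> 'a operator" where
  "slice_snd \<omega> T = (THE S. S \<in> bop \<and>
     (\<forall>u v. cinner u (blinfun_apply S v) = \<omega> (adj (otimes_left u) o\<^sub>L T o\<^sub>L otimes_left v)))"

lemma otimes_left_bop: "otimes_left x \<in> bop" and otimes_right_bop: "otimes_right y \<in> bop"
  by (simp_all add: bop_def otimes_left.rep_eq otimes_right.rep_eq otimes_scaleC_left otimes_scaleC_right)

lemma adj_additive: "S \<in> bop \<Longrightarrow> T \<in> bop \<Longrightarrow> adj (S + T) = adj S + adj T"
  by (rule adj_unique) (simp add: blinfun.add_left cinner_add_left cinner_add_right cinner_adj_left)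

lemma norm_adj_le: "T \<in> bop \<Longrightarrow> norm (adj T) \<le> norm T"
proof (rule norm_blinfun_bound)
  fix x assume T: "T \<in> bop"
  define y where "y = blinfun_apply (adj T) x"
  have "norm y * norm y = cmod (cinner y y)"
    unfolding cinner_self by (simp add: power2_eq_square norm_mult)
  also have "cinner y y = cinner x (blinfun_apply T y)" unfolding y_def by (rule cinner_adj_left[OF T])
  also have "cmod (cinner x (blinfun_apply T y)) \<le> norm x * norm (blinfun_apply T y)" by (rule norm_cinner_le)
  also have "\<dots> \<le> norm x * (norm T * norm y)" by (intro mult_left_mono norm_blinfun norm_ge_zero)
  finally have *: "norm y * norm y \<le> (norm T * norm x) * norm y" by (simp only: mult_ac)
  have "norm y \<le> norm T * norm x"
  proof (cases "norm y = 0")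
    case True
    then show ?thesis by simp
  next
    case False
    then have "0 < norm y" by simp
    with * show ?thesis by (rule mult_right_le_imp_le)
  qed
  then show "norm (blinfun_apply (adj T) x) \<le> norm T * norm x" unfolding y_def .
qed (rule norm_ge_zero)

lemma predual_bounded:
  assumes "\<omega> \<in> predual"
  shows "bounded_linear \<omega>" and "(\<And>x. blinfun_apply S x = c *\<^sub>C blinfun_apply T x) \<Longrightarrow> \<omega> S = c * \<omega> T"
proof -
  obtain x y where xy: "summable (\<lambda>n. (norm (x n))\<^sup>2)" "summable (\<lambda>n. (norm (y n))\<^sup>2)"
    and \<omega>: "\<And>T. \<omega> T = (\<Sum>n. cinner (x n) (blinfun_apply T (y n)))"
    using assms unfolding predual_def by blast
  let ?m = "\<lambda>n. (norm (x n))\<^sup>2 + (norm (y n))\<^sup>2"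
  have m: "summable ?m" using xy by (rule summable_add)
  have le: "cmod (cinner (x n) (blinfun_apply T (y n))) \<le> norm T * ?m n" for T n
  proof -
    have "cmod (cinner (x n) (blinfun_apply T (y n))) \<le> norm (x n) * (norm T * norm (y n))"
      by (rule order_trans[OF norm_cinner_le]) (intro mult_left_mono norm_blinfun norm_ge_zero)
    also have "\<dots> = norm T * (norm (x n) * norm (y n))" by (simp only: mult_ac)
    also have "\<dots> \<le> norm T * ?m n"
    proof (rule mult_left_mono)
      have "0 \<le> norm (x n) * norm (y n)" by simp
      then show "norm (x n) * norm (y n) \<le> ?m n"
        using sum_squares_bound[of "norm (x n)" "norm (y n)"] by linarith
    qed simp
    finally show ?thesis .
  qed
  have sn: "summable (\<lambda>n. cmod (cinner (x n) (blinfun_apply T (y n))))" for T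
    by (rule summable_comparison_test'[OF summable_mult[OF m, of "norm T"]]) (simp add: le)
  have s: "summable (\<lambda>n. cinner (x n) (blinfun_apply T (y n)))" for T
    by (rule summable_norm_cancel[OF sn])
  show "bounded_linear \<omega>"
  proof (rule bounded_linear_intro[of _ "suminf ?m"])
    show "\<omega> (S + T) = \<omega> S + \<omega> T" for S T
      unfolding \<omega> by (simp add: blinfun.add_left cinner_add_right suminf_add[OF s s])
    show "\<omega> (r *\<^sub>R T) = r *\<^sub>R \<omega> T" for r T
      unfolding \<omega> by (simp add: blinfun.scaleR_left cinner_scaleR_right scaleR_conv_of_real suminf_mult[OF s])
    show "norm (\<omega> T) \<le> norm T * suminf ?m" for T
    proof -
      have "norm (\<omega> T) \<le> (\<Sum>n. cmod (cinner (x n) (blinfun_apply T (y n))))"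
        unfolding \<omega> by (rule summable_norm[OF sn])
      also have "\<dots> \<le> (\<Sum>n. norm T * ?m n)"
        by (rule suminf_le[OF le sn summable_mult[OF m]])
      finally show ?thesis by (simp add: suminf_mult[OF m])
    qed
  qed
  show "\<omega> S = c * \<omega> T" if "\<And>x. blinfun_apply S x = c *\<^sub>C blinfun_apply T x"
    unfolding \<omega> by (simp add: that cinner_scaleC_right suminf_mult[OF s])
qed

lemma compression_ex:
  fixes L :: "'b::chilbert_space \<Rightarrow> 'a::chilbert_space \<Rightarrow>\<^sub>L 'c::chilbert_space"
  assumes \<omega>: "\<omega> \<in> predual" and T: "T \<in> bop" and L: "\<And>v. L v \<in> bop"
    and add: "\<And>u v. L (u + v) = L u + L v" and norm: "\<And>v. norm (L v) \<le> norm v"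
    and scale: "\<And>c v x. blinfun_apply (L (c *\<^sub>C v)) x = c *\<^sub>C blinfun_apply (L v) x"
  shows "\<exists>!S. S \<in> bop \<and> (\<forall>u v. cinner u (blinfun_apply S v) = \<omega> (adj (L u) o\<^sub>L T o\<^sub>L L v))"
proof -
  interpret \<omega>: bounded_linear \<omega> by (rule predual_bounded[OF \<omega>])
  obtain M where M: "M \<ge> 0" "\<And>S. norm (\<omega> S) \<le> norm S * M" using \<omega>.nonneg_bounded by blast
  have "\<exists>S\<in>bop. \<forall>u v. cinner u (blinfun_apply S v) = \<omega> (adj (L u) o\<^sub>L T o\<^sub>L L v)"
  proof (rule sesquilinear_op_ex)
    show "\<omega> (adj (L (u + u')) o\<^sub>L T o\<^sub>L L v) = \<omega> (adj (L u) o\<^sub>L T o\<^sub>L L v) + \<omega> (adj (L u') o\<^sub>L T o\<^sub>L L v)" for u u' v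
      by (simp add: add adj_additive L bounded_bilinear.add_left[OF bounded_bilinear_blinfun_compose] \<omega>.add)
    show "\<omega> (adj (L u) o\<^sub>L T o\<^sub>L L (v + v')) = \<omega> (adj (L u) o\<^sub>L T o\<^sub>L L v) + \<omega> (adj (L u) o\<^sub>L T o\<^sub>L L v')" for u v v'
      by (simp add: add bounded_bilinear.add_right[OF bounded_bilinear_blinfun_compose] \<omega>.add)
    show "\<omega> (adj (L (c *\<^sub>C u)) o\<^sub>L T o\<^sub>L L v) = cnj c * \<omega> (adj (L u) o\<^sub>L T o\<^sub>L L v)" for c u v
    proof (rule predual_bounded(2)[OF \<omega>])
      show "blinfun_apply (adj (L (c *\<^sub>C u)) o\<^sub>L T o\<^sub>L L v) x = cnj c *\<^sub>C blinfun_apply (adj (L u) o\<^sub>L T o\<^sub>L L v) x" for x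
        by (rule cinner_ext) (simp add: cinner_adj_right L scale cinner_scaleC_left cinner_scaleC_right)
    qed
    show "\<omega> (adj (L u) o\<^sub>L T o\<^sub>L L (c *\<^sub>C v)) = c * \<omega> (adj (L u) o\<^sub>L T o\<^sub>L L v)" for c u v
      by (rule predual_bounded(2)[OF \<omega>]) (simp add: scale bop_scaleC[OF T] bop_scaleC[OF adj_bop[OF L]])
    show "cmod (\<omega> (adj (L u) o\<^sub>L T o\<^sub>L L v)) \<le> (M * norm T) * norm u * norm v" for u v
    proof -
      have "norm (adj (L u) o\<^sub>L T o\<^sub>L L v) \<le> norm (adj (L u)) * norm T * norm (L v)"
        by (intro order_trans[OF norm_blinfun_compose] mult_right_mono norm_blinfun_compose norm_ge_zero)
      also have "\<dots> \<le> norm u * norm T * norm v"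
        by (intro mult_mono order_trans[OF norm_adj_le[OF L] norm] norm order_refl) simp_all
      finally have "norm (adj (L u) o\<^sub>L T o\<^sub>L L v) * M \<le> (norm u * norm T * norm v) * M"
        using M(1) by (rule mult_right_mono)
      with M(2)[of "adj (L u) o\<^sub>L T o\<^sub>L L v"] show ?thesis by (simp add: mult_ac)
    qed
  qed (use M in simp)
  then obtain S where S: "S \<in> bop" "\<And>u v. cinner u (blinfun_apply S v) = \<omega> (adj (L u) o\<^sub>L T o\<^sub>L L v)" by blast
  show ?thesis
  proof (rule ex1I[of _ S])
    fix R assume "R \<in> bop \<and> (\<forall>u v. cinner u (blinfun_apply R v) = \<omega> (adj (L u) o\<^sub>L T o\<^sub>L L v))"
    then show "R = S" by (intro blinfun_eqI cinner_ext) (simp add: S)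
  qed (simp add: S)
qed

lemma slice_fst:
  fixes T :: "('a::chilbert_space \<otimes>\<^sub>H 'b::chilbert_space) operator"
  assumes "\<omega> \<in> predual" "T \<in> bop"
  shows slice_fst_bop: "slice_fst \<omega> T \<in> bop"
    and cinner_slice_fst: "cinner u (blinfun_apply (slice_fst \<omega> T) v) = \<omega> (adj (otimes_right u) o\<^sub>L T o\<^sub>L otimes_right v)"
proof -
  have "\<exists>!S. S \<in> bop \<and> (\<forall>u v. cinner u (blinfun_apply S v) = \<omega> (adj (otimes_right u) o\<^sub>L T o\<^sub>L otimes_right v))"
  proof (rule compression_ex[OF assms])
    show "norm (otimes_right v) \<le> norm v" for v :: 'b
      by (rule norm_blinfun_bound) (simp_all add: otimes_right.rep_eq mult.commute)
    show "otimes_right (u + v) = otimes_right u + otimes_right v" for u v :: 'b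
      by (rule blinfun_eqI) (simp add: otimes_right.rep_eq otimes_add_right blinfun.add_left)
  qed (simp_all add: otimes_right_bop otimes_right.rep_eq otimes_scaleC_right)
  from theI'[OF this, folded slice_fst_def]
  show "slice_fst \<omega> T \<in> bop"
    "cinner u (blinfun_apply (slice_fst \<omega> T) v) = \<omega> (adj (otimes_right u) o\<^sub>L T o\<^sub>L otimes_right v)"
    by simp_all
qed

lemma slice_snd:
  fixes T :: "('a::chilbert_space \<otimes>\<^sub>H 'b::chilbert_space) operator"
  assumes "\<omega> \<in> predual" "T \<in> bop"
  shows slice_snd_bop: "slice_snd \<omega> T \<in> bop"
    and cinner_slice_snd: "cinner u (blinfun_apply (slice_snd \<omega> T) v) = \<omega> (adj (otimes_left u) o\<^sub>L T o\<^sub>L otimes_left v)"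
proof -
  have "\<exists>!S. S \<in> bop \<and> (\<forall>u v. cinner u (blinfun_apply S v) = \<omega> (adj (otimes_left u) o\<^sub>L T o\<^sub>L otimes_left v))"
  proof (rule compression_ex[OF assms])
    show "norm (otimes_left v) \<le> norm v" for v :: 'a
      by (rule norm_blinfun_bound) (simp_all add: otimes_left.rep_eq mult.commute)
    show "otimes_left (u + v) = otimes_left u + otimes_left v" for u v :: 'a
      by (rule blinfun_eqI) (simp add: otimes_left.rep_eq otimes_add_left blinfun.add_left)
  qed (simp_all add: otimes_left_bop otimes_left.rep_eq otimes_scaleC_left)
  from theI'[OF this, folded slice_snd_def]
  show "slice_snd \<omega> T \<in> bop"
    "cinner u (blinfun_apply (slice_snd \<omega> T) v) = \<omega> (adj (otimes_left u) o\<^sub>L T o\<^sub>L otimes_left v)"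
    by simp_all
qed


section \<open>Positive self-adjoint operators\<close>

text \<open>A possibly unbounded operator is represented by its graph: the domain is \<^const>\<open>Domain\<close>, and
  the inverse of an injective operator is \<^const>\<open>converse\<close>.\<close>

definition linear_operator :: "('a::chilbert_space \<times> 'a) set \<Rightarrow> bool" where
  "linear_operator Q \<longleftrightarrow> single_valued Q \<and> (0, 0) \<in> Q \<and>
     (\<forall>(x, x')\<in>Q. \<forall>(y, y')\<in>Q. (x + y, x' + y') \<in> Q) \<and> (\<forall>c. \<forall>(x, x')\<in>Q. (c *\<^sub>C x, c *\<^sub>C x') \<in> Q)"

definition adjoint_graph :: "('a::chilbert_space \<times> 'a) set \<Rightarrow> ('a \<times> 'a) set" where
  "adjoint_graph Q = {(y, y'). \<forall>(x, x')\<in>Q. cinner y x' = cinner y' x}"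

definition self_adjoint :: "('a::chilbert_space \<times> 'a) set \<Rightarrow> bool" where
  "self_adjoint Q \<longleftrightarrow> linear_operator Q \<and> closure (Domain Q) = UNIV \<and> adjoint_graph Q = Q"

definition positive_self_adjoint :: "('a::chilbert_space \<times> 'a) set \<Rightarrow> bool" where
  "positive_self_adjoint Q \<longleftrightarrow> self_adjoint Q \<and> (\<forall>(x, x')\<in>Q. cinner x x' \<in> \<real>\<^sub>\<ge>\<^sub>0)"

definition trivial_kernel :: "('a::chilbert_space \<times> 'a) set \<Rightarrow> bool" where
  "trivial_kernel Q \<longleftrightarrow> (\<forall>x. (x, 0) \<in> Q \<longrightarrow> x = 0)"

text \<open>The tensor product of two self-adjoint operators is the closure of their algebraic tensor product.\<close>

definition tensor_graph ::
    "('a::chilbert_space \<times> 'a) set \<Rightarrow> ('b::chilbert_space \<times> 'b) set \<Rightarrow> (('a \<otimes>\<^sub>H 'b) \<times> ('a \<otimes>\<^sub>H 'b)) set" where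
  "tensor_graph P Q = closure {(\<Sum>i<n. x i \<otimes>\<^sub>v y i, \<Sum>i<n. x' i \<otimes>\<^sub>v y' i) | (n::nat) x x' y y'.
     \<forall>i<n. (x i, x' i) \<in> P \<and> (y i, y' i) \<in> Q}"


section \<open>Modular multiplicative unitaries\<close>

text \<open>Leg numbering on \<open>H\<^sub>1 \<otimes> H\<^sub>2 \<otimes> H\<^sub>3\<close>, which is bracketed to the right.\<close>

definition leg23 :: "('b::chilbert_space \<otimes>\<^sub>H 'c::chilbert_space) operator \<Rightarrow>
    ('a::chilbert_space \<otimes>\<^sub>H 'b \<otimes>\<^sub>H 'c) operator" where
  "leg23 T = id_blinfun \<otimes>\<^sub>o T"

definition leg12 :: "('a::chilbert_space \<otimes>\<^sub>H 'b::chilbert_space) operator \<Rightarrow>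
    ('a \<otimes>\<^sub>H 'b \<otimes>\<^sub>H 'c::chilbert_space) operator" where
  "leg12 T = adj assoc o\<^sub>L (T \<otimes>\<^sub>o id_blinfun) o\<^sub>L assoc"

definition leg13 :: "('a::chilbert_space \<otimes>\<^sub>H 'c::chilbert_space) operator \<Rightarrow>
    ('a \<otimes>\<^sub>H 'b::chilbert_space \<otimes>\<^sub>H 'c) operator" where
  "leg13 T = (id_blinfun \<otimes>\<^sub>o flip) o\<^sub>L leg12 T o\<^sub>L (id_blinfun \<otimes>\<^sub>o flip)"

definition multiplicative_unitary :: "('h::chilbert_space \<otimes>\<^sub>H 'h) operator \<Rightarrow> bool" where
  "multiplicative_unitary W \<longleftrightarrow> unitary W \<and>
     (leg23 W o\<^sub>L leg12 W :: ('h \<otimes>\<^sub>H 'h \<otimes>\<^sub>H 'h) operator) = leg12 W o\<^sub>L leg13 W o\<^sub>L leg23 W"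

definition modular_multiplicative_unitary :: "('h::chilbert_space \<otimes>\<^sub>H 'h) operator \<Rightarrow> bool" where
  "modular_multiplicative_unitary W \<longleftrightarrow> multiplicative_unitary W \<and>
     (\<exists>(Qh :: ('h \<times> 'h) set) (Q :: ('h \<times> 'h) set) (Wt :: ('h conjugate \<otimes>\<^sub>H 'h) operator).
        positive_self_adjoint Qh \<and> trivial_kernel Qh \<and>
        positive_self_adjoint Q \<and> trivial_kernel Q \<and> unitary Wt \<and>
        {(\<xi>, blinfun_apply (adj W) \<eta>) | \<xi> \<eta>. (blinfun_apply W \<xi>, \<eta>) \<in> tensor_graph Qh Q} = tensor_graph Qh Q \<and>
        (\<forall>x z y Qy u Qinv_u. (y, Qy) \<in> Q \<longrightarrow> (u, Qinv_u) \<in> converse Q \<longrightarrow>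
           cinner (x \<otimes>\<^sub>v y) (blinfun_apply W (z \<otimes>\<^sub>v u)) =
           cinner (to_conj z \<otimes>\<^sub>v Qy) (blinfun_apply Wt (to_conj x \<otimes>\<^sub>v Qinv_u))))"


section \<open>Multipliers and quantum groups\<close>

text \<open>The C*-algebras below are nondegenerate algebras of operators on a Hilbert space; their
  multiplier algebras are the idealizers in the bounded operators.\<close>

definition spatial_tensor :: "'a::chilbert_space operator set \<Rightarrow> 'b::chilbert_space operator set \<Rightarrow>
    ('a \<otimes>\<^sub>H 'b) operator set" where
  "spatial_tensor D A = closure {\<Sum>i<n. d i \<otimes>\<^sub>o a i | (n::nat) d a. \<forall>i<n. d i \<in> D \<and> a i \<in> A}"

definition multipliers :: "'a::chilbert_space operator set \<Rightarrow> 'a operator set" where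
  "multipliers D = {T \<in> bop. \<forall>d\<in>D. T o\<^sub>L d \<in> D \<and> d o\<^sub>L T \<in> D}"

definition unitary_multipliers :: "'a::chilbert_space operator set \<Rightarrow> 'a operator set" where
  "unitary_multipliers D = {U \<in> multipliers D. unitary U}"

text \<open>The extension of the algebraic tensor product of two homomorphisms to the spatial tensor product.
  Additivity and continuity determine it by its values on elementary tensors.\<close>

definition tensor_map ::
    "'a::chilbert_space operator set \<Rightarrow> 'b::chilbert_space operator set \<Rightarrow>
     ('a operator \<Rightarrow> 'c::chilbert_space operator) \<Rightarrow> ('b operator \<Rightarrow> 'd::chilbert_space operator) \<Rightarrow>
     ('a \<otimes>\<^sub>H 'b) operator \<Rightarrow> ('c \<otimes>\<^sub>H 'd) operator" where
  "tensor_map D A \<phi> \<psi> = (THE \<Phi>. \<Phi> \<in> extensional (spatial_tensor D A) \<and>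
     continuous_on (spatial_tensor D A) \<Phi> \<and>
     (\<forall>S\<in>spatial_tensor D A. \<forall>T\<in>spatial_tensor D A. \<Phi> (S + T) = \<Phi> S + \<Phi> T) \<and>
     (\<forall>d\<in>D. \<forall>a\<in>A. \<Phi> (d \<otimes>\<^sub>o a) = \<phi> d \<otimes>\<^sub>o \<psi> a))"

text \<open>The unital extension to the multipliers of \<open>D\<close> of a nondegenerate *-homomorphism \<open>\<Phi>\<close> on \<open>D\<close>
  into the bounded operators; nondegeneracy makes the extending operator \<open>S\<close> unique.\<close>

definition multiplier_extension ::
    "'a::chilbert_space operator set \<Rightarrow> ('a operator \<Rightarrow> 'b::chilbert_space operator) \<Rightarrow>
     'a operator \<Rightarrow> 'b operator" where
  "multiplier_extension D \<Phi> T = (THE S. S \<in> bop \<and> (\<forall>d\<in>D. S o\<^sub>L \<Phi> d = \<Phi> (T o\<^sub>L d)))"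

definition qg_algebra :: "('h::chilbert_space \<otimes>\<^sub>H 'h) operator \<Rightarrow> 'h operator set" where
  "qg_algebra W = closure {slice_fst \<omega> W | \<omega>. \<omega> \<in> predual}"

definition qg_comult :: "('h::chilbert_space \<otimes>\<^sub>H 'h) operator \<Rightarrow> 'h operator \<Rightarrow> ('h \<otimes>\<^sub>H 'h) operator" where
  "qg_comult W x = W o\<^sub>L (x \<otimes>\<^sub>o id_blinfun) o\<^sub>L adj W"

definition dual_algebra :: "('h::chilbert_space \<otimes>\<^sub>H 'h) operator \<Rightarrow> 'h operator set" where
  "dual_algebra W = closure {slice_snd \<omega> (adj W) | \<omega>. \<omega> \<in> predual}"

definition dual_comult :: "('h::chilbert_space \<otimes>\<^sub>H 'h) operator \<Rightarrow> 'h operator \<Rightarrow> ('h \<otimes>\<^sub>H 'h) operator" where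
  "dual_comult W y = flip o\<^sub>L adj W o\<^sub>L (id_blinfun \<otimes>\<^sub>o y) o\<^sub>L W o\<^sub>L flip"


section \<open>Bicharacters and their composition\<close>

text \<open>A quantum group is given by its multiplicative unitary, and a unitary multiplier of
  \<open>dual_algebra WC \<otimes> qg_algebra WA\<close> is identified with its image on \<open>H\<^sub>C \<otimes> H\<^sub>A\<close>.  The conjugation by
  \<^const>\<open>assoc\<close> only rebrackets \<open>(H\<^sub>C \<otimes> H\<^sub>C) \<otimes> H\<^sub>A\<close>.\<close>

definition bicharacter ::
    "('c::chilbert_space \<otimes>\<^sub>H 'c) operator \<Rightarrow> ('a::chilbert_space \<otimes>\<^sub>H 'a) operator \<Rightarrow>
     ('c \<otimes>\<^sub>H 'a) operator \<Rightarrow> bool" where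
  "bicharacter WC WA V \<longleftrightarrow>
     (let C' = dual_algebra WC; A = qg_algebra WA; X = spatial_tensor C' A in
        V \<in> unitary_multipliers X \<and>
        adj assoc o\<^sub>L multiplier_extension X (tensor_map C' A (dual_comult WC) (\<lambda>a. a)) V o\<^sub>L assoc
          = leg23 V o\<^sub>L leg13 V \<and>
        multiplier_extension X (tensor_map C' A (\<lambda>c. c) (qg_comult WA)) V = leg12 V o\<^sub>L leg13 V)"

definition bicharacter_composition ::
    "('c::chilbert_space \<otimes>\<^sub>H 'c) operator \<Rightarrow> ('b::chilbert_space \<otimes>\<^sub>H 'b) operator \<Rightarrow>
     ('c \<otimes>\<^sub>H 'a::chilbert_space) operator \<Rightarrow> ('a \<otimes>\<^sub>H 'b) operator \<Rightarrow> ('c \<otimes>\<^sub>H 'b) operator \<Rightarrow> bool" where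
  "bicharacter_composition WC WB VCA VAB VCB \<longleftrightarrow>
     VCB \<in> unitary_multipliers (spatial_tensor (dual_algebra WC) (qg_algebra WB)) \<and>
     leg23 VAB o\<^sub>L leg12 VCA = leg12 VCA o\<^sub>L leg13 VCB o\<^sub>L leg23 VAB"

end

theory Submission
  imports Defs
begin

text \<open>
  Write \<open>W\<close> for the multiplicative unitary of \<open>A\<close>, and \<open>V\<close>, \<open>V'\<close> for the bicharacters from \<open>C\<close> to \<open>A\<close> and
  from \<open>A\<close> to \<open>B\<close>.  The composition has to have \<open>X = V\<^sup>*\<^sub>1\<^sub>2 V'\<^sub>2\<^sub>3 V\<^sub>1\<^sub>2 V'\<^sup>*\<^sub>2\<^sub>3\<close> as its image in legs 1 and 3, so one
  has to see that \<open>X\<close> is trivial in leg 2.  The bicharacter identities give \<open>X\<^sub>1\<^sub>3\<^sub>4 W\<^sub>2\<^sub>3 = W\<^sub>2\<^sub>3 X\<^sub>1\<^sub>2\<^sub>4\<close>, so every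
  slice \<open>a\<close> of \<open>X\<close> satisfies \<open>W (a \<otimes> 1) = (1 \<otimes> a) W\<close>.  Modularity forces such an \<open>a\<close> to be scalar: since \<open>W\<close>
  commutes with the tensor product of the two positive operators, one may replace \<open>a\<close> by a smoothed
  operator, for which the modularity relation can be evaluated on a vector in the domain of the first
  positive operator; unitarity of the companion of \<open>W\<close> then gives the claim.

  That the composition is a multiplier requires that the algebras are closed under adjoints.  This follows
  from the relation \<open>W\<^sub>2\<^sub>3 Wt\<^sub>1\<^sub>2 = Wt\<^sub>1\<^sub>3 Wt\<^sub>1\<^sub>2 W\<^sub>2\<^sub>3\<close> between \<open>W\<close> and its companion \<open>Wt\<close>, and from duality.
\<close>

section \<open>Bounded operators and separating sets\<close>

text \<open>A positive operator is usually used for smoothing through its unitary group. Here the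
  smoothing of \<open>a\<close> is the unique solution \<open>b\<close> of an algebraic equation
  \<open>b - K b K = 4 S a S\<close>, with bounded \<open>K\<close> and \<open>S\<close> built from
  the resolvent. Uniqueness is the point: a unitary commuting with \<open>K\<close> and
  \<open>S\<close> carries solutions to solutions, and for the tensor product of the two positive
  operators the solution belonging to \<open>a \<otimes> 1\<close> is again of the form
  \<open>b \<otimes> 1\<close>. So \<open>W (a \<otimes> 1) = (1 \<otimes> a) W\<close> becomes
  \<open>W (b \<otimes> 1) = (1 \<otimes> b') W\<close>, with \<open>b\<close> and \<open>b'\<close>
  smoothed by the two operators, without spectral theory.

  A second obstacle is that comultiplications reach multipliers only through two extensions. Both
  are implemented by unitaries, so a bicharacter amounts to two operator equations
  (\<open>bicharacter_iff\<close>), and the rest compares unitaries on three and four legs.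

  Multipliers return once more at the end. The middle leg belongs to \<open>A\<close> for
  \<open>V\<close> and to its dual for \<open>V'\<close>, two algebras on one space; replacing the
  middle algebra by vectors of that space gives a module that both unitaries preserve.\<close>

declare bop_compose [simp] adj_bop [simp] tensor_op_bop [simp] flip_bop [simp] assoc_bop [simp]
  otimes_left_bop [simp] otimes_right_bop [simp] otimes_left.rep_eq [simp] otimes_right.rep_eq [simp]
  flip_otimes [simp] assoc_otimes [simp] tensor_op_otimes [simp]

lemma blinfun_comp_assoc: "(R o\<^sub>L S) o\<^sub>L T = R o\<^sub>L (S o\<^sub>L T)"
  and blinfun_comp_id [simp]: "id_blinfun o\<^sub>L S = S" "S o\<^sub>L id_blinfun = S"
  by (rule blinfun_eqI, simp)+

lemma scaleC_diff_right: "c *\<^sub>C (x - y) = c *\<^sub>C x - c *\<^sub>C (y::'a::chilbert_space)"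
  using scaleC_add_right[of c "x - y" y] by (simp add: eq_diff_eq)

lemma bop_zero [simp]: "0 \<in> bop"
  and bop_add [simp]: "S \<in> bop \<Longrightarrow> T \<in> bop \<Longrightarrow> S + T \<in> bop"
  and bop_diff [simp]: "S \<in> bop \<Longrightarrow> T \<in> bop \<Longrightarrow> S - T \<in> bop"
  and bop_scaleR [simp]: "S \<in> bop \<Longrightarrow> r *\<^sub>R S \<in> bop"
  by (auto simp: bop_def blinfun.add_left blinfun.diff_left blinfun.scaleR_left scaleC_add_right
      scaleC_diff_right scaleR_scaleC scaleC_scaleC mult.commute)

lemma bop_eqI: "(\<And>u v. cinner u (blinfun_apply S v) = cinner u (blinfun_apply T v)) \<Longrightarrow> S = T"
  by (intro blinfun_eqI cinner_ext)

lemma adj_adj [simp]: "T \<in> bop \<Longrightarrow> adj (adj T) = T"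
  by (rule adj_unique) (simp add: cinner_adj_right)

lemma adj_compose: "S \<in> bop \<Longrightarrow> T \<in> bop \<Longrightarrow> adj (S o\<^sub>L T) = adj T o\<^sub>L adj S"
  by (rule adj_unique) (simp add: cinner_adj_left)

lemma adj_id [simp]: "adj id_blinfun = id_blinfun"
  by (rule adj_unique) simp

lemma adj_diff: "S \<in> bop \<Longrightarrow> T \<in> bop \<Longrightarrow> adj (S - T) = adj S - adj T"
  by (rule adj_unique) (simp add: blinfun.diff_left cinner_diff_left cinner_diff_right cinner_adj_left)

lemma adj_scaleR: "T \<in> bop \<Longrightarrow> adj (r *\<^sub>R T) = r *\<^sub>R adj T"
  by (rule adj_unique)
    (simp add: blinfun.scaleR_left cinner_scaleR_left cinner_scaleR_right cinner_adj_left)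

lemma norm_adj [simp]: "T \<in> bop \<Longrightarrow> norm (adj T) = norm T"
  using norm_adj_le[of T] norm_adj_le[of "adj T"] by simp

text \<open>Totality in dual form. It passes through tensor products and unitaries without any
  approximation; \<open>clspan_separating\<close> recovers density where density is needed.\<close>

definition separating :: "'a::chilbert_space set \<Rightarrow> bool" where
  "separating M \<longleftrightarrow> (\<forall>v. (\<forall>m\<in>M. cinner m v = 0) \<longrightarrow> v = 0)"

lemma separatingD: "separating M \<Longrightarrow> (\<And>m. m \<in> M \<Longrightarrow> cinner m v = 0) \<Longrightarrow> v = 0"
  by (auto simp: separating_def)

lemma separating_ext:
  assumes "separating M" "\<And>m. m \<in> M \<Longrightarrow> cinner m u = cinner m v"
  shows "u = v"
  using separatingD[OF assms(1), of "u - v"] assms(2) by (simp add: cinner_diff_right)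

lemma separating_mono: "separating M \<Longrightarrow> M \<subseteq> N \<Longrightarrow> separating N"
  by (auto simp: separating_def)

lemma separating_UNIV [simp]: "separating UNIV"
  using cinner_ext[of _ 0] by (auto simp: separating_def)

lemma separating_closure_span:
  assumes "closure (span M) = UNIV"
  shows "separating M"
  unfolding separating_def
proof (intro allI impI)
  fix v assume v: "\<forall>m\<in>M. cinner m v = 0"
  have bl: "bounded_linear (\<lambda>u. cinner u v)"
    by (rule bounded_bilinear.bounded_linear_left[OF bounded_bilinear_cinner])
  have "span M \<subseteq> {u. cinner u v = 0}"
    by (rule span_minimal) (use v in \<open>auto simp: subspace_def cinner_add_left cinner_scaleR_left\<close>)
  moreover have "closed {u. cinner u v = 0}"
    by (intro closed_Collect_eq bounded_linear.continuous_on[OF bl] continuous_intros)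
  ultimately have "closure (span M) \<subseteq> {u. cinner u v = 0}" by (rule closure_minimal)
  then have "cinner v v = 0" using assms by auto
  then show "v = 0" by (simp add: cinner_self)
qed

lemma separating_image:
  assumes M: "separating M" and T: "T \<in> bop" and inj: "\<And>v. (adj T) v = 0 \<Longrightarrow> v = 0"
  shows "separating (blinfun_apply T ` M)"
  unfolding separating_def
proof (intro allI impI)
  fix v assume v: "\<forall>m\<in>blinfun_apply T ` M. cinner m v = 0"
  then have "cinner m ((adj T) v) = 0" if "m \<in> M" for m
    using that by (simp add: cinner_adj_right[OF T])
  then show "v = 0" using separatingD[OF M] inj by blast
qed

text \<open>The adjoint of \<open>otimes_left x\<close> moves the orthogonality into one factor, so
  arbitrary vectors are reached first on the right leg and then on the left.\<close>

lemma separating_otimes: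
  assumes "separating M" "separating N"
  shows "separating {x \<otimes>\<^sub>v y | x y. x \<in> M \<and> y \<in> N}"
  unfolding separating_def
proof (intro allI impI)
  fix v :: "'a \<otimes>\<^sub>H 'b" assume "\<forall>m\<in>{x \<otimes>\<^sub>v y | x y. x \<in> M \<and> y \<in> N}. cinner m v = 0"
  then have v: "cinner (x \<otimes>\<^sub>v y) v = 0" if "x \<in> M" "y \<in> N" for x y
    using that by blast
  have *: "cinner (x \<otimes>\<^sub>v y) v = 0" if x: "x \<in> M" for x y
  proof -
    have "(adj (otimes_left x)) v = 0"
      by (rule separatingD[OF assms(2)]) (simp add: cinner_adj_right v x)
    then have "cinner y ((adj (otimes_left x)) v) = 0" by simp
    then show ?thesis by (simp add: cinner_adj_right)
  qed
  have "cinner (x \<otimes>\<^sub>v y) v = 0" for x y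
  proof -
    have "(adj (otimes_right y)) v = 0"
      by (rule separatingD[OF assms(1)]) (simp add: cinner_adj_right *)
    then have "cinner x ((adj (otimes_right y)) v) = 0" by simp
    then show ?thesis by (simp add: cinner_adj_right)
  qed
  then show "v = 0" by (rule htensor_orthogonal)
qed

lemma separating_elementary2: "separating {x \<otimes>\<^sub>v y | x y. True}"
  using separating_otimes[OF separating_UNIV separating_UNIV] by simp

lemma separating_elementary3: "separating {x \<otimes>\<^sub>v y \<otimes>\<^sub>v z | x y z. True}"
  by (rule separating_mono[OF separating_otimes[OF separating_UNIV separating_elementary2]]) auto

lemma separating_elementary4: "separating {w \<otimes>\<^sub>v x \<otimes>\<^sub>v y \<otimes>\<^sub>v z | w x y z. True}"
  by (rule separating_mono[OF separating_otimes[OF separating_UNIV separating_elementary3]]) auto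

text \<open>\<open>M\<close> gives \<open>S n = T n\<close> for \<open>n\<close> in
  \<open>N\<close>. Read for the adjoints, this is agreement tested against \<open>N\<close>, so
  \<open>adj S = adj T\<close>. No approximation enters.\<close>

lemma bop_separating_eqI:
  assumes S: "S \<in> bop" and T: "T \<in> bop" and M: "separating M" and N: "separating N"
    and eq: "\<And>m n. m \<in> M \<Longrightarrow> n \<in> N \<Longrightarrow> cinner m (S n) = cinner m (T n)"
  shows "S = T"
proof -
  have *: "S n = T n" if "n \<in> N" for n
    using separating_ext[OF M eq[OF _ that]] by blast
  have "adj S = adj T"
    by (rule blinfun_eqI, rule separating_ext[OF N]) (simp add: cinner_adj_right S T *)
  then show ?thesis using S T by (metis adj_adj)
qed

lemma bop_eqI2:
  assumes "S \<in> bop" "T \<in> bop"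
    and "\<And>x y x' y'. cinner (x \<otimes>\<^sub>v y) (S (x' \<otimes>\<^sub>v y')) = cinner (x \<otimes>\<^sub>v y) (T (x' \<otimes>\<^sub>v y'))"
  shows "S = T"
  by (rule bop_separating_eqI[OF assms(1,2) separating_elementary2 separating_elementary2])
    (use assms(3) in blast)

lemma bop_eqI3:
  assumes "S \<in> bop" "T \<in> bop"
    and "\<And>x y z x' y' z'. cinner (x \<otimes>\<^sub>v y \<otimes>\<^sub>v z) (S (x' \<otimes>\<^sub>v y' \<otimes>\<^sub>v z')) =
      cinner (x \<otimes>\<^sub>v y \<otimes>\<^sub>v z) (T (x' \<otimes>\<^sub>v y' \<otimes>\<^sub>v z'))"
  shows "S = T"
  by (rule bop_separating_eqI[OF assms(1,2) separating_elementary3 separating_elementary3])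
    (use assms(3) in blast)

lemma bop_eqI4:
  assumes "S \<in> bop" "T \<in> bop"
    and "\<And>w x y z w' x' y' z'. cinner (w \<otimes>\<^sub>v x \<otimes>\<^sub>v y \<otimes>\<^sub>v z) (S (w' \<otimes>\<^sub>v x' \<otimes>\<^sub>v y' \<otimes>\<^sub>v z')) =
      cinner (w \<otimes>\<^sub>v x \<otimes>\<^sub>v y \<otimes>\<^sub>v z) (T (w' \<otimes>\<^sub>v x' \<otimes>\<^sub>v y' \<otimes>\<^sub>v z'))"
  shows "S = T"
  by (rule bop_separating_eqI[OF assms(1,2) separating_elementary4 separating_elementary4])
    (use assms(3) in blast)

lemma adj_eqI:
  assumes "S \<in> bop" "T \<in> bop" "separating M" "separating N"
    and "\<And>m n. m \<in> M \<Longrightarrow> n \<in> N \<Longrightarrow> cinner (S m) n = cinner m (T n)"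
  shows "adj T = S"
proof -
  have "adj S = T"
    by (rule bop_separating_eqI[OF _ assms(2,3,4)]) (use assms in \<open>simp_all add: cinner_adj_right\<close>)
  then show ?thesis using assms(1) by (metis adj_adj)
qed

section \<open>Adjoints, unitaries and the rebracketing map\<close>

lemma adj_tensor_op:
  assumes "S \<in> bop" "T \<in> bop"
  shows "adj (S \<otimes>\<^sub>o T) = adj S \<otimes>\<^sub>o adj T"
  by (rule adj_eqI[OF _ _ separating_elementary2 separating_elementary2])
    (use assms in \<open>auto simp: cinner_otimes cinner_adj_left\<close>)

lemma adj_flip [simp]: "adj flip = flip"
  by (rule adj_eqI[OF _ _ separating_elementary2 separating_elementary2])
    (auto simp: cinner_otimes mult.commute)

lemma tensor_op_compose:
  assumes "S \<in> bop" "T \<in> bop" "S' \<in> bop" "T' \<in> bop"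
  shows "(S \<otimes>\<^sub>o T) o\<^sub>L (S' \<otimes>\<^sub>o T') = (S o\<^sub>L S') \<otimes>\<^sub>o (T o\<^sub>L T')"
  by (rule blinfun_otimes_eqI) (simp add: assms)

lemma tensor_op_id [simp]: "id_blinfun \<otimes>\<^sub>o id_blinfun = id_blinfun"
  by (rule blinfun_otimes_eqI) simp

lemma flip_flip [simp]: "flip o\<^sub>L flip = id_blinfun"
  by (rule blinfun_otimes_eqI) simp

lemma unitary_bop [simp]: "unitary U \<Longrightarrow> U \<in> bop"
  and unitary_adj_left: "unitary U \<Longrightarrow> adj U o\<^sub>L U = id_blinfun"
  and unitary_adj_right: "unitary U \<Longrightarrow> U o\<^sub>L adj U = id_blinfun"
  by (simp_all add: unitary_def)

lemma unitary_adj_apply [simp]: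
  assumes "unitary U"
  shows "(adj U) (U x) = x" "U ((adj U) y) = y"
  by (metis assms blinfun_apply_blinfun_compose id_blinfun.rep_eq id_apply unitary_adj_left)
     (metis assms blinfun_apply_blinfun_compose id_blinfun.rep_eq id_apply unitary_adj_right)

lemma unitary_adj [simp]: "unitary U \<Longrightarrow> unitary (adj U)"
  by (simp add: unitary_def)

lemma unitary_compose [simp]: "unitary U \<Longrightarrow> unitary V \<Longrightarrow> unitary (U o\<^sub>L V)"
  unfolding unitary_def[of "U o\<^sub>L V"] by (auto simp: adj_compose intro!: blinfun_eqI)

lemma cinner_unitary: "unitary U \<Longrightarrow> cinner (U x) (U y) = cinner x y"
  using cinner_adj_left[of U "U x" y] by simp

lemma unitary_cancel_left: "unitary U \<Longrightarrow> U o\<^sub>L S = U o\<^sub>L T \<Longrightarrow> S = T"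
  by (metis blinfun_comp_assoc blinfun_comp_id(1) unitary_adj_left)

lemma unitary_cancel_right: "unitary U \<Longrightarrow> S o\<^sub>L U = T o\<^sub>L U \<Longrightarrow> S = T"
  by (metis blinfun_comp_assoc blinfun_comp_id(2) unitary_adj_right)

lemma unitary_id [simp]: "unitary id_blinfun"
  by (simp add: unitary_def)

lemma unitary_flip [simp]: "unitary flip"
  by (simp add: unitary_def)

lemma unitary_tensor_op [simp]: "unitary S \<Longrightarrow> unitary T \<Longrightarrow> unitary (S \<otimes>\<^sub>o T)"
  by (simp add: unitary_def adj_tensor_op tensor_op_compose)

lemma separating_unitary: "unitary U \<Longrightarrow> separating M \<Longrightarrow> separating (blinfun_apply U ` M)"
  by (rule separating_image) (auto, metis unitary_adj_apply(2) blinfun.zero_right)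

text \<open>\<open>U o\<^sub>L adj U\<close> fixes every vector in the range of \<open>U\<close>,
  hence a total set.\<close>

lemma isometry_unitary:
  assumes U: "U \<in> bop" and iso: "adj U o\<^sub>L U = id_blinfun"
    and ran: "separating M" "M \<subseteq> range (blinfun_apply U)"
  shows "unitary U"
proof -
  have "U o\<^sub>L adj U = id_blinfun"
  proof (rule bop_separating_eqI[OF _ _ separating_UNIV ran(1)])
    fix m n assume "n \<in> M"
    then obtain v where "n = blinfun_apply U v" using ran(2) by blast
    then show "cinner m ((U o\<^sub>L adj U) n) = cinner m (id_blinfun n)"
      using iso by (metis blinfun_apply_blinfun_compose id_blinfun.rep_eq id_apply)
  qed (simp_all add: U)
  then show ?thesis by (simp add: unitary_def U iso)
qed

lemma unitary_assoc [simp]: "unitary assoc"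
proof (rule isometry_unitary)
  show "adj assoc o\<^sub>L assoc = id_blinfun"
    by (rule bop_eqI3) (simp_all add: cinner_adj_right cinner_otimes mult_ac)
  show "separating {u \<otimes>\<^sub>v z | u z. u \<in> {x \<otimes>\<^sub>v y | x y. True} \<and> z \<in> UNIV}"
    by (rule separating_otimes[OF separating_elementary2 separating_UNIV])
  show "{u \<otimes>\<^sub>v z | u z. u \<in> {x \<otimes>\<^sub>v y | x y. True} \<and> z \<in> UNIV} \<subseteq> range (blinfun_apply assoc)"
    by (auto simp flip: assoc_otimes)
qed simp

lemma adj_assoc_otimes [simp]: "(adj assoc) ((x \<otimes>\<^sub>v y) \<otimes>\<^sub>v z) = x \<otimes>\<^sub>v y \<otimes>\<^sub>v z"
  by (metis assoc_otimes unitary_adj_apply(1) unitary_assoc)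

section \<open>Leg numbering\<close>

lemma leg12_bop [simp]: "T \<in> bop \<Longrightarrow> leg12 T \<in> bop"
  and leg13_bop [simp]: "T \<in> bop \<Longrightarrow> leg13 T \<in> bop"
  and leg23_bop [simp]: "T \<in> bop \<Longrightarrow> leg23 T \<in> bop"
  by (simp_all add: leg12_def leg13_def leg23_def)

lemma leg23_otimes: "T \<in> bop \<Longrightarrow> (leg23 T) (x \<otimes>\<^sub>v \<xi>) = x \<otimes>\<^sub>v T \<xi>"
  by (simp add: leg23_def)

text \<open>Coefficients of legs factor on elementary tensors. With \<open>bop_eqI3\<close> and
  \<open>bop_eqI4\<close>, the three formulas of this kind keep \<open>assoc\<close> and
  \<open>flip\<close> out of most later leg identities.\<close>

lemma cinner_leg23:
  "T \<in> bop \<Longrightarrow> cinner (x \<otimes>\<^sub>v \<xi>) ((leg23 T) (x' \<otimes>\<^sub>v \<xi>')) = cinner x x' * cinner \<xi> (T \<xi>')"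
  by (simp add: leg23_otimes cinner_otimes)

lemma cinner_leg12:
  "T \<in> bop \<Longrightarrow> cinner (x \<otimes>\<^sub>v y \<otimes>\<^sub>v z) ((leg12 T) (x' \<otimes>\<^sub>v y' \<otimes>\<^sub>v z')) =
     cinner (x \<otimes>\<^sub>v y) (T (x' \<otimes>\<^sub>v y')) * cinner z z'"
  by (simp add: leg12_def cinner_adj_right cinner_otimes)

lemma cinner_leg13:
  assumes "T \<in> bop"
  shows "cinner (x \<otimes>\<^sub>v y \<otimes>\<^sub>v z) ((leg13 T) (x' \<otimes>\<^sub>v y' \<otimes>\<^sub>v z')) =
     cinner (x \<otimes>\<^sub>v z) (T (x' \<otimes>\<^sub>v z')) * cinner y y'"
proof -
  have "cinner (x \<otimes>\<^sub>v y \<otimes>\<^sub>v z) ((id_blinfun \<otimes>\<^sub>o flip) \<xi>) = cinner (x \<otimes>\<^sub>v z \<otimes>\<^sub>v y) \<xi>" for \<xi>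
    using cinner_adj_left[of "id_blinfun \<otimes>\<^sub>o flip" "x \<otimes>\<^sub>v y \<otimes>\<^sub>v z" \<xi>] by (simp add: adj_tensor_op)
  then show ?thesis by (simp add: leg13_def cinner_leg12 assms)
qed

lemma leg12_tensor_op:
  "S \<in> bop \<Longrightarrow> T \<in> bop \<Longrightarrow> leg12 (S \<otimes>\<^sub>o T) = S \<otimes>\<^sub>o T \<otimes>\<^sub>o id_blinfun"
  by (rule bop_eqI3) (simp_all add: cinner_leg12 cinner_otimes mult_ac)

lemma leg13_tensor_op:
  "S \<in> bop \<Longrightarrow> T \<in> bop \<Longrightarrow> leg13 (S \<otimes>\<^sub>o T) = S \<otimes>\<^sub>o id_blinfun \<otimes>\<^sub>o T"
  by (rule bop_eqI3) (simp_all add: cinner_leg13 cinner_otimes mult_ac)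

lemma leg12_id [simp]: "leg12 id_blinfun = id_blinfun"
  and leg13_id [simp]: "leg13 id_blinfun = id_blinfun"
  and leg23_id [simp]: "leg23 id_blinfun = id_blinfun"
  using leg12_tensor_op[OF bop_id bop_id] leg13_tensor_op[OF bop_id bop_id] by (simp_all add: leg23_def)

lemma leg12_compose:
  assumes "S \<in> bop" "T \<in> bop"
  shows "leg12 (S o\<^sub>L T) = leg12 S o\<^sub>L leg12 T"
proof -
  have *: "(S o\<^sub>L T) \<otimes>\<^sub>o id_blinfun = (S \<otimes>\<^sub>o id_blinfun) o\<^sub>L (T \<otimes>\<^sub>o id_blinfun)"
    by (simp add: tensor_op_compose assms)
  show ?thesis
    unfolding leg12_def * by (rule blinfun_eqI) simp
qed

lemma id_flip_id_flip [simp]: "(id_blinfun \<otimes>\<^sub>o flip) ((id_blinfun \<otimes>\<^sub>o flip) \<xi>) = \<xi>"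
proof -
  have "((id_blinfun \<otimes>\<^sub>o flip) o\<^sub>L (id_blinfun \<otimes>\<^sub>o flip)) \<xi> = \<xi>"
    by (subst tensor_op_compose) simp_all
  then show ?thesis by simp
qed

lemma leg13_compose: "S \<in> bop \<Longrightarrow> T \<in> bop \<Longrightarrow> leg13 (S o\<^sub>L T) = leg13 S o\<^sub>L leg13 T"
  by (rule blinfun_eqI) (simp add: leg13_def leg12_compose)

lemma leg23_compose: "S \<in> bop \<Longrightarrow> T \<in> bop \<Longrightarrow> leg23 (S o\<^sub>L T) = leg23 S o\<^sub>L leg23 T"
  by (simp add: leg23_def tensor_op_compose)

lemma adj_leg12: "T \<in> bop \<Longrightarrow> adj (leg12 T) = leg12 (adj T)"
  by (simp add: leg12_def adj_compose adj_tensor_op blinfun_comp_assoc)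

lemma adj_leg13: "T \<in> bop \<Longrightarrow> adj (leg13 T) = leg13 (adj T)"
  by (simp add: leg13_def adj_compose adj_tensor_op adj_leg12 blinfun_comp_assoc)

lemma adj_leg23: "T \<in> bop \<Longrightarrow> adj (leg23 T) = leg23 (adj T)"
  by (simp add: leg23_def adj_tensor_op)

lemma unitary_leg12 [simp]: "unitary T \<Longrightarrow> unitary (leg12 T)"
  and unitary_leg13 [simp]: "unitary T \<Longrightarrow> unitary (leg13 T)"
  and unitary_leg23 [simp]: "unitary T \<Longrightarrow> unitary (leg23 T)"
  by (simp_all add: leg12_def leg13_def leg23_def)

text \<open>A nonzero vector on the idle middle leg contributes the factor
  \<open>cinner p p\<close>, which cancels.\<close>

lemma leg13_inject:
  fixes S T :: "('a::chilbert_space \<otimes>\<^sub>H 'c::chilbert_space) operator" and p :: "'b::chilbert_space"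
  assumes "p \<noteq> 0" "S \<in> bop" "T \<in> bop" "(leg13 S :: ('a \<otimes>\<^sub>H 'b \<otimes>\<^sub>H 'c) operator) = leg13 T"
  shows "S = T"
proof (rule bop_eqI2[OF assms(2,3)])
  fix x y x' y'
  have "cinner (x \<otimes>\<^sub>v y) (S (x' \<otimes>\<^sub>v y')) * cinner p p = cinner (x \<otimes>\<^sub>v y) (T (x' \<otimes>\<^sub>v y')) * cinner p p"
    using assms by (metis cinner_leg13)
  then show "cinner (x \<otimes>\<^sub>v y) (S (x' \<otimes>\<^sub>v y')) = cinner (x \<otimes>\<^sub>v y) (T (x' \<otimes>\<^sub>v y'))"
    using assms(1) by (simp add: cinner_self)
qed

section \<open>Orthogonal projection and closed linear spans\<close>

text \<open>A minimizing sequence for the distance is Cauchy by the parallelogram law, and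
  minimality gives orthogonality. The real inner product is used because the lemma serves graphs
  inside a product space as well as closed real spans.\<close>

lemma orthogonal_projection_ex:
  fixes G :: "'a::{real_inner, complete_space} set"
  assumes G: "subspace G" "closed G"
  shows "\<exists>g\<in>G. \<forall>h\<in>G. inner (x - g) h = 0"
proof -
  define d where "d = (INF g\<in>G. norm (x - g))"
  have G0: "0 \<in> G" using G(1) by (rule subspace_0)
  have bdd: "bdd_below ((\<lambda>g. norm (x - g)) ` G)" by (rule bdd_belowI[of _ 0]) auto
  have d_le: "d \<le> norm (x - g)" if "g \<in> G" for g
    unfolding d_def by (rule cINF_lower[OF bdd that])
  have d0: "0 \<le> d" unfolding d_def using G0 by (intro cINF_greatest) auto
  have "\<exists>g\<in>G. norm (x - g) < d + 1 / Suc n" for n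
    using cInf_lessD[of "(\<lambda>g. norm (x - g)) ` G" "d + 1 / Suc n"] G0 unfolding d_def by fastforce
  then obtain g where g: "\<And>n. g n \<in> G" "\<And>n. norm (x - g n) < d + 1 / Suc n" by metis
  \<comment> \<open>The excess of \<open>(norm (x - g n))\<^sup>2\<close> over
    \<open>d\<^sup>2\<close> is at most \<open>(2 * d + 1) * (1 / Suc n)\<close>; the parallelogram
    law adds two such terms, each doubled.\<close>
  define \<delta> where "\<delta> n = 4 * (2 * d + 1) * (1 / Suc n)" for n :: nat
  have sq: "(norm (x - g n))\<^sup>2 \<le> d\<^sup>2 + (2 * d + 1) * (1 / Suc n)" for n
  proof -
    have "(norm (x - g n))\<^sup>2 \<le> (d + 1 / Suc n)\<^sup>2"
      using g(2)[of n] by (intro power_mono) auto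
    also have "\<dots> = d\<^sup>2 + 2 * d * (1 / Suc n) + (1 / Suc n) * (1 / Suc n)"
      by (simp add: power2_eq_square algebra_simps)
    also have "(1 / Suc n) * (1 / Suc n) \<le> 1 * (1 / real (Suc n))" by (intro mult_right_mono) auto
    finally show ?thesis by (simp add: algebra_simps)
  qed
  have close: "(norm (g m - g n))\<^sup>2 \<le> \<delta> N" if "m \<ge> N" "n \<ge> N" for m n N
  proof -
    have "d \<le> norm (x - (1/2) *\<^sub>R (g m + g n))"
      by (intro d_le subspace_scale subspace_add G g)
    then have "d\<^sup>2 \<le> (norm (x - (1/2) *\<^sub>R (g m + g n)))\<^sup>2" using d0 by (intro power_mono) auto
    moreover have "(norm (g m - g n))\<^sup>2 = 2 * (norm (x - g m))\<^sup>2 + 2 * (norm (x - g n))\<^sup>2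
        - 4 * (norm (x - (1/2) *\<^sub>R (g m + g n)))\<^sup>2"
      by (simp add: power2_norm_eq_inner inner_diff_left inner_diff_right inner_add_left inner_add_right
          inner_commute algebra_simps)
    moreover have "(2 * d + 1) * (1 / Suc m) \<le> (2 * d + 1) * (1 / Suc N)"
      "(2 * d + 1) * (1 / Suc n) \<le> (2 * d + 1) * (1 / Suc N)"
      using that d0 by (intro mult_left_mono; simp add: frac_le)+
    ultimately show ?thesis using sq[of m] sq[of n] unfolding \<delta>_def by linarith
  qed
  have lim: "\<delta> \<longlonglongrightarrow> 0"
    unfolding \<delta>_def using tendsto_mult_right_zero[OF LIMSEQ_inverse_real_of_nat, of "4 * (2 * d + 1)"]
    by (simp add: inverse_eq_divide)
  have "Cauchy g"
  proof (rule metric_CauchyI)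
    fix e :: real assume e: "e > 0"
    then have "0 < e\<^sup>2" by simp
    with order_tendstoD(2)[OF lim this] obtain N where N: "\<delta> N < e\<^sup>2"
      unfolding eventually_sequentially by blast
    have "dist (g m) (g n) < e" if "m \<ge> N" "n \<ge> N" for m n
      unfolding dist_norm by (rule power2_less_imp_less) (use close[OF that] N e in auto)
    then show "\<exists>M. \<forall>m\<ge>M. \<forall>n\<ge>M. dist (g m) (g n) < e" by blast
  qed
  then obtain l where l: "g \<longlonglongrightarrow> l" using Cauchy_convergent convergent_def by blast
  have lG: "l \<in> G" using closed_sequentially[OF G(2) _ l] g(1) by blast
  have "norm (x - l) \<le> d"
  proof (rule LIMSEQ_le)
    show "(\<lambda>n. norm (x - g n)) \<longlonglongrightarrow> norm (x - l)" by (intro tendsto_intros l)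
    show "(\<lambda>n. d + 1 / Suc n) \<longlonglongrightarrow> d"
      using tendsto_add[OF tendsto_const LIMSEQ_inverse_real_of_nat, of d] by (simp add: inverse_eq_divide)
    show "\<exists>N. \<forall>n\<ge>N. norm (x - g n) \<le> d + 1 / Suc n" using g(2) less_imp_le by blast
  qed
  then have xl: "norm (x - l) = d" using d_le[OF lG] by simp
  show ?thesis
  proof (intro bexI[of _ l] ballI lG)
    fix h assume h: "h \<in> G"
    show "inner (x - l) h = 0"
    proof (cases "h = 0")
      case False
      \<comment> \<open>The minimizer of \<open>norm ((x - l) - t *\<^sub>R h)\<close> over real
        \<open>t\<close>.\<close>
      define t where "t = inner (x - l) h / inner h h"
      have hh: "inner h h > 0" using False by simp
      have expand: "(norm (y - t *\<^sub>R h))\<^sup>2 = (norm y)\<^sup>2 - 2 * t * inner y h + t * t * inner h h" for y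
        by (simp add: power2_norm_eq_inner inner_diff_left inner_diff_right inner_commute algebra_simps)
      have "d \<le> norm (x - (l + t *\<^sub>R h))" by (intro d_le subspace_add subspace_scale G lG h)
      then have "d \<le> norm ((x - l) - t *\<^sub>R h)" by (simp only: diff_diff_eq)
      then have "(norm (x - l))\<^sup>2 \<le> (norm ((x - l) - t *\<^sub>R h))\<^sup>2"
        unfolding xl using d0 by (rule power_mono)
      also have "\<dots> = (norm (x - l))\<^sup>2 - 2 * t * inner (x - l) h + t * t * inner h h"
        by (rule expand)
      also have "\<dots> = (norm (x - l))\<^sup>2 - t * inner (x - l) h"
        using hh by (simp add: t_def power2_eq_square field_simps)
      finally have "inner (x - l) h * inner (x - l) h \<le> 0"
        using hh by (simp add: t_def field_simps)
      then show ?thesis by (metis mult_eq_0_iff not_square_less_zero order_le_less)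
    qed simp
  qed
qed

section \<open>Closed real linear spans\<close>

abbreviation clspan :: "'a::real_normed_vector set \<Rightarrow> 'a set" where
  "clspan M \<equiv> closure (span M)"

lemma clspan_base: "x \<in> M \<Longrightarrow> x \<in> clspan M"
  using closure_subset span_base by blast

lemma subspace_clspan: "subspace (clspan M)"
  unfolding subspace_def
proof (intro conjI ballI allI)
  show "0 \<in> clspan M" using closure_subset span_zero by blast
next
  fix x y assume "x \<in> clspan M" "y \<in> clspan M"
  then obtain f g where f: "\<And>n. f n \<in> span M" "f \<longlonglongrightarrow> x" and g: "\<And>n. g n \<in> span M" "g \<longlonglongrightarrow> y"
    unfolding closure_sequential by blast
  have "\<forall>n. f n + g n \<in> span M" using f g by (simp add: span_add)
  moreover have "(\<lambda>n. f n + g n) \<longlonglongrightarrow> x + y" by (intro tendsto_add f g)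
  ultimately show "x + y \<in> clspan M"
    unfolding closure_sequential by (intro exI[of _ "\<lambda>n. f n + g n"] conjI)
next
  fix r x assume "x \<in> clspan M"
  then obtain f where f: "\<And>n. f n \<in> span M" "f \<longlonglongrightarrow> x"
    unfolding closure_sequential by blast
  have "\<forall>n. r *\<^sub>R f n \<in> span M" using f by (simp add: span_scale)
  moreover have "(\<lambda>n. r *\<^sub>R f n) \<longlonglongrightarrow> r *\<^sub>R x" by (intro tendsto_intros f)
  ultimately show "r *\<^sub>R x \<in> clspan M"
    unfolding closure_sequential by (intro exI[of _ "\<lambda>n. r *\<^sub>R f n"] conjI)
qed

lemma clspan_minimal: "M \<subseteq> G \<Longrightarrow> subspace G \<Longrightarrow> closed G \<Longrightarrow> clspan M \<subseteq> G"
  by (intro closure_minimal span_minimal)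

lemma clspan_mono: "M \<subseteq> clspan N \<Longrightarrow> clspan M \<subseteq> clspan N"
  by (intro clspan_minimal subspace_clspan closed_closure)

lemma clspan_eqI: "M \<subseteq> clspan N \<Longrightarrow> N \<subseteq> clspan M \<Longrightarrow> clspan M = clspan N"
  by (intro subset_antisym clspan_mono)

text \<open>The difference of \<open>x\<close> and its projection onto \<open>clspan M\<close> is at
  first orthogonal to \<open>M\<close> only for the real inner product. Closure of \<open>M\<close>
  under complex scalars makes this complex orthogonality.\<close>

lemma clspan_separating:
  fixes M :: "'a::chilbert_space set"
  assumes M: "separating M" and scale: "\<And>c m. m \<in> M \<Longrightarrow> c *\<^sub>C m \<in> M"
  shows "clspan M = UNIV"
proof -
  have "x \<in> clspan M" for x
  proof -
    obtain g where g: "g \<in> clspan M" "\<And>h. h \<in> clspan M \<Longrightarrow> inner (x - g) h = 0"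
      using orthogonal_projection_ex[OF subspace_clspan closed_closure] by blast
    have "cinner m (x - g) = 0" if m: "m \<in> M" for m
    proof -
      have re: "Re (cinner (c *\<^sub>C m) (x - g)) = 0" for c
        using g(2)[OF clspan_base[OF scale[OF m, of c]]] by (simp add: Re_cinner inner_commute)
      \<comment> \<open>\<open>c = 1\<close> gives the real part of the inner product and
        \<open>c = \<i>\<close> the imaginary part.\<close>
      show ?thesis using re[of 1] re[of \<i>] by (simp add: cinner_scaleC_left complex_eq_iff)
    qed
    then have "x - g = 0" by (rule separatingD[OF M])
    then show ?thesis using g(1) by simp
  qed
  then show ?thesis by blast
qed

lemma clspan_linear:
  assumes f: "bounded_linear f" and D: "\<And>d. d \<in> D \<Longrightarrow> f d \<in> clspan G" and x: "x \<in> clspan D"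
  shows "f x \<in> clspan G"
proof -
  interpret f: bounded_linear f by (rule f)
  have "closed (f -` clspan G)" by (intro closed_vimage f.continuous_on closed_closure continuous_intros)
  moreover have "subspace (f -` clspan G)"
    using subspace_clspan[of G] by (auto simp: subspace_def f.zero f.add f.scale)
  ultimately have "clspan D \<subseteq> f -` clspan G" using D by (intro clspan_minimal) auto
  then show ?thesis using x by blast
qed

lemma clspan_bilinear:
  assumes f: "bounded_bilinear f" and DE: "\<And>d e. d \<in> D \<Longrightarrow> e \<in> E \<Longrightarrow> f d e \<in> clspan G"
    and x: "x \<in> clspan D" and y: "y \<in> clspan E"
  shows "f x y \<in> clspan G"
  by (rule clspan_linear[OF bounded_bilinear.bounded_linear_left[OF f] _ x],
      rule clspan_linear[OF bounded_bilinear.bounded_linear_right[OF f] DE y])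

text \<open>The spatial tensor product and the tensor product of graphs are closures of finite sums
  without coefficients. These are spans because scalars can be absorbed into the generators.\<close>

lemma finite_sums_eq_span:
  fixes G :: "'a::real_vector set"
  assumes scale: "\<And>r g. g \<in> G \<Longrightarrow> r *\<^sub>R g \<in> G"
  shows "{\<Sum>i<n. g i | (n::nat) g. \<forall>i<n. g i \<in> G} = span G"
proof (intro subset_antisym subsetI)
  fix x assume "x \<in> span G"
  then obtain t r where t: "finite t" "t \<subseteq> G" "x = (\<Sum>a\<in>t. r a *\<^sub>R a)"
    unfolding span_explicit by blast
  obtain h where h: "bij_betw h {..<card t} t"
    using ex_bij_betw_nat_finite[OF t(1)] by (auto simp: atLeast0LessThan)
  have "x = (\<Sum>i<card t. r (h i) *\<^sub>R h i)"
    unfolding t(3) by (rule sum.reindex_bij_betw[OF h, symmetric])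
  moreover have "\<forall>i<card t. r (h i) *\<^sub>R h i \<in> G"
    using t(2) bij_betw_apply[OF h] scale by blast
  ultimately show "x \<in> {\<Sum>i<n. g i | (n::nat) g. \<forall>i<n. g i \<in> G}" by blast
qed (auto intro!: span_sum intro: span_base)

section \<open>Maps that are linear and bounded on the complex linear operators\<close>

lemma subspace_bop: "subspace bop"
  by (simp add: subspace_def)

lemma closed_bop: "closed (bop :: ('a::chilbert_space \<Rightarrow>\<^sub>L 'b::chilbert_space) set)"
proof -
  have "bounded_linear (\<lambda>T :: 'a \<Rightarrow>\<^sub>L 'b. c *\<^sub>C T x)" for c x
    by (rule bounded_linear_compose[OF bounded_linear_scaleC blinfun.bounded_linear_left])
  then have *: "closed {T :: 'a \<Rightarrow>\<^sub>L 'b. T (c *\<^sub>C x) = c *\<^sub>C T x}" for c x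
    by (intro closed_Collect_eq linear_continuous_on blinfun.bounded_linear_left)
  have eq: "(bop :: ('a \<Rightarrow>\<^sub>L 'b) set) = (\<Inter>c. \<Inter>x. {T. blinfun_apply T (c *\<^sub>C x) = c *\<^sub>C blinfun_apply T x})"
    by (auto simp: bop_def)
  show ?thesis unfolding eq by (intro closed_INT ballI *)
qed

lemma clspan_bop: "D \<subseteq> bop \<Longrightarrow> clspan D \<subseteq> bop"
  by (rule clspan_minimal[OF _ subspace_bop closed_bop])

text \<open>The adjoint, the tensor product and the leg maps are junk outside \<open>bop\<close>, so they are not
  \<open>bounded_linear\<close> on the real type of bounded operators.\<close>

definition blin :: "(('a::chilbert_space \<Rightarrow>\<^sub>L 'b::chilbert_space) \<Rightarrow> ('c::chilbert_space \<Rightarrow>\<^sub>L 'd::chilbert_space)) \<Rightarrow> bool" where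
  "blin f \<longleftrightarrow> (\<forall>S\<in>bop. f S \<in> bop) \<and> (\<forall>S\<in>bop. \<forall>T\<in>bop. f (S + T) = f S + f T) \<and>
     (\<forall>r. \<forall>S\<in>bop. f (r *\<^sub>R S) = r *\<^sub>R f S) \<and> (\<exists>K. \<forall>S\<in>bop. norm (f S) \<le> K * norm S)"

lemma blin_bop: "blin f \<Longrightarrow> S \<in> bop \<Longrightarrow> f S \<in> bop"
  and blin_add: "blin f \<Longrightarrow> S \<in> bop \<Longrightarrow> T \<in> bop \<Longrightarrow> f (S + T) = f S + f T"
  and blin_scaleR: "blin f \<Longrightarrow> S \<in> bop \<Longrightarrow> f (r *\<^sub>R S) = r *\<^sub>R f S"
  by (simp_all add: blin_def)

lemma blin_diff: "blin f \<Longrightarrow> S \<in> bop \<Longrightarrow> T \<in> bop \<Longrightarrow> f (S - T) = f S - f T"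
  using blin_add[of f "S - T" T] by simp

lemma blin_continuous:
  fixes f :: "('a::chilbert_space \<Rightarrow>\<^sub>L 'b::chilbert_space) \<Rightarrow> ('c::chilbert_space \<Rightarrow>\<^sub>L 'd::chilbert_space)"
  assumes f: "blin f"
  shows "continuous_on bop f"
proof -
  obtain K where K: "\<And>S. S \<in> bop \<Longrightarrow> norm (f S) \<le> K * norm S" using f unfolding blin_def by blast
  have K': "norm (f S) \<le> \<bar>K\<bar> * norm S" if "S \<in> bop" for S
    using K[OF that] by (meson abs_ge_self mult_right_mono norm_ge_zero order_trans)
  show ?thesis
  proof (rule continuous_on_iff[THEN iffD2], intro ballI allI impI)
    fix S :: "'a \<Rightarrow>\<^sub>L 'b" and e :: real assume S: "S \<in> bop" and e: "e > 0"
    have "dist (f T) (f S) < e" if T: "T \<in> bop" "dist T S < e / (\<bar>K\<bar> + 1)" for T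
    proof -
      have "dist (f T) (f S) \<le> \<bar>K\<bar> * norm (T - S)"
        unfolding dist_norm blin_diff[OF f T(1) S, symmetric] using T S by (intro K') simp
      also have "\<dots> \<le> (\<bar>K\<bar> + 1) * norm (T - S)" by (intro mult_right_mono) auto
      also have "\<dots> < e" using T(2) by (simp add: dist_norm pos_less_divide_eq mult.commute)
      finally show ?thesis .
    qed
    then show "\<exists>d>0. \<forall>T\<in>bop. dist T S < d \<longrightarrow> dist (f T) (f S) < e"
      using e by (intro exI[of _ "e / (\<bar>K\<bar> + 1)"]) auto
  qed
qed

lemma clspan_blin:
  assumes f: "blin f" and D: "D \<subseteq> bop" "\<And>d. d \<in> D \<Longrightarrow> f d \<in> clspan G" and x: "x \<in> clspan D"
  shows "f x \<in> clspan G"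
proof -
  let ?P = "{S\<in>bop. f S \<in> clspan G}"
  have "f 0 = 0" using blin_add[OF f, of 0 0] by simp
  then have "subspace ?P"
    using subspace_clspan[of G] f by (auto simp: subspace_def blin_add blin_scaleR)
  moreover have "closed ?P"
    using continuous_closed_preimage[OF blin_continuous[OF f] closed_bop closed_closure]
    by (simp add: vimage_def Int_def)
  ultimately have "clspan D \<subseteq> ?P" using D by (intro clspan_minimal) auto
  then show ?thesis using x by blast
qed

lemma blin_adj: "blin adj"
  unfolding blin_def by (auto simp: adj_additive adj_scaleR intro!: exI[of _ 1])

lemma clspan_adj: "D \<subseteq> bop \<Longrightarrow> x \<in> clspan D \<Longrightarrow> adj x \<in> clspan (adj ` D)"
  by (rule clspan_blin[OF blin_adj]) (auto intro: clspan_base)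

lemma blin_compose_right: "R \<in> bop \<Longrightarrow> blin (\<lambda>T. T o\<^sub>L R)"
  unfolding blin_def
  by (auto simp: bounded_bilinear.add_left[OF bounded_bilinear_blinfun_compose] mult.commute
      bounded_bilinear.scaleR_left[OF bounded_bilinear_blinfun_compose] intro!: exI[of _ "norm R"])
    (metis norm_blinfun_compose mult.commute)

lemma blin_compose_left: "R \<in> bop \<Longrightarrow> blin (\<lambda>T. R o\<^sub>L T)"
  unfolding blin_def
  by (auto simp: bounded_bilinear.add_right[OF bounded_bilinear_blinfun_compose]
      bounded_bilinear.scaleR_right[OF bounded_bilinear_blinfun_compose] intro!: exI[of _ "norm R"]
      norm_blinfun_compose)

lemma blin_comp: 
  assumes "blin f" "blin g"
  shows "blin (\<lambda>T. f (g T))"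
proof -
  obtain K where K: "\<And>S. S \<in> bop \<Longrightarrow> norm (f S) \<le> K * norm S"
    using assms(1) unfolding blin_def by blast
  obtain L where L: "\<And>S. S \<in> bop \<Longrightarrow> norm (g S) \<le> L * norm S"
    using assms(2) unfolding blin_def by blast
  have "norm (f (g S)) \<le> (\<bar>K\<bar> * L) * norm S" if S: "S \<in> bop" for S
  proof -
    have "norm (f (g S)) \<le> K * norm (g S)" by (rule K[OF blin_bop[OF assms(2) S]])
    also have "\<dots> \<le> \<bar>K\<bar> * norm (g S)" by (intro mult_right_mono) auto
    also have "\<dots> \<le> \<bar>K\<bar> * (L * norm S)" by (rule mult_left_mono[OF L[OF S]]) simp
    finally show ?thesis by (simp add: mult_ac)
  qed
  then have "\<exists>M. \<forall>S\<in>bop. norm (f (g S)) \<le> M * norm S" by blast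
  then show ?thesis using assms unfolding blin_def by simp
qed

lemma norm_unitary_le: "unitary U \<Longrightarrow> norm U \<le> 1"
proof (rule norm_blinfun_bound)
  fix x assume U: "unitary U"
  have "complex_of_real ((norm (U x))\<^sup>2) = complex_of_real ((norm x)\<^sup>2)"
    unfolding cinner_self[symmetric] by (rule cinner_unitary[OF U])
  then show "norm (U x) \<le> 1 * norm x"
    by (metis of_real_eq_iff power2_eq_iff_nonneg norm_ge_zero mult_1 order_refl)
qed simp

text \<open>Finite sums of \<open>f \<otimes>\<^sub>v v f\<close> over orthonormal \<open>f\<close>
  obey Pythagoras, so \<open>norm T\<close> bounds the image summand by summand. They form a dense
  subspace, and the bound survives limits.\<close>

lemma norm_tensor_right_le:
  fixes T :: "'b::chilbert_space \<Rightarrow>\<^sub>L 'c::chilbert_space"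
  assumes T: "T \<in> bop"
  shows "norm ((id_blinfun :: 'a::chilbert_space operator) \<otimes>\<^sub>o T) \<le> norm T"
proof (rule norm_blinfun_bound)
  let ?R = "(id_blinfun :: 'a operator) \<otimes>\<^sub>o T"
  let ?S = "{\<xi> :: 'a \<otimes>\<^sub>H 'b. \<exists>F v. finite F \<and> F \<subseteq> hbasis \<and> \<xi> = (\<Sum>f\<in>F. f \<otimes>\<^sub>v v f)}"
  let ?E = "{e \<otimes>\<^sub>v y | (e::'a) (y::'b). e \<in> hbasis \<and> y \<in> UNIV}"
  have z: "(f::'a) \<otimes>\<^sub>v 0 = (0 :: 'a \<otimes>\<^sub>H 'b)" for f by (rule bounded_bilinear.zero_right[OF bounded_bilinear_otimes])
  have ext: "(\<Sum>f\<in>F. f \<otimes>\<^sub>v v f) = (\<Sum>f\<in>H. f \<otimes>\<^sub>v (if f \<in> F then v f else 0))"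
    if "finite H" "F \<subseteq> H" for F H :: "'a set" and v :: "'a \<Rightarrow> 'b"
    using that by (intro sum.mono_neutral_cong_left) (auto simp: z)
  have S: "subspace ?S"
    unfolding subspace_def
  proof (intro conjI ballI allI)
    show "0 \<in> ?S" by (auto intro!: exI[of _ "{}"])
    fix \<xi> \<eta> assume "\<xi> \<in> ?S" "\<eta> \<in> ?S"
    then obtain F v G w where F: "finite F" "F \<subseteq> hbasis" "\<xi> = (\<Sum>f\<in>F. f \<otimes>\<^sub>v v f)"
      and G: "finite G" "G \<subseteq> hbasis" "\<eta> = (\<Sum>f\<in>G. f \<otimes>\<^sub>v w f)" by blast
    \<comment> \<open>Both families are extended by zero to the union of the index sets.\<close>
    define u where "u f = (if f \<in> F then v f else 0) + (if f \<in> G then w f else 0)" for f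
    have "\<xi> + \<eta> = (\<Sum>f\<in>F \<union> G. f \<otimes>\<^sub>v u f)"
      unfolding u_def otimes_add_right sum.distrib F(3) G(3)
      using ext[of "F \<union> G" F v] ext[of "F \<union> G" G w] F(1) G(1) by simp
    moreover have "finite (F \<union> G)" "F \<union> G \<subseteq> hbasis" using F G by auto
    ultimately show "\<xi> + \<eta> \<in> ?S" by blast
  next
    fix r and \<xi> assume "\<xi> \<in> ?S"
    then obtain F v where F: "finite F" "F \<subseteq> hbasis" "\<xi> = (\<Sum>f\<in>F. f \<otimes>\<^sub>v v f)" by blast
    have "r *\<^sub>R \<xi> = (\<Sum>f\<in>F. f \<otimes>\<^sub>v (r *\<^sub>R v f))"
      unfolding F(3) scaleR_sum_right unfolding scaleR_scaleC otimes_scaleC_right ..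
    then show "r *\<^sub>R \<xi> \<in> ?S" using F(1,2) by (intro CollectI exI[of _ F] exI[of _ "\<lambda>f. r *\<^sub>R v f"] conjI)
  qed
  have "e \<otimes>\<^sub>v y \<in> ?S" if "e \<in> hbasis" for e y
    by (rule CollectI, rule exI[of _ "{e}"], rule exI[of _ "\<lambda>_. y"]) (use that in simp)
  then have "span ?E \<subseteq> ?S" by (intro span_minimal S) auto
  moreover have "clspan ?E = UNIV"
  proof (rule clspan_separating)
    have "separating (hbasis :: 'a set)" using hbasis_total by (auto simp: separating_def)
    then show "separating ?E" by (rule separating_otimes[OF _ separating_UNIV])
    show "c *\<^sub>C m \<in> ?E" if m: "m \<in> ?E" for c m
    proof -
      obtain e y where "m = e \<otimes>\<^sub>v y" "e \<in> hbasis" using m by blast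
      then have "c *\<^sub>C m = e \<otimes>\<^sub>v (c *\<^sub>C y)" "e \<in> hbasis" by (simp_all add: otimes_scaleC_right)
      then show ?thesis by blast
    qed
  qed
  ultimately have S_dense: "closure ?S = UNIV" using closure_mono[of "span ?E" ?S] by blast
  have *: "norm (?R \<xi>) \<le> norm T * norm \<xi>" if \<xi>: "\<xi> \<in> ?S" for \<xi>
  proof -
    obtain F v where F: "finite F" "F \<subseteq> hbasis" "\<xi> = (\<Sum>f\<in>F. f \<otimes>\<^sub>v v f)" using \<xi> by blast
    have "(norm (?R \<xi>))\<^sup>2 = (\<Sum>f\<in>F. (norm (T (v f)))\<^sup>2)"
      unfolding F(3) blinfun.sum_right tensor_op_otimes[OF bop_id T]
      using norm_sum_otimes_left[OF F(1,2), of "\<lambda>f. T (v f)"] by simp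
    also have "\<dots> \<le> (\<Sum>f\<in>F. (norm T)\<^sup>2 * (norm (v f))\<^sup>2)"
      unfolding power_mult_distrib[symmetric] by (intro sum_mono power_mono norm_blinfun) auto
    also have "\<dots> = (norm T * norm \<xi>)\<^sup>2"
      unfolding F(3) power_mult_distrib by (simp add: norm_sum_otimes_left F(1,2) sum_distrib_left)
    finally show ?thesis by (rule power2_le_imp_le) simp
  qed
  have "closed {\<xi>. norm (?R \<xi>) \<le> norm T * norm \<xi>}"
    by (intro closed_Collect_le continuous_intros)
  then have "closure ?S \<subseteq> {\<xi>. norm (?R \<xi>) \<le> norm T * norm \<xi>}"
    using * by (intro closure_minimal) auto
  then show "norm (?R \<xi>) \<le> norm T * norm \<xi>" for \<xi> unfolding S_dense by blast
qed simp

lemma blin_tensor_right: "blin (\<lambda>T. (id_blinfun :: 'a::chilbert_space operator) \<otimes>\<^sub>o T)"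
  unfolding blin_def
proof (intro conjI ballI allI exI[of _ 1])
  fix S T :: "'b \<Rightarrow>\<^sub>L 'c" and r assume ST: "S \<in> bop" "T \<in> bop"
  show "(id_blinfun :: 'a operator) \<otimes>\<^sub>o (S + T) = id_blinfun \<otimes>\<^sub>o S + id_blinfun \<otimes>\<^sub>o T"
    by (rule blinfun_otimes_eqI) (simp add: ST blinfun.add_left otimes_add_right)
next
  fix S :: "'b \<Rightarrow>\<^sub>L 'c" and r assume S: "S \<in> bop"
  show "(id_blinfun :: 'a operator) \<otimes>\<^sub>o (r *\<^sub>R S) = r *\<^sub>R (id_blinfun \<otimes>\<^sub>o S)"
    by (rule blinfun_otimes_eqI) (simp add: S blinfun.scaleR_left scaleR_scaleC otimes_scaleC_right)
qed (use norm_tensor_right_le in auto)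

lemma tensor_left_eq_flip:
  "T \<in> bop \<Longrightarrow> T \<otimes>\<^sub>o id_blinfun = flip o\<^sub>L (id_blinfun \<otimes>\<^sub>o T) o\<^sub>L flip"
  by (rule blinfun_otimes_eqI) simp

lemma blin_cong: "blin f \<Longrightarrow> (\<And>T. T \<in> bop \<Longrightarrow> g T = f T) \<Longrightarrow> blin g"
  unfolding blin_def by auto

lemma blin_tensor_left: "blin (\<lambda>T. T \<otimes>\<^sub>o (id_blinfun :: 'a::chilbert_space operator))"
  by (rule blin_cong[OF _ tensor_left_eq_flip])
    (intro blin_comp[OF blin_compose_right] blin_comp[OF blin_compose_left] blin_tensor_right flip_bop)

lemma blin_leg23: "blin leg23"
  unfolding leg23_def by (rule blin_tensor_right)

lemma blin_leg12: "blin leg12"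
  unfolding leg12_def
  by (intro blin_comp[OF blin_compose_right] blin_comp[OF blin_compose_left] blin_tensor_left assoc_bop adj_bop)

lemma norm_blinfun_compose3: "norm (A o\<^sub>L B o\<^sub>L C) \<le> norm A * norm B * norm C"
  by (meson norm_blinfun_compose mult_right_mono norm_ge_zero order_trans)

text \<open>The operator factors into \<open>S\<close> on the left leg after \<open>T\<close> on the
  right leg; flips reduce the left factor to the bound for the right leg.\<close>

lemma norm_tensor_op_le:
  fixes S :: "'a::chilbert_space \<Rightarrow>\<^sub>L 'c::chilbert_space" and T :: "'b::chilbert_space \<Rightarrow>\<^sub>L 'd::chilbert_space"
  assumes "S \<in> bop" "T \<in> bop"
  shows "norm (S \<otimes>\<^sub>o T) \<le> norm S * norm T"
proof -
  have "norm (S \<otimes>\<^sub>o T) = norm ((flip o\<^sub>L (id_blinfun \<otimes>\<^sub>o S)) o\<^sub>L flip o\<^sub>L (id_blinfun \<otimes>\<^sub>o T))"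
    by (rule arg_cong[of _ _ norm], rule blinfun_otimes_eqI) (simp add: assms)
  also have "\<dots> \<le> ((1 * norm S) * 1) * norm T"
    by (rule order_trans[OF norm_blinfun_compose3],
        intro mult_mono order_trans[OF norm_blinfun_compose] norm_tensor_right_le norm_unitary_le unitary_flip assms)
      auto
  finally show ?thesis by simp
qed

section \<open>Slices\<close>

text \<open>The slice of \<open>T\<close> by the vector functional of \<open>x\<close> and
  \<open>z\<close> on the first leg. Real bilinearity in these vectors lets total sets of vectors
  control closed spans of slices.\<close>

definition lslice :: "'c::chilbert_space \<Rightarrow> (('a::chilbert_space \<otimes>\<^sub>H 'b::chilbert_space) \<Rightarrow>\<^sub>L ('c \<otimes>\<^sub>H 'd::chilbert_space)) \<Rightarrow> 'a \<Rightarrow> 'b \<Rightarrow>\<^sub>L 'd"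
  where "lslice x T z = adj (otimes_left x) o\<^sub>L T o\<^sub>L otimes_left z"

lemma lslice_bop [simp]: "T \<in> bop \<Longrightarrow> lslice x T z \<in> bop"
  by (simp add: lslice_def)

lemma cinner_lslice: "cinner u ((lslice x T z) v) = cinner (x \<otimes>\<^sub>v u) (T (z \<otimes>\<^sub>v v))"
  by (simp add: lslice_def cinner_adj_right)

lemma adj_lslice: "T \<in> bop \<Longrightarrow> adj (lslice x T z) = lslice z (adj T) x"
  by (simp add: lslice_def adj_compose blinfun_comp_assoc)

lemma norm_otimes_left_le: "norm (otimes_left x) \<le> norm x"
  by (rule norm_blinfun_bound) simp_all

lemma bounded_bilinear_lslice: "bounded_bilinear (\<lambda>x z. lslice x T z)"
proof -
  have ol: "otimes_left (x + y) = otimes_left x + otimes_left y" "otimes_left (r *\<^sub>R x) = r *\<^sub>R otimes_left x"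
    for x y :: "'x::chilbert_space" and r
    by (rule blinfun_eqI, simp add: blinfun.add_left blinfun.scaleR_left otimes_add_left scaleR_scaleC otimes_scaleC_left)+
  have "norm (lslice x T z) \<le> norm x * norm z * norm T" for x z
  proof -
    have "norm (lslice x T z) \<le> norm x * norm T * norm z"
      unfolding lslice_def
      by (rule order_trans[OF norm_blinfun_compose3], intro mult_mono) (auto simp: norm_otimes_left_le)
    then show ?thesis by (simp add: mult_ac)
  qed
  then show ?thesis
    by unfold_locales
      (auto simp: lslice_def ol adj_additive adj_scaleR
        bounded_bilinear.add_left[OF bounded_bilinear_blinfun_compose]
        bounded_bilinear.add_right[OF bounded_bilinear_blinfun_compose]
        bounded_bilinear.scaleR_left[OF bounded_bilinear_blinfun_compose]
        bounded_bilinear.scaleR_right[OF bounded_bilinear_blinfun_compose])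
qed

lemma scaleR_lslice: "r *\<^sub>R lslice x T z = lslice x T (r *\<^sub>R z)"
  by (simp add: bounded_bilinear.scaleR_right[OF bounded_bilinear_lslice])

text \<open>A normal functional is a series of vector functionals with square-summable data, so its
  slice is the norm-convergent series of the vector slices.\<close>

lemma slice_fst_limit:
  fixes T :: "('a::chilbert_space \<otimes>\<^sub>H 'b::chilbert_space) operator"
  assumes x: "summable (\<lambda>n. (norm (x n))\<^sup>2)" and y: "summable (\<lambda>n. (norm (y n))\<^sup>2)" and T: "T \<in> bop"
  shows "(\<lambda>n. lslice (x n) T (y n)) sums slice_fst (\<lambda>T. \<Sum>n. cinner (x n) (blinfun_apply T (y n))) T"
proof -
  let ?\<omega> = "\<lambda>T. \<Sum>n. cinner (x n) (blinfun_apply T (y n))"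
  have \<omega>: "?\<omega> \<in> predual" unfolding predual_def using x y by blast
  obtain K where K: "K \<ge> 0" "\<And>x y. norm (lslice x T y) \<le> norm x * norm y * K"
    using bounded_bilinear.nonneg_bounded[OF bounded_bilinear_lslice] by blast
  have "summable (\<lambda>n. norm (lslice (x n) T (y n)))"
  proof (rule summable_comparison_test')
    show "summable (\<lambda>n. ((norm (x n))\<^sup>2 + (norm (y n))\<^sup>2) * K)"
      by (intro summable_mult2 summable_add x y)
    show "norm (norm (lslice (x n) T (y n))) \<le> ((norm (x n))\<^sup>2 + (norm (y n))\<^sup>2) * K" for n
    proof -
      have "0 \<le> norm (x n) * norm (y n)" by simp
      then have "norm (x n) * norm (y n) \<le> (norm (x n))\<^sup>2 + (norm (y n))\<^sup>2"
        using sum_squares_bound[of "norm (x n)" "norm (y n)"] by linarith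
      from mult_right_mono[OF this K(1)] show ?thesis using K(2)[of "x n" "y n"] by simp
    qed
  qed
  then have s: "summable (\<lambda>n. lslice (x n) T (y n))" by (rule summable_norm_cancel)
  have "slice_fst ?\<omega> T = (\<Sum>n. lslice (x n) T (y n))"
  proof (rule bop_eqI)
    fix u v :: 'b
    have bl: "bounded_linear (\<lambda>S :: 'b operator. cinner u (S v))"
      by (rule bounded_linear_compose[OF bounded_bilinear.bounded_linear_right[OF bounded_bilinear_cinner] blinfun.bounded_linear_left])
    have "cinner u ((slice_fst ?\<omega> T) v) = (\<Sum>n. cinner u ((lslice (x n) T (y n)) v))"
      unfolding cinner_slice_fst[OF \<omega> T] by (simp add: cinner_lslice cinner_adj_right)
    also have "\<dots> = cinner u ((\<Sum>n. lslice (x n) T (y n)) v)"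
      by (rule bounded_linear.suminf[OF bl s, symmetric])
    finally show "cinner u ((slice_fst ?\<omega> T) v) = \<dots>" .
  qed
  then show ?thesis using s by (simp add: summable_sums)
qed

text \<open>Replaces normal functionals by vector functionals for good: a normal slice is a norm
  limit of finite sums of vector slices, and every such finite sum is a normal slice.\<close>

lemma closure_slice_fst:
  fixes T :: "('a::chilbert_space \<otimes>\<^sub>H 'b::chilbert_space) operator"
  assumes T: "T \<in> bop"
  shows "closure {slice_fst \<omega> T | \<omega>. \<omega> \<in> predual} = clspan {lslice x T z | x z. True}"
proof (rule subset_antisym)
  let ?L = "{lslice x T z | x z. True}"
  show "closure {slice_fst \<omega> T | \<omega>. \<omega> \<in> predual} \<subseteq> clspan ?L"
  proof (rule closure_minimal[OF _ closed_closure], rule subsetI)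
    fix S assume "S \<in> {slice_fst \<omega> T | \<omega>. \<omega> \<in> predual}"
    then obtain x y where x: "summable (\<lambda>n. (norm (x n))\<^sup>2)" and y: "summable (\<lambda>n. (norm (y n))\<^sup>2)"
      and S: "S = slice_fst (\<lambda>T. \<Sum>n. cinner (x n) (blinfun_apply T (y n))) T"
      unfolding predual_def by blast
    have lim: "(\<lambda>N. \<Sum>n<N. lslice (x n) T (y n)) \<longlonglongrightarrow> S"
      using slice_fst_limit[OF x y T] unfolding S sums_def .
    have "(\<Sum>n<N. lslice (x n) T (y n)) \<in> clspan ?L" for N
      by (intro subspace_sum subspace_clspan clspan_base) blast
    then show "S \<in> clspan ?L" by (rule closed_sequentially[OF closed_closure _ lim])
  qed
  have "span ?L \<subseteq> {slice_fst \<omega> T | \<omega>. \<omega> \<in> predual}"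
  proof
    fix S assume "S \<in> span ?L"
    also have "span ?L = {\<Sum>i<n. g i | (n::nat) g. \<forall>i<n. g i \<in> ?L}"
      by (rule finite_sums_eq_span[symmetric]) (use scaleR_lslice in blast)
    finally obtain n :: nat and g where S: "S = (\<Sum>i<n. g i)" and g: "\<forall>i<n. \<exists>x z. g i = lslice x T z" by auto
    then obtain x z where xz: "\<And>i. i < n \<Longrightarrow> g i = lslice (x i) T (z i)" by metis
    \<comment> \<open>Padding with zeros makes the finite families square summable, so that together
      they give a single normal functional.\<close>
    define x' where "x' i = (if i < n then x i else 0)" for i
    define z' where "z' i = (if i < n then z i else 0)" for i
    have fin: "summable (\<lambda>i. (norm (x' i))\<^sup>2)" "summable (\<lambda>i. (norm (z' i))\<^sup>2)"
      by (rule summable_finite[of "{..<n}"]; simp add: x'_def z'_def)+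
    have "(\<lambda>i. lslice (x' i) T (z' i)) sums (\<Sum>i<n. lslice (x' i) T (z' i))"
      by (rule sums_finite) (auto simp: x'_def bounded_bilinear.zero_left[OF bounded_bilinear_lslice])
    moreover have "(\<Sum>i<n. lslice (x' i) T (z' i)) = S" unfolding S by (auto simp: x'_def z'_def xz)
    ultimately have "slice_fst (\<lambda>T. \<Sum>n. cinner (x' n) (blinfun_apply T (z' n))) T = S"
      using slice_fst_limit[OF fin T] sums_unique2 by blast
    moreover have "(\<lambda>T. \<Sum>n. cinner (x' n) (blinfun_apply T (z' n))) \<in> predual"
      unfolding predual_def using fin by blast
    ultimately show "S \<in> {slice_fst \<omega> T | \<omega>. \<omega> \<in> predual}" by blast
  qed
  then show "clspan ?L \<subseteq> closure {slice_fst \<omega> T | \<omega>. \<omega> \<in> predual}" by (rule closure_mono)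
qed

lemma qg_algebra_eq: "W \<in> bop \<Longrightarrow> qg_algebra W = clspan {lslice x W z | x z. True}"
  unfolding qg_algebra_def by (rule closure_slice_fst)

text \<open>The compressions that characterize the two slices coincide, because \<open>flip\<close>
  exchanges \<open>otimes_left\<close> and \<open>otimes_right\<close>.\<close>

lemma slice_snd_eq_flip:
  fixes T :: "('a::chilbert_space \<otimes>\<^sub>H 'b::chilbert_space) operator"
  shows "slice_snd \<omega> T = slice_fst \<omega> (flip o\<^sub>L T o\<^sub>L flip)"
proof -
  let ?R = "otimes_right :: 'a \<Rightarrow> 'b \<Rightarrow>\<^sub>L ('b \<otimes>\<^sub>H 'a)" and ?L = "otimes_left :: 'a \<Rightarrow> 'b \<Rightarrow>\<^sub>L ('a \<otimes>\<^sub>H 'b)"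
  have 1: "flip o\<^sub>L ?R v = ?L v" for v
    by (rule blinfun_eqI) simp
  have "adj (?R u) o\<^sub>L flip = adj (flip o\<^sub>L ?R u)" for u
    by (simp add: adj_compose)
  then have 2: "adj (?R u) o\<^sub>L flip = adj (?L u)" for u
    by (simp add: 1)
  have "adj (?R u) o\<^sub>L (flip o\<^sub>L T o\<^sub>L flip) o\<^sub>L ?R v = (adj (?R u) o\<^sub>L flip) o\<^sub>L T o\<^sub>L (flip o\<^sub>L ?R v)" for u v
    by (simp only: blinfun_comp_assoc)
  then have "adj (?R u) o\<^sub>L (flip o\<^sub>L T o\<^sub>L flip) o\<^sub>L ?R v = adj (?L u) o\<^sub>L T o\<^sub>L ?L v" for u v
    by (simp only: 1 2)
  then show ?thesis
    unfolding slice_snd_def slice_fst_def by simp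
qed

text \<open>The multiplicative unitary of the dual. Through it the dual algebra is itself a
  \<open>qg_algebra\<close>, so nondegeneracy and closure under adjoints are proved only
  once.\<close>

definition dual_unitary :: "('h::chilbert_space \<otimes>\<^sub>H 'h) operator \<Rightarrow> ('h \<otimes>\<^sub>H 'h) operator" where
  "dual_unitary W = flip o\<^sub>L adj W o\<^sub>L flip"

lemma dual_algebra_eq: "dual_algebra W = qg_algebra (dual_unitary W)"
  unfolding dual_algebra_def qg_algebra_def dual_unitary_def slice_snd_eq_flip ..

lemma unitary_dual_unitary [simp]: "unitary W \<Longrightarrow> unitary (dual_unitary W)"
  by (simp add: dual_unitary_def)

lemma qg_algebra_bop: "W \<in> bop \<Longrightarrow> qg_algebra W \<subseteq> bop"
  unfolding qg_algebra_eq by (rule clspan_bop) auto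

lemma qg_algebra_subspace: "W \<in> bop \<Longrightarrow> subspace (qg_algebra W)"
  unfolding qg_algebra_eq by (rule subspace_clspan)

definition nondegenerate :: "'h::chilbert_space operator set \<Rightarrow> bool" where
  "nondegenerate D \<longleftrightarrow> separating {blinfun_apply d x | d x. d \<in> D}"

text \<open>The offending vector is used for slicing: if \<open>u\<close> is orthogonal to all
  \<open>d x\<close>, then \<open>adj W\<close> maps \<open>u \<otimes>\<^sub>v u\<close> to a
  vector orthogonal to every elementary tensor.\<close>

lemma qg_algebra_nondegenerate:
  fixes W :: "('h::chilbert_space \<otimes>\<^sub>H 'h) operator"
  assumes W: "unitary W"
  shows "nondegenerate (qg_algebra W)"
  unfolding nondegenerate_def separating_def
proof (intro allI impI)
  fix u assume u: "\<forall>m\<in>{blinfun_apply d x | d x. d \<in> qg_algebra W}. cinner m u = 0"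
  have "cinner (z \<otimes>\<^sub>v v) ((adj W) (u \<otimes>\<^sub>v u)) = 0" for z v
  proof -
    have "lslice u W z \<in> qg_algebra W" using W by (auto simp: qg_algebra_eq intro: clspan_base)
    then have "cinner ((lslice u W z) v) u = 0" using u by blast
    then have "cinner u ((lslice u W z) v) = 0"
      using cinner_commute[of u "(lslice u W z) v"] by simp
    then have "cinner (u \<otimes>\<^sub>v u) (W (z \<otimes>\<^sub>v v)) = 0" by (simp add: cinner_lslice)
    then have "cinner (W (z \<otimes>\<^sub>v v)) (u \<otimes>\<^sub>v u) = 0"
      using cinner_commute[of "W (z \<otimes>\<^sub>v v)" "u \<otimes>\<^sub>v u"] by simp
    then show ?thesis using W by (simp add: cinner_adj_right)
  qed
  then have "(adj W) (u \<otimes>\<^sub>v u) = 0" by (rule htensor_orthogonal)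
  then have "W ((adj W) (u \<otimes>\<^sub>v u)) = 0" by simp
  then have "u \<otimes>\<^sub>v u = 0" using W by simp
  then show "u = 0" using norm_otimes[of u u] by simp
qed

section \<open>Extension of comultiplications and bicharacters\<close>

lemma spatial_tensor_eq:
  assumes "D \<subseteq> bop" "A \<subseteq> bop" "subspace D"
  shows "spatial_tensor D A = clspan {d \<otimes>\<^sub>o a | d a. d \<in> D \<and> a \<in> A}"
proof -
  let ?G = "{d \<otimes>\<^sub>o a | d a. d \<in> D \<and> a \<in> A}"
  have "{\<Sum>i<n. d i \<otimes>\<^sub>o a i | (n::nat) d a. \<forall>i<n. d i \<in> D \<and> a i \<in> A} = {\<Sum>i<n. g i | (n::nat) g. \<forall>i<n. g i \<in> ?G}"
  proof (intro subset_antisym subsetI)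
    fix x assume "x \<in> {\<Sum>i<n. d i \<otimes>\<^sub>o a i | (n::nat) d a. \<forall>i<n. d i \<in> D \<and> a i \<in> A}"
    then obtain n :: nat and d a where x: "x = (\<Sum>i<n. d i \<otimes>\<^sub>o a i)" "\<forall>i<n. d i \<in> D \<and> a i \<in> A" by blast
    then have "\<forall>i<n. d i \<otimes>\<^sub>o a i \<in> ?G" by blast
    with x(1) show "x \<in> {\<Sum>i<n. g i | (n::nat) g. \<forall>i<n. g i \<in> ?G}" by blast
  next
    fix x assume "x \<in> {\<Sum>i<n. g i | (n::nat) g. \<forall>i<n. g i \<in> ?G}"
    then obtain n :: nat and g where x: "x = (\<Sum>i<n. g i)" "\<forall>i<n. \<exists>d a. g i = d \<otimes>\<^sub>o a \<and> d \<in> D \<and> a \<in> A" by blast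
    then obtain d a where da: "\<And>i. i < n \<Longrightarrow> g i = d i \<otimes>\<^sub>o a i \<and> d i \<in> D \<and> a i \<in> A" by metis
    then have "x = (\<Sum>i<n. d i \<otimes>\<^sub>o a i)" "\<forall>i<n. d i \<in> D \<and> a i \<in> A" using x(1) by simp_all
    then show "x \<in> {\<Sum>i<n. d i \<otimes>\<^sub>o a i | (n::nat) d a. \<forall>i<n. d i \<in> D \<and> a i \<in> A}" by blast
  qed
  also have "\<dots> = span ?G"
  proof (rule finite_sums_eq_span)
    fix r g assume "g \<in> ?G"
    then obtain d a where g: "g = d \<otimes>\<^sub>o a" "d \<in> D" "a \<in> A" by blast
    then have "r *\<^sub>R g = (r *\<^sub>R d) \<otimes>\<^sub>o a"
      using assms by (intro blinfun_otimes_eqI)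
        (auto simp: subset_iff blinfun.scaleR_left scaleR_scaleC otimes_scaleC_left)
    moreover have "r *\<^sub>R d \<in> D" using g(2) assms(3) by (rule subspace_scale[rotated])
    ultimately show "r *\<^sub>R g \<in> ?G" using g(3) by blast
  qed
  finally show ?thesis unfolding spatial_tensor_def by (rule arg_cong)
qed

lemma spatial_tensor_bop:
  assumes "D \<subseteq> bop" "A \<subseteq> bop" "subspace D"
  shows "spatial_tensor D A \<subseteq> bop"
  unfolding spatial_tensor_eq[OF assms] by (rule clspan_bop) (use assms in \<open>auto simp: subset_iff\<close>)

text \<open>Identifies the abstract extension with any bounded linear map that has the right values
  on elementary tensors. The dense sums carry no coefficients, so additivity and continuity
  determine the map.\<close>

lemma tensor_map_eq:
  assumes DA: "D \<subseteq> bop" "A \<subseteq> bop" "subspace D"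
    and \<Phi>: "blin \<Phi>" "\<And>d a. d \<in> D \<Longrightarrow> a \<in> A \<Longrightarrow> \<Phi> (d \<otimes>\<^sub>o a) = \<phi> d \<otimes>\<^sub>o \<psi> a"
  shows "tensor_map D A \<phi> \<psi> = restrict \<Phi> (spatial_tensor D A)"
  unfolding tensor_map_def
proof (rule the_equality)
  let ?X = "spatial_tensor D A" and ?G = "{d \<otimes>\<^sub>o a | d a. d \<in> D \<and> a \<in> A}"
  have X: "?X \<subseteq> bop" "subspace ?X"
    using spatial_tensor_bop[OF DA] spatial_tensor_eq[OF DA] subspace_clspan by auto
  have G: "d \<otimes>\<^sub>o a \<in> ?X" if "d \<in> D" "a \<in> A" for d a
    unfolding spatial_tensor_eq[OF DA] using that by (intro clspan_base) blast
  have cont: "continuous_on ?X \<Phi>"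
    by (rule continuous_on_subset[OF blin_continuous[OF \<Phi>(1)] X(1)])
  have add: "\<Phi> (S + T) = \<Phi> S + \<Phi> T" if "S \<in> ?X" "T \<in> ?X" for S T
    using that X(1) by (intro blin_add[OF \<Phi>(1)]) auto
  show "restrict \<Phi> ?X \<in> extensional ?X \<and> continuous_on ?X (restrict \<Phi> ?X) \<and>
      (\<forall>S\<in>?X. \<forall>T\<in>?X. restrict \<Phi> ?X (S + T) = restrict \<Phi> ?X S + restrict \<Phi> ?X T) \<and>
      (\<forall>d\<in>D. \<forall>a\<in>A. restrict \<Phi> ?X (d \<otimes>\<^sub>o a) = \<phi> d \<otimes>\<^sub>o \<psi> a)"
  proof (intro conjI ballI)
    show "continuous_on ?X (restrict \<Phi> ?X)" using cont by (rule continuous_on_eq) simp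
  qed (use add G subspace_add[OF X(2)] in \<open>simp_all add: \<Phi>(2)\<close>)
  fix \<Psi> assume "\<Psi> \<in> extensional ?X \<and> continuous_on ?X \<Psi> \<and>
      (\<forall>S\<in>?X. \<forall>T\<in>?X. \<Psi> (S + T) = \<Psi> S + \<Psi> T) \<and> (\<forall>d\<in>D. \<forall>a\<in>A. \<Psi> (d \<otimes>\<^sub>o a) = \<phi> d \<otimes>\<^sub>o \<psi> a)"
  then have \<Psi>: "\<Psi> \<in> extensional ?X" "continuous_on ?X \<Psi>"
      "\<And>S T. S \<in> ?X \<Longrightarrow> T \<in> ?X \<Longrightarrow> \<Psi> (S + T) = \<Psi> S + \<Psi> T"
      "\<And>d a. d \<in> D \<Longrightarrow> a \<in> A \<Longrightarrow> \<Psi> (d \<otimes>\<^sub>o a) = \<phi> d \<otimes>\<^sub>o \<psi> a" by auto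
  have zero: "\<Psi> 0 = \<Phi> 0" using \<Psi>(3)[of 0 0] add[of 0 0] subspace_0[OF X(2)] by simp
  let ?S = "{\<Sum>i<n. d i \<otimes>\<^sub>o a i | (n::nat) d a. \<forall>i<n. d i \<in> D \<and> a i \<in> A}"
  have closure_S: "closure ?S = ?X" by (simp add: spatial_tensor_def)
  have sum: "(\<Sum>i<n. d i \<otimes>\<^sub>o a i) \<in> ?X \<and> \<Psi> (\<Sum>i<n. d i \<otimes>\<^sub>o a i) = \<Phi> (\<Sum>i<n. d i \<otimes>\<^sub>o a i)"
    if "\<forall>i<n. d i \<in> D \<and> a i \<in> A" for n :: nat and d a
    using that by (induction n) (simp_all add: zero subspace_0[OF X(2)] subspace_add[OF X(2)] G \<Psi> add \<Phi>(2))
  have eq: "\<Psi> x = \<Phi> x" if "x \<in> ?X" for x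
  proof -
    have "x \<in> closure ?S" using that closure_S by simp
    then obtain f where f: "\<And>n. f n \<in> ?S" "f \<longlonglongrightarrow> x" unfolding closure_sequential by blast
    have fX: "f n \<in> ?X" "\<Psi> (f n) = \<Phi> (f n)" for n using f(1)[of n] sum by auto
    have "(\<lambda>n. \<Psi> (f n)) \<longlonglongrightarrow> \<Psi> x" "(\<lambda>n. \<Phi> (f n)) \<longlonglongrightarrow> \<Phi> x"
      using \<open>x \<in> ?X\<close> fX(1) f(2) \<Psi>(2) cont by (auto simp: continuous_on_sequentially o_def)
    then show ?thesis unfolding fX(2) by (rule LIMSEQ_unique)
  qed
  show "\<Psi> = restrict \<Phi> ?X"
    by (rule extensionalityI[OF \<Psi>(1) restrict_extensional]) (simp add: eq)
qed

text \<open>A multiplicative \<open>\<Phi>\<close> given on all of \<open>bop\<close> is its own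
  extension to multipliers. Its values on \<open>X\<close> map onto a total set of vectors, which
  pins down the extending operator.\<close>

lemma multiplier_extension_eq:
  assumes X: "X \<subseteq> bop" and V: "V \<in> multipliers X" and \<Phi>: "blin \<Phi>"
    and mult: "\<And>S T. S \<in> bop \<Longrightarrow> T \<in> bop \<Longrightarrow> \<Phi> (S o\<^sub>L T) = \<Phi> S o\<^sub>L \<Phi> T"
    and sep: "separating {(\<Phi> d) v | d v. d \<in> X}"
  shows "multiplier_extension X (restrict \<Phi> X) V = \<Phi> V"
  unfolding multiplier_extension_def
proof (rule the_equality)
  have VX: "V \<in> bop" "\<And>d. d \<in> X \<Longrightarrow> V o\<^sub>L d \<in> X" using V by (auto simp: multipliers_def)
  have \<Phi>V: "\<Phi> V o\<^sub>L \<Phi> d = \<Phi> (V o\<^sub>L d)" if "d \<in> X" for d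
    using that X VX by (simp add: mult subset_iff)
  show "\<Phi> V \<in> bop \<and> (\<forall>d\<in>X. \<Phi> V o\<^sub>L restrict \<Phi> X d = restrict \<Phi> X (V o\<^sub>L d))"
    using blin_bop[OF \<Phi> VX(1)] VX(2) by (simp add: \<Phi>V)
  fix S assume S: "S \<in> bop \<and> (\<forall>d\<in>X. S o\<^sub>L restrict \<Phi> X d = restrict \<Phi> X (V o\<^sub>L d))"
  show "S = \<Phi> V"
  proof (rule bop_separating_eqI[OF _ _ separating_UNIV sep])
    fix m n assume "n \<in> {(\<Phi> d) v | d v. d \<in> X}"
    then obtain d v where n: "n = blinfun_apply (\<Phi> d) v" "d \<in> X" by blast
    have "S o\<^sub>L \<Phi> d = \<Phi> V o\<^sub>L \<Phi> d" using S n(2) VX(2) by (simp add: \<Phi>V)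
    then have "S n = (\<Phi> V) n"
      unfolding n(1) by (metis blinfun_apply_blinfun_compose)
    then show "cinner m (S n) = cinner m ((\<Phi> V) n)" by simp
  qed (use S blin_bop[OF \<Phi> VX(1)] in auto)
qed

lemma unitary_conj_iff:
  assumes U: "unitary U"
  shows "adj U o\<^sub>L S o\<^sub>L U = T \<longleftrightarrow> S o\<^sub>L U = U o\<^sub>L T"
    and "U o\<^sub>L S' o\<^sub>L adj U = T' \<longleftrightarrow> U o\<^sub>L S' = T' o\<^sub>L U"
proof -
  show "adj U o\<^sub>L S o\<^sub>L U = T \<longleftrightarrow> S o\<^sub>L U = U o\<^sub>L T"
  proof
    assume "adj U o\<^sub>L S o\<^sub>L U = T"
    then show "S o\<^sub>L U = U o\<^sub>L T" using U by (auto intro!: blinfun_eqI)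
  next
    assume *: "S o\<^sub>L U = U o\<^sub>L T"
    have "adj U o\<^sub>L S o\<^sub>L U = adj U o\<^sub>L (S o\<^sub>L U)" by (rule blinfun_comp_assoc)
    then show "adj U o\<^sub>L S o\<^sub>L U = T" unfolding * using U by (auto intro!: blinfun_eqI)
  qed
  show "U o\<^sub>L S' o\<^sub>L adj U = T' \<longleftrightarrow> U o\<^sub>L S' = T' o\<^sub>L U"
    using U by (auto intro!: blinfun_eqI)
qed

lemma assoc_conj_tensor:
  fixes R :: "'a::chilbert_space operator" and S :: "'b::chilbert_space operator" and T :: "'c::chilbert_space operator"
  assumes "R \<in> bop" "S \<in> bop" "T \<in> bop"
  shows "assoc o\<^sub>L (R \<otimes>\<^sub>o S \<otimes>\<^sub>o T) o\<^sub>L adj assoc = (R \<otimes>\<^sub>o S) \<otimes>\<^sub>o T"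
proof (rule bop_separating_eqI)
  let ?M = "{u \<otimes>\<^sub>v z | u z. u \<in> {x \<otimes>\<^sub>v y | (x::'a) (y::'b). True} \<and> z \<in> (UNIV :: 'c set)}"
  show "separating ?M" "separating ?M"
    by (rule separating_otimes[OF separating_elementary2 separating_UNIV])+
  fix m n assume "m \<in> ?M" "n \<in> ?M"
  then show "cinner m ((assoc o\<^sub>L (R \<otimes>\<^sub>o S \<otimes>\<^sub>o T) o\<^sub>L adj assoc) n) =
      cinner m (((R \<otimes>\<^sub>o S) \<otimes>\<^sub>o T) n)"
    by (auto simp: assms)
qed (simp_all add: assms)

lemma leg12_flip_otimes [simp]: "(leg12 flip) (x \<otimes>\<^sub>v y \<otimes>\<^sub>v z) = y \<otimes>\<^sub>v x \<otimes>\<^sub>v z"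
  by (simp add: leg12_def)

lemma leg12_flip_flip [simp]: "leg12 flip o\<^sub>L leg12 flip = id_blinfun"
  by (simp flip: leg12_compose)

lemma cinner_leg12_flip: "cinner \<xi> ((leg12 flip) \<eta>) = cinner ((leg12 flip) \<xi>) \<eta>"
  using cinner_adj_right[of "leg12 flip" \<xi> \<eta>] by (simp add: adj_leg12)

lemma leg12_flip_leg23:
  "T \<in> bop \<Longrightarrow> leg12 flip o\<^sub>L leg23 T o\<^sub>L leg12 flip = leg13 T"
  by (rule bop_eqI3) (simp_all add: cinner_leg12_flip cinner_leg23 cinner_leg13)

lemma leg12_flip_leg13:
  "T \<in> bop \<Longrightarrow> leg12 flip o\<^sub>L leg13 T o\<^sub>L leg12 flip = leg23 T"
  by (rule bop_eqI3) (simp_all add: cinner_leg12_flip cinner_leg23 cinner_leg13)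

text \<open>The extended comultiplication is conjugation of \<open>leg23 T\<close> by one unitary
  \<open>U\<close>, which makes sense for multipliers too. The flip inside
  \<open>dual_comult\<close> exchanges the first two legs; hence the product of
  \<open>leg23 V\<close> and \<open>leg13 V\<close> reappears in the opposite order.\<close>

lemma dual_comult_extension:
  fixes V :: "('c::chilbert_space \<otimes>\<^sub>H 'a::chilbert_space) operator"
  assumes W: "unitary (W :: ('c \<otimes>\<^sub>H 'c) operator)"
    and D: "D \<subseteq> bop" "subspace D" "nondegenerate D" and A: "A \<subseteq> bop" "nondegenerate A"
    and V: "V \<in> multipliers (spatial_tensor D A)"
  shows "adj assoc o\<^sub>L multiplier_extension (spatial_tensor D A) (tensor_map D A (dual_comult W) (\<lambda>a. a)) V o\<^sub>L assoc
           = leg23 V o\<^sub>L leg13 V \<longleftrightarrow> leg23 V o\<^sub>L leg12 W = leg12 W o\<^sub>L leg13 V o\<^sub>L leg23 V"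
proof -
  let ?X = "spatial_tensor D A"
  have Wb: "W \<in> bop" and Vb: "V \<in> bop" using W V by (auto simp: multipliers_def)
  define U :: "('c \<otimes>\<^sub>H 'c \<otimes>\<^sub>H 'a) \<Rightarrow>\<^sub>L (('c \<otimes>\<^sub>H 'c) \<otimes>\<^sub>H 'a)" where "U = ((flip o\<^sub>L adj W) \<otimes>\<^sub>o id_blinfun) o\<^sub>L assoc"
  define \<Phi> where "\<Phi> T = U o\<^sub>L leg23 T o\<^sub>L adj U" for T :: "('c \<otimes>\<^sub>H 'a) operator"
  have U: "unitary U" unfolding U_def using W by simp
  have adjU: "adj U = adj assoc o\<^sub>L ((W o\<^sub>L flip) \<otimes>\<^sub>o id_blinfun)"
    unfolding U_def using Wb by (simp add: adj_compose adj_tensor_op)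
  have blin: "blin \<Phi>"
    unfolding \<Phi>_def using U
    by (intro blin_comp[OF blin_compose_right] blin_comp[OF blin_compose_left] blin_leg23) simp_all
  have mult: "\<Phi> (S o\<^sub>L T) = \<Phi> S o\<^sub>L \<Phi> T" if "S \<in> bop" "T \<in> bop" for S T
    using that U by (auto simp: \<Phi>_def leg23_compose intro!: blinfun_eqI)
  have tens: "\<Phi> (d \<otimes>\<^sub>o a) = dual_comult W d \<otimes>\<^sub>o a" if da: "d \<in> bop" "a \<in> bop" for d a
  proof -
    have "\<Phi> (d \<otimes>\<^sub>o a) = ((flip o\<^sub>L adj W) \<otimes>\<^sub>o id_blinfun) o\<^sub>L (assoc o\<^sub>L (id_blinfun \<otimes>\<^sub>o d \<otimes>\<^sub>o a) o\<^sub>L adj assoc)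
        o\<^sub>L ((W o\<^sub>L flip) \<otimes>\<^sub>o id_blinfun)"
      unfolding \<Phi>_def adjU leg23_def unfolding U_def by (simp only: blinfun_comp_assoc)
    also have "\<dots> = dual_comult W d \<otimes>\<^sub>o a"
      unfolding assoc_conj_tensor[OF bop_id da]
      by (simp add: tensor_op_compose Wb da dual_comult_def blinfun_comp_assoc)
    finally show ?thesis .
  qed
  have tm: "tensor_map D A (dual_comult W) (\<lambda>a. a) = restrict \<Phi> ?X"
    by (rule tensor_map_eq[OF D(1) A(1) D(2) blin]) (use tens D A in blast)
  have sep: "separating {(\<Phi> d) v | d v. d \<in> ?X}"
  proof (rule separating_mono)
    let ?M = "{x \<otimes>\<^sub>v \<xi> | x \<xi>. x \<in> (UNIV :: 'c set) \<and> \<xi> \<in> {u \<otimes>\<^sub>v v | u v. u \<in> {blinfun_apply d x | d x. d \<in> D} \<and>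
      v \<in> {blinfun_apply a x | a x. a \<in> A}}}"
    show "separating (blinfun_apply U ` ?M)"
      using D(3) A(2) unfolding nondegenerate_def
      by (intro separating_unitary U separating_otimes separating_UNIV)
    show "blinfun_apply U ` ?M \<subseteq> {(\<Phi> d) v | d v. d \<in> ?X}"
    proof
      fix m assume "m \<in> blinfun_apply U ` ?M"
      then obtain x d y a z where m: "m = blinfun_apply U (x \<otimes>\<^sub>v blinfun_apply d y \<otimes>\<^sub>v blinfun_apply a z)"
        and da: "d \<in> D" "a \<in> A" by blast
      then have "m = (\<Phi> (d \<otimes>\<^sub>o a)) (U (x \<otimes>\<^sub>v y \<otimes>\<^sub>v z))"
        using U D(1) A(1) by (auto simp: \<Phi>_def leg23_otimes subset_iff)
      moreover have "d \<otimes>\<^sub>o a \<in> ?X"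
        unfolding spatial_tensor_eq[OF D(1) A(1) D(2)] using da by (intro clspan_base) blast
      ultimately show "m \<in> {(\<Phi> d) v | d v. d \<in> ?X}" by blast
    qed
  qed
  have ext: "multiplier_extension ?X (tensor_map D A (dual_comult W) (\<lambda>a. a)) V = \<Phi> V"
    unfolding tm by (rule multiplier_extension_eq[OF spatial_tensor_bop[OF D(1) A(1) D(2)] V blin mult sep])
  let ?F = "leg12 flip :: ('c \<otimes>\<^sub>H 'c \<otimes>\<^sub>H 'a) operator"
  have F: "unitary ?F" "adj ?F = ?F" by (simp_all add: adj_leg12)
  have "adj assoc o\<^sub>L \<Phi> V o\<^sub>L assoc = (adj assoc o\<^sub>L ((flip o\<^sub>L adj W) \<otimes>\<^sub>o id_blinfun) o\<^sub>L assoc) o\<^sub>L leg23 V o\<^sub>L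
      (adj assoc o\<^sub>L ((W o\<^sub>L flip) \<otimes>\<^sub>o id_blinfun) o\<^sub>L assoc)"
    unfolding \<Phi>_def adjU unfolding U_def by (simp only: blinfun_comp_assoc)
  also have "\<dots> = leg12 (flip o\<^sub>L adj W) o\<^sub>L leg23 V o\<^sub>L leg12 (W o\<^sub>L flip)"
    by (simp only: leg12_def)
  \<comment> \<open>The flip of the first two legs is pulled out, so that only
    \<open>leg12 W\<close> remains around \<open>leg23 V\<close>.\<close>
  also have "\<dots> = adj ?F o\<^sub>L (adj (leg12 W) o\<^sub>L leg23 V o\<^sub>L leg12 W) o\<^sub>L ?F"
    by (simp add: leg12_compose Wb adj_leg12 blinfun_comp_assoc)
  finally have "adj assoc o\<^sub>L \<Phi> V o\<^sub>L assoc = leg23 V o\<^sub>L leg13 V \<longleftrightarrow>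
      (adj (leg12 W) o\<^sub>L leg23 V o\<^sub>L leg12 W) o\<^sub>L ?F = ?F o\<^sub>L (leg23 V o\<^sub>L leg13 V)"
    by (simp only: unitary_conj_iff(1)[OF F(1)])
  also have "\<dots> \<longleftrightarrow> adj (leg12 W) o\<^sub>L leg23 V o\<^sub>L leg12 W = ?F o\<^sub>L (leg23 V o\<^sub>L leg13 V) o\<^sub>L adj ?F"
    using unitary_conj_iff(2)[OF F(1), of "leg23 V o\<^sub>L leg13 V"] by (metis)
  also have "?F o\<^sub>L (leg23 V o\<^sub>L leg13 V) o\<^sub>L adj ?F = (?F o\<^sub>L leg23 V o\<^sub>L ?F) o\<^sub>L (?F o\<^sub>L leg13 V o\<^sub>L ?F)"
  proof -
    have "?F o\<^sub>L (?F o\<^sub>L T) = T" for T :: "('c \<otimes>\<^sub>H 'c \<otimes>\<^sub>H 'a) operator"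
      by (simp flip: blinfun_comp_assoc)
    then show ?thesis by (simp add: F(2) blinfun_comp_assoc)
  qed
  also have "\<dots> = leg13 V o\<^sub>L leg23 V" by (simp only: leg12_flip_leg23[OF Vb] leg12_flip_leg13[OF Vb])
  also have "adj (leg12 W) o\<^sub>L leg23 V o\<^sub>L leg12 W = leg13 V o\<^sub>L leg23 V \<longleftrightarrow>
      leg23 V o\<^sub>L leg12 W = leg12 W o\<^sub>L (leg13 V o\<^sub>L leg23 V)"
    using W by (intro unitary_conj_iff) simp
  finally show ?thesis by (simp only: ext blinfun_comp_assoc)
qed

text \<open>The argument for the dual side with \<open>leg23 W\<close> as implementing unitary; no
  flip occurs, so the order of the legs stays.\<close>

lemma comult_extension:
  fixes V :: "('c::chilbert_space \<otimes>\<^sub>H 'a::chilbert_space) operator"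
  assumes W: "unitary (W :: ('a \<otimes>\<^sub>H 'a) operator)"
    and D: "D \<subseteq> bop" "subspace D" "nondegenerate D" and A: "A \<subseteq> bop" "nondegenerate A"
    and V: "V \<in> multipliers (spatial_tensor D A)"
  shows "multiplier_extension (spatial_tensor D A) (tensor_map D A (\<lambda>c. c) (qg_comult W)) V
           = leg12 V o\<^sub>L leg13 V \<longleftrightarrow> leg23 W o\<^sub>L leg12 V = leg12 V o\<^sub>L leg13 V o\<^sub>L leg23 W"
proof -
  let ?X = "spatial_tensor D A"
  have Wb: "W \<in> bop" and Vb: "V \<in> bop" using W V by (auto simp: multipliers_def)
  define U :: "('c \<otimes>\<^sub>H 'a \<otimes>\<^sub>H 'a) operator" where "U = leg23 W"
  define \<Phi> where "\<Phi> T = U o\<^sub>L leg12 T o\<^sub>L adj U" for T :: "('c \<otimes>\<^sub>H 'a) operator"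
  have U: "unitary U" unfolding U_def using W by simp
  have adjU: "adj U = leg23 (adj W)" unfolding U_def using Wb by (rule adj_leg23)
  have blin: "blin \<Phi>"
    unfolding \<Phi>_def using U
    by (intro blin_comp[OF blin_compose_right] blin_comp[OF blin_compose_left] blin_leg12) simp_all
  have mult: "\<Phi> (S o\<^sub>L T) = \<Phi> S o\<^sub>L \<Phi> T" if "S \<in> bop" "T \<in> bop" for S T
    using that U by (auto simp: \<Phi>_def leg12_compose intro!: blinfun_eqI)
  have tens: "\<Phi> (d \<otimes>\<^sub>o a) = d \<otimes>\<^sub>o qg_comult W a" if da: "d \<in> bop" "a \<in> bop" for d a
    unfolding \<Phi>_def adjU unfolding U_def leg12_tensor_op[OF da] leg23_def
    by (simp add: tensor_op_compose Wb da qg_comult_def)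
  have tm: "tensor_map D A (\<lambda>c. c) (qg_comult W) = restrict \<Phi> ?X"
    by (rule tensor_map_eq[OF D(1) A(1) D(2) blin]) (use tens D A in blast)
  have sep: "separating {(\<Phi> d) v | d v. d \<in> ?X}"
  proof (rule separating_mono)
    let ?M = "{x \<otimes>\<^sub>v \<xi> | x \<xi>. x \<in> {blinfun_apply d x | d x. d \<in> D} \<and> \<xi> \<in> {u \<otimes>\<^sub>v v | u v.
      u \<in> {blinfun_apply a x | a x. a \<in> A} \<and> v \<in> (UNIV :: 'a set)}}"
    show "separating (blinfun_apply U ` ?M)"
      using D(3) A(2) unfolding nondegenerate_def
      by (intro separating_unitary U separating_otimes separating_UNIV)
    show "blinfun_apply U ` ?M \<subseteq> {(\<Phi> d) v | d v. d \<in> ?X}"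
    proof
      fix m assume "m \<in> blinfun_apply U ` ?M"
      then obtain x d y a z where m: "m = blinfun_apply U (blinfun_apply d x \<otimes>\<^sub>v blinfun_apply a y \<otimes>\<^sub>v z)"
        and da: "d \<in> D" "a \<in> A" by blast
      then have "m = (\<Phi> (d \<otimes>\<^sub>o a)) (U (x \<otimes>\<^sub>v y \<otimes>\<^sub>v z))"
        using U D(1) A(1) by (auto simp: \<Phi>_def leg12_tensor_op subset_iff)
      moreover have "d \<otimes>\<^sub>o a \<in> ?X"
        unfolding spatial_tensor_eq[OF D(1) A(1) D(2)] using da by (intro clspan_base) blast
      ultimately show "m \<in> {(\<Phi> d) v | d v. d \<in> ?X}" by blast
    qed
  qed
  have ext: "multiplier_extension ?X (tensor_map D A (\<lambda>c. c) (qg_comult W)) V = \<Phi> V"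
    unfolding tm by (rule multiplier_extension_eq[OF spatial_tensor_bop[OF D(1) A(1) D(2)] V blin mult sep])
  show ?thesis unfolding ext unfolding \<Phi>_def unitary_conj_iff(2)[OF U] unfolding U_def ..
qed

text \<open>From here on comultiplications are gone: a bicharacter is a unitary multiplier
  satisfying two equations of pentagon type, one for each quantum group.\<close>

lemma bicharacter_iff:
  assumes "unitary WC" "unitary WA"
  shows "bicharacter WC WA V \<longleftrightarrow>
    V \<in> unitary_multipliers (spatial_tensor (dual_algebra WC) (qg_algebra WA)) \<and>
    leg23 V o\<^sub>L leg12 WC = leg12 WC o\<^sub>L leg13 V o\<^sub>L leg23 V \<and>
    leg23 WA o\<^sub>L leg12 V = leg12 V o\<^sub>L leg13 V o\<^sub>L leg23 WA"
proof -
  have D: "dual_algebra WC \<subseteq> bop" "subspace (dual_algebra WC)" "nondegenerate (dual_algebra WC)"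
    and A: "qg_algebra WA \<subseteq> bop" "nondegenerate (qg_algebra WA)"
    using assms by (simp_all add: dual_algebra_eq qg_algebra_bop qg_algebra_subspace qg_algebra_nondegenerate)
  show ?thesis
    unfolding bicharacter_def Let_def unitary_multipliers_def
    using dual_comult_extension[OF assms(1) D A, of V] comult_extension[OF assms(2) D A, of V] by auto
qed

section \<open>Graphs of self-adjoint operators\<close>

lemma self_adjoint_linear: "self_adjoint Q \<Longrightarrow> linear_operator Q"
  by (simp add: self_adjoint_def)

lemma linear_operator_add: "linear_operator Q \<Longrightarrow> (x, x') \<in> Q \<Longrightarrow> (y, y') \<in> Q \<Longrightarrow> (x + y, x' + y') \<in> Q"
  and linear_operator_scaleC: "linear_operator Q \<Longrightarrow> (x, x') \<in> Q \<Longrightarrow> (c *\<^sub>C x, c *\<^sub>C x') \<in> Q"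
  by (auto simp: linear_operator_def split: prod.splits)

lemma self_adjoint_symmetric:
  assumes "self_adjoint Q" "(x, x') \<in> Q" "(y, y') \<in> Q"
  shows "cinner x y' = cinner x' y"
proof -
  have "(x, x') \<in> adjoint_graph Q" using assms(1,2) by (simp add: self_adjoint_def)
  then show ?thesis using assms(3) by (auto simp: adjoint_graph_def)
qed

lemma self_adjoint_mem:
  assumes "self_adjoint Q" "\<And>x x'. (x, x') \<in> Q \<Longrightarrow> cinner y x' = cinner y' x"
  shows "(y, y') \<in> Q"
proof -
  have "(y, y') \<in> adjoint_graph Q" using assms(2) by (auto simp: adjoint_graph_def)
  then show ?thesis using assms(1) by (simp add: self_adjoint_def)
qed

lemma self_adjoint_Domain: "self_adjoint Q \<Longrightarrow> separating (Domain Q)"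
  using closure_mono[OF span_superset[of "Domain Q"]]
  by (intro separating_closure_span) (auto simp: self_adjoint_def)

text \<open>If \<open>v\<close> is orthogonal to the range, then \<open>(v, 0)\<close> satisfies the
  condition defining the adjoint graph, so \<open>v\<close> lies in the kernel.\<close>

lemma self_adjoint_Range:
  assumes "self_adjoint Q" "trivial_kernel Q"
  shows "separating (Range Q)"
  unfolding separating_def
proof (intro allI impI)
  fix v assume v: "\<forall>m\<in>Range Q. cinner m v = 0"
  have "(v, 0) \<in> Q"
  proof (rule self_adjoint_mem[OF assms(1)])
    fix x x' assume "(x, x') \<in> Q"
    then have "cinner x' v = 0" using v by blast
    then show "cinner v x' = cinner 0 x" using cinner_commute[of v x'] by simp
  qed
  then show "v = 0" using assms(2) by (simp add: trivial_kernel_def)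
qed

lemma self_adjoint_clspan:
  assumes "self_adjoint Q"
  shows "clspan (Domain Q) = UNIV" "trivial_kernel Q \<Longrightarrow> clspan (Range Q) = UNIV"
  using assms linear_operator_scaleC[OF self_adjoint_linear[OF assms]]
  by (auto intro!: clspan_separating self_adjoint_Domain self_adjoint_Range)

lemma tensor_graph_eq:
  assumes P: "linear_operator P"
  shows "tensor_graph P Q = clspan {(x \<otimes>\<^sub>v y, x' \<otimes>\<^sub>v y') | x x' y y'. (x, x') \<in> P \<and> (y, y') \<in> Q}"
proof -
  let ?G = "{(x \<otimes>\<^sub>v y, x' \<otimes>\<^sub>v y') | x x' y y'. (x, x') \<in> P \<and> (y, y') \<in> Q}"
  let ?S = "{(\<Sum>i<n. x i \<otimes>\<^sub>v y i, \<Sum>i<n. x' i \<otimes>\<^sub>v y' i) | (n::nat) x x' y y'. \<forall>i<n. (x i, x' i) \<in> P \<and> (y i, y' i) \<in> Q}"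
  have "?S = {\<Sum>i<n. g i | (n::nat) g. \<forall>i<n. g i \<in> ?G}"
  proof (intro subset_antisym subsetI)
    fix p assume "p \<in> ?S"
    then obtain n :: nat and x x' y y' where p: "p = (\<Sum>i<n. x i \<otimes>\<^sub>v y i, \<Sum>i<n. x' i \<otimes>\<^sub>v y' i)"
      "\<forall>i<n. (x i, x' i) \<in> P \<and> (y i, y' i) \<in> Q" by blast
    have "p = (\<Sum>i<n. (x i \<otimes>\<^sub>v y i, x' i \<otimes>\<^sub>v y' i))" unfolding p(1) by (simp add: sum_prod)
    moreover have "\<forall>i<n. (x i \<otimes>\<^sub>v y i, x' i \<otimes>\<^sub>v y' i) \<in> ?G" using p(2) by blast
    ultimately show "p \<in> {\<Sum>i<n. g i | (n::nat) g. \<forall>i<n. g i \<in> ?G}" by blast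
  next
    fix p assume "p \<in> {\<Sum>i<n. g i | (n::nat) g. \<forall>i<n. g i \<in> ?G}"
    then obtain n :: nat and g where p: "p = (\<Sum>i<n. g i)"
      "\<forall>i<n. \<exists>x x' y y'. g i = (x \<otimes>\<^sub>v y, x' \<otimes>\<^sub>v y') \<and> (x, x') \<in> P \<and> (y, y') \<in> Q" by blast
    then obtain x x' y y' where g: "\<And>i. i < n \<Longrightarrow> g i = (x i \<otimes>\<^sub>v y i, x' i \<otimes>\<^sub>v y' i) \<and> (x i, x' i) \<in> P \<and> (y i, y' i) \<in> Q"
      by metis
    have "p = (\<Sum>i<n. (x i \<otimes>\<^sub>v y i, x' i \<otimes>\<^sub>v y' i))" unfolding p(1) using g by (intro sum.cong) auto
    then have "p = (\<Sum>i<n. x i \<otimes>\<^sub>v y i, \<Sum>i<n. x' i \<otimes>\<^sub>v y' i)" by (simp add: sum_prod)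
    with g show "p \<in> ?S" by blast
  qed
  also have "\<dots> = span ?G"
  proof (rule finite_sums_eq_span)
    fix r g assume "g \<in> ?G"
    then obtain x x' y y' where g: "g = (x \<otimes>\<^sub>v y, x' \<otimes>\<^sub>v y')" "(x, x') \<in> P" "(y, y') \<in> Q" by blast
    have "r *\<^sub>R g = ((complex_of_real r *\<^sub>C x) \<otimes>\<^sub>v y, (complex_of_real r *\<^sub>C x') \<otimes>\<^sub>v y')"
      by (simp add: g(1) scaleR_scaleC otimes_scaleC_left)
    then show "r *\<^sub>R g \<in> ?G" using linear_operator_scaleC[OF P g(2)] g(3) by blast
  qed
  finally show ?thesis unfolding tensor_graph_def by (rule arg_cong)
qed

lemma tensor_graph_base:
  "linear_operator P \<Longrightarrow> (x, x') \<in> P \<Longrightarrow> (y, y') \<in> Q \<Longrightarrow> (x \<otimes>\<^sub>v y, x' \<otimes>\<^sub>v y') \<in> tensor_graph P Q"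
  unfolding tensor_graph_eq by (intro clspan_base) blast

lemma tensor_graph_flip:
  assumes PQ: "linear_operator P" "linear_operator Q" and \<xi>: "(\<xi>, \<xi>') \<in> tensor_graph P Q"
  shows "(flip \<xi>, flip \<xi>') \<in> tensor_graph Q P"
proof -
  have bl: "bounded_linear (\<lambda>p. (flip (fst p), flip (snd p)))"
    by (intro bounded_linear_Pair bounded_linear_compose[OF blinfun.bounded_linear_right] bounded_linear_fst bounded_linear_snd)
  have "(\<lambda>p. (flip (fst p), flip (snd p))) (\<xi>, \<xi>') \<in> tensor_graph Q P"
    unfolding tensor_graph_eq[OF PQ(2)]
    by (rule clspan_linear[OF bl _ \<xi>[unfolded tensor_graph_eq[OF PQ(1)]]])
      (use tensor_graph_base[OF PQ(2), of _ _ _ _ P] in \<open>auto simp: tensor_graph_eq[OF PQ(2)]\<close>)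
  then show ?thesis by simp
qed

text \<open>Symmetry is extended from generators one argument at a time: with the other argument
  fixed, the condition cuts out a closed subspace.\<close>

lemma tensor_graph_symmetric:
  assumes PQ: "self_adjoint P" "self_adjoint Q"
    and \<xi>: "(\<xi>, \<xi>') \<in> tensor_graph P Q" and \<eta>: "(\<eta>, \<eta>') \<in> tensor_graph P Q"
  shows "cinner \<xi> \<eta>' = cinner \<xi>' \<eta>"
proof -
  let ?G = "{(x \<otimes>\<^sub>v y, x' \<otimes>\<^sub>v y') | x x' y y'. (x, x') \<in> P \<and> (y, y') \<in> Q}"
  have T: "tensor_graph P Q = clspan ?G" by (rule tensor_graph_eq[OF self_adjoint_linear[OF PQ(1)]])
  have cont: "continuous_on UNIV (\<lambda>p. cinner (f p) (g p))"
    if "continuous_on UNIV f" "continuous_on UNIV g" for f g :: "('a \<otimes>\<^sub>H 'b) \<times> ('a \<otimes>\<^sub>H 'b) \<Rightarrow> 'a \<otimes>\<^sub>H 'b"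
    using bounded_bilinear.continuous_on[OF bounded_bilinear_cinner that] .
  have 1: "?G \<subseteq> {p. cinner (fst p) (snd q) = cinner (snd p) (fst q)}" if q: "q \<in> ?G" for q
    using q self_adjoint_symmetric[OF PQ(1)] self_adjoint_symmetric[OF PQ(2)] by (auto simp: cinner_otimes)
  have 2: "clspan ?G \<subseteq> {p. cinner (fst p) (snd q) = cinner (snd p) (fst q)}" if "q \<in> ?G" for q
    by (rule clspan_minimal[OF 1[OF that]])
      (auto simp: subspace_def cinner_add_left cinner_scaleR_left intro!: closed_Collect_eq cont continuous_intros)
  have "clspan ?G \<subseteq> {q. cinner \<xi> (snd q) = cinner \<xi>' (fst q)}"
  proof (rule clspan_minimal)
    show "?G \<subseteq> {q. cinner \<xi> (snd q) = cinner \<xi>' (fst q)}" using 2 \<xi> unfolding T by fastforce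
  qed (auto simp: subspace_def cinner_add_right cinner_scaleR_right intro!: closed_Collect_eq cont continuous_intros)
  then show ?thesis using \<eta> unfolding T by fastforce
qed

section \<open>Modular multiplicative unitaries\<close>

text \<open>Exposes the three witnesses of modularity so that a locale can fix them.
  \<open>P\<close> is the operator bound as \<open>Qh\<close> in the definition of modularity,
  \<open>Wt\<close> the companion unitary.\<close>

definition modular_data ::
    "('h::chilbert_space \<otimes>\<^sub>H 'h) operator \<Rightarrow> ('h \<times> 'h) set \<Rightarrow> ('h \<times> 'h) set \<Rightarrow> ('h conjugate \<otimes>\<^sub>H 'h) operator \<Rightarrow> bool" where
  "modular_data W P Q Wt \<longleftrightarrow> multiplicative_unitary W \<and> positive_self_adjoint P \<and> trivial_kernel P \<and>
     positive_self_adjoint Q \<and> trivial_kernel Q \<and> unitary Wt \<and>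
     {(\<xi>, (adj W) \<eta>) | \<xi> \<eta>. (W \<xi>, \<eta>) \<in> tensor_graph P Q} = tensor_graph P Q \<and>
     (\<forall>x z y Qy u Qinv_u. (y, Qy) \<in> Q \<longrightarrow> (u, Qinv_u) \<in> converse Q \<longrightarrow>
        cinner (x \<otimes>\<^sub>v y) (W (z \<otimes>\<^sub>v u)) =
        cinner (to_conj z \<otimes>\<^sub>v Qy) (Wt (to_conj x \<otimes>\<^sub>v Qinv_u)))"

lemma modular_multiplicative_unitary_iff:
  "modular_multiplicative_unitary W \<longleftrightarrow> (\<exists>P Q Wt. modular_data W P Q Wt)"
  unfolding modular_multiplicative_unitary_def modular_data_def by (simp only: ex_simps)

lemma cinner_conj [simp]: "cinner (to_conj x) (to_conj y) = cinner y x"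
  by (simp add: cinner_conjugate_def)

lemma separating_to_conj: "separating M \<Longrightarrow> separating (to_conj ` M)"
  unfolding separating_def
proof (intro allI impI)
  fix v assume M: "\<forall>v. (\<forall>m\<in>M. cinner m v = 0) \<longrightarrow> v = 0" and v: "\<forall>m\<in>to_conj ` M. cinner m v = 0"
  have "cinner m (of_conj v) = 0" if "m \<in> M" for m
  proof -
    have "cinner (of_conj v) m = 0" using v that by (simp add: cinner_conjugate_def)
    then show ?thesis using cinner_commute[of m "of_conj v"] by simp
  qed
  then have "of_conj v = 0" using M by blast
  then have "v = to_conj 0" by (metis of_conj_inverse)
  then show "v = 0" by (simp add: zero_conjugate_def)
qed

locale modular =
  fixes W :: "('h::chilbert_space \<otimes>\<^sub>H 'h) operator" and P Q :: "('h \<times> 'h) set" and Wt :: "('h conjugate \<otimes>\<^sub>H 'h) operator"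
  assumes modular_data: "modular_data W P Q Wt"
begin

lemma unitary_W [simp]: "unitary W" and unitary_Wt [simp]: "unitary Wt"
  and pentagon: "(leg23 W o\<^sub>L leg12 W :: ('h \<otimes>\<^sub>H 'h \<otimes>\<^sub>H 'h) operator) = leg12 W o\<^sub>L leg13 W o\<^sub>L leg23 W"
  and self_adjoint_P: "self_adjoint P" and self_adjoint_Q: "self_adjoint Q"
  and trivial_kernel_P: "trivial_kernel P" and trivial_kernel_Q: "trivial_kernel Q"
  using modular_data by (simp_all add: modular_data_def multiplicative_unitary_def positive_self_adjoint_def)

lemmas linear_P = self_adjoint_linear[OF self_adjoint_P] and linear_Q = self_adjoint_linear[OF self_adjoint_Q]

lemma modularity:
  "(y, y') \<in> Q \<Longrightarrow> (u, u') \<in> Q \<Longrightarrow> cinner (x \<otimes>\<^sub>v y) (W (z \<otimes>\<^sub>v u')) =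
     cinner (to_conj z \<otimes>\<^sub>v y') (Wt (to_conj x \<otimes>\<^sub>v u))"
  using modular_data unfolding modular_data_def by blast

lemma graph_invariant:
  assumes "(\<xi>, \<xi>') \<in> tensor_graph P Q"
  shows "(W \<xi>, W \<xi>') \<in> tensor_graph P Q"
    and "((adj W) \<xi>, (adj W) \<xi>') \<in> tensor_graph P Q"
proof -
  have eq: "{(\<xi>, (adj W) \<eta>) | \<xi> \<eta>. (W \<xi>, \<eta>) \<in> tensor_graph P Q} = tensor_graph P Q"
    using modular_data by (simp add: modular_data_def)
  have "(\<xi>, \<xi>') \<in> {(\<xi>, (adj W) \<eta>) | \<xi> \<eta>. (W \<xi>, \<eta>) \<in> tensor_graph P Q}"
    using assms unfolding eq .
  then obtain \<eta> where "\<xi>' = blinfun_apply (adj W) \<eta>" "(blinfun_apply W \<xi>, \<eta>) \<in> tensor_graph P Q" by blast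
  then show "(W \<xi>, W \<xi>') \<in> tensor_graph P Q" by simp
  have "(W ((adj W) \<xi>), \<xi>') \<in> tensor_graph P Q" using assms by simp
  then have "((adj W) \<xi>, (adj W) \<xi>') \<in>
      {(\<xi>, (adj W) \<eta>) | \<xi> \<eta>. (W \<xi>, \<eta>) \<in> tensor_graph P Q}" by blast
  then show "((adj W) \<xi>, (adj W) \<xi>') \<in> tensor_graph P Q" unfolding eq .
qed

text \<open>The modularity relation is used only through this identity, from which \<open>Q\<close>
  has disappeared. With \<open>x' = P x\<close> and \<open>m = Q y\<close>, invariance of
  \<open>P \<otimes> Q\<close> under \<open>W\<close> moves both operators to the right-hand vector;
  modularity moves \<open>Q\<close> back and leaves \<open>Wt\<close>.\<close>

lemma slice_shift:
  assumes x: "(x, x') \<in> P" and z: "(z, z') \<in> P"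
  shows "lslice x' W z = lslice (to_conj z') Wt (to_conj x)"
proof (rule bop_separating_eqI)
  show "separating (Range Q)" "separating (Domain Q)"
    by (intro self_adjoint_Range self_adjoint_Domain self_adjoint_Q trivial_kernel_Q)+
  fix m n assume "m \<in> Range Q" "n \<in> Domain Q"
  then obtain y n' where y: "(y, m) \<in> Q" and n: "(n, n') \<in> Q" by blast
  have "cinner (x' \<otimes>\<^sub>v m) (W (z \<otimes>\<^sub>v n)) = cinner (x \<otimes>\<^sub>v y) (W (z' \<otimes>\<^sub>v n'))"
    by (rule tensor_graph_symmetric[OF self_adjoint_P self_adjoint_Q, symmetric];
        intro graph_invariant tensor_graph_base linear_P x z y n)
  also have "\<dots> = cinner (to_conj z' \<otimes>\<^sub>v m) (Wt (to_conj x \<otimes>\<^sub>v n))"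
    by (rule modularity[OF y n])
  finally show "cinner m ((lslice x' W z) n) = cinner m ((lslice (to_conj z') Wt (to_conj x)) n)"
    by (simp add: cinner_lslice)
qed simp_all

end

lemma lslice_leg12: "T \<in> bop \<Longrightarrow> lslice x (leg12 T) z = lslice x T z \<otimes>\<^sub>o id_blinfun"
  by (rule bop_eqI2) (simp_all add: cinner_lslice cinner_leg12 cinner_otimes)

lemma lslice_conj_leg23:
  assumes "R \<in> bop" "S \<in> bop" "T \<in> bop"
  shows "lslice x (leg23 R o\<^sub>L T o\<^sub>L leg23 S) z = R o\<^sub>L lslice x T z o\<^sub>L S"
proof (rule bop_eqI)
  fix u v
  have "cinner (x \<otimes>\<^sub>v u) ((leg23 R) \<xi>) = cinner (x \<otimes>\<^sub>v (adj R) u) \<xi>" for \<xi>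
    using cinner_adj_left[of "leg23 R" "x \<otimes>\<^sub>v u" \<xi>] assms by (simp add: adj_leg23 leg23_otimes)
  then show "cinner u ((lslice x (leg23 R o\<^sub>L T o\<^sub>L leg23 S) z) v) = cinner u ((R o\<^sub>L lslice x T z o\<^sub>L S) v)"
    using assms by (simp add: cinner_lslice leg23_otimes cinner_adj_left[symmetric])
qed

text \<open>The two factors share only the first leg, so a coefficient of their product is an inner
  product of two vectors of that leg, one from each factor. In this form a symmetric operator on the
  first leg can be shifted across.\<close>

lemma cinner_leg12_leg13:
  fixes S :: "('a::chilbert_space \<otimes>\<^sub>H 'b::chilbert_space) operator" and T :: "('a \<otimes>\<^sub>H 'c::chilbert_space) operator"
  assumes S: "S \<in> bop" and T: "T \<in> bop"
  shows "cinner (x \<otimes>\<^sub>v y \<otimes>\<^sub>v z) ((leg12 S) ((leg13 T) (x' \<otimes>\<^sub>v y' \<otimes>\<^sub>v z'))) =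
    cinner ((adj (otimes_right y')) ((adj S) (x \<otimes>\<^sub>v y)))
      ((adj (otimes_right z)) (T (x' \<otimes>\<^sub>v z')))"
proof -
  \<comment> \<open>Creating \<open>y'\<close> on leg 2 and then removing \<open>z\<close> from leg
    3 is the same as removing first and creating afterwards.\<close>
  have *: "adj (adj assoc o\<^sub>L otimes_right z) o\<^sub>L ((id_blinfun \<otimes>\<^sub>o flip) o\<^sub>L adj assoc o\<^sub>L otimes_right y') =
    (otimes_right y' :: 'a \<Rightarrow>\<^sub>L ('a \<otimes>\<^sub>H 'b)) o\<^sub>L adj (otimes_right z)"
  proof (rule bop_eqI2)
    fix p q r s
    show "cinner (p \<otimes>\<^sub>v q) ((adj (adj assoc o\<^sub>L otimes_right z) o\<^sub>L ((id_blinfun \<otimes>\<^sub>o flip) o\<^sub>L adj assoc o\<^sub>L otimes_right y')) (r \<otimes>\<^sub>v s)) =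
      cinner (p \<otimes>\<^sub>v q) (((otimes_right y' :: 'a \<Rightarrow>\<^sub>L ('a \<otimes>\<^sub>H 'b)) o\<^sub>L adj (otimes_right z)) (r \<otimes>\<^sub>v s))"
    proof -
      have "(adj (otimes_right z)) (r \<otimes>\<^sub>v s) = cinner z s *\<^sub>C r"
        by (rule cinner_ext) (simp add: cinner_adj_right cinner_otimes cinner_scaleC_right)
      then show ?thesis by (simp add: cinner_adj_right cinner_otimes cinner_scaleC_right)
    qed
  qed simp_all
  have 1: "(leg12 (adj S)) (x \<otimes>\<^sub>v y \<otimes>\<^sub>v z) = (adj assoc o\<^sub>L otimes_right z) ((adj S) (x \<otimes>\<^sub>v y))"
    using S by (simp add: leg12_def)
  have 2: "(leg13 T) (x' \<otimes>\<^sub>v y' \<otimes>\<^sub>v z') =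
      ((id_blinfun \<otimes>\<^sub>o flip) o\<^sub>L adj assoc o\<^sub>L otimes_right y') (T (x' \<otimes>\<^sub>v z'))"
    using T by (simp add: leg13_def leg12_def)
  have "cinner (x \<otimes>\<^sub>v y \<otimes>\<^sub>v z) ((leg12 S) ((leg13 T) (x' \<otimes>\<^sub>v y' \<otimes>\<^sub>v z'))) =
      cinner ((leg12 (adj S)) (x \<otimes>\<^sub>v y \<otimes>\<^sub>v z)) ((leg13 T) (x' \<otimes>\<^sub>v y' \<otimes>\<^sub>v z'))"
    using S by (simp add: cinner_adj_left flip: adj_leg12)
  also have "\<dots> = cinner ((adj S) (x \<otimes>\<^sub>v y))
      ((adj (adj assoc o\<^sub>L otimes_right z) o\<^sub>L ((id_blinfun \<otimes>\<^sub>o flip) o\<^sub>L adj assoc o\<^sub>L otimes_right y')) (T (x' \<otimes>\<^sub>v z')))"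
    unfolding 1 2 by (subst blinfun_apply_blinfun_compose, subst cinner_adj_right) simp_all
  also have "\<dots> = cinner ((adj (otimes_right y')) ((adj S) (x \<otimes>\<^sub>v y)))
      ((adj (otimes_right z)) (T (x' \<otimes>\<^sub>v z')))"
    unfolding * using cinner_adj_left[of "otimes_right y' :: 'a \<Rightarrow>\<^sub>L ('a \<otimes>\<^sub>H 'b)"] by simp
  finally show ?thesis .
qed

section \<open>The pentagon relation of the companion unitary\<close>

context modular
begin

text \<open>The vectors on the first leg are related by \<open>P\<close>, which sends
  \<open>of_conj \<alpha>\<close> to \<open>\<alpha>'\<close> and \<open>\<beta>'\<close> to
  \<open>of_conj \<beta>\<close>. Symmetry of \<open>P\<close> trades one pair for the other;
  complex conjugation on the first leg reverses the order of the factors.\<close>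

lemma cinner_coproduct:
  assumes x: "(x, x') \<in> P" and z: "(z, z') \<in> P"
  shows "cinner (x' \<otimes>\<^sub>v \<eta>2 \<otimes>\<^sub>v \<eta>3) ((leg12 W o\<^sub>L leg13 W) (z \<otimes>\<^sub>v \<theta>2 \<otimes>\<^sub>v \<theta>3)) =
    cinner (to_conj z' \<otimes>\<^sub>v \<eta>2 \<otimes>\<^sub>v \<eta>3) ((leg13 Wt o\<^sub>L leg12 Wt) (to_conj x \<otimes>\<^sub>v \<theta>2 \<otimes>\<^sub>v \<theta>3))"
proof -
  define \<alpha>' where "\<alpha>' = (adj (otimes_right \<theta>2)) ((adj W) (x' \<otimes>\<^sub>v \<eta>2))"
  define \<beta>' where "\<beta>' = (adj (otimes_right \<eta>3)) (W (z \<otimes>\<^sub>v \<theta>3))"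
  define \<alpha> where "\<alpha> = (adj (otimes_right \<eta>2)) (Wt (to_conj x \<otimes>\<^sub>v \<theta>2))"
  define \<beta> where "\<beta> = (adj (otimes_right \<theta>3)) ((adj Wt) (to_conj z' \<otimes>\<^sub>v \<eta>3))"
  \<comment> \<open>As \<open>P\<close> equals its adjoint, membership can be tested against an
    arbitrary element of the graph, and \<open>slice_shift\<close> evaluates the test.\<close>
  have 1: "(of_conj \<alpha>, \<alpha>') \<in> P"
  proof (rule self_adjoint_mem[OF self_adjoint_P])
    fix e e' assume e: "(e, e') \<in> P"
    have "cinner \<alpha>' e = cinner \<eta>2 ((lslice x' W e) \<theta>2)"
      by (simp add: \<alpha>'_def cinner_adj_left cinner_lslice)
    also have "\<dots> = cinner (to_conj e') \<alpha>"
      unfolding slice_shift[OF x e] by (simp add: \<alpha>_def cinner_adj_right cinner_lslice)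
    finally show "cinner (of_conj \<alpha>) e' = cinner \<alpha>' e" by (simp add: cinner_conjugate_def)
  qed
  have 2: "(\<beta>', of_conj \<beta>) \<in> P"
  proof (rule self_adjoint_mem[OF self_adjoint_P])
    fix e e' assume e: "(e, e') \<in> P"
    have "cinner e' \<beta>' = cinner \<eta>3 ((lslice e' W z) \<theta>3)"
      by (simp add: \<beta>'_def cinner_adj_right cinner_lslice)
    also have "\<dots> = cinner \<beta> (to_conj e)"
      unfolding slice_shift[OF e z] by (simp add: \<beta>_def cinner_adj_left cinner_lslice)
    finally have "cinner e' \<beta>' = cinner e (of_conj \<beta>)" by (simp add: cinner_conjugate_def)
    then show "cinner \<beta>' e' = cinner (of_conj \<beta>) e" by (metis cinner_commute)
  qed
  have "cinner (x' \<otimes>\<^sub>v \<eta>2 \<otimes>\<^sub>v \<eta>3) ((leg12 W o\<^sub>L leg13 W) (z \<otimes>\<^sub>v \<theta>2 \<otimes>\<^sub>v \<theta>3)) = cinner \<alpha>' \<beta>'"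
    by (simp add: cinner_leg12_leg13 \<alpha>'_def \<beta>'_def)
  also have "\<dots> = cinner (of_conj \<alpha>) (of_conj \<beta>)"
    by (rule self_adjoint_symmetric[OF self_adjoint_P 1 2, symmetric])
  also have "\<dots> = cnj (cinner \<alpha> \<beta>)" by (metis cinner_commute cinner_conjugate_def)
  also have "cinner \<alpha> \<beta> = cinner (to_conj x \<otimes>\<^sub>v \<theta>2 \<otimes>\<^sub>v \<theta>3)
      ((adj (leg13 Wt o\<^sub>L leg12 Wt)) (to_conj z' \<otimes>\<^sub>v \<eta>2 \<otimes>\<^sub>v \<eta>3))"
    by (simp add: adj_compose adj_leg12 adj_leg13 cinner_leg12_leg13 \<alpha>_def \<beta>_def)
  also have "\<dots> = cinner ((leg13 Wt o\<^sub>L leg12 Wt) (to_conj x \<otimes>\<^sub>v \<theta>2 \<otimes>\<^sub>v \<theta>3)) (to_conj z' \<otimes>\<^sub>v \<eta>2 \<otimes>\<^sub>v \<eta>3)"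
    by (rule cinner_adj_right) simp
  finally show ?thesis by (metis cinner_commute)
qed

text \<open>First-leg slices of the conjugated \<open>leg12 Wt\<close> are slices of the conjugated
  \<open>leg12 W\<close>, to which the pentagon equation applies; \<open>cinner_coproduct\<close>
  translates the result back. Range and domain of \<open>P\<close> supply enough slices.\<close>

lemma Wt_comult:
  "(leg23 W o\<^sub>L leg12 Wt o\<^sub>L leg23 (adj W) :: ('h conjugate \<otimes>\<^sub>H 'h \<otimes>\<^sub>H 'h) operator) = leg13 Wt o\<^sub>L leg12 Wt"
proof (rule bop_separating_eqI)
  show "separating {x \<otimes>\<^sub>v \<xi> | x \<xi>. x \<in> to_conj ` Range P \<and> \<xi> \<in> {(y::'h) \<otimes>\<^sub>v (z::'h) | y z. True}}"
    "separating {x \<otimes>\<^sub>v \<xi> | x \<xi>. x \<in> to_conj ` Domain P \<and> \<xi> \<in> {(y::'h) \<otimes>\<^sub>v (z::'h) | y z. True}}"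
    by (intro separating_otimes separating_to_conj separating_elementary2 self_adjoint_Range
        self_adjoint_Domain self_adjoint_P trivial_kernel_P)+
  fix m n assume "m \<in> {x \<otimes>\<^sub>v \<xi> | x \<xi>. x \<in> to_conj ` Range P \<and> \<xi> \<in> {(y::'h) \<otimes>\<^sub>v (z::'h) | y z. True}}"
    "n \<in> {x \<otimes>\<^sub>v \<xi> | x \<xi>. x \<in> to_conj ` Domain P \<and> \<xi> \<in> {(y::'h) \<otimes>\<^sub>v (z::'h) | y z. True}}"
  then obtain z z' \<eta>2 \<eta>3 x x' \<theta>2 \<theta>3 where m: "m = to_conj z' \<otimes>\<^sub>v \<eta>2 \<otimes>\<^sub>v \<eta>3" and z: "(z, z') \<in> P"
    and n: "n = to_conj x \<otimes>\<^sub>v \<theta>2 \<otimes>\<^sub>v \<theta>3" and x: "(x, x') \<in> P" by blast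
  have pent: "(leg23 W o\<^sub>L leg12 W o\<^sub>L leg23 (adj W) :: ('h \<otimes>\<^sub>H 'h \<otimes>\<^sub>H 'h) operator) = leg12 W o\<^sub>L leg13 W"
    unfolding pentagon by (rule blinfun_eqI) (simp add: adj_leg23[symmetric])
  have "lslice (to_conj z') (leg23 W o\<^sub>L leg12 Wt o\<^sub>L leg23 (adj W)) (to_conj x) =
      lslice x' (leg23 W o\<^sub>L leg12 W o\<^sub>L leg23 (adj W)) z"
    by (simp add: lslice_conj_leg23 lslice_leg12 slice_shift[OF x z])
  then have "cinner (\<eta>2 \<otimes>\<^sub>v \<eta>3) ((lslice (to_conj z') (leg23 W o\<^sub>L leg12 Wt o\<^sub>L leg23 (adj W)) (to_conj x)) (\<theta>2 \<otimes>\<^sub>v \<theta>3)) =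
      cinner (\<eta>2 \<otimes>\<^sub>v \<eta>3) ((lslice x' (leg12 W o\<^sub>L leg13 W) z) (\<theta>2 \<otimes>\<^sub>v \<theta>3))"
    by (simp only: pent)
  then show "cinner m ((leg23 W o\<^sub>L leg12 Wt o\<^sub>L leg23 (adj W)) n) = cinner m ((leg13 Wt o\<^sub>L leg12 Wt) n)"
    unfolding cinner_lslice m n cinner_coproduct[OF x z] .
qed simp_all

end

section \<open>The quantum group algebras are closed under adjoints\<close>

lemma clspan_to_conj:
  assumes "separating M" "\<And>c m. m \<in> M \<Longrightarrow> c *\<^sub>C m \<in> M"
  shows "clspan (to_conj ` M) = UNIV"
proof (rule clspan_separating[OF separating_to_conj[OF assms(1)]])
  fix c m assume "m \<in> to_conj ` M"
  then obtain n where "m = to_conj n" "n \<in> M" by blast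
  then have "c *\<^sub>C m = to_conj (cnj c *\<^sub>C n)" "cnj c *\<^sub>C n \<in> M"
    by (simp_all add: scaleC_conjugate_def assms(2))
  then show "c *\<^sub>C m \<in> to_conj ` M" by blast
qed

lemma lslice_assoc_conj:
  assumes "X \<in> bop"
  shows "cinner u ((lslice (k \<otimes>\<^sub>v p) (assoc o\<^sub>L X o\<^sub>L adj assoc) (k' \<otimes>\<^sub>v q)) v) =
    cinner (k \<otimes>\<^sub>v p \<otimes>\<^sub>v u) (X (k' \<otimes>\<^sub>v q \<otimes>\<^sub>v v))"
  by (simp add: cinner_lslice flip: cinner_adj_left)

lemma lslice_leg13: "T \<in> bop \<Longrightarrow> lslice x (leg13 T) z = id_blinfun \<otimes>\<^sub>o lslice x T z"
  by (rule bop_eqI2) (simp_all add: cinner_lslice cinner_leg13 cinner_otimes)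

lemma clspan_lslice_elementary:
  fixes T :: "(('k::chilbert_space \<otimes>\<^sub>H 'p::chilbert_space) \<otimes>\<^sub>H 'h::chilbert_space) operator"
  shows
  "clspan {lslice \<zeta> T \<zeta>' | \<zeta> \<zeta>'. True} = clspan {lslice (k \<otimes>\<^sub>v p) T (k' \<otimes>\<^sub>v q) | k p k' q. True}"
  (is "clspan ?L = clspan ?E")
proof (rule clspan_eqI)
  show "?L \<subseteq> clspan ?E"
  proof
    fix x assume "x \<in> ?L"
    then obtain \<zeta> \<zeta>' where x: "x = lslice \<zeta> T \<zeta>'" by blast
    show "x \<in> clspan ?E"
      unfolding x
    proof (rule clspan_bilinear[OF bounded_bilinear_lslice])
      fix d e :: "'k \<otimes>\<^sub>H 'p" assume "d \<in> {x \<otimes>\<^sub>v y | x y. True}" "e \<in> {x \<otimes>\<^sub>v y | x y. True}"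
      then show "lslice d T e \<in> clspan ?E" by (intro clspan_base) blast
    qed (simp_all only: otimes_total UNIV_I)
  qed
  show "?E \<subseteq> clspan ?L"
  proof
    fix x assume "x \<in> ?E"
    then have "x \<in> ?L" by blast
    then show "x \<in> clspan ?L" by (rule clspan_base)
  qed
qed

lemma lslice_tensor_conj:
  fixes U :: "'k::chilbert_space operator" and T :: "('k \<otimes>\<^sub>H 'h::chilbert_space) operator"
  assumes "U \<in> bop" "T \<in> bop"
  shows "lslice \<zeta> ((U \<otimes>\<^sub>o id_blinfun) o\<^sub>L T o\<^sub>L (adj U \<otimes>\<^sub>o id_blinfun)) \<zeta>' =
    lslice ((adj U) \<zeta>) T ((adj U) \<zeta>')"
proof (rule bop_eqI)
  fix u v :: 'h
  have "cinner (\<zeta> \<otimes>\<^sub>v u) ((U \<otimes>\<^sub>o id_blinfun) \<xi>) = cinner ((adj U) \<zeta> \<otimes>\<^sub>v u) \<xi>" for \<xi>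
    using cinner_adj_left[of "U \<otimes>\<^sub>o id_blinfun" "\<zeta> \<otimes>\<^sub>v u" \<xi>] assms by (simp add: adj_tensor_op)
  then show "cinner u ((lslice \<zeta> ((U \<otimes>\<^sub>o id_blinfun) o\<^sub>L T o\<^sub>L (adj U \<otimes>\<^sub>o id_blinfun)) \<zeta>') v) =
      cinner u ((lslice ((adj U) \<zeta>) T ((adj U) \<zeta>')) v)"
    using assms by (simp add: cinner_lslice)
qed

context modular
begin

text \<open>\<open>slice_shift\<close> identifies slices of \<open>W\<close> and of
  \<open>Wt\<close> by vectors from the range and the domain of \<open>P\<close>, and these vectors
  are total on either side.\<close>

lemma qg_algebra_Wt: "qg_algebra W = clspan {lslice k Wt k' | k k'. True}"
proof -
  let ?S = "{lslice x' W z | x x' z z'. (x, x') \<in> P \<and> (z, z') \<in> P}"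
  have 1: "clspan {lslice x W z | x z. True} = clspan ?S"
  proof (rule clspan_eqI)
    show "{lslice x W z | x z. True} \<subseteq> clspan ?S"
    proof
      fix a assume "a \<in> {lslice x W z | x z. True}"
      then obtain x z where a: "a = lslice x W z" by blast
      show "a \<in> clspan ?S"
        unfolding a
      proof (rule clspan_bilinear[OF bounded_bilinear_lslice, where D = "Range P" and E = "Domain P"])
        fix d e assume "d \<in> Range P" "e \<in> Domain P"
        then obtain x z' where "(x, d) \<in> P" "(e, z') \<in> P" by (elim RangeE DomainE)
        then have "lslice d W e \<in> ?S"
          by (intro CollectI exI[of _ x] exI[of _ d] exI[of _ e] exI[of _ z'] conjI refl)
        then show "lslice d W e \<in> clspan ?S" by (rule clspan_base)
      qed (simp_all add: self_adjoint_clspan[OF self_adjoint_P] trivial_kernel_P)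
    qed
    show "?S \<subseteq> clspan {lslice x W z | x z. True}"
    proof
      fix a assume "a \<in> ?S"
      then obtain x z where "a = lslice x W z" by (elim CollectE exE conjE)
      then show "a \<in> clspan {lslice x W z | x z. True}" by (intro clspan_base) blast
    qed
  qed
  have 2: "clspan {lslice k Wt k' | k k'. True} = clspan ?S"
  proof (rule clspan_eqI)
    show "{lslice k Wt k' | k k'. True} \<subseteq> clspan ?S"
    proof
      fix a assume "a \<in> {lslice k Wt k' | k k'. True}"
      then obtain k k' where a: "a = lslice k Wt k'" by blast
      show "a \<in> clspan ?S"
        unfolding a
      proof (rule clspan_bilinear[OF bounded_bilinear_lslice, where D = "to_conj ` Range P" and E = "to_conj ` Domain P"])
        fix d e assume "d \<in> to_conj ` Range P" "e \<in> to_conj ` Domain P"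
        then obtain z z' x x' where "d = to_conj z'" "(z, z') \<in> P" "e = to_conj x" "(x, x') \<in> P" by blast
        then have "lslice d Wt e = lslice x' W z" by (simp add: slice_shift)
        then have "lslice d Wt e \<in> ?S" using \<open>(x, x') \<in> P\<close> \<open>(z, z') \<in> P\<close>
          by (intro CollectI exI[of _ x] exI[of _ x'] exI[of _ z] exI[of _ z'] conjI)
        then show "lslice d Wt e \<in> clspan ?S" by (rule clspan_base)
      next
        have "clspan (to_conj ` Range P) = UNIV"
          by (rule clspan_to_conj[OF self_adjoint_Range[OF self_adjoint_P trivial_kernel_P]])
            (use linear_operator_scaleC[OF linear_P] in blast)
        then show "k \<in> clspan (to_conj ` Range P)" by simp
        have "clspan (to_conj ` Domain P) = UNIV"
          by (rule clspan_to_conj[OF self_adjoint_Domain[OF self_adjoint_P]])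
            (use linear_operator_scaleC[OF linear_P] in blast)
        then show "k' \<in> clspan (to_conj ` Domain P)" by simp
      qed
    qed
    show "?S \<subseteq> clspan {lslice k Wt k' | k k'. True}"
    proof
      fix a assume "a \<in> ?S"
      then obtain x x' z z' where "a = lslice x' W z" "(x, x') \<in> P" "(z, z') \<in> P" by (elim CollectE exE conjE)
      then have "a = lslice (to_conj z') Wt (to_conj x)" by (simp add: slice_shift)
      then show "a \<in> clspan {lslice k Wt k' | k k'. True}" by (intro clspan_base) blast
    qed
  qed
  show ?thesis by (simp only: qg_algebra_eq[OF unitary_bop[OF unitary_W]] 1 2)
qed

text \<open>Conjugating \<open>1 \<otimes> W\<close> by the first two legs of \<open>Wt\<close> gives \<open>Wt\<^sup>*\<^sub>1\<^sub>3 W\<^sub>2\<^sub>3\<close>.  A unitary conjugation does not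
  change the span of the slices, so \<open>A\<close> is densely spanned by \<open>A\<^sup>* A\<close>.\<close>

lemma qg_algebra_products:
  "qg_algebra W = clspan {lslice k (adj Wt) k' o\<^sub>L lslice p W q | k k' p q. True}"
proof -
  \<comment> \<open>The first two legs are bracketed together because both are sliced away.\<close>
  let ?T = "assoc o\<^sub>L leg23 W o\<^sub>L adj assoc :: (('h conjugate \<otimes>\<^sub>H 'h) \<otimes>\<^sub>H 'h) operator"
  let ?T' = "assoc o\<^sub>L (leg13 (adj Wt) o\<^sub>L leg23 W) o\<^sub>L adj assoc :: (('h conjugate \<otimes>\<^sub>H 'h) \<otimes>\<^sub>H 'h) operator"
  have T_elem: "lslice (k \<otimes>\<^sub>v p) ?T (k' \<otimes>\<^sub>v q) = lslice p W (cinner k k' *\<^sub>C q)" for k p k' q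
    by (rule bop_eqI, subst lslice_assoc_conj)
      (simp_all add: cinner_leg23 cinner_lslice otimes_scaleC_left bop_scaleC cinner_scaleC_right)
  have T'_elem: "lslice (k \<otimes>\<^sub>v p) ?T' (k' \<otimes>\<^sub>v q) = lslice k (adj Wt) k' o\<^sub>L lslice p W q" for k p k' q
  proof (rule bop_eqI)
    fix u v
    let ?y = "lslice k (adj Wt) k'"
    have y: "?y \<in> bop" by simp
    have "lslice k (leg23 id_blinfun o\<^sub>L leg13 (adj Wt) o\<^sub>L leg23 W) k' = id_blinfun o\<^sub>L (id_blinfun \<otimes>\<^sub>o ?y) o\<^sub>L W"
      by (subst lslice_conj_leg23) (simp_all add: lslice_leg13)
    then have 1: "lslice k (leg13 (adj Wt) o\<^sub>L leg23 W) k' = (id_blinfun \<otimes>\<^sub>o ?y) o\<^sub>L W" by simp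
    have "cinner u ((lslice (k \<otimes>\<^sub>v p) ?T' (k' \<otimes>\<^sub>v q)) v) =
        cinner (p \<otimes>\<^sub>v u) ((lslice k (leg13 (adj Wt) o\<^sub>L leg23 W) k') (q \<otimes>\<^sub>v v))"
      by (subst lslice_assoc_conj) (simp_all add: cinner_lslice)
    also have "\<dots> = cinner ((adj (id_blinfun \<otimes>\<^sub>o ?y)) (p \<otimes>\<^sub>v u)) (W (q \<otimes>\<^sub>v v))"
      unfolding 1 by (simp add: cinner_adj_left)
    also have "\<dots> = cinner u ((?y o\<^sub>L lslice p W q) v)"
      using y by (simp add: adj_tensor_op cinner_lslice[symmetric] cinner_adj_left del: lslice_bop)
    finally show "cinner u ((lslice (k \<otimes>\<^sub>v p) ?T' (k' \<otimes>\<^sub>v q)) v) =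
        cinner u ((?y o\<^sub>L lslice p W q) v)" .
  qed
  have conj: "?T' = (Wt \<otimes>\<^sub>o id_blinfun) o\<^sub>L ?T o\<^sub>L (adj Wt \<otimes>\<^sub>o id_blinfun)"
  proof -
    have comm: "leg23 W o\<^sub>L leg12 Wt = leg13 Wt o\<^sub>L leg12 Wt o\<^sub>L (leg23 W :: ('h conjugate \<otimes>\<^sub>H 'h \<otimes>\<^sub>H 'h) operator)"
      unfolding Wt_comult[symmetric] by (rule blinfun_eqI) (simp add: adj_leg23[symmetric])
    have eq: "(leg23 W) ((leg12 Wt) \<xi>) =
        (leg13 Wt) ((leg12 Wt) ((leg23 W) \<xi>))" for \<xi> :: "'h conjugate \<otimes>\<^sub>H 'h \<otimes>\<^sub>H 'h"
      using arg_cong[OF comm, of "\<lambda>T. blinfun_apply T \<xi>"] by simp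
    have "leg13 (adj Wt) o\<^sub>L leg23 W = leg12 Wt o\<^sub>L leg23 W o\<^sub>L (leg12 (adj Wt) :: ('h conjugate \<otimes>\<^sub>H 'h \<otimes>\<^sub>H 'h) operator)"
    proof (rule blinfun_eqI)
      fix \<xi> :: "'h conjugate \<otimes>\<^sub>H 'h \<otimes>\<^sub>H 'h"
      show "(leg13 (adj Wt) o\<^sub>L leg23 W) \<xi> = (leg12 Wt o\<^sub>L leg23 W o\<^sub>L leg12 (adj Wt)) \<xi>"
        using eq[of "(adj (leg12 Wt)) \<xi>"] by (simp flip: adj_leg12 adj_leg13)
    qed
    then show ?thesis
      by (simp add: leg12_def blinfun_comp_assoc) (auto intro!: blinfun_eqI)
  qed
  have "qg_algebra W = clspan {lslice (k \<otimes>\<^sub>v p) ?T (k' \<otimes>\<^sub>v q) | k p k' q. True}"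
    unfolding qg_algebra_eq[OF unitary_bop[OF unitary_W]]
  proof (rule clspan_eqI)
    show "{lslice (k \<otimes>\<^sub>v p) ?T (k' \<otimes>\<^sub>v q) | k p k' q. True} \<subseteq> clspan {lslice x W z | x z. True}"
      unfolding T_elem by (blast intro: clspan_base)
    show "{lslice x W z | x z. True} \<subseteq> clspan {lslice (k \<otimes>\<^sub>v p) ?T (k' \<otimes>\<^sub>v q) | k p k' q. True}"
    proof
      fix a assume "a \<in> {lslice x W z | x z. True}"
      then obtain x z where a: "a = lslice x W z" by blast
      show "a \<in> clspan {lslice (k \<otimes>\<^sub>v p) ?T (k' \<otimes>\<^sub>v q) | k p k' q. True}"
      proof (cases "x = 0")
        case True
        then have "a = 0" by (simp add: a bounded_bilinear.zero_left[OF bounded_bilinear_lslice])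
        then show ?thesis using subspace_0[OF subspace_clspan] by simp
      next
        case False
        \<comment> \<open>A unit vector of the conjugate space makes the factor
          \<open>cinner k k\<close> equal to 1; the normalized \<open>x\<close> provides
          one.\<close>
        define k where "k = to_conj ((1 / norm x) *\<^sub>R x)"
        have "cinner k k = 1" using False by (simp add: k_def cinner_self norm_conjugate_def)
        then have "a = lslice (k \<otimes>\<^sub>v x) ?T (k \<otimes>\<^sub>v z)" unfolding T_elem a by simp
        then show ?thesis by (intro clspan_base) blast
      qed
    qed
  qed
  also have "\<dots> = clspan {lslice \<zeta> ?T \<zeta>' | \<zeta> \<zeta>'. True}" by (rule clspan_lslice_elementary[symmetric])
  \<comment> \<open>A unitary on the sliced legs only relabels the slicing vectors.\<close>
  also have "{lslice \<zeta> ?T \<zeta>' | \<zeta> \<zeta>'. True} = {lslice \<zeta> ?T' \<zeta>' | \<zeta> \<zeta>'. True}"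
  proof -
    have "lslice \<zeta> ?T' \<zeta>' = lslice ((adj Wt) \<zeta>) ?T ((adj Wt) \<zeta>')" for \<zeta> \<zeta>'
      unfolding conj by (rule lslice_tensor_conj) simp_all
    moreover have "lslice \<zeta> ?T \<zeta>' = lslice (Wt \<zeta>) ?T' (Wt \<zeta>')" for \<zeta> \<zeta>'
      unfolding calculation by simp
    ultimately show ?thesis by blast
  qed
  also have "clspan {lslice \<zeta> ?T' \<zeta>' | \<zeta> \<zeta>'. True} = clspan {lslice (k \<otimes>\<^sub>v p) ?T' (k' \<otimes>\<^sub>v q) | k p k' q. True}"
    by (rule clspan_lslice_elementary)
  also have "{lslice (k \<otimes>\<^sub>v p) ?T' (k' \<otimes>\<^sub>v q) | k p k' q. True} =
      {lslice k (adj Wt) k' o\<^sub>L lslice p W q | k k' p q. True}"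
    unfolding T'_elem by blast
  finally show ?thesis .
qed

text \<open>Under the adjoint the two kinds of factors in \<open>qg_algebra_products\<close> change
  places: by \<open>qg_algebra_Wt\<close>, the adjoint of a \<open>W\<close> slice lies in the
  closed span of slices of \<open>adj Wt\<close>, and a \<open>Wt\<close> slice in that of slices of
  \<open>W\<close>.\<close>

lemma qg_algebra_adj:
  assumes "a \<in> qg_algebra W"
  shows "adj a \<in> qg_algebra W"
proof -
  let ?L = "{lslice x W z | x z. True}" and ?Lt = "{lslice k Wt k' | k k'. True}"
    and ?Y = "{lslice k (adj Wt) k' | k k'. True}"
  let ?YW = "{lslice k (adj Wt) k' o\<^sub>L lslice p W q | k k' p q. True}"
  have A: "qg_algebra W = clspan ?L" by (rule qg_algebra_eq) simp
  have "adj ` ?YW \<subseteq> clspan ?YW"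
  proof
    fix b assume "b \<in> adj ` ?YW"
    then obtain k k' p q where b: "b = adj (lslice k (adj Wt) k' o\<^sub>L lslice p W q)" by blast
    then have b': "b = adj (lslice p W q) o\<^sub>L lslice k' Wt k" by (simp add: adj_compose adj_lslice)
    have "lslice p W q \<in> clspan ?Lt"
      unfolding qg_algebra_Wt[symmetric] A by (intro clspan_base) blast
    then have "adj (lslice p W q) \<in> clspan (adj ` ?Lt)" by (intro clspan_adj) auto
    also have "adj ` ?Lt \<subseteq> ?Y" using adj_lslice[OF unitary_bop[OF unitary_Wt]] by blast
    then have "clspan (adj ` ?Lt) \<subseteq> clspan ?Y" by (intro closure_mono span_mono)
    finally have y: "adj (lslice p W q) \<in> clspan ?Y" .
    have w: "lslice k' Wt k \<in> clspan ?L"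
      unfolding A[symmetric] qg_algebra_Wt by (intro clspan_base) blast
    show "b \<in> clspan ?YW"
      unfolding b'
      by (rule clspan_bilinear[OF bounded_bilinear_blinfun_compose _ y w]) (blast intro: clspan_base)
  qed
  then have "clspan (adj ` ?YW) \<subseteq> clspan ?YW" by (rule clspan_mono)
  moreover have "adj a \<in> clspan (adj ` ?YW)"
    using assms unfolding qg_algebra_products by (intro clspan_adj) auto
  ultimately show ?thesis unfolding qg_algebra_products by blast
qed

end

section \<open>Duality\<close>

definition conj_op :: "'a::chilbert_space operator \<Rightarrow> 'a conjugate operator" where
  "conj_op T = Blinfun (\<lambda>\<xi>. to_conj (T (of_conj \<xi>)))"

lemma conj_op_apply [simp]: "(conj_op T) \<xi> = to_conj (T (of_conj \<xi>))"
proof -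
  have "bounded_linear (\<lambda>\<xi>. to_conj (T (of_conj \<xi>)))"
    by (rule bounded_linear_intro[of _ "norm T"])
      (auto simp: plus_conjugate_def scaleR_conjugate_def norm_conjugate_def blinfun.add_right
        blinfun.scaleR_right norm_blinfun mult.commute[of _ "norm T"])
  then show ?thesis unfolding conj_op_def by (simp add: bounded_linear_Blinfun_apply)
qed

lemma conj_op_bop [simp]: "T \<in> bop \<Longrightarrow> conj_op T \<in> bop"
  by (rule bopI) (simp add: scaleC_conjugate_def bop_scaleC)

lemma adj_conj_op: "T \<in> bop \<Longrightarrow> adj (conj_op T) = conj_op (adj T)"
  by (rule adj_unique) (simp add: cinner_conjugate_def cinner_adj_right)

lemma unitary_conj_op: "unitary T \<Longrightarrow> unitary (conj_op T)"
  unfolding unitary_def[of "conj_op T"] by (auto simp: adj_conj_op intro!: blinfun_eqI)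

definition rev3 :: "('a::chilbert_space \<otimes>\<^sub>H 'a \<otimes>\<^sub>H 'a) operator" where
  "rev3 = leg12 flip o\<^sub>L leg23 flip o\<^sub>L leg12 flip"

lemma rev3_bop [simp]: "rev3 \<in> bop"
  by (simp add: rev3_def)

lemma rev3_otimes [simp]: "rev3 (x \<otimes>\<^sub>v y \<otimes>\<^sub>v z) = z \<otimes>\<^sub>v y \<otimes>\<^sub>v x"
  by (simp add: rev3_def leg23_otimes)

lemma adj_rev3 [simp]: "adj rev3 = rev3"
  by (simp add: rev3_def adj_compose adj_leg12 adj_leg23 blinfun_comp_assoc)

lemma cinner_rev3: "cinner \<xi> (rev3 \<eta>) = cinner (rev3 \<xi>) \<eta>"
  using cinner_adj_right[of rev3 \<xi> \<eta>] by simp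

lemma rev3_rev3 [simp]: "rev3 o\<^sub>L rev3 = id_blinfun"
  by (rule bop_eqI3) simp_all

lemma cinner_flip: "cinner \<xi> (flip \<eta>) = cinner (flip \<xi>) \<eta>"
  using cinner_adj_right[of flip \<xi> \<eta>] by simp

lemma rev3_conj_legs:
  assumes "T \<in> bop"
  shows "rev3 o\<^sub>L leg12 T o\<^sub>L rev3 = leg23 (flip o\<^sub>L T o\<^sub>L flip)"
    and "rev3 o\<^sub>L leg13 T o\<^sub>L rev3 = leg13 (flip o\<^sub>L T o\<^sub>L flip)"
    and "rev3 o\<^sub>L leg23 T o\<^sub>L rev3 = leg12 (flip o\<^sub>L T o\<^sub>L flip)"
  by (rule bop_eqI3; simp add: assms cinner_rev3 cinner_leg12 cinner_leg13 cinner_leg23 cinner_flip)+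

text \<open>Adjoints reverse the products in the pentagon equation, and reversing the three legs
  exchanges \<open>leg12\<close> and \<open>leg23\<close>; together they restore its form for the
  flipped adjoint.\<close>

lemma multiplicative_unitary_dual:
  assumes "multiplicative_unitary W"
  shows "multiplicative_unitary (dual_unitary W)"
proof -
  have W: "unitary W" and pent: "leg23 W o\<^sub>L leg12 W = leg12 W o\<^sub>L leg13 W o\<^sub>L leg23 W"
    using assms by (simp_all add: multiplicative_unitary_def)
  have rr: "rev3 o\<^sub>L (rev3 o\<^sub>L T) = T" for T :: "('a \<otimes>\<^sub>H 'a \<otimes>\<^sub>H 'a) operator"
    by (simp flip: blinfun_comp_assoc)
  let ?V = "adj W"
  have "leg12 ?V o\<^sub>L leg23 ?V = adj (leg23 W o\<^sub>L leg12 W)"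
    using W by (simp add: adj_compose adj_leg12 adj_leg23)
  also have "\<dots> = leg23 ?V o\<^sub>L leg13 ?V o\<^sub>L leg12 ?V"
    unfolding pent using W by (simp add: adj_compose adj_leg12 adj_leg13 adj_leg23 blinfun_comp_assoc)
  finally have "rev3 o\<^sub>L (leg12 ?V o\<^sub>L leg23 ?V) o\<^sub>L rev3 = rev3 o\<^sub>L (leg23 ?V o\<^sub>L leg13 ?V o\<^sub>L leg12 ?V) o\<^sub>L rev3"
    by simp
  then have "(rev3 o\<^sub>L leg12 ?V o\<^sub>L rev3) o\<^sub>L (rev3 o\<^sub>L leg23 ?V o\<^sub>L rev3) =
      (rev3 o\<^sub>L leg23 ?V o\<^sub>L rev3) o\<^sub>L (rev3 o\<^sub>L leg13 ?V o\<^sub>L rev3) o\<^sub>L (rev3 o\<^sub>L leg12 ?V o\<^sub>L rev3)"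
    by (simp only: blinfun_comp_assoc rr)
  then show ?thesis
    using W by (simp add: rev3_conj_legs multiplicative_unitary_def flip: dual_unitary_def)
qed

context modular
begin

text \<open>For the dual, \<open>P\<close> and \<open>Q\<close> exchange roles: its second leg is
  the first leg of \<open>W\<close>, where \<open>slice_shift\<close> already gives the required
  relation with \<open>P\<close>.\<close>

lemma dual_modular_data: "\<exists>Vt. modular_data (dual_unitary W) Q P Vt"
proof -
  let ?W = "dual_unitary W"
  have adjW: "adj ?W = flip o\<^sub>L W o\<^sub>L flip"
    by (simp add: dual_unitary_def adj_compose blinfun_comp_assoc)
  \<comment> \<open>Exchanges the two factors up to conjugation, so that the complex conjugate of
    \<open>Wt\<close> can be carried back to
    \<open>'h conjugate \<otimes>\<^sub>H 'h\<close>.\<close>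
  obtain U :: "('h conjugate \<otimes>\<^sub>H 'h) \<Rightarrow>\<^sub>L ('h conjugate \<otimes>\<^sub>H 'h) conjugate"
    where U: "U \<in> bop" "\<And>x y. U (x \<otimes>\<^sub>v y) = to_conj (to_conj y \<otimes>\<^sub>v of_conj x)"
    using otimes_isometry_ex[of "\<lambda>(x::'h conjugate) (y::'h). to_conj (to_conj y \<otimes>\<^sub>v of_conj x)"]
    by (auto simp: cinner_otimes cinner_conjugate_def mult.commute)
  have unitary_U: "unitary U"
  proof (rule isometry_unitary[OF U(1)])
    show "adj U o\<^sub>L U = id_blinfun"
      by (rule bop_eqI2) (simp_all add: U cinner_adj_right cinner_otimes cinner_conjugate_def mult.commute)
    show "separating (to_conj ` {(x::'h conjugate) \<otimes>\<^sub>v (y::'h) | x y. True})"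
      by (intro separating_to_conj separating_elementary2)
    show "to_conj ` {(x::'h conjugate) \<otimes>\<^sub>v (y::'h) | x y. True} \<subseteq> range (blinfun_apply U)"
    proof
      fix m assume "m \<in> to_conj ` {(x::'h conjugate) \<otimes>\<^sub>v (y::'h) | x y. True}"
      then obtain x y where "m = to_conj ((x::'h conjugate) \<otimes>\<^sub>v (y::'h))" by blast
      then have "m = U (to_conj y \<otimes>\<^sub>v of_conj x)" by (simp add: U)
      then show "m \<in> range (blinfun_apply U)" by blast
    qed
  qed
  define Vt where "Vt = adj U o\<^sub>L conj_op Wt o\<^sub>L U"
  have "modular_data ?W Q P Vt"
    unfolding modular_data_def
  proof (intro conjI allI impI)
    show "multiplicative_unitary ?W"
      using modular_data by (simp add: modular_data_def multiplicative_unitary_dual)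
    show "positive_self_adjoint Q" "trivial_kernel Q" "positive_self_adjoint P" "trivial_kernel P"
      using modular_data by (simp_all add: modular_data_def)
    show "unitary Vt" unfolding Vt_def by (intro unitary_compose unitary_adj unitary_U unitary_conj_op unitary_Wt)
    have inv: "(?W \<xi>, ?W \<xi>') \<in> tensor_graph Q P"
      "((adj ?W) \<xi>, (adj ?W) \<xi>') \<in> tensor_graph Q P"
      if "(\<xi>, \<xi>') \<in> tensor_graph Q P" for \<xi> \<xi>'
      unfolding adjW unfolding dual_unitary_def blinfun_apply_blinfun_compose
      by (intro tensor_graph_flip[OF linear_P linear_Q] graph_invariant tensor_graph_flip[OF linear_Q linear_P] that)+
    show "{(\<xi>, (adj ?W) \<eta>) | \<xi> \<eta>. (?W \<xi>, \<eta>) \<in> tensor_graph Q P} = tensor_graph Q P"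
    proof (intro subset_antisym subsetI)
      fix p assume "p \<in> {(\<xi>, (adj ?W) \<eta>) | \<xi> \<eta>. (?W \<xi>, \<eta>) \<in> tensor_graph Q P}"
      then obtain \<xi> \<eta> where p: "p = (\<xi>, blinfun_apply (adj ?W) \<eta>)" "(blinfun_apply ?W \<xi>, \<eta>) \<in> tensor_graph Q P" by blast
      from inv(2)[OF p(2)] show "p \<in> tensor_graph Q P" by (simp add: p(1))
    next
      fix p assume p: "p \<in> tensor_graph Q P"
      have "(?W (fst p), ?W (snd p)) \<in> tensor_graph Q P"
        by (rule inv(1)) (simp add: p)
      moreover have "p = (fst p, (adj ?W) (?W (snd p)))" by simp
      ultimately show "p \<in> {(\<xi>, (adj ?W) \<eta>) | \<xi> \<eta>. (?W \<xi>, \<eta>) \<in> tensor_graph Q P}" by blast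
    qed
    fix x z y y' u v assume y: "(y, y') \<in> P" and "(u, v) \<in> P\<inverse>"
    then have v: "(v, u) \<in> P" by simp
    have "cinner (x \<otimes>\<^sub>v y) (?W (z \<otimes>\<^sub>v u)) = cinner (W (y \<otimes>\<^sub>v x)) (u \<otimes>\<^sub>v z)"
      by (simp add: dual_unitary_def cinner_flip cinner_adj_right)
    also have "\<dots> = cnj (cinner z ((lslice u W y) x))"
      by (simp add: cinner_lslice flip: cinner_commute)
    also have "\<dots> = cnj (cinner (to_conj y' \<otimes>\<^sub>v z) (Wt (to_conj v \<otimes>\<^sub>v x)))"
      unfolding slice_shift[OF v y] by (simp add: cinner_lslice)
    also have "\<dots> = cinner (Wt (to_conj v \<otimes>\<^sub>v x)) (to_conj y' \<otimes>\<^sub>v z)"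
      by (simp flip: cinner_commute)
    also have "\<dots> = cinner (to_conj z \<otimes>\<^sub>v y') (Vt (to_conj x \<otimes>\<^sub>v v))"
      by (simp add: Vt_def cinner_adj_right U)
    finally show "cinner (x \<otimes>\<^sub>v y) (?W (z \<otimes>\<^sub>v u)) =
        cinner (to_conj z \<otimes>\<^sub>v y') (Vt (to_conj x \<otimes>\<^sub>v v))" .
  qed
  then show ?thesis by blast
qed

end

lemma modular_unitary: "modular_multiplicative_unitary W \<Longrightarrow> unitary W"
  by (simp add: modular_multiplicative_unitary_def multiplicative_unitary_def)

lemma qg_algebra_adj_closed: "modular_multiplicative_unitary W \<Longrightarrow> a \<in> qg_algebra W \<Longrightarrow> adj a \<in> qg_algebra W"
  unfolding modular_multiplicative_unitary_iff using modular.qg_algebra_adj[OF modular.intro] by blast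

lemma modular_multiplicative_unitary_dual:
  assumes "modular_multiplicative_unitary W"
  shows "modular_multiplicative_unitary (dual_unitary W)"
proof -
  obtain P Q Wt where "modular_data W P Q Wt" using assms unfolding modular_multiplicative_unitary_iff by blast
  then interpret modular W P Q Wt by (rule modular.intro)
  show ?thesis unfolding modular_multiplicative_unitary_iff using dual_modular_data by blast
qed

lemma dual_algebra_adj_closed: "modular_multiplicative_unitary W \<Longrightarrow> a \<in> dual_algebra W \<Longrightarrow> adj a \<in> dual_algebra W"
  unfolding dual_algebra_eq by (intro qg_algebra_adj_closed modular_multiplicative_unitary_dual)

section \<open>Resolvents and a Sylvester equation\<close>

text \<open>In the applications \<open>S = Q (1 + Q\<^sup>2)\<^sup>-\<^sup>1\<close> and \<open>K = (1 - Q\<^sup>2) (1 + Q\<^sup>2)\<^sup>-\<^sup>1\<close> for a self-adjoint \<open>Q\<close> with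
  trivial kernel.  The equation \<open>b - K b K = 4 S a S\<close> is a bounded form of \<open>Q\<^sup>2 b + b Q\<^sup>2 = 2 Q a Q\<close>; its
  solution \<open>b\<close> is a smoothing of \<open>a\<close> with respect to \<open>Q\<close>, constructed without functional calculus.\<close>

locale cayley =
  fixes K S :: "'h::chilbert_space operator"
  assumes K [simp]: "K \<in> bop" and S [simp]: "S \<in> bop" and adj_K [simp]: "adj K = K" and adj_S [simp]: "adj S = S"
    and KS: "\<And>v. K (S v) = S (K v)"
    and KK: "\<And>v. K (K v) = v - 4 *\<^sub>R S (S v)"
    and sep_S: "separating (range (blinfun_apply S))"
begin

abbreviation Kn :: "nat \<Rightarrow> 'h \<Rightarrow> 'h" where "Kn n \<equiv> blinfun_apply K ^^ n"

lemma cinner_K: "cinner (K u) v = cinner u (K v)"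
  and cinner_S: "cinner (S u) v = cinner u (S v)"
  using cinner_adj_left[of K u v] cinner_adj_left[of S u v] by simp_all

lemma S_inj: "S v = 0 \<Longrightarrow> v = 0"
  by (rule separatingD[OF sep_S]) (auto simp: cinner_S)

lemma norm_KS: "(norm (K v))\<^sup>2 + 4 * (norm (S v))\<^sup>2 = (norm v)\<^sup>2"
proof -
  have "complex_of_real ((norm (K v))\<^sup>2) + 4 * complex_of_real ((norm (S v))\<^sup>2) = complex_of_real ((norm v)\<^sup>2)"
    by (simp only: cinner_self[symmetric] cinner_K cinner_S KK) (simp add: cinner_diff_right cinner_scaleR_right)
  then have "complex_of_real ((norm (K v))\<^sup>2 + 4 * (norm (S v))\<^sup>2) = complex_of_real ((norm v)\<^sup>2)"
    by simp
  then show ?thesis by (simp only: of_real_eq_iff)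
qed

lemma norm_K: "norm (K v) \<le> norm v"
proof (rule power2_le_imp_le)
  show "(norm (K v))\<^sup>2 \<le> (norm v)\<^sup>2"
    using norm_KS[of v] zero_le_power2[of "norm (S v)"] by linarith
qed simp

lemma Kn_S: "Kn n (S v) = S (Kn n v)"
  by (induction n) (simp_all add: KS)

lemma norm_Kn: "norm (Kn n v) \<le> norm v"
  by (induction n) (auto intro: order_trans[OF norm_K])

lemma sum_norm_S_Kn: "(\<Sum>i<n. 4 * (norm (S (Kn i v)))\<^sup>2) = (norm v)\<^sup>2 - (norm (Kn n v))\<^sup>2"
proof (induction n)
  case (Suc n)
  then show ?case using norm_KS[of "Kn n v"] by simp
qed simp

lemma S_Kn_antimono: "m \<le> n \<Longrightarrow> norm (S (Kn n v)) \<le> norm (S (Kn m v))"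
proof (induction n rule: dec_induct)
  case (step n)
  have "norm (S (Kn (Suc n) v)) \<le> norm (S (Kn n v))"
    using norm_K[of "S (Kn n v)"] by (simp add: KS)
  with step(3) show ?case by simp
qed simp

text \<open>The numbers \<open>(norm (S (Kn i v)))\<^sup>2\<close> decrease in \<open>i\<close> and
  their telescoping sum is at most \<open>(norm v)\<^sup>2\<close>, so the last is bounded by an
  average. This replaces a spectral estimate.\<close>

lemma S_Kn_decay: "norm (S (Kn n v)) \<le> norm v / sqrt (Suc n)"
proof -
  have "(\<Sum>i<Suc n. (norm (S (Kn n v)))\<^sup>2) \<le> (\<Sum>i<Suc n. 4 * (norm (S (Kn i v)))\<^sup>2)"
  proof (rule sum_mono)
    fix i assume "i \<in> {..<Suc n}"
    then have "(norm (S (Kn n v)))\<^sup>2 \<le> (norm (S (Kn i v)))\<^sup>2"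
      by (intro power_mono S_Kn_antimono) auto
    then show "(norm (S (Kn n v)))\<^sup>2 \<le> 4 * (norm (S (Kn i v)))\<^sup>2"
      using zero_le_power2[of "norm (S (Kn i v))"] by linarith
  qed
  also have "\<dots> \<le> (norm v)\<^sup>2" unfolding sum_norm_S_Kn by simp
  finally have "real (Suc n) * (norm (S (Kn n v)))\<^sup>2 \<le> (norm v)\<^sup>2" by simp
  then have "(sqrt (Suc n) * norm (S (Kn n v)))\<^sup>2 \<le> (norm v)\<^sup>2"
    by (simp add: power_mult_distrib)
  then have "sqrt (Suc n) * norm (S (Kn n v)) \<le> norm v"
    by (rule power2_le_imp_le) simp
  then show ?thesis by (simp add: pos_le_divide_eq mult.commute)
qed

lemma Kn_S_tendsto: "(\<lambda>n. Kn n (S v)) \<longlonglongrightarrow> 0"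
proof (rule Lim_null_comparison)
  show "\<forall>\<^sub>F n in sequentially. norm (Kn n (blinfun_apply S v)) \<le> norm v * sqrt (1 / Suc n)"
    using S_Kn_decay[of _ v] by (simp add: Kn_S real_sqrt_divide)
  show "(\<lambda>n. norm v * sqrt (1 / Suc n)) \<longlonglongrightarrow> 0"
    using tendsto_mult_right_zero[OF tendsto_real_sqrt[OF LIMSEQ_inverse_real_of_nat, simplified], of "norm v"]
    by (simp add: inverse_eq_divide)
qed

text \<open>Four factors \<open>S\<close> are present, one in front and three inside
  \<open>z\<close>. Distributed over four blocks \<open>Kn m\<close>, each gives the decay of
  \<open>S_Kn_decay\<close>, hence the summable rate
  \<open>1 / (real (Suc m))\<^sup>2\<close>.\<close>

lemma summable_S_Kn:
  defines "z \<equiv> \<lambda>y. S (S (S y))"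
  shows "summable (\<lambda>n. norm (S (Kn n (z y))))"
proof (rule summable_comparison_test')
  have "summable (\<lambda>n. inverse (real n ^ 2))" using inverse_power_summable[of 2, where 'a = real] by simp
  then have "summable (\<lambda>n. inverse (real (Suc n) ^ 2))" using summable_Suc_iff[of "\<lambda>n. inverse (real n ^ 2)"] by simp
  \<comment> \<open>The 16 is the square of 4: with \<open>m = n div 4\<close> one has
    \<open>Suc n \<le> 4 * Suc m\<close>.\<close>
  then show "summable (\<lambda>n. (16 * norm y) * inverse (real (Suc n) ^ 2))" by (rule summable_mult)
  have S4: "norm (S (Kn (4 * m) (z y))) \<le> norm y / (real (Suc m))\<^sup>2" for m
  proof -
    let ?A = "\<lambda>v. S (Kn m v)"
    have "4 * m = m + (m + (m + m))" by simp
    then have "Kn (4 * m) v = Kn m (Kn m (Kn m (Kn m v)))" for v by (simp only: funpow_add o_apply)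
    then have "S (Kn (4 * m) (z y)) = ?A (?A (?A (?A y)))"
      unfolding z_def by (simp add: Kn_S)
    also have "norm \<dots> \<le> norm (?A (?A (?A y))) / sqrt (Suc m)" by (rule S_Kn_decay)
    also have "\<dots> \<le> norm (?A (?A y)) / sqrt (Suc m) / sqrt (Suc m)" by (intro divide_right_mono S_Kn_decay) simp
    also have "\<dots> \<le> norm (?A y) / sqrt (Suc m) / sqrt (Suc m) / sqrt (Suc m)" by (intro divide_right_mono S_Kn_decay) simp_all
    also have "\<dots> \<le> norm y / sqrt (Suc m) / sqrt (Suc m) / sqrt (Suc m) / sqrt (Suc m)" by (intro divide_right_mono S_Kn_decay) simp_all
    also have "\<dots> = norm y / (real (Suc m))\<^sup>2"
      by (simp add: power2_eq_square divide_simps)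
    finally show ?thesis .
  qed
  show "norm (norm (S (Kn n (z y)))) \<le> (16 * norm y) * inverse (real (Suc n) ^ 2)" for n
  proof -
    let ?m = "n div 4"
    have "norm (S (Kn n (z y))) \<le> norm y / (real (Suc ?m))\<^sup>2"
      by (rule order_trans[OF S_Kn_antimono[of "4 * ?m"] S4]) simp
    also have "\<dots> \<le> norm y / (real (Suc n) / 4)\<^sup>2"
    proof (rule divide_left_mono)
      have "Suc n \<le> 4 * Suc ?m" by presburger
      then have "real (Suc n) \<le> 4 * real (Suc ?m)" using of_nat_le_iff[of "Suc n" "4 * Suc ?m", where 'a = real] by simp
      then show "(real (Suc n) / 4)\<^sup>2 \<le> (real (Suc ?m))\<^sup>2" by (intro power_mono) auto
    qed simp_all
    also have "\<dots> = (16 * norm y) * inverse (real (Suc n) ^ 2)" by (simp add: power_divide field_simps)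
    finally show ?thesis by simp
  qed
qed

definition sylvester :: "'h operator \<Rightarrow> 'h operator \<Rightarrow> bool" where
  "sylvester a b \<longleftrightarrow> b - (K o\<^sub>L b o\<^sub>L K) = 4 *\<^sub>R (S o\<^sub>L a o\<^sub>L S)"

lemma sylvester_apply:
  "sylvester a b \<Longrightarrow> b v = K (b (K v)) + 4 *\<^sub>R S (a (S v))"
  unfolding sylvester_def
  by (drule arg_cong[of _ _ "\<lambda>T. blinfun_apply T v"]) (simp add: blinfun.diff_left blinfun.scaleR_left algebra_simps)

text \<open>The difference of two solutions satisfies \<open>d = K d K\<close>. Iterating, its
  coefficients on the range of \<open>S\<close> tend to 0, because \<open>Kn n\<close> does so
  there.\<close>

lemma sylvester_unique:
  assumes "sylvester a b" "sylvester a b'" "b \<in> bop" "b' \<in> bop"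
  shows "b = b'"
proof -
  define d where "d = b - b'"
  have d: "d v = K (d (K v))" for v
    using sylvester_apply[OF assms(1), of v] sylvester_apply[OF assms(2), of v]
    by (simp add: d_def blinfun.diff_left blinfun.diff_right)
  have dn: "cinner u (d v) = cinner (Kn n u) (d (Kn n v))" for n u v
  proof (induction n arbitrary: u v)
    case (Suc n)
    have "cinner u (d v) = cinner (Kn n u) (d (Kn n v))" by (rule Suc)
    also have "\<dots> = cinner (K (Kn n u)) (d (K (Kn n v)))"
      by (subst d) (simp add: cinner_K)
    finally show ?case by simp
  qed simp
  have "cinner (S u) (d (S v)) = 0" for u v
  proof -
    have "(\<lambda>n. d (Kn n (S v))) \<longlonglongrightarrow> d 0"
      by (rule bounded_linear.tendsto[OF blinfun.bounded_linear_right Kn_S_tendsto])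
    from bounded_bilinear.tendsto[OF bounded_bilinear_cinner Kn_S_tendsto[of u] this]
    have "(\<lambda>n. cinner (Kn n (S u)) (d (Kn n (S v)))) \<longlonglongrightarrow> 0" by simp
    then show ?thesis unfolding dn[symmetric] by (simp add: LIMSEQ_const_iff)
  qed
  then have "d = 0"
    by (intro bop_separating_eqI[OF _ _ sep_S sep_S]) (use assms in \<open>auto simp: d_def\<close>)
  then show ?thesis by (simp add: d_def)
qed

text \<open>The solution is the series of the operators \<open>4 K\<^sup>n S a S K\<^sup>n\<close>,
  summed as a sesquilinear form; Cauchy-Schwarz and \<open>sum_norm_S_Kn\<close> bound it by
  \<open>norm a\<close>.\<close>

lemma sylvester_ex:
  assumes a: "a \<in> bop"
  shows "\<exists>b\<in>bop. sylvester a b"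
proof -
  define f where "f u v n = 4 * cinner (S (Kn n u)) (a (S (Kn n v)))" for u v n
  have le: "cmod (f u v n) \<le> norm a * (4 * (norm (S (Kn n u)) * norm (S (Kn n v))))" for u v n
  proof -
    have "cmod (f u v n) \<le> 4 * (norm (S (Kn n u)) * norm (a (S (Kn n v))))"
      using norm_cinner_le unfolding f_def norm_mult by simp
    also have "\<dots> \<le> 4 * (norm (S (Kn n u)) * (norm a * norm (S (Kn n v))))"
      by (intro mult_left_mono norm_blinfun) auto
    finally show ?thesis by (simp add: mult_ac)
  qed
  have sum_le: "(\<Sum>n<N. cmod (f u v n)) \<le> norm a * norm u * norm v" for u v N
  proof -
    \<comment> \<open>The factor 4 is split into 2 on either side, which turns the square of
      \<open>?p w\<close> into the telescoping sum.\<close>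
    let ?p = "\<lambda>w. sqrt (\<Sum>n<N. (2 * norm (S (Kn n w)))\<^sup>2)"
    have p: "?p w \<le> norm w" for w
      using sum_norm_S_Kn[where n = N and v = w] by (intro real_le_lsqrt) (simp_all add: power_mult_distrib)
    have "(\<Sum>n<N. cmod (f u v n)) \<le> (\<Sum>n<N. norm a * ((2 * norm (S (Kn n u))) * (2 * norm (S (Kn n v)))))"
      by (rule sum_mono) (use le in \<open>simp add: mult_ac\<close>)
    also have "\<dots> = norm a * (\<Sum>n<N. (2 * norm (S (Kn n u))) * (2 * norm (S (Kn n v))))"
      by (simp add: sum_distrib_left)
    also have "\<dots> \<le> norm a * (?p u * ?p v)"
      using L2_set_mult_ineq[of "\<lambda>n. 2 * norm (S (Kn n u))" "\<lambda>n. 2 * norm (S (Kn n v))" "{..<N}"]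
      by (intro mult_left_mono) (auto simp: L2_set_def)
    also have "\<dots> \<le> norm a * (norm u * norm v)"
      by (intro mult_left_mono mult_mono p) (auto simp: sum_nonneg)
    finally show ?thesis by (simp add: mult_ac)
  qed
  have sn: "summable (\<lambda>n. cmod (f u v n))" for u v
    by (rule summableI_nonneg_bounded[OF _ sum_le]) simp
  have s: "summable (f u v)" for u v by (rule summable_norm_cancel[OF sn])
  have Kn_add: "Kn n (u + v) = Kn n u + Kn n v" and Kn_scale: "Kn n (c *\<^sub>C u) = c *\<^sub>C Kn n u" for n u v c
    by (induction n) (simp_all add: blinfun.add_right bop_scaleC)
  have "\<exists>b\<in>bop. \<forall>u v. cinner u (b v) = (\<Sum>n. f u v n)"
  proof (rule sesquilinear_op_ex)
    show "suminf (f (u + u') v) = suminf (f u v) + suminf (f u' v)" for u u' v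
      unfolding suminf_add[OF s s]
      by (rule suminf_cong) (simp add: f_def Kn_add blinfun.add_right cinner_add_left algebra_simps)
    show "suminf (f u (v + v')) = suminf (f u v) + suminf (f u v')" for u v v'
      unfolding suminf_add[OF s s]
      by (rule suminf_cong) (simp add: f_def Kn_add blinfun.add_right cinner_add_right algebra_simps)
    show "suminf (f (c *\<^sub>C u) v) = cnj c * suminf (f u v)" for c u v
      unfolding suminf_mult[OF s, symmetric]
      by (rule suminf_cong) (simp add: f_def Kn_scale bop_scaleC cinner_scaleC_left)
    show "suminf (f u (c *\<^sub>C v)) = c * suminf (f u v)" for c u v
      unfolding suminf_mult[OF s, symmetric]
      by (rule suminf_cong) (simp add: f_def Kn_scale bop_scaleC a cinner_scaleC_right)
    show "cmod (suminf (f u v)) \<le> norm a * norm u * norm v" for u v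
      by (rule order_trans[OF summable_norm[OF sn] suminf_le_const[OF sn sum_le]])
  qed simp
  then obtain b where b: "b \<in> bop" "\<And>u v. cinner u (blinfun_apply b v) = (\<Sum>n. f u v n)" by blast
  have "sylvester a b"
    unfolding sylvester_def
  proof (rule bop_eqI)
    fix u v
    \<comment> \<open>Without its term for 0 the series is that of \<open>K u\<close> and
      \<open>K v\<close>.\<close>
    have "(\<Sum>n. f u v n) = (\<Sum>n. f u v (Suc n)) + f u v 0" by (rule suminf_split_head[OF s, symmetric, THEN diff_eq_eq[THEN iffD1]])
    moreover have "f u v (Suc n) = f (K u) (K v) n" for n
      by (simp add: f_def funpow_swap1)
    ultimately show "cinner u ((b - (K o\<^sub>L b o\<^sub>L K)) v) = cinner u ((4 *\<^sub>R (S o\<^sub>L a o\<^sub>L S)) v)"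
      by (simp add: blinfun.diff_left cinner_diff_right cinner_K[symmetric] b(2))
        (simp add: f_def blinfun.scaleR_left cinner_scaleR_right cinner_S)
  qed
  with b(1) show ?thesis by blast
qed

text \<open>For scalar \<open>b\<close> the left side of the equation is
  \<open>4 \<beta> S\<^sup>2\<close>. One \<open>S\<close> is cancelled by injectivity, the other by
  totality of its range.\<close>

lemma sylvester_scalar:
  assumes ab: "sylvester a b" and a: "a \<in> bop" and b: "\<And>v. b v = \<beta> *\<^sub>C v"
  shows "a v = \<beta> *\<^sub>C v"
proof -
  have aS: "a (S v) = \<beta> *\<^sub>C S v" for v
  proof -
    have "\<beta> *\<^sub>C v = \<beta> *\<^sub>C K (K v) + 4 *\<^sub>R S (a (S v))"
      using sylvester_apply[OF ab, of v] by (simp add: b bop_scaleC)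
    then have "4 *\<^sub>R S (a (S v)) = 4 *\<^sub>R S (\<beta> *\<^sub>C S v)"
      by (simp add: KK scaleC_diff_right bop_scaleC scaleR_scaleC scaleC_scaleC mult.commute)
    then have "S (a (S v) - \<beta> *\<^sub>C S v) = 0"
      by (simp add: blinfun.diff_right)
    from S_inj[OF this] show ?thesis by simp
  qed
  have adj_a: "(adj a) u = cnj \<beta> *\<^sub>C u" for u
  proof (rule separating_ext[OF sep_S])
    fix m assume "m \<in> range (blinfun_apply S)"
    then obtain v where "m = blinfun_apply S v" by blast
    then show "cinner m ((adj a) u) = cinner m (cnj \<beta> *\<^sub>C u)"
      by (simp add: cinner_adj_right a aS cinner_scaleC_left cinner_scaleC_right)
  qed
  show ?thesis
    by (rule cinner_ext) (simp add: cinner_adj_left[OF a, symmetric] adj_a cinner_scaleC_left cinner_scaleC_right)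
qed

text \<open>Unrolling the equation \<open>N\<close> times leaves a remainder tending to 0 on the
  range of \<open>S\<close>. The series thus converges there in norm, as a closed graph requires,
  while \<open>sylvester_ex\<close> only gives coefficients.\<close>

lemma sylvester_partial_sums:
  assumes ab: "sylvester a b" and b: "b \<in> bop"
  shows "(\<lambda>n. 4 *\<^sub>R Kn n (S (a (S (Kn n (S y))))))
    sums b (S y)"
proof -
  let ?z = "S y"
  let ?s = "\<lambda>N. \<Sum>n<N. 4 *\<^sub>R Kn n (S (a (S (Kn n ?z))))"
  have Kn_add: "Kn n (u + v) = Kn n u + Kn n v" and Kn_scale: "Kn n (r *\<^sub>R u) = r *\<^sub>R Kn n u" for n u v r
    by (induction n) (simp_all add: blinfun.add_right blinfun.scaleR_right)
  have eq: "b ?z = Kn N (b (Kn N ?z)) + ?s N" for N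
  proof (induction N)
    case (Suc N)
    have "Kn N (b (Kn N ?z)) = Kn (Suc N) (b (Kn (Suc N) ?z))
        + 4 *\<^sub>R Kn N (S (a (S (Kn N ?z))))"
      by (subst sylvester_apply[OF ab]) (simp add: Kn_add Kn_scale funpow_swap1)
    with Suc show ?case by simp
  qed simp
  have "(\<lambda>N. Kn N (b (Kn N ?z))) \<longlonglongrightarrow> 0"
  proof (rule Lim_null_comparison)
    show "\<forall>\<^sub>F N in sequentially. norm (Kn N (b (Kn N ?z))) \<le> norm b * norm (Kn N ?z)"
      by (intro always_eventually allI order_trans[OF norm_Kn] norm_blinfun)
    show "(\<lambda>N. norm b * norm (Kn N ?z)) \<longlonglongrightarrow> 0"
      using tendsto_mult_right_zero[OF tendsto_norm_zero[OF Kn_S_tendsto]] .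
  qed
  from tendsto_diff[OF tendsto_const this, of "b ?z"]
  have "(\<lambda>N. b ?z - Kn N (b (Kn N ?z))) \<longlonglongrightarrow> b ?z" by simp
  moreover have "b ?z - Kn N (b (Kn N ?z)) = ?s N" for N using eq[of N] by (simp add: diff_eq_eq add.commute)
  ultimately show ?thesis unfolding sums_def by simp
qed

end

section \<open>Resolvents of closed symmetric graphs\<close>

locale symmetric_graph =
  fixes Q :: "('h::chilbert_space \<times> 'h) set"
  assumes symmetric: "\<And>x x' y y'. (x, x') \<in> Q \<Longrightarrow> (y, y') \<in> Q \<Longrightarrow> cinner x y' = cinner x' y"
    and add: "\<And>x x' y y'. (x, x') \<in> Q \<Longrightarrow> (y, y') \<in> Q \<Longrightarrow> (x + y, x' + y') \<in> Q"
    and scale: "\<And>c x x'. (x, x') \<in> Q \<Longrightarrow> (c *\<^sub>C x, c *\<^sub>C x') \<in> Q"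
    and closed: "closed Q"
begin

lemma diff: "(x, x') \<in> Q \<Longrightarrow> (y, y') \<in> Q \<Longrightarrow> (x - y, x' - y') \<in> Q"
  using add[of x x' "(-1) *\<^sub>C y" "(-1) *\<^sub>C y'"] scale[of y y' "-1"]
  by (simp add: scaleR_scaleC[of "-1", simplified, symmetric])

text \<open>The graph form of \<open>v = (1 + Q\<^sup>2) r\<close> with \<open>s = Q r\<close>.
  Symmetry alone makes \<open>r\<close> and \<open>s\<close> unique and bounded by \<open>v\<close>;
  existence is a separate question.\<close>

definition splits :: "'h \<Rightarrow> 'h \<Rightarrow> 'h \<Rightarrow> bool" where
  "splits v r s \<longleftrightarrow> (r, s) \<in> Q \<and> (s, v - r) \<in> Q"

lemma splits_norm:
  assumes "splits v r s"
  shows "(norm v)\<^sup>2 = (norm r)\<^sup>2 + 2 * (norm s)\<^sup>2 + (norm (v - r))\<^sup>2"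
proof -
  have "cinner r (v - r) = cinner s s"
    using assms symmetric[of r s s "v - r"] by (simp add: splits_def)
  then have "inner r (v - r) = (norm s)\<^sup>2"
    by (metis Re_cinner cinner_self Re_complex_of_real)
  moreover have "(norm (x + y))\<^sup>2 = (norm x)\<^sup>2 + 2 * inner x y + (norm y)\<^sup>2" for x y :: 'h
    by (simp add: power2_norm_eq_inner inner_add_left inner_add_right inner_commute)
  from this[of r "v - r"] have "(norm v)\<^sup>2 = (norm r)\<^sup>2 + 2 * inner r (v - r) + (norm (v - r))\<^sup>2" by simp
  ultimately show ?thesis by simp
qed

lemma splits_bounds:
  assumes "splits v r s"
  shows "norm r \<le> norm v" "norm s \<le> norm v"
proof -
  have "(norm r)\<^sup>2 \<le> (norm v)\<^sup>2" "(norm s)\<^sup>2 \<le> (norm v)\<^sup>2"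
    using splits_norm[OF assms] zero_le_power2[of "norm s"] zero_le_power2[of "norm r"] zero_le_power2[of "norm (v - r)"]
    by linarith+
  then show "norm r \<le> norm v" "norm s \<le> norm v" by (auto intro: power2_le_imp_le)
qed

lemma splits_add: "splits v r s \<Longrightarrow> splits v' r' s' \<Longrightarrow> splits (v + v') (r + r') (s + s')"
  and splits_diff: "splits v r s \<Longrightarrow> splits v' r' s' \<Longrightarrow> splits (v - v') (r - r') (s - s')"
  and splits_scale: "splits v r s \<Longrightarrow> splits (c *\<^sub>C v) (c *\<^sub>C r) (c *\<^sub>C s)"
proof -
  have eqs: "(v + v') - (r + r') = (v - r) + (v' - r')" "(v - v') - (r - r') = (v - r) - (v' - r')"
    "c *\<^sub>C v - c *\<^sub>C r = c *\<^sub>C (v - r)"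
    by (simp_all add: algebra_simps scaleC_diff_right)
  show "splits v r s \<Longrightarrow> splits v' r' s' \<Longrightarrow> splits (v + v') (r + r') (s + s')"
    "splits v r s \<Longrightarrow> splits v' r' s' \<Longrightarrow> splits (v - v') (r - r') (s - s')"
    "splits v r s \<Longrightarrow> splits (c *\<^sub>C v) (c *\<^sub>C r) (c *\<^sub>C s)"
    unfolding splits_def eqs by (auto intro: add diff scale)
qed

lemma splits_unique:
  assumes "splits v r s" "splits v r' s'"
  shows "r = r'" "s = s'"
  using splits_bounds[OF splits_diff[OF assms]] by simp_all

lemma resolvent_ex:
  assumes "\<And>v. \<exists>r s. splits v r s"
  shows "\<exists>R\<in>bop. \<exists>S\<in>bop. \<forall>v. splits v (R v) (S v)"
proof -
  obtain r s where rs: "\<And>v. splits v (r v) (s v)" using assms by metis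
  have add: "r (u + v) = r u + r v" "s (u + v) = s u + s v" for u v
    using splits_unique[OF rs splits_add[OF rs rs]] by simp_all
  have scale: "r (c *\<^sub>C v) = c *\<^sub>C r v" "s (c *\<^sub>C v) = c *\<^sub>C s v" for c v
    using splits_unique[OF rs splits_scale[OF rs]] by simp_all
  have "bounded_linear r" "bounded_linear s"
    by (rule bounded_linear_intro[of _ 1]; simp add: add scale scaleR_scaleC splits_bounds[OF rs])+
  then show ?thesis
    by (intro bexI[of _ "Blinfun r"] bexI[of _ "Blinfun s"])
      (auto simp: bounded_linear_Blinfun_apply bop_def scale rs)
qed

end

text \<open>That is, \<open>R = (1 + Q\<^sup>2)\<^sup>-\<^sup>1\<close> and \<open>S = Q R\<close>.\<close>

locale graph_resolvent = symmetric_graph Q for Q :: "('h::chilbert_space \<times> 'h) set" +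
  fixes R S :: "'h operator"
  assumes R [simp]: "R \<in> bop" and S [simp]: "S \<in> bop"
    and resolvent: "\<And>v. splits v (R v) (S v)"
begin

lemma resolvent_eqI:
  assumes "(r, s) \<in> Q" "(s, v - r) \<in> Q"
  shows "R v = r" "S v = s"
  using splits_unique[OF resolvent, of v r s] assms by (simp_all add: splits_def)

lemma graph_R: "(R v, S v) \<in> Q"
  and graph_S: "(S v, v - R v) \<in> Q"
  using resolvent[of v] by (simp_all add: splits_def)

lemma cinner_R: "cinner (R u) v = cinner u (R v)"
proof -
  have "cinner (R u) (v - R v) = cinner (S u) (S v)"
    "cinner (u - R u) (R v) = cinner (S u) (S v)"
    using symmetric[OF graph_R graph_S, of u v] symmetric[OF graph_S graph_R, of u v] by simp_all
  then show ?thesis by (simp add: cinner_diff_left cinner_diff_right algebra_simps)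
qed

lemma cinner_R_compl: "cinner (R u) (v - R v) = cinner (S u) (S v)"
  and cinner_compl_R: "cinner (u - R u) (R v) = cinner (S u) (S v)"
  using symmetric[OF graph_R graph_S, of u v] symmetric[OF graph_S graph_R, of u v] by simp_all

lemma cinner_S: "cinner (S u) v = cinner u (S v)"
proof -
  have "cinner (S u) (R v) = cinner (R u) (S v)"
    "cinner (S u) (v - R v) = cinner (u - R u) (S v)"
    using symmetric[OF graph_R graph_R, of u v] symmetric[OF graph_S graph_S, of u v] by simp_all
  then show ?thesis by (simp add: cinner_diff_left cinner_diff_right algebra_simps)
qed

text \<open>Both formulas express one splitting: that of \<open>S v\<close> is
  \<open>S (R v)\<close> together with \<open>R v - R (R v)\<close>.\<close>

lemma SS: "S (S v) = R v - R (R v)"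
  and RS: "R (S v) = S (R v)"
proof -
  have "(S (R v), R v - R (R v)) \<in> Q"
    by (rule graph_S)
  moreover have "(R v - R (R v), S v - S (R v)) \<in> Q"
    by (rule diff[OF graph_R graph_R])
  ultimately show "S (S v) = R v - R (R v)"
    "R (S v) = S (R v)"
    by (rule resolvent_eqI(2), rule resolvent_eqI(1))
qed

definition K :: "'h operator" where "K = 2 *\<^sub>R R - id_blinfun"

lemma K_apply: "K v = R v - (v - R v)"
  by (simp add: K_def blinfun.diff_left blinfun.add_left scaleR_2)

text \<open>From \<open>K = 2 R - 1\<close> one gets
  \<open>K\<^sup>2 = 1 - 4 (R - R\<^sup>2)\<close>, and \<open>R - R\<^sup>2 = S\<^sup>2\<close> by
  \<open>SS\<close>.\<close>

lemma cayley: "separating (range (blinfun_apply S)) \<Longrightarrow> cayley K S"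
proof
  show "K \<in> bop" by (simp add: K_def)
  show "adj K = K"
    by (rule adj_unique) (simp add: K_apply cinner_diff_left cinner_diff_right cinner_R)
  show "adj S = S" by (rule adj_unique) (simp add: cinner_S)
  show "K (S v) = S (K v)" for v
    by (simp add: K_apply RS blinfun.diff_right)
  have "4 *\<^sub>R x = x + x + x + x" for x :: 'h
    using scaleR_left.sum[of "\<lambda>_. 1" "{..<4::nat}" x] by (simp add: numeral_eq_Suc lessThan_Suc)
  then show "K (K v) = v - 4 *\<^sub>R S (S v)" for v
    by (simp add: K_apply SS blinfun.diff_right blinfun.add_right algebra_simps)
qed auto

lemma norm_compl: "norm (v - R v) \<le> norm v"
proof (rule power2_le_imp_le)
  show "(norm (v - R v))\<^sup>2 \<le> (norm v)\<^sup>2"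
    using splits_norm[OF resolvent[of v]] zero_le_power2[of "norm (R v)"] zero_le_power2[of "norm (S v)"]
    by linarith
qed simp

text \<open>On the range of \<open>S\<^sup>3\<close> the norms of the terms of the series for \<open>b\<close> are summable even after applying \<open>Q\<close>.\<close>

lemma sylvester_domain:
  assumes sep: "separating (range (blinfun_apply S))" and a: "a \<in> bop" and b: "b \<in> bop" "cayley.sylvester K S a b"
  shows "b (S (S (S y))) \<in> Domain Q"
proof -
  interpret cayley K S by (rule cayley[OF sep])
  define z where "z = S (S (S y))"
  define x where "x n = a (S (Kn n z))" for n
  define s where "s n = 4 *\<^sub>R Kn n (S (x n))" for n
  \<comment> \<open>This is \<open>Q\<close> applied to \<open>s n\<close>, because
    \<open>Q S = 1 - R\<close> and \<open>R\<close> commutes with \<open>K\<close>.\<close>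
  define t where "t n = 4 *\<^sub>R Kn n (x n - R (x n))" for n
  have KR: "K (v - R v) = K v - R (K v)" for v
    by (simp add: K_apply blinfun.diff_right)
  have KnR: "Kn n (v - R v) = Kn n v - R (Kn n v)" for n v
    by (induction n) (simp_all add: KR)
  have st: "(s n, t n) \<in> Q" for n
  proof -
    have "(S (Kn n (x n)), Kn n (x n) - R (Kn n (x n))) \<in> Q" by (rule graph_S)
    from scale[OF this, of 4] show ?thesis by (simp add: s_def t_def KnR Kn_S scaleR_scaleC)
  qed
  have s: "s sums b z"
    unfolding s_def x_def z_def by (rule sylvester_partial_sums[OF b(2,1)])
  have "summable t"
  proof (rule summable_norm_cancel, rule summable_comparison_test')
    show "summable (\<lambda>n. (4 * norm a) * norm (S (Kn n z)))"
      unfolding z_def by (intro summable_mult summable_S_Kn)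
    show "norm (norm (t n)) \<le> (4 * norm a) * norm (S (Kn n z))" for n
    proof -
      have "norm (t n) \<le> 4 * norm (x n)"
        unfolding t_def using order_trans[OF norm_Kn norm_compl, of n "x n"] by simp
      also have "norm (x n) \<le> norm a * norm (S (Kn n z))" unfolding x_def by (rule norm_blinfun)
      finally show ?thesis by simp
    qed
  qed
  then have t: "t sums suminf t" by (rule summable_sums)
  have zero: "(0, 0) \<in> Q" using scale[OF graph_R, of 0 0] by simp
  have mem: "(\<Sum>n<N. s n, \<Sum>n<N. t n) \<in> Q" for N
    by (induction N) (simp_all add: zero add st)
  have "(\<lambda>N. (\<Sum>n<N. s n, \<Sum>n<N. t n)) \<longlonglongrightarrow> (b z, suminf t)"
    using s t unfolding sums_def by (rule tendsto_Pair)
  then have "(b z, suminf t) \<in> Q"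
    by (rule closed_sequentially[OF closed mem])
  then show ?thesis unfolding z_def by blast
qed

end

lemma self_adjoint_symmetric_graph:
  assumes "self_adjoint Q"
  shows "symmetric_graph Q"
proof
  show "closed Q"
  proof -
    have bl: "bounded_linear (\<lambda>p. cinner (fst p) x)" "bounded_linear (\<lambda>p. cinner (snd p) x)" for x :: 'a
      by (intro bounded_linear_compose[OF bounded_bilinear.bounded_linear_left[OF bounded_bilinear_cinner]]
          bounded_linear_fst bounded_linear_snd)+
    have "p \<in> adjoint_graph Q \<longleftrightarrow> (\<forall>q\<in>Q. cinner (fst p) (snd q) = cinner (snd p) (fst q))" for p
      by (cases p) (simp add: adjoint_graph_def split_beta)
    then have "adjoint_graph Q = (\<Inter>q\<in>Q. {p. cinner (fst p) (snd q) = cinner (snd p) (fst q)})" by auto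
    moreover have "closed (\<Inter>q\<in>Q. {p. cinner (fst p) (snd q) = cinner (snd p) (fst q)})"
      by (intro closed_INT ballI closed_Collect_eq linear_continuous_on bl)
    ultimately show ?thesis using assms by (simp add: self_adjoint_def)
  qed
qed (use self_adjoint_symmetric[OF assms] self_adjoint_linear[OF assms] in
    \<open>auto intro: linear_operator_add linear_operator_scaleC\<close>)

text \<open>Von Neumann's argument: projecting \<open>(v, 0)\<close> onto the graph at
  \<open>(r, s)\<close> leaves \<open>(v - r, - s)\<close> orthogonal to the graph, which says that
  \<open>(s, v - r)\<close> lies in the adjoint graph.\<close>

lemma self_adjoint_resolvent_ex:
  assumes Q: "self_adjoint Q"
  shows "\<exists>R S. graph_resolvent Q R S"
proof -
  interpret symmetric_graph Q by (rule self_adjoint_symmetric_graph[OF Q])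
  have zero: "(0, 0) \<in> Q" using self_adjoint_linear[OF Q] by (simp add: linear_operator_def)
  have subspace: "subspace Q"
    using add scale zero by (auto simp: subspace_def zero_prod_def scaleR_scaleC)
  have "\<exists>r s. splits v r s" for v
  proof -
    obtain g where "g \<in> Q" "\<And>h. h \<in> Q \<Longrightarrow> inner ((v, 0) - g) h = 0"
      using orthogonal_projection_ex[OF subspace closed, of "(v, 0)"] by blast
    then obtain r s where rs: "(r, s) \<in> Q" and orth: "\<And>x x'. (x, x') \<in> Q \<Longrightarrow> inner (v - r) x = inner s x'"
      by (cases g) fastforce
    have "(s, v - r) \<in> Q"
    proof (rule self_adjoint_mem[OF Q])
      fix x x' assume x: "(x, x') \<in> Q"
      have "Re (c * cinner (v - r) x) = Re (c * cinner s x')" for c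
        using orth[OF scale[OF x, of c]] by (simp only: Re_cinner[symmetric] cinner_scaleC_right)
      from this[of 1] this[of \<i>] show "cinner s x' = cinner (v - r) x"
        by (simp add: complex_eq_iff)
    qed
    then show ?thesis using rs unfolding splits_def by blast
  qed
  from resolvent_ex[OF this] obtain R S where "R \<in> bop" "S \<in> bop" "\<And>v. splits v (blinfun_apply R v) (blinfun_apply S v)" by blast
  then have "graph_resolvent Q R S" by unfold_locales
  then show ?thesis by blast
qed

text \<open>By symmetry of \<open>S\<close> only its kernel matters: \<open>S v = 0\<close> puts
  \<open>(R v, 0)\<close> into \<open>Q\<close>, so \<open>R v = 0\<close>, and then
  \<open>(0, v)\<close> lies in \<open>Q\<close>.\<close>

lemma (in graph_resolvent) separating_range:
  assumes "trivial_kernel Q" "single_valued Q"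
  shows "separating (range (blinfun_apply S))"
  unfolding separating_def
proof (intro allI impI)
  fix v assume v: "\<forall>m\<in>range (blinfun_apply S). cinner m v = 0"
  have "S v = 0"
  proof (rule cinner_ext)
    fix u show "cinner u (S v) = cinner u 0" using v cinner_S[of u v] by simp
  qed
  then have "R v = 0" "(0, v - R v) \<in> Q"
    using graph_R[of v] graph_S[of v] assms(1) by (auto simp: trivial_kernel_def)
  moreover have "(0, 0) \<in> Q" using scale[OF graph_R, of 0 0] by simp
  ultimately show "v = 0" using assms(2) by (auto simp: single_valued_def)
qed

section \<open>Invariant operators are scalar\<close>

lemma tensor_graph_symmetric_graph:
  assumes P: "self_adjoint P" and Q: "self_adjoint Q"
  shows "symmetric_graph (tensor_graph P Q)"
proof
  note eq = tensor_graph_eq[OF self_adjoint_linear[OF P], of Q]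
  show "closed (tensor_graph P Q)" by (simp add: tensor_graph_def)
  show "cinner x y' = cinner x' y" if "(x, x') \<in> tensor_graph P Q" "(y, y') \<in> tensor_graph P Q" for x x' y y'
    by (rule tensor_graph_symmetric[OF P Q that])
  show "(x + y, x' + y') \<in> tensor_graph P Q" if "(x, x') \<in> tensor_graph P Q" "(y, y') \<in> tensor_graph P Q" for x x' y y'
    using subspace_add[OF subspace_clspan that[unfolded eq]] unfolding eq by simp
  show "(c *\<^sub>C x, c *\<^sub>C x') \<in> tensor_graph P Q" if x: "(x, x') \<in> tensor_graph P Q" for c x x'
  proof -
    let ?f = "\<lambda>p :: ('a \<otimes>\<^sub>H 'b) \<times> ('a \<otimes>\<^sub>H 'b). (c *\<^sub>C fst p, c *\<^sub>C snd p)"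
    have bl: "bounded_linear ?f"
      by (intro bounded_linear_Pair bounded_linear_compose[OF bounded_linear_scaleC] bounded_linear_fst bounded_linear_snd)
    have "?f (x, x') \<in> tensor_graph P Q"
      unfolding eq
    proof (rule clspan_linear[OF bl _ x[unfolded eq]])
      fix d assume "d \<in> {(x \<otimes>\<^sub>v y, x' \<otimes>\<^sub>v y') | x x' y y'. (x, x') \<in> P \<and> (y, y') \<in> Q}"
      then obtain x x' y y' where d: "d = (x \<otimes>\<^sub>v y, x' \<otimes>\<^sub>v y')" "(x, x') \<in> P" "(y, y') \<in> Q" by blast
      have "?f d = ((c *\<^sub>C x) \<otimes>\<^sub>v y, (c *\<^sub>C x') \<otimes>\<^sub>v y')" by (simp add: d(1) otimes_scaleC_left)
      moreover have "(c *\<^sub>C x, c *\<^sub>C x') \<in> P" using d(2) by (rule linear_operator_scaleC[OF self_adjoint_linear[OF P]])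
      ultimately show "?f d \<in> clspan {(x \<otimes>\<^sub>v y, x' \<otimes>\<^sub>v y') | x x' y y'. (x, x') \<in> P \<and> (y, y') \<in> Q}"
        using d(3) by (intro clspan_base) blast
    qed
    then show ?thesis by simp
  qed
qed

text \<open>The tensor product of two sums of squares is a sum of four squares of self-adjoint
  operators. Dropping three of them gives the bound without taking square roots of positive
  operators.\<close>

lemma cinner_tensor_squares:
  fixes X Y :: "'a::chilbert_space operator" and X' Y' :: "'b::chilbert_space operator"
  assumes bop: "X \<in> bop" "Y \<in> bop" "X' \<in> bop" "Y' \<in> bop"
    and adj: "adj X = X" "adj Y = Y" "adj X' = X'" "adj Y' = Y'"
  shows "(norm ((Y \<otimes>\<^sub>o Y') \<zeta>))\<^sup>2 \<le>
    Re (cinner \<zeta> ((((X o\<^sub>L X) + (Y o\<^sub>L Y)) \<otimes>\<^sub>o ((X' o\<^sub>L X') + (Y' o\<^sub>L Y'))) \<zeta>))"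
proof -
  have sq: "Re (cinner \<zeta> ((U \<otimes>\<^sub>o U') ((U \<otimes>\<^sub>o U') \<zeta>))) = (norm ((U \<otimes>\<^sub>o U') \<zeta>))\<^sup>2"
    if "U \<in> bop" "U' \<in> bop" "adj U = U" "adj U' = U'" for U U'
  proof -
    have "cinner \<zeta> ((U \<otimes>\<^sub>o U') ((U \<otimes>\<^sub>o U') \<zeta>)) =
        cinner ((U \<otimes>\<^sub>o U') \<zeta>) ((U \<otimes>\<^sub>o U') \<zeta>)"
      using cinner_adj_left[of "U \<otimes>\<^sub>o U'" \<zeta> "(U \<otimes>\<^sub>o U') \<zeta>"] that by (simp add: adj_tensor_op)
    then show ?thesis by (simp only: cinner_self Re_complex_of_real)
  qed
  have "((X o\<^sub>L X) + (Y o\<^sub>L Y)) \<otimes>\<^sub>o ((X' o\<^sub>L X') + (Y' o\<^sub>L Y')) =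
      ((X \<otimes>\<^sub>o X') o\<^sub>L (X \<otimes>\<^sub>o X')) + ((X \<otimes>\<^sub>o Y') o\<^sub>L (X \<otimes>\<^sub>o Y')) + ((Y \<otimes>\<^sub>o X') o\<^sub>L (Y \<otimes>\<^sub>o X')) + ((Y \<otimes>\<^sub>o Y') o\<^sub>L (Y \<otimes>\<^sub>o Y'))"
    by (rule blinfun_otimes_eqI) (simp add: bop blinfun.add_left otimes_add_left otimes_add_right)
  then show ?thesis
    by (simp add: blinfun.add_left cinner_add_right sq bop adj)
qed

section \<open>The resolvent and the Sylvester equation of a tensor product\<close>

locale tensor_resolvent = P: graph_resolvent P Rp Sp + Q: graph_resolvent Q Rq Sq
  for P :: "('a::chilbert_space \<times> 'a) set" and Rp Sp and Q :: "('b::chilbert_space \<times> 'b) set" and Rq Sq +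
  assumes saP: "self_adjoint P" and saQ: "self_adjoint Q"
    and kerP: "trivial_kernel P" and kerQ: "trivial_kernel Q"
begin

text \<open>This is \<open>1 + P\<^sup>2 \<otimes> Q\<^sup>2\<close> applied to
  \<open>Rp x \<otimes>\<^sub>v Rq y\<close>, since \<open>P\<^sup>2 Rp = 1 - Rp\<close> and
  likewise for \<open>Q\<close>. On these vectors the resolvent of the tensor product is
  explicit.\<close>

definition M :: "'a \<Rightarrow> 'b \<Rightarrow> 'a \<otimes>\<^sub>H 'b" where
  "M x y = Rp x \<otimes>\<^sub>v Rq y + (x - Rp x) \<otimes>\<^sub>v (y - Rq y)"

sublocale T: symmetric_graph "tensor_graph P Q"
  by (rule tensor_graph_symmetric_graph[OF saP saQ])

lemma sep_Sp: "separating (range (blinfun_apply Sp))" and sep_Sq: "separating (range (blinfun_apply Sq))"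
  using self_adjoint_linear[OF saP] self_adjoint_linear[OF saQ]
  by (auto intro!: P.separating_range Q.separating_range kerP kerQ simp: linear_operator_def)

lemma sep_S: "separating {Sp x \<otimes>\<^sub>v Sq y | x y. True}"
  by (rule separating_mono[OF separating_otimes[OF sep_Sp sep_Sq]]) blast

text \<open>The underlying operator \<open>Rp \<otimes> Rq + (1 - Rp) \<otimes> (1 - Rq)\<close> has
  two positive summands. Each dominates the square of \<open>Sp \<otimes> Sq\<close>, as
  \<open>Sp\<^sup>2\<close> is part of both \<open>Rp\<close> and \<open>1 - Rp\<close>; so its
  kernel lies in the trivial kernel of \<open>Sp \<otimes> Sq\<close>.\<close>

lemma sep_M: "separating {M x y | x y. True}"
  unfolding separating_def
proof (intro allI impI)
  fix \<zeta> assume \<zeta>: "\<forall>m\<in>{M x y | x y. True}. cinner m \<zeta> = 0"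
  let ?Cp = "id_blinfun - Rp" and ?Cq = "id_blinfun - Rq"
  let ?M = "(Rp \<otimes>\<^sub>o Rq) + (?Cp \<otimes>\<^sub>o ?Cq)"
  have adjs: "adj Rp = Rp" "adj Sp = Sp" "adj Rq = Rq" "adj Sq = Sq"
    by (rule adj_unique, simp add: P.cinner_R P.cinner_S Q.cinner_R Q.cinner_S)+
  then have adjC: "adj ?Cp = ?Cp" "adj ?Cq = ?Cq" by (simp_all add: adj_diff)
  have M: "?M \<in> bop" by simp
  have adjM: "adj ?M = ?M" by (simp add: adj_additive adj_tensor_op adjs adjC)
  have "?M \<zeta> = 0"
  proof (rule htensor_orthogonal)
    fix x y
    have "cinner (x \<otimes>\<^sub>v y) (?M \<zeta>) = cinner (?M (x \<otimes>\<^sub>v y)) \<zeta>"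
      using cinner_adj_right[OF M, of "x \<otimes>\<^sub>v y" \<zeta>] by (simp only: adjM)
    also have "?M (x \<otimes>\<^sub>v y) = M x y" by (simp add: M_def blinfun.add_left blinfun.diff_left)
    also have "cinner (M x y) \<zeta> = 0" using \<zeta> by blast
    finally show "cinner (x \<otimes>\<^sub>v y) (?M \<zeta>) = 0" .
  qed
  then have zero: "Re (cinner \<zeta> ((Rp \<otimes>\<^sub>o Rq) \<zeta>)) + Re (cinner \<zeta> ((?Cp \<otimes>\<^sub>o ?Cq) \<zeta>)) = 0"
    by (metis blinfun.add_left cinner_add_right cinner_zero_right plus_complex.sel(1) zero_complex.sel(1))
  have sq: "Rp = (Rp o\<^sub>L Rp) + (Sp o\<^sub>L Sp)" "Rq = (Rq o\<^sub>L Rq) + (Sq o\<^sub>L Sq)"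
    "?Cp = (?Cp o\<^sub>L ?Cp) + (Sp o\<^sub>L Sp)" "?Cq = (?Cq o\<^sub>L ?Cq) + (Sq o\<^sub>L Sq)"
    by (rule blinfun_eqI; simp add: blinfun.add_left blinfun.diff_left blinfun.diff_right P.SS Q.SS)+
  have "(norm ((Sp \<otimes>\<^sub>o Sq) \<zeta>))\<^sup>2 \<le> Re (cinner \<zeta> ((Rp \<otimes>\<^sub>o Rq) \<zeta>))"
    using cinner_tensor_squares[of Rp Sp Rq Sq \<zeta>] by (simp add: adjs flip: sq)
  moreover have "(norm ((Sp \<otimes>\<^sub>o Sq) \<zeta>))\<^sup>2 \<le> Re (cinner \<zeta> ((?Cp \<otimes>\<^sub>o ?Cq) \<zeta>))"
    using cinner_tensor_squares[of ?Cp Sp ?Cq Sq \<zeta>] by (simp add: adjs adjC flip: sq)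
  ultimately have "(norm ((Sp \<otimes>\<^sub>o Sq) \<zeta>))\<^sup>2 \<le> 0" using zero by linarith
  then have S0: "(Sp \<otimes>\<^sub>o Sq) \<zeta> = 0" by simp
  show "\<zeta> = 0"
  proof (rule separatingD[OF sep_S])
    fix m assume "m \<in> {Sp x \<otimes>\<^sub>v Sq y | x y. True}"
    then obtain x y where m: "m = blinfun_apply (Sp \<otimes>\<^sub>o Sq) (x \<otimes>\<^sub>v y)" by auto
    have "cinner m \<zeta> = cinner (x \<otimes>\<^sub>v y) ((adj (Sp \<otimes>\<^sub>o Sq)) \<zeta>)" unfolding m by (simp add: cinner_adj_right)
    then show "cinner m \<zeta> = 0" by (simp add: adj_tensor_op adjs S0)
  qed
qed

lemma splits_M: "T.splits (M x y) (Rp x \<otimes>\<^sub>v Rq y) (Sp x \<otimes>\<^sub>v Sq y)"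
  unfolding T.splits_def M_def
  by (auto intro!: tensor_graph_base self_adjoint_linear saP P.graph_R Q.graph_R P.graph_S Q.graph_S)

text \<open>The tensor graph is known only to be closed and symmetric. The vectors that split form a
  subspace, closed by the bounds on splittings, and it contains the total set of all
  \<open>M x y\<close>.\<close>

lemma splits_ex: "\<exists>r s. T.splits v r s"
proof -
  let ?V = "{v. \<exists>r s. T.splits v r s}"
  have zero: "T.splits 0 0 0"
    using T.splits_scale[OF splits_M, of 0 0 0] by simp
  have "subspace ?V"
    unfolding subspace_def
  proof (intro conjI ballI allI)
    show "0 \<in> ?V" using zero by blast
    show "u + v \<in> ?V" if "u \<in> ?V" "v \<in> ?V" for u v using that T.splits_add by blast
    show "c *\<^sub>R v \<in> ?V" if "v \<in> ?V" for c v using that T.splits_scale by (auto simp: scaleR_scaleC) blast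
  qed
  moreover have "closed ?V"
  proof (rule closed_sequential_limits[THEN iffD2], intro allI impI, elim conjE)
    fix f l assume f: "\<forall>n. f n \<in> ?V" and l: "f \<longlonglongrightarrow> l"
    then obtain r s where rs: "\<And>n. T.splits (f n) (r n) (s n)" by (auto) metis
    have "Cauchy f" using l by (rule LIMSEQ_imp_Cauchy)
    then have "Cauchy r" "Cauchy s"
      unfolding Cauchy_def dist_norm using T.splits_bounds[OF T.splits_diff[OF rs rs]] by (meson le_less_trans)+
    then obtain r' s' where r': "r \<longlonglongrightarrow> r'" and s': "s \<longlonglongrightarrow> s'" using Cauchy_convergent convergent_def by metis
    have "(r', s') \<in> tensor_graph P Q"
      by (rule closed_sequentially[OF T.closed _ tendsto_Pair[OF r' s']]) (use rs in \<open>simp add: T.splits_def\<close>)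
    moreover have "(s', l - r') \<in> tensor_graph P Q"
      by (rule closed_sequentially[OF T.closed _ tendsto_Pair[OF s' tendsto_diff[OF l r']]]) (use rs in \<open>simp add: T.splits_def\<close>)
    ultimately show "l \<in> ?V" unfolding T.splits_def by blast
  qed
  ultimately have "clspan {M x y | x y. True} \<subseteq> ?V"
    using splits_M by (intro clspan_minimal) auto
  moreover have "clspan {M x y | x y. True} = UNIV"
  proof (rule clspan_separating[OF sep_M])
    fix c m assume "m \<in> {M x y | x y. True}"
    then obtain x y where "m = M x y" by blast
    then have "c *\<^sub>C m = M (c *\<^sub>C x) y"
      by (simp add: M_def bop_scaleC scaleC_add_right flip: otimes_scaleC_left scaleC_diff_right)
    then show "c *\<^sub>C m \<in> {M x y | x y. True}" by blast
  qed
  ultimately show ?thesis by blast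
qed

lemma graph_resolvent_ex: "\<exists>R S. graph_resolvent (tensor_graph P Q) R S"
proof -
  from T.resolvent_ex[OF splits_ex] obtain R S where "R \<in> bop" "S \<in> bop"
    "\<And>v. T.splits v (R v) (S v)" by blast
  then have "graph_resolvent (tensor_graph P Q) R S" by unfold_locales
  then show ?thesis by blast
qed

context
  fixes R S assumes resolvent: "graph_resolvent (tensor_graph P Q) R S"
begin

interpretation TR: graph_resolvent "tensor_graph P Q" R S by (rule resolvent)

lemma tensor_R: "R (M x y) = Rp x \<otimes>\<^sub>v Rq y"
  and tensor_S: "S (M x y) = Sp x \<otimes>\<^sub>v Sq y"
  using T.splits_unique[OF TR.resolvent splits_M] by simp_all

lemma tensor_sep: "separating (range (blinfun_apply S))"
proof (rule separating_mono[OF sep_S], rule subsetI)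
  fix m assume "m \<in> {Sp x \<otimes>\<^sub>v Sq y | x y. True}"
  then obtain x y where "m = blinfun_apply S (M x y)" by (auto simp: tensor_S)
  then show "m \<in> range (blinfun_apply S)" by blast
qed

lemma tensor_K: "TR.K (M x y) =
    Rp x \<otimes>\<^sub>v Rq y - (x - Rp x) \<otimes>\<^sub>v (y - Rq y)"
  unfolding TR.K_apply tensor_R by (simp add: M_def)

lemma sylvester_tensorI:
  assumes "a \<in> bop" "b \<in> bop"
    and eq: "\<And>x y x' y'. cinner (M x y) (b (M x' y')) -
        cinner (TR.K (M x y)) (b (TR.K (M x' y'))) =
      4 * cinner (Sp x \<otimes>\<^sub>v Sq y) (a (Sp x' \<otimes>\<^sub>v Sq y'))"
  shows "cayley.sylvester TR.K S a b"
proof -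
  interpret C: cayley TR.K S by (rule TR.cayley[OF tensor_sep])
  show ?thesis
    unfolding C.sylvester_def
  proof (rule bop_separating_eqI[OF _ _ sep_M sep_M])
    fix m n assume "m \<in> {M x y | x y. True}" "n \<in> {M x y | x y. True}"
    then obtain x y x' y' where mn: "m = M x y" "n = M x' y'" by blast
    show "cinner m ((b - (TR.K o\<^sub>L b o\<^sub>L TR.K)) n) = cinner m ((4 *\<^sub>R (S o\<^sub>L a o\<^sub>L S)) n)"
      unfolding mn using eq[of x y x' y']
      by (simp add: blinfun.diff_left cinner_diff_right blinfun.scaleR_left cinner_scaleR_right
          tensor_S flip: C.cinner_K C.cinner_S)
  qed (use assms in simp_all)
qed

text \<open>With \<open>x = r0 + r1\<close> and \<open>y = q0 + q1\<close>, \<open>TR.K\<close>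
  changes the sign of \<open>r1 \<otimes>\<^sub>v q1\<close> in \<open>M x y\<close>. Only mixed
  terms survive in the difference. Their second leg always contributes
  \<open>cinner (Sq y) (Sq y')\<close>, and on the first leg they are the mixed terms of the
  equation for \<open>P\<close> alone.\<close>

lemma sylvester_tensor_left:
  assumes ab: "cayley.sylvester P.K Sp a b" and a: "a \<in> bop" and b: "b \<in> bop"
  shows "cayley.sylvester TR.K S (a \<otimes>\<^sub>o id_blinfun) (b \<otimes>\<^sub>o id_blinfun)"
proof (rule sylvester_tensorI)
  interpret C: cayley P.K Sp by (rule P.cayley[OF sep_Sp])
  fix x y x' y'
  define r0 r1 q0 q1 where "r0 = Rp x" "r1 = x - Rp x" "q0 = Rq y" "q1 = y - Rq y"
  define r0' r1' q0' q1' where "r0' = Rp x'" "r1' = x' - Rp x'" "q0' = Rq y'" "q1' = y' - Rq y'"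
  note defs = r0_r1_q0_q1_def r0'_r1'_q0'_q1'_def
  have q: "cinner q0 q1' = cinner (Sq y) (Sq y')" "cinner q1 q0' = cinner (Sq y) (Sq y')"
    unfolding defs by (rule Q.cinner_R_compl Q.cinner_compl_R)+
  have "cinner (r0 + r1) (b (r0' + r1')) - cinner (r0 - r1) (b (r0' - r1')) =
      4 * cinner (Sp x) (a (Sp x'))"
  proof -
    have "cinner x (b x') - cinner (P.K x) (b (P.K x')) =
        4 * cinner (Sp x) (a (Sp x'))"
      using arg_cong[OF C.sylvester_apply[OF ab, of x'], of "cinner x"]
      by (simp add: cinner_add_right cinner_scaleR_right flip: C.cinner_K C.cinner_S)
    then show ?thesis by (simp add: P.K_apply defs)
  qed
  then have r: "2 * (cinner r0 (b r1') + cinner r1 (b r0')) =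
      4 * cinner (Sp x) (a (Sp x'))"
    by (simp add: blinfun.add_right blinfun.diff_right cinner_add_left cinner_add_right cinner_diff_left cinner_diff_right algebra_simps)
  have "cinner (r0 \<otimes>\<^sub>v q0 + r1 \<otimes>\<^sub>v q1) ((b \<otimes>\<^sub>o id_blinfun) (r0' \<otimes>\<^sub>v q0' + r1' \<otimes>\<^sub>v q1')) -
      cinner (r0 \<otimes>\<^sub>v q0 - r1 \<otimes>\<^sub>v q1) ((b \<otimes>\<^sub>o id_blinfun) (r0' \<otimes>\<^sub>v q0' - r1' \<otimes>\<^sub>v q1')) =
      2 * (cinner r0 (b r1') + cinner r1 (b r0')) * cinner (Sq y) (Sq y')"
    using b by (simp add: blinfun.add_right blinfun.diff_right cinner_add_left cinner_add_right cinner_diff_left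
        cinner_diff_right cinner_otimes q algebra_simps)
  then show "cinner (M x y) ((b \<otimes>\<^sub>o id_blinfun) (M x' y')) -
        cinner (TR.K (M x y)) ((b \<otimes>\<^sub>o id_blinfun) (TR.K (M x' y'))) =
      4 * cinner (Sp x \<otimes>\<^sub>v Sq y) ((a \<otimes>\<^sub>o id_blinfun) (Sp x' \<otimes>\<^sub>v Sq y'))"
    unfolding tensor_K unfolding M_def r using a by (simp add: defs cinner_otimes)
qed (use a b in simp_all)

lemma sylvester_tensor_right:
  assumes ab: "cayley.sylvester Q.K Sq a b" and a: "a \<in> bop" and b: "b \<in> bop"
  shows "cayley.sylvester TR.K S (id_blinfun \<otimes>\<^sub>o a) (id_blinfun \<otimes>\<^sub>o b)"
proof (rule sylvester_tensorI)
  interpret C: cayley Q.K Sq by (rule Q.cayley[OF sep_Sq])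
  fix x y x' y'
  define r0 r1 q0 q1 where "r0 = Rp x" "r1 = x - Rp x" "q0 = Rq y" "q1 = y - Rq y"
  define r0' r1' q0' q1' where "r0' = Rp x'" "r1' = x' - Rp x'" "q0' = Rq y'" "q1' = y' - Rq y'"
  note defs = r0_r1_q0_q1_def r0'_r1'_q0'_q1'_def
  have r: "cinner r0 r1' = cinner (Sp x) (Sp x')" "cinner r1 r0' = cinner (Sp x) (Sp x')"
    unfolding defs by (rule P.cinner_R_compl P.cinner_compl_R)+
  have "cinner (q0 + q1) (b (q0' + q1')) - cinner (q0 - q1) (b (q0' - q1')) =
      4 * cinner (Sq y) (a (Sq y'))"
  proof -
    have "cinner y (b y') - cinner (Q.K y) (b (Q.K y')) =
        4 * cinner (Sq y) (a (Sq y'))"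
      using arg_cong[OF C.sylvester_apply[OF ab, of y'], of "cinner y"]
      by (simp add: cinner_add_right cinner_scaleR_right flip: C.cinner_K C.cinner_S)
    then show ?thesis by (simp add: Q.K_apply defs)
  qed
  then have q: "2 * (cinner q0 (b q1') + cinner q1 (b q0')) =
      4 * cinner (Sq y) (a (Sq y'))"
    by (simp add: blinfun.add_right blinfun.diff_right cinner_add_left cinner_add_right cinner_diff_left cinner_diff_right algebra_simps)
  have "cinner (r0 \<otimes>\<^sub>v q0 + r1 \<otimes>\<^sub>v q1) ((id_blinfun \<otimes>\<^sub>o b) (r0' \<otimes>\<^sub>v q0' + r1' \<otimes>\<^sub>v q1')) -
      cinner (r0 \<otimes>\<^sub>v q0 - r1 \<otimes>\<^sub>v q1) ((id_blinfun \<otimes>\<^sub>o b) (r0' \<otimes>\<^sub>v q0' - r1' \<otimes>\<^sub>v q1')) =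
      cinner (Sp x) (Sp x') * (2 * (cinner q0 (b q1') + cinner q1 (b q0')))"
    using b by (simp add: blinfun.add_right blinfun.diff_right cinner_add_left cinner_add_right cinner_diff_left
        cinner_diff_right cinner_otimes r algebra_simps)
  then show "cinner (M x y) ((id_blinfun \<otimes>\<^sub>o b) (M x' y')) -
        cinner (TR.K (M x y)) ((id_blinfun \<otimes>\<^sub>o b) (TR.K (M x' y'))) =
      4 * cinner (Sp x \<otimes>\<^sub>v Sq y) ((id_blinfun \<otimes>\<^sub>o a) (Sp x' \<otimes>\<^sub>v Sq y'))"
    unfolding tensor_K unfolding M_def q using a by (simp add: defs cinner_otimes)
qed (use a b in simp_all)

end

end

section \<open>Scalarity of invariant operators\<close>

context modular
begin

text \<open>\<open>slice_shift\<close> is applied to \<open>z\<close> and to \<open>b z\<close>,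
  whose slices of \<open>W\<close> are related by invariance. As \<open>Wt\<close> is unitary, the
  vectors paired with it agree: \<open>to_conj z' \<otimes>\<^sub>v (adj b') u = to_conj w
  \<otimes>\<^sub>v u\<close> for all \<open>u\<close>, which forces \<open>adj b'\<close> to be
  scalar.\<close>

lemma scalar_of_domain:
  assumes inv: "W o\<^sub>L (b \<otimes>\<^sub>o id_blinfun) = (id_blinfun \<otimes>\<^sub>o b') o\<^sub>L W" and b: "b \<in> bop" "b' \<in> bop"
    and z: "(z, z') \<in> P" "z \<noteq> 0" and bz: "(b z, w) \<in> P"
  shows "\<exists>\<beta>. \<forall>v. b' v = \<beta> *\<^sub>C v"
proof -
  have z': "z' \<noteq> 0" using z trivial_kernel_P by (auto simp: trivial_kernel_def)
  have eq: "to_conj z' \<otimes>\<^sub>v (adj b') u = to_conj w \<otimes>\<^sub>v u" for u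
  proof (rule separating_ext)
    show "separating (blinfun_apply Wt ` {x \<otimes>\<^sub>v y | x (y::'h). x \<in> to_conj ` Domain P \<and> y \<in> UNIV})"
      by (intro separating_unitary unitary_Wt separating_otimes separating_to_conj self_adjoint_Domain
          self_adjoint_P separating_UNIV)
    fix m assume "m \<in> blinfun_apply Wt ` {x \<otimes>\<^sub>v y | x (y::'h). x \<in> to_conj ` Domain P \<and> y \<in> UNIV}"
    then obtain x x' v where m: "m = blinfun_apply Wt (to_conj x \<otimes>\<^sub>v v)" and x: "(x, x') \<in> P" by blast
    have "cinner (to_conj z' \<otimes>\<^sub>v (adj b') u) m = cinner ((adj b') u) ((lslice x' W z) v)"
      unfolding slice_shift[OF x z(1)] by (simp add: m cinner_lslice)
    also have "\<dots> = cinner ((id_blinfun \<otimes>\<^sub>o adj b') (x' \<otimes>\<^sub>v u)) (W (z \<otimes>\<^sub>v v))"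
      using b by (simp add: cinner_lslice)
    also have "\<dots> = cinner (x' \<otimes>\<^sub>v u) (((id_blinfun \<otimes>\<^sub>o b') o\<^sub>L W) (z \<otimes>\<^sub>v v))"
      using cinner_adj_left[of "id_blinfun \<otimes>\<^sub>o b'" "x' \<otimes>\<^sub>v u"] b by (simp add: adj_tensor_op)
    also have "\<dots> = cinner u ((lslice x' W (b z)) v)"
      unfolding inv[symmetric] using b by (simp add: cinner_lslice)
    also have "\<dots> = cinner (to_conj w \<otimes>\<^sub>v u) m"
      unfolding slice_shift[OF x bz] by (simp add: m cinner_lslice)
    finally have "cinner (to_conj z' \<otimes>\<^sub>v (adj b') u) m = cinner (to_conj w \<otimes>\<^sub>v u) m" .
    then show "cinner m (to_conj z' \<otimes>\<^sub>v (adj b') u) = cinner m (to_conj w \<otimes>\<^sub>v u)" by (metis cinner_commute)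
  qed
  \<comment> \<open>Found by pairing the first leg of \<open>eq\<close> with
    \<open>to_conj z'\<close>.\<close>
  define \<mu> where "\<mu> = cinner w z' / cinner z' z'"
  have "cinner z' z' \<noteq> 0" using z' by (simp add: cinner_self)
  have adj_b: "(adj b') u = \<mu> *\<^sub>C u" for u
  proof (rule cinner_ext)
    fix t
    have "cinner z' z' * cinner t ((adj b') u) = cinner w z' * cinner t u"
      using arg_cong[OF eq, of "cinner (to_conj z' \<otimes>\<^sub>v t)" u] by (simp add: cinner_otimes)
    then show "cinner t ((adj b') u) = cinner t (\<mu> *\<^sub>C u)"
      using \<open>cinner z' z' \<noteq> 0\<close> by (simp add: \<mu>_def cinner_scaleC_right field_simps)
  qed
  have "b' v = cnj \<mu> *\<^sub>C v" for v
    by (rule cinner_ext) (simp add: cinner_adj_left[OF b(2), symmetric] adj_b cinner_scaleC_left cinner_scaleC_right)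
  then show ?thesis by blast
qed

text \<open>\<open>W\<close> commutes with \<open>TR.K\<close> and \<open>S\<close>, so conjugation
  by \<open>W\<close> carries the solution for \<open>a \<otimes> 1\<close> to one for
  \<open>1 \<otimes> a'\<close>. Uniqueness transfers the intertwining relation to the smoothed
  \<open>b\<close> and \<open>b'\<close>, where \<open>scalar_of_domain\<close> applies.\<close>

theorem invariant_scalar:
  assumes inv: "W o\<^sub>L (a \<otimes>\<^sub>o id_blinfun) = (id_blinfun \<otimes>\<^sub>o a') o\<^sub>L W" and a: "a \<in> bop" "a' \<in> bop"
  shows "\<exists>\<beta>. \<forall>v. a' v = \<beta> *\<^sub>C v"
proof (cases "\<exists>y::'h. y \<noteq> 0")
  case False
  then have "a' v = 0 *\<^sub>C v" for v by simp
  then show ?thesis by blast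
next
  case True
  then obtain y :: 'h where y: "y \<noteq> 0" by blast
  obtain Rp Sp Rq Sq where "graph_resolvent P Rp Sp" "graph_resolvent Q Rq Sq"
    using self_adjoint_resolvent_ex[OF self_adjoint_P] self_adjoint_resolvent_ex[OF self_adjoint_Q] by blast
  then interpret tensor_resolvent P Rp Sp Q Rq Sq
    by (intro tensor_resolvent.intro tensor_resolvent_axioms.intro self_adjoint_P self_adjoint_Q trivial_kernel_P trivial_kernel_Q)
  obtain R S where RS: "graph_resolvent (tensor_graph P Q) R S" using graph_resolvent_ex by blast
  interpret TR: graph_resolvent "tensor_graph P Q" R S by (rule RS)
  interpret CP: cayley P.K Sp by (rule P.cayley[OF sep_Sp])
  interpret CQ: cayley Q.K Sq by (rule Q.cayley[OF sep_Sq])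
  interpret CT: cayley TR.K S by (rule TR.cayley[OF tensor_sep[OF RS]])
  obtain b where b: "b \<in> bop" "CP.sylvester a b" using CP.sylvester_ex[OF a(1)] by blast
  obtain b' where b': "b' \<in> bop" "CQ.sylvester a' b'" using CQ.sylvester_ex[OF a(2)] by blast
  have comm: "R (W v) = W (R v)"
    "S (W v) = W (S v)" for v
  proof -
    have "(W (R v), W (S v)) \<in> tensor_graph P Q"
      by (intro graph_invariant TR.graph_R)
    moreover have "(W (S v), W v - W (R v)) \<in> tensor_graph P Q"
      using graph_invariant(1)[OF TR.graph_S[of v]] by (simp add: blinfun.diff_right)
    ultimately show "R (W v) = W (R v)"
      "S (W v) = W (S v)"
      by (rule TR.resolvent_eqI)+
  qed
  have KW: "TR.K o\<^sub>L W = W o\<^sub>L TR.K" and SW: "S o\<^sub>L W = W o\<^sub>L S"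
    by (rule blinfun_eqI; simp add: TR.K_apply comm blinfun.diff_right)+
  let ?b1 = "b \<otimes>\<^sub>o id_blinfun :: ('h \<otimes>\<^sub>H 'h) operator" and ?a1 = "a \<otimes>\<^sub>o id_blinfun :: ('h \<otimes>\<^sub>H 'h) operator"
    and ?b2 = "id_blinfun \<otimes>\<^sub>o b' :: ('h \<otimes>\<^sub>H 'h) operator" and ?a2 = "id_blinfun \<otimes>\<^sub>o a' :: ('h \<otimes>\<^sub>H 'h) operator"
  define B where "B = W o\<^sub>L ?b1 o\<^sub>L adj W"
  have KW': "adj W o\<^sub>L TR.K = TR.K o\<^sub>L adj W" and SW': "adj W o\<^sub>L S = S o\<^sub>L adj W"
    using arg_cong[OF KW, of adj] arg_cong[OF SW, of adj] by (simp_all add: adj_compose)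
  have a2: "?a2 = W o\<^sub>L ?a1 o\<^sub>L adj W"
    unfolding inv by (rule blinfun_eqI) simp
  have "CT.sylvester ?a2 B"
    unfolding CT.sylvester_def
  proof (rule blinfun_eqI)
    fix v
    have "?b1 u = TR.K (?b1 (TR.K u)) +
        4 *\<^sub>R S (?a1 (S u))" for u
      by (rule CT.sylvester_apply[OF sylvester_tensor_left[OF RS b(2) a(1) b(1)]])
    note b1 = this[of "(adj W) v"]
    have pw: "TR.K (W u) = W (TR.K u)"
      "S (W u) = W (S u)"
      "(adj W) (TR.K u) = TR.K ((adj W) u)"
      "(adj W) (S u) = S ((adj W) u)" for u
      using KW SW KW' SW' by (metis blinfun_apply_blinfun_compose)+
    have "B v = W (TR.K (?b1 (TR.K ((adj W) v)))) +
        4 *\<^sub>R W (S (?a1 (S ((adj W) v))))"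
      unfolding B_def by (simp only: blinfun_apply_blinfun_compose) (subst b1, simp only: blinfun.add_right blinfun.scaleR_right)
    then show "(B - (TR.K o\<^sub>L B o\<^sub>L TR.K)) v = (4 *\<^sub>R (S o\<^sub>L ?a2 o\<^sub>L S)) v"
      by (simp add: blinfun.diff_left blinfun.scaleR_left a2 pw) (simp add: B_def pw)
  qed
  moreover have "CT.sylvester ?a2 ?b2" by (rule sylvester_tensor_right[OF RS b'(2) a(2) b'(1)])
  moreover have "B \<in> bop" unfolding B_def using b by simp
  ultimately have "B = ?b2" using b' by (intro CT.sylvester_unique) simp_all
  then have binv: "W o\<^sub>L ?b1 = ?b2 o\<^sub>L W"
    unfolding B_def by (simp add: unitary_conj_iff)
  \<comment> \<open>The cube puts \<open>b ?z\<close> into the domain of \<open>P\<close> by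
    \<open>sylvester_domain\<close>; injectivity of \<open>Sp\<close> keeps \<open>?z\<close>
    nonzero.\<close>
  let ?z = "Sp (Sp (Sp y))"
  have "?z \<noteq> 0" using y CP.S_inj by blast
  moreover have "?z \<in> Domain P" using P.graph_S by blast
  moreover have "b ?z \<in> Domain P" by (rule P.sylvester_domain[OF sep_Sp a(1) b])
  ultimately obtain \<beta> where "\<And>v. blinfun_apply b' v = \<beta> *\<^sub>C v"
    using scalar_of_domain[OF binv b(1) b'(1)] by blast
  then have "a' v = \<beta> *\<^sub>C v" for v
    by (rule CQ.sylvester_scalar[OF b'(2) a(2)])
  then show ?thesis by blast
qed

end

section \<open>Four legs\<close>

text \<open>With bracketing to the right, trailing legs count as one: on four legs
  \<open>leg13 X\<close> already means \<open>X\<close> on legs 1, 3, 4, and \<open>leg23 X\<close>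
  means \<open>X\<close> on legs 2, 3, 4. Legs 1, 2, 3 and 1, 2, 4 require rebracketing.\<close>

definition leg123 :: "('a::chilbert_space \<otimes>\<^sub>H 'b::chilbert_space \<otimes>\<^sub>H 'c::chilbert_space) operator \<Rightarrow>
    ('a \<otimes>\<^sub>H 'b \<otimes>\<^sub>H 'c \<otimes>\<^sub>H 'd::chilbert_space) operator" where
  "leg123 T = adj (id_blinfun \<otimes>\<^sub>o assoc) o\<^sub>L leg12 T o\<^sub>L (id_blinfun \<otimes>\<^sub>o assoc)"

definition leg124 :: "('a::chilbert_space \<otimes>\<^sub>H 'b::chilbert_space \<otimes>\<^sub>H 'd::chilbert_space) operator \<Rightarrow>
    ('a \<otimes>\<^sub>H 'b \<otimes>\<^sub>H 'c::chilbert_space \<otimes>\<^sub>H 'd) operator" where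
  "leg124 T = adj (id_blinfun \<otimes>\<^sub>o id_blinfun \<otimes>\<^sub>o flip) o\<^sub>L leg123 T o\<^sub>L (id_blinfun \<otimes>\<^sub>o id_blinfun \<otimes>\<^sub>o flip)"

lemma leg123_bop [simp]: "T \<in> bop \<Longrightarrow> leg123 T \<in> bop"
  and leg124_bop [simp]: "T \<in> bop \<Longrightarrow> leg124 T \<in> bop"
  by (simp_all add: leg123_def leg124_def)

lemma cinner_leg123:
  "T \<in> bop \<Longrightarrow> cinner (w \<otimes>\<^sub>v x \<otimes>\<^sub>v y \<otimes>\<^sub>v z) ((leg123 T) (w' \<otimes>\<^sub>v x' \<otimes>\<^sub>v y' \<otimes>\<^sub>v z')) =
     cinner (w \<otimes>\<^sub>v x \<otimes>\<^sub>v y) (T (w' \<otimes>\<^sub>v x' \<otimes>\<^sub>v y')) * cinner z z'"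
  by (simp add: leg123_def cinner_adj_right cinner_leg12)

lemma cinner_leg124:
  "T \<in> bop \<Longrightarrow> cinner (w \<otimes>\<^sub>v x \<otimes>\<^sub>v y \<otimes>\<^sub>v z) ((leg124 T) (w' \<otimes>\<^sub>v x' \<otimes>\<^sub>v y' \<otimes>\<^sub>v z')) =
     cinner (w \<otimes>\<^sub>v x \<otimes>\<^sub>v z) (T (w' \<otimes>\<^sub>v x' \<otimes>\<^sub>v z')) * cinner y y'"
  by (simp add: leg124_def cinner_adj_right cinner_leg123)

lemma leg123_compose: "S \<in> bop \<Longrightarrow> T \<in> bop \<Longrightarrow> leg123 (S o\<^sub>L T) = leg123 S o\<^sub>L leg123 T"
  by (rule blinfun_eqI) (simp add: leg123_def leg12_compose)

lemma leg124_compose: "S \<in> bop \<Longrightarrow> T \<in> bop \<Longrightarrow> leg124 (S o\<^sub>L T) = leg124 S o\<^sub>L leg124 T"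
  by (rule blinfun_eqI) (simp add: leg124_def leg123_compose)

lemma leg123_legs:
  assumes "T \<in> bop"
  shows "leg123 (leg12 T) = leg12 T" "leg123 (leg13 T) = leg13 (leg12 T)" "leg123 (leg23 T) = leg23 (leg12 T)"
  by (rule bop_eqI4; simp add: assms cinner_leg123 cinner_leg12 cinner_leg13 cinner_leg23 cinner_otimes)+

lemma leg124_legs:
  assumes "T \<in> bop"
  shows "leg124 (leg12 T) = leg12 T" "leg124 (leg13 T) = leg13 (leg13 T)" "leg124 (leg23 T) = leg23 (leg13 T)"
  by (rule bop_eqI4; simp add: assms cinner_leg124 cinner_leg12 cinner_leg13 cinner_leg23 cinner_otimes)+

lemma leg13_leg23: "T \<in> bop \<Longrightarrow> leg13 (leg23 T) = leg23 (leg23 T)"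
  by (rule bop_eqI4) (simp_all add: cinner_leg13 cinner_leg23)

lemma leg124_inject:
  fixes S T :: "('a::chilbert_space \<otimes>\<^sub>H 'b::chilbert_space \<otimes>\<^sub>H 'd::chilbert_space) operator" and p :: "'c::chilbert_space"
  assumes "p \<noteq> 0" "S \<in> bop" "T \<in> bop" "(leg124 S :: ('a \<otimes>\<^sub>H 'b \<otimes>\<^sub>H 'c \<otimes>\<^sub>H 'd) operator) = leg124 T"
  shows "S = T"
proof (rule bop_eqI3[OF assms(2,3)])
  fix x y z x' y' z'
  have "cinner (x \<otimes>\<^sub>v y \<otimes>\<^sub>v z) (S (x' \<otimes>\<^sub>v y' \<otimes>\<^sub>v z')) * cinner p p =
      cinner (x \<otimes>\<^sub>v y \<otimes>\<^sub>v p \<otimes>\<^sub>v z) ((leg124 S) (x' \<otimes>\<^sub>v y' \<otimes>\<^sub>v p \<otimes>\<^sub>v z'))"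
    by (simp add: cinner_leg124 assms(2))
  also have "\<dots> = cinner (x \<otimes>\<^sub>v y \<otimes>\<^sub>v z) (T (x' \<otimes>\<^sub>v y' \<otimes>\<^sub>v z')) * cinner p p"
    unfolding assms(4) by (simp add: cinner_leg124 assms(3))
  finally show "cinner (x \<otimes>\<^sub>v y \<otimes>\<^sub>v z) (S (x' \<otimes>\<^sub>v y' \<otimes>\<^sub>v z')) =
      cinner (x \<otimes>\<^sub>v y \<otimes>\<^sub>v z) (T (x' \<otimes>\<^sub>v y' \<otimes>\<^sub>v z'))"
    using assms(1) by (simp add: cinner_self)
qed

lemma tensor_op_commute:
  assumes U: "U \<in> bop" "U o\<^sub>L adj U = id_blinfun" and "S \<in> bop" "T \<in> bop"
    and "A = adj U o\<^sub>L (S \<otimes>\<^sub>o id_blinfun) o\<^sub>L U" "B = adj U o\<^sub>L (id_blinfun \<otimes>\<^sub>o T) o\<^sub>L U"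
  shows "A (B \<xi>) = B (A \<xi>)"
proof -
  have "U ((adj U) \<eta>) = \<eta>" for \<eta>
    using arg_cong[OF U(2), of "\<lambda>X. blinfun_apply X \<eta>"] by simp
  moreover have "(S \<otimes>\<^sub>o id_blinfun) ((id_blinfun \<otimes>\<^sub>o T) \<eta>) =
      (id_blinfun \<otimes>\<^sub>o T) ((S \<otimes>\<^sub>o id_blinfun) \<eta>)" for \<eta>
  proof -
    have "(S \<otimes>\<^sub>o id_blinfun) o\<^sub>L (id_blinfun \<otimes>\<^sub>o T) = (id_blinfun \<otimes>\<^sub>o T) o\<^sub>L (S \<otimes>\<^sub>o id_blinfun)"
      by (simp add: tensor_op_compose assms(3,4))
    from arg_cong[OF this, of "\<lambda>X. blinfun_apply X \<eta>"] show ?thesis by simp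
  qed
  ultimately show ?thesis by (simp add: assms(5,6))
qed

lemma leg12_leg34_commute:
  fixes S :: "('a::chilbert_space \<otimes>\<^sub>H 'b::chilbert_space) operator" and T :: "('c::chilbert_space \<otimes>\<^sub>H 'd::chilbert_space) operator"
  assumes ST: "S \<in> bop" "T \<in> bop"
  shows "(leg12 S) ((leg23 (leg23 T)) \<xi>) = (leg23 (leg23 T)) ((leg12 S) \<xi>)"
proof (rule tensor_op_commute[OF _ _ ST leg12_def])
  show "leg23 (leg23 T) = adj assoc o\<^sub>L (id_blinfun \<otimes>\<^sub>o T) o\<^sub>L (assoc :: ('a \<otimes>\<^sub>H 'b \<otimes>\<^sub>H 'c \<otimes>\<^sub>H 'd) \<Rightarrow>\<^sub>L _)"
    by (rule bop_eqI4) (simp_all add: ST cinner_leg23 cinner_adj_right cinner_otimes)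
qed (simp_all add: unitary_adj_right)

text \<open>\<open>U\<close> groups legs 1, 4 and legs 2, 3, after which the operators act on
  different factors.\<close>

lemma leg14_leg23_commute:
  fixes S :: "('a::chilbert_space \<otimes>\<^sub>H 'd::chilbert_space) operator" and T :: "('b::chilbert_space \<otimes>\<^sub>H 'c::chilbert_space) operator"
  assumes ST: "S \<in> bop" "T \<in> bop"
  shows "(leg13 (leg13 S)) ((leg23 (leg12 T)) \<xi>) = (leg23 (leg12 T)) ((leg13 (leg13 S)) \<xi>)"
proof -
  define U :: "('a \<otimes>\<^sub>H 'b \<otimes>\<^sub>H 'c \<otimes>\<^sub>H 'd) \<Rightarrow>\<^sub>L (('a \<otimes>\<^sub>H 'd) \<otimes>\<^sub>H 'b \<otimes>\<^sub>H 'c)"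
    where "U = assoc o\<^sub>L (id_blinfun \<otimes>\<^sub>o flip) o\<^sub>L (id_blinfun \<otimes>\<^sub>o assoc)"
  have U: "unitary U" "U (w \<otimes>\<^sub>v x \<otimes>\<^sub>v y \<otimes>\<^sub>v z) = (w \<otimes>\<^sub>v z) \<otimes>\<^sub>v x \<otimes>\<^sub>v y" for w x y z
    by (simp_all add: U_def)
  show ?thesis
  proof (rule tensor_op_commute[OF _ _ ST])
    show "leg13 (leg13 S) = adj U o\<^sub>L (S \<otimes>\<^sub>o id_blinfun) o\<^sub>L U" "leg23 (leg12 T) = adj U o\<^sub>L (id_blinfun \<otimes>\<^sub>o T) o\<^sub>L U"
      by (rule bop_eqI4; simp add: U ST cinner_leg13 cinner_leg12 cinner_leg23 cinner_adj_right cinner_otimes)+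
  qed (use U(1) in \<open>simp_all add: unitary_adj_right\<close>)
qed

section \<open>Left multipliers\<close>

text \<open>These operators insert the vector \<open>p\<close> as a middle leg; their closed span is
  the module on which left multipliers are tested. The middle leg carries a vector instead of an
  algebra element, so an algebra and its dual can both act there.\<close>

lemma bounded_linear_insert:
  fixes c :: "'c::chilbert_space operator" and b :: "'b::chilbert_space operator"
  assumes "c \<in> bop" "b \<in> bop"
  shows "bounded_linear (\<lambda>p :: 'a::chilbert_space. c \<otimes>\<^sub>o (otimes_left p o\<^sub>L b))"
proof (rule bounded_linear_intro[of _ "norm c * norm b"])
  fix p q :: 'a and r
  show "c \<otimes>\<^sub>o (otimes_left (p + q) o\<^sub>L b) = c \<otimes>\<^sub>o (otimes_left p o\<^sub>L b) + c \<otimes>\<^sub>o (otimes_left q o\<^sub>L b)"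
    by (rule blinfun_otimes_eqI) (simp add: assms blinfun.add_left otimes_add_left otimes_add_right)
  show "c \<otimes>\<^sub>o (otimes_left (r *\<^sub>R p) o\<^sub>L b) = r *\<^sub>R (c \<otimes>\<^sub>o (otimes_left p o\<^sub>L b))"
    by (rule blinfun_otimes_eqI)
      (simp add: assms blinfun.scaleR_left scaleR_scaleC otimes_scaleC_left otimes_scaleC_right)
  have "norm (c \<otimes>\<^sub>o (otimes_left p o\<^sub>L b)) \<le> norm c * norm (otimes_left p o\<^sub>L b)"
    by (rule norm_tensor_op_le) (simp_all add: assms)
  also have "\<dots> \<le> norm c * (norm p * norm b)"
    by (intro mult_left_mono order_trans[OF norm_blinfun_compose] mult_right_mono norm_otimes_left_le) simp_all
  finally show "norm (c \<otimes>\<^sub>o (otimes_left p o\<^sub>L b)) \<le> norm p * (norm c * norm b)" by (simp add: mult_ac)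
qed

lemma nondegenerate_clspan:
  assumes "A \<subseteq> bop" "nondegenerate A"
  shows "clspan {blinfun_apply a p | a p. a \<in> A} = UNIV"
proof (rule clspan_separating)
  show "separating {blinfun_apply a p | a p. a \<in> A}" using assms(2) by (simp add: nondegenerate_def)
  fix c m assume "m \<in> {blinfun_apply a p | a p. a \<in> A}"
  then obtain a p where "m = blinfun_apply a p" "a \<in> A" by blast
  then have "c *\<^sub>C m = a (c *\<^sub>C p)" "a \<in> A" using assms(1) by (auto simp: bop_scaleC)
  then show "c *\<^sub>C m \<in> {blinfun_apply a p | a p. a \<in> A}" by blast
qed

text \<open>By nondegeneracy the inserted vector may be taken as \<open>a q'\<close>. Then
  \<open>c\<close> and \<open>a\<close> form an element of the tensor product, on which
  \<open>V\<close> acts as a left multiplier.\<close>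

lemma insert_leg12:
  fixes V :: "('c::chilbert_space \<otimes>\<^sub>H 'a::chilbert_space) operator" and C :: "'c operator set" and B :: "'b::chilbert_space operator set"
  assumes C: "C \<subseteq> bop" and A: "A \<subseteq> bop" "nondegenerate A" and B: "B \<subseteq> bop" and V: "V \<in> bop"
    and left: "\<And>c a. c \<in> C \<Longrightarrow> a \<in> A \<Longrightarrow> V o\<^sub>L (c \<otimes>\<^sub>o a) \<in> clspan {c \<otimes>\<^sub>o a | c a. c \<in> C \<and> a \<in> A}"
    and x: "x \<in> clspan {c \<otimes>\<^sub>o (otimes_left p o\<^sub>L b) | c (p::'a) b. c \<in> C \<and> b \<in> B}" (is "_ \<in> clspan ?E")
  shows "leg12 V o\<^sub>L x \<in> clspan ?E"
proof (rule clspan_linear[OF bounded_bilinear.bounded_linear_right[OF bounded_bilinear_blinfun_compose] _ x])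
  fix d assume "d \<in> ?E"
  then obtain c p b where d: "d = c \<otimes>\<^sub>o (otimes_left p o\<^sub>L b)" and cb: "c \<in> C" "b \<in> B" by blast
  have bops: "c \<in> bop" "b \<in> bop" using cb C B by auto
  have "bounded_linear (\<lambda>p. leg12 V o\<^sub>L (c \<otimes>\<^sub>o (otimes_left p o\<^sub>L b)))"
    by (rule bounded_linear_compose[OF bounded_bilinear.bounded_linear_right[OF bounded_bilinear_blinfun_compose]
        bounded_linear_insert[OF bops]])
  then show "leg12 V o\<^sub>L d \<in> clspan ?E"
    unfolding d
  proof (rule clspan_linear)
    show "p \<in> clspan {blinfun_apply a p | a p. a \<in> A}" using nondegenerate_clspan[OF A] by blast
    fix q assume "q \<in> {blinfun_apply a p | a p. a \<in> A}"
    then obtain a q' where q: "q = blinfun_apply a q'" and a: "a \<in> A" by blast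
    let ?J = "id_blinfun \<otimes>\<^sub>o (otimes_left q' o\<^sub>L b) :: ('c \<otimes>\<^sub>H 'b) \<Rightarrow>\<^sub>L ('c \<otimes>\<^sub>H 'a \<otimes>\<^sub>H 'b)"
    have ins: "leg12 (c' \<otimes>\<^sub>o a') o\<^sub>L ?J = c' \<otimes>\<^sub>o (otimes_left (a' q') o\<^sub>L b)" if "c' \<in> bop" "a' \<in> bop" for c' a'
      by (rule blinfun_otimes_eqI) (simp add: that bops leg12_tensor_op)
    have "leg12 V o\<^sub>L (c \<otimes>\<^sub>o (otimes_left q o\<^sub>L b)) = leg12 (V o\<^sub>L (c \<otimes>\<^sub>o a)) o\<^sub>L ?J"
      using bops a A V by (auto simp: q ins[symmetric] leg12_compose blinfun_comp_assoc)
    also have "\<dots> \<in> clspan ?E"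
    proof (rule clspan_blin[OF blin_comp[OF blin_compose_right blin_leg12] _ _ left[OF cb(1) a]])
      show "?J \<in> bop" by (simp add: bops)
      show "{c \<otimes>\<^sub>o a | c a. c \<in> C \<and> a \<in> A} \<subseteq> bop" using C A by (auto simp: subset_iff)
      fix e assume "e \<in> {c \<otimes>\<^sub>o a | c a. c \<in> C \<and> a \<in> A}"
      then obtain c' a' where e: "e = c' \<otimes>\<^sub>o a'" "c' \<in> C" "a' \<in> A" by blast
      then have "leg12 e o\<^sub>L ?J = c' \<otimes>\<^sub>o (otimes_left (a' q') o\<^sub>L b)"
        using C A by (auto simp: ins subset_iff)
      then show "leg12 e o\<^sub>L ?J \<in> clspan ?E" using e(2) cb(2) by (intro clspan_base) blast
    qed
    finally show "leg12 V o\<^sub>L (c \<otimes>\<^sub>o (otimes_left q o\<^sub>L b)) \<in> clspan ?E" .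
  qed
qed

lemma insert_leg23:
  fixes V :: "('a::chilbert_space \<otimes>\<^sub>H 'b::chilbert_space) operator" and C :: "'c::chilbert_space operator set" and B :: "'b operator set"
  assumes C: "C \<subseteq> bop" and A: "A \<subseteq> bop" "nondegenerate A" and B: "B \<subseteq> bop" and V: "V \<in> bop"
    and left: "\<And>a b. a \<in> A \<Longrightarrow> b \<in> B \<Longrightarrow> V o\<^sub>L (a \<otimes>\<^sub>o b) \<in> clspan {a \<otimes>\<^sub>o b | a b. a \<in> A \<and> b \<in> B}"
    and x: "x \<in> clspan {c \<otimes>\<^sub>o (otimes_left p o\<^sub>L b) | c (p::'a) b. c \<in> C \<and> b \<in> B}" (is "_ \<in> clspan ?E")
  shows "leg23 V o\<^sub>L x \<in> clspan ?E"
proof (rule clspan_linear[OF bounded_bilinear.bounded_linear_right[OF bounded_bilinear_blinfun_compose] _ x])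
  fix d assume "d \<in> ?E"
  then obtain c p b where d: "d = c \<otimes>\<^sub>o (otimes_left p o\<^sub>L b)" and cb: "c \<in> C" "b \<in> B" by blast
  have bops: "c \<in> bop" "b \<in> bop" using cb C B by auto
  have "bounded_linear (\<lambda>p. leg23 V o\<^sub>L (c \<otimes>\<^sub>o (otimes_left p o\<^sub>L b)))"
    by (rule bounded_linear_compose[OF bounded_bilinear.bounded_linear_right[OF bounded_bilinear_blinfun_compose]
        bounded_linear_insert[OF bops]])
  then show "leg23 V o\<^sub>L d \<in> clspan ?E"
    unfolding d
  proof (rule clspan_linear)
    show "p \<in> clspan {blinfun_apply a p | a p. a \<in> A}" using nondegenerate_clspan[OF A] by blast
    fix q assume "q \<in> {blinfun_apply a p | a p. a \<in> A}"
    then obtain a q' where q: "q = blinfun_apply a q'" and a: "a \<in> A" by blast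
    let ?J = "c \<otimes>\<^sub>o otimes_left q' :: ('c \<otimes>\<^sub>H 'b) \<Rightarrow>\<^sub>L ('c \<otimes>\<^sub>H 'a \<otimes>\<^sub>H 'b)"
    have ins: "leg23 (a' \<otimes>\<^sub>o b') o\<^sub>L ?J = c \<otimes>\<^sub>o (otimes_left (a' q') o\<^sub>L b')" if "a' \<in> bop" "b' \<in> bop" for a' b'
      by (rule blinfun_otimes_eqI) (simp add: that bops leg23_def)
    have "leg23 V o\<^sub>L (c \<otimes>\<^sub>o (otimes_left q o\<^sub>L b)) = leg23 (V o\<^sub>L (a \<otimes>\<^sub>o b)) o\<^sub>L ?J"
      using bops a A V by (auto simp: q ins[symmetric] leg23_compose blinfun_comp_assoc)
    also have "\<dots> \<in> clspan ?E"
    proof (rule clspan_blin[OF blin_comp[OF blin_compose_right blin_leg23] _ _ left[OF a cb(2)]])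
      show "?J \<in> bop" by (simp add: bops)
      show "{a \<otimes>\<^sub>o b | a b. a \<in> A \<and> b \<in> B} \<subseteq> bop" using A B by (auto simp: subset_iff)
      fix e assume "e \<in> {a \<otimes>\<^sub>o b | a b. a \<in> A \<and> b \<in> B}"
      then obtain a' b' where e: "e = a' \<otimes>\<^sub>o b'" "a' \<in> A" "b' \<in> B" by blast
      then have "leg23 e o\<^sub>L ?J = c \<otimes>\<^sub>o (otimes_left (a' q') o\<^sub>L b')"
        using A B by (auto simp: ins subset_iff)
      then show "leg23 e o\<^sub>L ?J \<in> clspan ?E" using e(3) cb(1) by (intro clspan_base) blast
    qed
    finally show "leg23 V o\<^sub>L (c \<otimes>\<^sub>o (otimes_left q o\<^sub>L b)) \<in> clspan ?E" .
  qed
qed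

text \<open>The operator is \<open>b\<close> times the complex number \<open>cinner p q\<close>.
  Closed spans are real here, so the scalar is absorbed into a vector of each slice.\<close>

lemma qg_algebra_scale:
  assumes W: "W \<in> bop" and b: "b \<in> qg_algebra W"
  shows "adj (otimes_left p) o\<^sub>L (otimes_left q o\<^sub>L b) \<in> qg_algebra W"
proof -
  have bl: "bounded_linear (\<lambda>b. adj (otimes_left p) o\<^sub>L (otimes_left q o\<^sub>L b))"
    by (rule bounded_linear_compose[OF bounded_bilinear.bounded_linear_right[OF bounded_bilinear_blinfun_compose]
        bounded_bilinear.bounded_linear_right[OF bounded_bilinear_blinfun_compose]])
  show ?thesis
    unfolding qg_algebra_eq[OF W]
  proof (rule clspan_linear[OF bl _ b[unfolded qg_algebra_eq[OF W]]])
    fix d assume "d \<in> {lslice x W z | x z. True}"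
    then obtain x z where d: "d = lslice x W z" by blast
    have "adj (otimes_left p) o\<^sub>L (otimes_left q o\<^sub>L d) = lslice x W (cinner p q *\<^sub>C z)"
      by (rule bop_eqI)
        (simp add: d cinner_adj_right cinner_otimes cinner_lslice otimes_scaleC_left bop_scaleC W cinner_scaleC_right)
    then show "adj (otimes_left p) o\<^sub>L (otimes_left q o\<^sub>L d) \<in> clspan {lslice x W z | x z. True}"
      by (intro clspan_base) blast
  qed
qed

lemma spatial_tensor_adj:
  assumes D: "D \<subseteq> bop" "subspace D" "\<And>d. d \<in> D \<Longrightarrow> adj d \<in> D" and A: "A \<subseteq> bop" "\<And>a. a \<in> A \<Longrightarrow> adj a \<in> A"
    and x: "x \<in> spatial_tensor D A"
  shows "adj x \<in> spatial_tensor D A"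
proof -
  let ?G = "{d \<otimes>\<^sub>o a | d a. d \<in> D \<and> a \<in> A}"
  have "?G \<subseteq> bop" using D(1) A(1) by (auto simp: subset_iff)
  then have "adj x \<in> clspan (adj ` ?G)"
    using x unfolding spatial_tensor_eq[OF D(1) A(1) D(2)] by (rule clspan_adj)
  moreover have "adj ` ?G \<subseteq> ?G"
  proof
    fix y assume "y \<in> adj ` ?G"
    then obtain d a where "y = adj (d \<otimes>\<^sub>o a)" "d \<in> D" "a \<in> A" by blast
    then have "y = adj d \<otimes>\<^sub>o adj a" "adj d \<in> D" "adj a \<in> A"
      using D A by (auto simp: adj_tensor_op subset_iff)
    then show "y \<in> ?G" by blast
  qed
  then have "clspan (adj ` ?G) \<subseteq> clspan ?G" by (intro closure_mono span_mono)
  ultimately show ?thesis unfolding spatial_tensor_eq[OF D(1) A(1) D(2)] by blast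
qed

text \<open>The product is the adjoint of \<open>adj x o\<^sub>L V\<close>; here closure under
  adjoints enters.\<close>

lemma unitary_multipliers_adj:
  assumes X: "\<And>x. x \<in> X \<Longrightarrow> adj x \<in> X" "X \<subseteq> bop" and V: "V \<in> multipliers X" and x: "x \<in> X"
  shows "adj V o\<^sub>L x \<in> X"
proof -
  have "adj x o\<^sub>L V \<in> X" using V X(1)[OF x] by (simp add: multipliers_def)
  then have "adj (adj x o\<^sub>L V) \<in> X" by (rule X(1))
  moreover have "x \<in> bop" "V \<in> bop" using x X(2) V by (auto simp: multipliers_def)
  ultimately show ?thesis by (simp add: adj_compose)
qed

text \<open>Inserting a unit vector and removing it again recovers \<open>Y\<close> from
  \<open>leg13 Y\<close>. Insertion maps the tensor product into the module; its adjoint maps back,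
  since contracting two inserted vectors gives a scalar.\<close>

lemma leg13_left_multiplier:
  fixes Y :: "('c::chilbert_space \<otimes>\<^sub>H 'b::chilbert_space) operator" and p :: "'a::chilbert_space"
    and WB :: "('b \<otimes>\<^sub>H 'b) operator"
  assumes C: "C \<subseteq> bop" "subspace C" and WB: "WB \<in> bop" and p: "norm p = 1" and Y: "Y \<in> bop"
    and left: "\<And>x. x \<in> clspan {c \<otimes>\<^sub>o (otimes_left p o\<^sub>L b) | c (p::'a) b. c \<in> C \<and> b \<in> qg_algebra WB} \<Longrightarrow>
      leg13 Y o\<^sub>L x \<in> clspan {c \<otimes>\<^sub>o (otimes_left p o\<^sub>L b) | c (p::'a) b. c \<in> C \<and> b \<in> qg_algebra WB}"
    and x: "x \<in> spatial_tensor C (qg_algebra WB)"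
  shows "Y o\<^sub>L x \<in> spatial_tensor C (qg_algebra WB)"
proof -
  let ?E = "{c \<otimes>\<^sub>o (otimes_left p o\<^sub>L b) | c (p::'a) b. c \<in> C \<and> b \<in> qg_algebra WB}"
  note B = qg_algebra_bop[OF WB]
  note st = spatial_tensor_eq[OF C(1) B C(2)]
  let ?I = "id_blinfun \<otimes>\<^sub>o otimes_left p :: ('c \<otimes>\<^sub>H 'b) \<Rightarrow>\<^sub>L ('c \<otimes>\<^sub>H 'a \<otimes>\<^sub>H 'b)"
  have adjI: "adj ?I = id_blinfun \<otimes>\<^sub>o adj (otimes_left p)" by (simp add: adj_tensor_op)
  have YI: "adj ?I o\<^sub>L leg13 Y o\<^sub>L ?I = Y"
    by (rule bop_eqI2) (simp_all add: Y cinner_adj_right cinner_leg13 cinner_self p)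
  have E: "adj ?I o\<^sub>L y \<in> spatial_tensor C (qg_algebra WB)" if "y \<in> clspan ?E" for y
    unfolding st
  proof (rule clspan_linear[OF bounded_bilinear.bounded_linear_right[OF bounded_bilinear_blinfun_compose] _ that])
    fix d assume "d \<in> ?E"
    then obtain c q b where d: "d = c \<otimes>\<^sub>o (otimes_left q o\<^sub>L b)" and cb: "c \<in> C" "b \<in> qg_algebra WB" by blast
    have bops: "c \<in> bop" "b \<in> bop" using cb C B by auto
    have "adj ?I o\<^sub>L d = c \<otimes>\<^sub>o (adj (otimes_left p) o\<^sub>L (otimes_left q o\<^sub>L b))"
      unfolding adjI d by (simp add: tensor_op_compose bops)
    then show "adj ?I o\<^sub>L d \<in> clspan {c \<otimes>\<^sub>o b | c b. c \<in> C \<and> b \<in> qg_algebra WB}"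
      using cb(1) qg_algebra_scale[OF WB cb(2)] by (intro clspan_base) blast
  qed
  show ?thesis
    unfolding st
  proof (rule clspan_linear[OF bounded_bilinear.bounded_linear_right[OF bounded_bilinear_blinfun_compose] _ x[unfolded st]])
    fix d assume "d \<in> {c \<otimes>\<^sub>o b | c b. c \<in> C \<and> b \<in> qg_algebra WB}"
    then obtain c b where d: "d = c \<otimes>\<^sub>o b" and cb: "c \<in> C" "b \<in> qg_algebra WB" by blast
    have bops: "c \<in> bop" "b \<in> bop" using cb C B by auto
    have "?I o\<^sub>L d = c \<otimes>\<^sub>o (otimes_left p o\<^sub>L b)" unfolding d by (simp add: tensor_op_compose bops)
    then have "?I o\<^sub>L d \<in> clspan ?E" using cb by (intro clspan_base) blast
    from E[OF left[OF this]] have "(adj ?I o\<^sub>L leg13 Y o\<^sub>L ?I) o\<^sub>L d \<in> spatial_tensor C (qg_algebra WB)"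
      by (simp add: blinfun_comp_assoc)
    then show "Y o\<^sub>L d \<in> clspan {c \<otimes>\<^sub>o b | c b. c \<in> C \<and> b \<in> qg_algebra WB}" unfolding YI st .
  qed
qed

section \<open>Composition of bicharacters\<close>

lemma composition_leg13_ex:
  fixes WA :: "('a::chilbert_space \<otimes>\<^sub>H 'a) operator"
    and V :: "('c::chilbert_space \<otimes>\<^sub>H 'a) operator" and V' :: "('a \<otimes>\<^sub>H 'b::chilbert_space) operator" and p :: 'a
  assumes WA: "modular_multiplicative_unitary WA" and V: "unitary V" and V': "unitary V'" and p: "norm p = 1"
    and bV: "leg23 WA o\<^sub>L leg12 V = leg12 V o\<^sub>L leg13 V o\<^sub>L leg23 WA"
    and bV': "leg23 V' o\<^sub>L leg12 WA = leg12 WA o\<^sub>L leg13 V' o\<^sub>L leg23 V'"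
  shows "\<exists>Y. unitary Y \<and> leg13 Y = adj (leg12 V) o\<^sub>L leg23 V' o\<^sub>L leg12 V o\<^sub>L adj (leg23 V')"
proof -
  obtain P Q Wt where "modular_data WA P Q Wt" using WA unfolding modular_multiplicative_unitary_iff by blast
  then interpret modular WA P Q Wt by (rule modular.intro)
  define X :: "('c \<otimes>\<^sub>H 'a \<otimes>\<^sub>H 'b) operator" where "X = adj (leg12 V) o\<^sub>L leg23 V' o\<^sub>L leg12 V o\<^sub>L adj (leg23 V')"
  have X: "unitary X" unfolding X_def by (intro unitary_compose unitary_adj unitary_leg12 unitary_leg23 V V')
  have XV: "leg23 V' o\<^sub>L leg12 V = leg12 V o\<^sub>L X o\<^sub>L leg23 V'"
    unfolding X_def using V V' by (intro blinfun_eqI) simp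
  let ?W = "leg23 (leg12 WA) :: ('c \<otimes>\<^sub>H 'a \<otimes>\<^sub>H 'a \<otimes>\<^sub>H 'b) operator"
  have inv: "leg13 X o\<^sub>L ?W = ?W o\<^sub>L leg124 X"
  proof (rule blinfun_eqI)
    fix v :: "'c \<otimes>\<^sub>H 'a \<otimes>\<^sub>H 'a \<otimes>\<^sub>H 'b"
    let ?V12 = "blinfun_apply (leg12 V) :: 'c \<otimes>\<^sub>H 'a \<otimes>\<^sub>H 'a \<otimes>\<^sub>H 'b \<Rightarrow> _"
      and ?V13 = "blinfun_apply (leg13 (leg12 V)) :: 'c \<otimes>\<^sub>H 'a \<otimes>\<^sub>H 'a \<otimes>\<^sub>H 'b \<Rightarrow> _"
      and ?V24 = "blinfun_apply (leg23 (leg13 V')) :: 'c \<otimes>\<^sub>H 'a \<otimes>\<^sub>H 'a \<otimes>\<^sub>H 'b \<Rightarrow> _"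
      and ?V34 = "blinfun_apply (leg23 (leg23 V')) :: 'c \<otimes>\<^sub>H 'a \<otimes>\<^sub>H 'a \<otimes>\<^sub>H 'b \<Rightarrow> _"
    let ?w = "blinfun_apply ?W" and ?X124 = "blinfun_apply (leg124 X) :: 'c \<otimes>\<^sub>H 'a \<otimes>\<^sub>H 'a \<otimes>\<^sub>H 'b \<Rightarrow> _"
      and ?X134 = "blinfun_apply (leg13 X) :: 'c \<otimes>\<^sub>H 'a \<otimes>\<^sub>H 'a \<otimes>\<^sub>H 'b \<Rightarrow> _"
    have bops: "V \<in> bop" "V' \<in> bop" "X \<in> bop" using V V' X by simp_all
    have e1: "?w (?V12 u) = ?V12 (?V13 (?w u))" for u
      using arg_cong[OF bV, of "\<lambda>T. blinfun_apply (leg123 T) u"] by (simp add: leg123_compose leg123_legs bops)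
    have e2: "?V34 (?w u) = ?w (?V24 (?V34 u))" for u
      using arg_cong[OF bV', of "\<lambda>T. blinfun_apply (leg23 T) u"] by (simp add: leg23_compose bops)
    have c: "?V12 (?V34 u) = ?V34 (?V12 u)" for u by (rule leg12_leg34_commute[OF bops(1,2)])
    have x1: "?V24 (?V12 u) = ?V12 (?X124 (?V24 u))" for u
      using arg_cong[OF XV, of "\<lambda>T. blinfun_apply (leg124 T) u"] by (simp add: leg124_compose leg124_legs bops)
    have x2: "?V34 (?V13 u) = ?V13 (?X134 (?V34 u))" for u
      using arg_cong[OF XV, of "\<lambda>T. blinfun_apply (leg13 T) u"] by (simp add: leg13_compose leg13_leg23 bops)
    \<comment> \<open>Writing \<open>v\<close> as an image under the invertible \<open>?V24\<close>
      and \<open>?V34\<close> supplies the factors that \<open>e2\<close>, \<open>x1\<close> and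
      \<open>x2\<close> need on the right.\<close>
    define t where "t = (adj (leg23 (leg23 V'))) ((adj (leg23 (leg13 V'))) v)"
    have v: "v = ?V24 (?V34 t)" unfolding t_def using V' by simp
    have "?V12 (?V13 (?X134 (?w v))) = ?V12 (?V13 (?X134 (?V34 (?w t))))" unfolding v e2 ..
    also have "\<dots> = ?V34 (?V12 (?V13 (?w t)))" unfolding x2[symmetric] c ..
    also have "\<dots> = ?w (?V24 (?V34 (?V12 t)))" unfolding e1[symmetric] e2 ..
    also have "\<dots> = ?w (?V12 (?X124 v))" unfolding c[symmetric] x1 v ..
    also have "\<dots> = ?V12 (?V13 (?w (?X124 v)))" by (rule e1)
    finally have *: "?V12 (?V13 (?X134 (?w v))) = ?V12 (?V13 (?w (?X124 v)))" .
    have inj: "?V12 x = ?V12 y \<Longrightarrow> x = y" "?V13 x = ?V13 y \<Longrightarrow> x = y" for x y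
      using V by (metis unitary_adj_apply(1) unitary_leg12 unitary_leg13)+
    show "(leg13 X o\<^sub>L ?W) v = (?W o\<^sub>L leg124 X) v"
      using inj(2)[OF inj(1)[OF *]] by simp
  qed
  \<comment> \<open>Legs 1 and 3 of \<open>X\<close> are sliced away; what remains on leg 2 has to
    be scalar.\<close>
  define a where "a c b c' b' = adj (otimes_right b) o\<^sub>L lslice c X c' o\<^sub>L otimes_right b'" for c c' b b'
  have a: "a c b c' b' \<in> bop" for c b c' b' unfolding a_def using X by simp
  have cinner_a: "cinner y ((a c b c' b') y') = cinner (c \<otimes>\<^sub>v y \<otimes>\<^sub>v b) (X (c' \<otimes>\<^sub>v y' \<otimes>\<^sub>v b'))"
    for c b c' b' y y'
    using X by (simp add: a_def cinner_adj_right cinner_lslice)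
  have scalar: "\<exists>\<beta>. \<forall>v. (a c b c' b') v = \<beta> *\<^sub>C v" for c b c' b'
  proof (rule invariant_scalar)
    \<comment> \<open>Slicing the last leg through \<open>?J\<close> turns \<open>leg13 X\<close>
      into \<open>1 \<otimes> a\<close> and \<open>leg124 X\<close> into
      \<open>a \<otimes> 1\<close>, while \<open>W\<close> passes through unchanged.\<close>
    let ?J = "\<lambda>b. adj assoc o\<^sub>L otimes_right b :: ('a \<otimes>\<^sub>H 'a) \<Rightarrow>\<^sub>L ('a \<otimes>\<^sub>H 'a \<otimes>\<^sub>H 'b)"
    let ?a = "a c b c' b'"
    have 1: "adj (?J b) o\<^sub>L lslice c (leg13 X) c' o\<^sub>L ?J b' = id_blinfun \<otimes>\<^sub>o ?a"
      using X a by (intro bop_eqI2) (simp_all add: cinner_adj_right cinner_lslice cinner_leg13 cinner_otimes cinner_a)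
    have 2: "adj (?J b) o\<^sub>L lslice c (leg124 X) c' o\<^sub>L ?J b' = ?a \<otimes>\<^sub>o id_blinfun"
      using X a by (intro bop_eqI2) (simp_all add: cinner_adj_right cinner_lslice cinner_leg124 cinner_otimes cinner_a)
    have J: "leg12 T o\<^sub>L ?J b = ?J b o\<^sub>L T" if "T \<in> bop" for T and b
      by (rule blinfun_eqI) (simp add: leg12_def that)
    have J': "adj (?J b) o\<^sub>L leg12 WA = WA o\<^sub>L adj (?J b)"
      using arg_cong[OF J[of "adj WA" b], of adj] by (simp add: adj_compose adj_leg12)
    have "lslice c (leg13 X o\<^sub>L ?W) c' = lslice c (leg13 X) c' o\<^sub>L leg12 WA"
      using lslice_conj_leg23[of id_blinfun "leg12 WA" "leg13 X" c c'] X by simp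
    moreover have "lslice c (?W o\<^sub>L leg124 X) c' = leg12 WA o\<^sub>L lslice c (leg124 X) c'"
      using lslice_conj_leg23[of "leg12 WA" id_blinfun "leg124 X" c c'] X by simp
    ultimately have eq: "lslice c (leg13 X) c' o\<^sub>L leg12 WA = leg12 WA o\<^sub>L lslice c (leg124 X) c'" by (simp add: inv)
    have "WA o\<^sub>L (?a \<otimes>\<^sub>o id_blinfun) = (WA o\<^sub>L adj (?J b)) o\<^sub>L lslice c (leg124 X) c' o\<^sub>L ?J b'"
      unfolding 2[symmetric] by (simp only: blinfun_comp_assoc)
    also have "\<dots> = adj (?J b) o\<^sub>L (leg12 WA o\<^sub>L lslice c (leg124 X) c') o\<^sub>L ?J b'"
      unfolding J'[symmetric] by (simp only: blinfun_comp_assoc)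
    also have "\<dots> = adj (?J b) o\<^sub>L lslice c (leg13 X) c' o\<^sub>L (leg12 WA o\<^sub>L ?J b')"
      unfolding eq[symmetric] by (simp only: blinfun_comp_assoc)
    also have "\<dots> = (id_blinfun \<otimes>\<^sub>o ?a) o\<^sub>L WA"
      unfolding 1[symmetric] J[OF unitary_bop[OF unitary_W]] by (simp only: blinfun_comp_assoc)
    finally show "WA o\<^sub>L (?a \<otimes>\<^sub>o id_blinfun) = (id_blinfun \<otimes>\<^sub>o ?a) o\<^sub>L WA" .
  qed (rule a)+
  let ?I = "id_blinfun \<otimes>\<^sub>o otimes_left p :: ('c \<otimes>\<^sub>H 'b) \<Rightarrow>\<^sub>L ('c \<otimes>\<^sub>H 'a \<otimes>\<^sub>H 'b)"
  \<comment> \<open>The middle leg carries only scalars, so compressing it with the unit vector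
    \<open>p\<close> loses nothing.\<close>
  define Y where "Y = adj ?I o\<^sub>L X o\<^sub>L ?I"
  have Y: "Y \<in> bop" unfolding Y_def using X by simp
  have cinner_Y: "cinner (c \<otimes>\<^sub>v b) (Y (c' \<otimes>\<^sub>v b')) = cinner p ((a c b c' b') p)" for c b c' b'
    by (simp add: Y_def cinner_adj_right cinner_a)
  have leg13_Y: "leg13 Y = X"
  proof (rule bop_eqI3)
    fix c y b c' y' b'
    obtain \<beta> where \<beta>: "\<And>v. blinfun_apply (a c b c' b') v = \<beta> *\<^sub>C v" using scalar by blast
    show "cinner (c \<otimes>\<^sub>v y \<otimes>\<^sub>v b) ((leg13 Y) (c' \<otimes>\<^sub>v y' \<otimes>\<^sub>v b')) =
        cinner (c \<otimes>\<^sub>v y \<otimes>\<^sub>v b) (X (c' \<otimes>\<^sub>v y' \<otimes>\<^sub>v b'))"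
      using p by (simp add: cinner_leg13 Y cinner_Y cinner_a[symmetric] \<beta> cinner_scaleC_right cinner_self)
  qed (use X Y in simp_all)
  have "p \<noteq> 0" using p by auto
  have "unitary Y"
    unfolding unitary_def
  proof (intro conjI Y)
    show "adj Y o\<^sub>L Y = id_blinfun" "Y o\<^sub>L adj Y = id_blinfun"
      by (rule leg13_inject[OF \<open>p \<noteq> 0\<close>];
          simp add: Y leg13_compose leg13_Y unitary_adj_left[OF X] unitary_adj_right[OF X] flip: adj_leg13)+
  qed
  then show ?thesis using leg13_Y unfolding X_def by blast
qed

text \<open>The computation runs on legs C, C, A, B. The factors of \<open>V\<close> and
  \<open>V'\<close> meeting in leg A are carried through and cancelled; \<open>Y\<close> on legs 1,
  4 passes \<open>V\<close> on legs 2, 3 because these are disjoint. The result does not touch leg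
  A, which \<open>leg124_inject\<close> removes.\<close>

lemma composition_comult_left:
  fixes WC :: "('c::chilbert_space \<otimes>\<^sub>H 'c) operator" and V :: "('c \<otimes>\<^sub>H 'a::chilbert_space) operator"
    and V' :: "('a \<otimes>\<^sub>H 'b::chilbert_space) operator" and p :: 'a
  assumes p: "p \<noteq> 0" and unitary: "unitary WC" "unitary V" "unitary V'" "unitary Y"
    and bV: "leg23 V o\<^sub>L leg12 WC = leg12 WC o\<^sub>L leg13 V o\<^sub>L leg23 V"
    and Y: "leg23 V' o\<^sub>L leg12 V = leg12 V o\<^sub>L leg13 Y o\<^sub>L leg23 V'"
  shows "leg23 Y o\<^sub>L leg12 WC = leg12 WC o\<^sub>L leg13 Y o\<^sub>L leg23 Y"
proof -
  let ?W = "blinfun_apply (leg12 WC) :: 'c \<otimes>\<^sub>H 'c \<otimes>\<^sub>H 'a \<otimes>\<^sub>H 'b \<Rightarrow> _"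
    and ?V13 = "blinfun_apply (leg13 (leg12 V)) :: 'c \<otimes>\<^sub>H 'c \<otimes>\<^sub>H 'a \<otimes>\<^sub>H 'b \<Rightarrow> _"
    and ?V23 = "blinfun_apply (leg23 (leg12 V)) :: 'c \<otimes>\<^sub>H 'c \<otimes>\<^sub>H 'a \<otimes>\<^sub>H 'b \<Rightarrow> _"
    and ?V34 = "blinfun_apply (leg23 (leg23 V')) :: 'c \<otimes>\<^sub>H 'c \<otimes>\<^sub>H 'a \<otimes>\<^sub>H 'b \<Rightarrow> _"
    and ?Y14 = "blinfun_apply (leg13 (leg13 Y)) :: 'c \<otimes>\<^sub>H 'c \<otimes>\<^sub>H 'a \<otimes>\<^sub>H 'b \<Rightarrow> _"
    and ?Y24 = "blinfun_apply (leg23 (leg13 Y)) :: 'c \<otimes>\<^sub>H 'c \<otimes>\<^sub>H 'a \<otimes>\<^sub>H 'b \<Rightarrow> _"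
  have bops: "WC \<in> bop" "V \<in> bop" "V' \<in> bop" "Y \<in> bop" using unitary by simp_all
  have e: "?V23 (?W u) = ?W (?V13 (?V23 u))" for u
    using arg_cong[OF bV, of "\<lambda>T. blinfun_apply (leg123 T) u"] by (simp add: leg123_compose leg123_legs bops)
  have x1: "?V34 (?V23 u) = ?V23 (?Y24 (?V34 u))" for u
    using arg_cong[OF Y, of "\<lambda>T. blinfun_apply (leg23 T) u"] by (simp add: leg23_compose bops)
  have x2: "?V34 (?V13 u) = ?V13 (?Y14 (?V34 u))" for u
    using arg_cong[OF Y, of "\<lambda>T. blinfun_apply (leg13 T) u"] by (simp add: leg13_compose leg13_leg23 bops)
  have c: "?W (?V34 u) = ?V34 (?W u)" for u by (rule leg12_leg34_commute[OF bops(1,3)])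
  have d: "?Y14 (?V23 u) = ?V23 (?Y14 u)" for u by (rule leg14_leg23_commute[OF bops(4,2)])
  have "?Y24 (?W v) = ?W (?Y14 (?Y24 v))" for v
  proof -
    define t where "t = (adj (leg23 (leg23 V'))) v"
    have v: "v = ?V34 t" unfolding t_def using unitary by simp
    have "?V23 (?Y24 (?W v)) = ?V34 (?V23 (?W t))" unfolding v c x1 ..
    also have "\<dots> = ?W (?V34 (?V13 (?V23 t)))" unfolding e c ..
    also have "\<dots> = ?W (?V13 (?V23 (?Y14 (?Y24 v))))" unfolding x2 x1 d v ..
    also have "\<dots> = ?V23 (?W (?Y14 (?Y24 v)))" by (rule e[symmetric])
    finally have "?V23 (?Y24 (?W v)) = ?V23 (?W (?Y14 (?Y24 v)))" .
    then show ?thesis using unitary by (metis unitary_adj_apply(1) unitary_leg12 unitary_leg23)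
  qed
  then have "(leg124 (leg23 Y o\<^sub>L leg12 WC) :: ('c \<otimes>\<^sub>H 'c \<otimes>\<^sub>H 'a \<otimes>\<^sub>H 'b) operator) = leg124 (leg12 WC o\<^sub>L leg13 Y o\<^sub>L leg23 Y)"
    by (intro blinfun_eqI) (simp add: leg124_compose leg124_legs bops)
  then show ?thesis by (rule leg124_inject[OF p, rotated 2]) (simp_all add: bops)
qed

text \<open>The mirrored computation on legs C, A, B, B; the auxiliary leg is now the second, so
  \<open>leg13_inject\<close> removes it.\<close>

lemma composition_comult_right:
  fixes WB :: "('b::chilbert_space \<otimes>\<^sub>H 'b) operator" and V :: "('c::chilbert_space \<otimes>\<^sub>H 'a::chilbert_space) operator"
    and V' :: "('a \<otimes>\<^sub>H 'b) operator" and p :: 'a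
  assumes p: "p \<noteq> 0" and unitary: "unitary WB" "unitary V" "unitary V'" "unitary Y"
    and bV': "leg23 WB o\<^sub>L leg12 V' = leg12 V' o\<^sub>L leg13 V' o\<^sub>L leg23 WB"
    and Y: "leg23 V' o\<^sub>L leg12 V = leg12 V o\<^sub>L leg13 Y o\<^sub>L leg23 V'"
  shows "leg23 WB o\<^sub>L leg12 Y = leg12 Y o\<^sub>L leg13 Y o\<^sub>L leg23 WB"
proof -
  let ?W = "blinfun_apply (leg23 (leg23 WB)) :: 'c \<otimes>\<^sub>H 'a \<otimes>\<^sub>H 'b \<otimes>\<^sub>H 'b \<Rightarrow> _"
    and ?V12 = "blinfun_apply (leg12 V) :: 'c \<otimes>\<^sub>H 'a \<otimes>\<^sub>H 'b \<otimes>\<^sub>H 'b \<Rightarrow> _"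
    and ?V23 = "blinfun_apply (leg23 (leg12 V')) :: 'c \<otimes>\<^sub>H 'a \<otimes>\<^sub>H 'b \<otimes>\<^sub>H 'b \<Rightarrow> _"
    and ?V24 = "blinfun_apply (leg23 (leg13 V')) :: 'c \<otimes>\<^sub>H 'a \<otimes>\<^sub>H 'b \<otimes>\<^sub>H 'b \<Rightarrow> _"
    and ?Y13 = "blinfun_apply (leg13 (leg12 Y)) :: 'c \<otimes>\<^sub>H 'a \<otimes>\<^sub>H 'b \<otimes>\<^sub>H 'b \<Rightarrow> _"
    and ?Y14 = "blinfun_apply (leg13 (leg13 Y)) :: 'c \<otimes>\<^sub>H 'a \<otimes>\<^sub>H 'b \<otimes>\<^sub>H 'b \<Rightarrow> _"
  have bops: "WB \<in> bop" "V \<in> bop" "V' \<in> bop" "Y \<in> bop" using unitary by simp_all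
  have e: "?W (?V23 u) = ?V23 (?V24 (?W u))" for u
    using arg_cong[OF bV', of "\<lambda>T. blinfun_apply (leg23 T) u"] by (simp add: leg23_compose bops)
  have x1: "?V23 (?V12 u) = ?V12 (?Y13 (?V23 u))" for u
    using arg_cong[OF Y, of "\<lambda>T. blinfun_apply (leg123 T) u"] by (simp add: leg123_compose leg123_legs bops)
  have x2: "?V24 (?V12 u) = ?V12 (?Y14 (?V24 u))" for u
    using arg_cong[OF Y, of "\<lambda>T. blinfun_apply (leg124 T) u"] by (simp add: leg124_compose leg124_legs bops)
  have c: "?V12 (?W u) = ?W (?V12 u)" for u by (rule leg12_leg34_commute[OF bops(2,1)])
  have d: "?Y14 (?V23 u) = ?V23 (?Y14 u)" for u by (rule leg14_leg23_commute[OF bops(4,3)])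
  have "?W (?Y13 v) = ?Y13 (?Y14 (?W v))" for v
  proof -
    define t where "t = (adj (leg23 (leg12 V'))) v"
    have v: "v = ?V23 t" unfolding t_def using unitary by simp
    have "?V12 (?W (?Y13 v)) = ?W (?V23 (?V12 t))" unfolding c v x1 ..
    also have "\<dots> = ?V23 (?V24 (?V12 (?W t)))" unfolding e c ..
    also have "\<dots> = ?V12 (?Y13 (?Y14 (?V23 (?V24 (?W t)))))" unfolding x2 x1 d ..
    also have "\<dots> = ?V12 (?Y13 (?Y14 (?W v)))" unfolding v e ..
    finally have "?V12 (?W (?Y13 v)) = ?V12 (?Y13 (?Y14 (?W v)))" .
    then show ?thesis using unitary by (metis unitary_adj_apply(1) unitary_leg12)
  qed
  then have "(leg13 (leg23 WB o\<^sub>L leg12 Y) :: ('c \<otimes>\<^sub>H 'a \<otimes>\<^sub>H 'b \<otimes>\<^sub>H 'b) operator) = leg13 (leg12 Y o\<^sub>L leg13 Y o\<^sub>L leg23 WB)"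
    by (intro blinfun_eqI) (simp add: leg13_compose leg13_leg23 bops)
  then show ?thesis by (rule leg13_inject[OF p, rotated 2]) (simp_all add: bops)
qed

text \<open>All factors of \<open>leg13 Y\<close> and of its adjoint preserve the module of
  insertions, so \<open>Y\<close> and \<open>adj Y\<close> are left multipliers. Closure under
  adjoints turns left multiplication by \<open>adj Y\<close> into right multiplication by
  \<open>Y\<close>.\<close>

lemma composition_multiplier:
  fixes WC :: "('c::chilbert_space \<otimes>\<^sub>H 'c) operator" and WA :: "('a::chilbert_space \<otimes>\<^sub>H 'a) operator"
    and WB :: "('b::chilbert_space \<otimes>\<^sub>H 'b) operator" and p :: 'a
  assumes p: "norm p = 1" and modular: "modular_multiplicative_unitary WC" "modular_multiplicative_unitary WA"
      "modular_multiplicative_unitary WB"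
    and V: "V \<in> unitary_multipliers (spatial_tensor (dual_algebra WC) (qg_algebra WA))"
    and V': "V' \<in> unitary_multipliers (spatial_tensor (dual_algebra WA) (qg_algebra WB))"
    and Y: "unitary Y" "leg13 Y = adj (leg12 V) o\<^sub>L leg23 V' o\<^sub>L leg12 V o\<^sub>L adj (leg23 V')"
  shows "Y \<in> unitary_multipliers (spatial_tensor (dual_algebra WC) (qg_algebra WB))"
proof -
  note W = modular[THEN modular_unitary]
  have Wd: "dual_unitary WC \<in> bop" "dual_unitary WA \<in> bop" and Wb: "WA \<in> bop" "WB \<in> bop" using W by simp_all
  note C = qg_algebra_bop[OF Wd(1), folded dual_algebra_eq] qg_algebra_subspace[OF Wd(1), folded dual_algebra_eq]
  note A' = qg_algebra_bop[OF Wd(2), folded dual_algebra_eq] qg_algebra_subspace[OF Wd(2), folded dual_algebra_eq]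
  have nd: "nondegenerate (dual_algebra WA)" "nondegenerate (qg_algebra WA)"
    unfolding dual_algebra_eq using W by (simp_all add: qg_algebra_nondegenerate)
  note A = qg_algebra_bop[OF Wb(1)] and B = qg_algebra_bop[OF Wb(2)]
  let ?CA = "spatial_tensor (dual_algebra WC) (qg_algebra WA)" and ?AB = "spatial_tensor (dual_algebra WA) (qg_algebra WB)"
    and ?CB = "spatial_tensor (dual_algebra WC) (qg_algebra WB)"
  note CA = spatial_tensor_eq[OF C(1) A C(2)] and AB = spatial_tensor_eq[OF A'(1) B A'(2)]
  have adj_CA: "adj x \<in> ?CA" if "x \<in> ?CA" for x
    by (rule spatial_tensor_adj[OF C _ A _ that]) (intro dual_algebra_adj_closed qg_algebra_adj_closed modular; assumption)+
  have adj_AB: "adj x \<in> ?AB" if "x \<in> ?AB" for x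
    by (rule spatial_tensor_adj[OF A' _ B _ that]) (intro dual_algebra_adj_closed qg_algebra_adj_closed modular; assumption)+
  have adj_CB: "adj x \<in> ?CB" if "x \<in> ?CB" for x
    by (rule spatial_tensor_adj[OF C _ B _ that]) (intro dual_algebra_adj_closed qg_algebra_adj_closed modular; assumption)+
  have Vu: "unitary V" "V \<in> multipliers ?CA" and V'u: "unitary V'" "V' \<in> multipliers ?AB"
    using V V' by (simp_all add: unitary_multipliers_def)
  have left: "V o\<^sub>L x \<in> ?CA" "adj V o\<^sub>L x \<in> ?CA" if "x \<in> ?CA" for x
    using Vu(2) that unitary_multipliers_adj[OF adj_CA spatial_tensor_bop[OF C(1) A C(2)] Vu(2) that]
    by (simp_all add: multipliers_def)
  have left': "V' o\<^sub>L x \<in> ?AB" "adj V' o\<^sub>L x \<in> ?AB" if "x \<in> ?AB" for x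
    using V'u(2) that unitary_multipliers_adj[OF adj_AB spatial_tensor_bop[OF A'(1) B A'(2)] V'u(2) that]
    by (simp_all add: multipliers_def)
  have CA_base: "c \<otimes>\<^sub>o a \<in> ?CA" if "c \<in> dual_algebra WC" "a \<in> qg_algebra WA" for c a
    unfolding CA using that by (intro clspan_base) blast
  have AB_base: "a \<otimes>\<^sub>o b \<in> ?AB" if "a \<in> dual_algebra WA" "b \<in> qg_algebra WB" for a b
    unfolding AB using that by (intro clspan_base) blast
  let ?E = "clspan {c \<otimes>\<^sub>o (otimes_left p o\<^sub>L b) | c (p::'a) b. c \<in> dual_algebra WC \<and> b \<in> qg_algebra WB}"
  have E: "leg12 V o\<^sub>L x \<in> ?E" "adj (leg12 V) o\<^sub>L x \<in> ?E" "leg23 V' o\<^sub>L x \<in> ?E" "adj (leg23 V') o\<^sub>L x \<in> ?E" if "x \<in> ?E" for x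
    using insert_leg12[OF C(1) A nd(2) B _ _ that, of V] insert_leg12[OF C(1) A nd(2) B _ _ that, of "adj V"]
      insert_leg23[OF C(1) A'(1) nd(1) B _ _ that, of V'] insert_leg23[OF C(1) A'(1) nd(1) B _ _ that, of "adj V'"]
      left[OF CA_base] left'[OF AB_base] Vu(1) V'u(1)
    by (simp_all add: adj_leg12 adj_leg23 CA AB)
  have YE: "leg13 Y o\<^sub>L x \<in> ?E" if "x \<in> ?E" for x
    unfolding Y(2) blinfun_comp_assoc by (intro E that)
  have adj_Y: "leg13 (adj Y) = leg23 V' o\<^sub>L adj (leg12 V) o\<^sub>L adj (leg23 V') o\<^sub>L leg12 V"
    using arg_cong[OF Y(2), of adj] Y(1) Vu(1) V'u(1) by (simp add: adj_leg13 adj_compose blinfun_comp_assoc)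
  have YE': "leg13 (adj Y) o\<^sub>L x \<in> ?E" if "x \<in> ?E" for x
    unfolding adj_Y blinfun_comp_assoc by (intro E that)
  have YX: "Y o\<^sub>L x \<in> ?CB" if "x \<in> ?CB" for x
    by (rule leg13_left_multiplier[OF C Wb(2) p _ YE that]) (use Y(1) in simp_all)
  have YX': "adj Y o\<^sub>L x \<in> ?CB" if "x \<in> ?CB" for x
    by (rule leg13_left_multiplier[OF C Wb(2) p _ YE' that]) (use Y(1) in simp_all)
  have "x o\<^sub>L Y \<in> ?CB" if x: "x \<in> ?CB" for x
  proof -
    have "adj (adj Y o\<^sub>L adj x) \<in> ?CB" by (intro adj_CB YX' x)
    moreover have "x \<in> bop" using x spatial_tensor_bop[OF C(1) B C(2)] by blast
    ultimately show ?thesis using Y(1) by (simp add: adj_compose)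
  qed
  then show ?thesis using YX Y(1) by (simp add: unitary_multipliers_def multipliers_def)
qed

theorem lemma3p11:
  fixes WC :: "('c::chilbert_space \<otimes>\<^sub>H 'c) operator"
    and WA :: "('a::chilbert_space \<otimes>\<^sub>H 'a) operator"
    and WB :: "('b::chilbert_space \<otimes>\<^sub>H 'b) operator"
    and VCA :: "('c \<otimes>\<^sub>H 'a) operator"
    and VAB :: "('a \<otimes>\<^sub>H 'b) operator"
  assumes "\<exists>x::'a. x \<noteq> 0"
    and "modular_multiplicative_unitary WC"
    and "modular_multiplicative_unitary WA"
    and "modular_multiplicative_unitary WB"
    and "bicharacter WC WA VCA"
    and "bicharacter WA WB VAB"
  shows "(\<exists>!VCB. bicharacter_composition WC WB VCA VAB VCB) \<and>
    (\<forall>VCB. bicharacter_composition WC WB VCA VAB VCB \<longrightarrow> bicharacter WC WB VCB)"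
proof -
  obtain x :: 'a where x: "x \<noteq> 0" using assms(1) by blast
  \<comment> \<open>The unit vector that fills the middle leg, both for compressing to
    \<open>Y\<close> and for the injectivity of \<open>leg13\<close>.\<close>
  define p where "p = (1 / norm x) *\<^sub>R x"
  have p: "norm p = 1" "p \<noteq> 0" using x by (auto simp: p_def)
  note W = assms(2-4)[THEN modular_unitary]
  note VCA = assms(5)[unfolded bicharacter_iff[OF W(1,2)]]
  note VAB = assms(6)[unfolded bicharacter_iff[OF W(2,3)]]
  have V: "unitary VCA" "unitary VAB" using VCA VAB by (simp_all add: unitary_multipliers_def)
  obtain Y where Y: "unitary Y" "leg13 Y = adj (leg12 VCA) o\<^sub>L leg23 VAB o\<^sub>L leg12 VCA o\<^sub>L adj (leg23 VAB)"
    using composition_leg13_ex[OF assms(3) V p(1)] VCA VAB by blast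
  have "leg23 VAB o\<^sub>L leg12 VCA = leg12 VCA o\<^sub>L leg13 Y o\<^sub>L leg23 VAB"
    unfolding Y(2) using V by (intro blinfun_eqI) simp
  then have comp_Y: "bicharacter_composition WC WB VCA VAB Y"
    unfolding bicharacter_composition_def
    using composition_multiplier[OF p(1) assms(2-4) _ _ Y] VCA VAB by blast
  have "Y1 = Y2" if "bicharacter_composition WC WB VCA VAB Y1" "bicharacter_composition WC WB VCA VAB Y2" for Y1 Y2
  proof -
    have "leg12 VCA o\<^sub>L leg13 Y1 o\<^sub>L leg23 VAB = leg12 VCA o\<^sub>L leg13 Y2 o\<^sub>L leg23 VAB"
      using that unfolding bicharacter_composition_def by metis
    then have "leg12 VCA o\<^sub>L leg13 Y1 = leg12 VCA o\<^sub>L leg13 Y2"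
      by (rule unitary_cancel_right[OF unitary_leg23[OF V(2)]])
    then have "(leg13 Y1 :: ('c \<otimes>\<^sub>H 'a \<otimes>\<^sub>H 'b) operator) = leg13 Y2" by (rule unitary_cancel_left[OF unitary_leg12[OF V(1)]])
    then show ?thesis
      by (rule leg13_inject[OF p(2), rotated 2])
        (use that in \<open>simp_all add: bicharacter_composition_def unitary_multipliers_def\<close>)
  qed
  moreover have "bicharacter WC WB Y'" if Y': "bicharacter_composition WC WB VCA VAB Y'" for Y'
  proof -
    have unitary: "unitary Y'" and eq: "leg23 VAB o\<^sub>L leg12 VCA = leg12 VCA o\<^sub>L leg13 Y' o\<^sub>L leg23 VAB"
      using Y' by (simp_all add: bicharacter_composition_def unitary_multipliers_def)
    show ?thesis
      unfolding bicharacter_iff[OF W(1,3)]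
      using composition_comult_left[OF p(2) W(1) V unitary _ eq] composition_comult_right[OF p(2) W(3) V unitary _ eq]
        VCA VAB Y' by (simp add: bicharacter_composition_def)
  qed
  ultimately show ?thesis using comp_Y by blast
qed

end
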